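(* Let $\mu$ be any integer partition, let $m,n\ge 1$, and let $m^n$ be the rectangular partition with $n$ parts equal to $m$. Let $\sigma=\mu\cap m^n$, let $\bar\sigma$ be the complementary partition of $\sigma$ in $m^n$, and let $\lambda=\mu\cup m^n$. Then the strong Stanley conjecture holds for $\langle J_\mu J_{\bar\sigma},J_{\lambda}\rangle$, with an explicit choice of hooks: $$\langle J_\mu J_{\bar\sigma},J_{\lambda}\rangle=\Big(\prod_{b\in\mu}\tilde h_\mu(b)\Big)\Big(\prod_{b\in\bar\sigma}\tilde h_{\bar\sigma}(b)\Big)\Big(\prod_{b\in\lambda}\tilde h_\lambda(b)\Big),$$ where each factor $\tilde h_\rho(b)$ is either the upper hook value $h^{U}_\rho(b)$ or the lower hook value $h^{L}_\rho(b)$, and in the whole expression exactly $|\lambda|$ upper hooks and exactly $|\lambda|$ lower hooks are chosen. The choice is the following. Put $a=\min(\mu_{n+1},m)$ and $c=\min(\mu'_{m+1},n)$ (where $\mu'$ is the conjugate partition, and parts beyond the length are $0$), and let $K=\{(x,y)\in\mathbb Z^2: a\le x\le m-1,\ c\le y\le n-1\}$. (i) For $b=(b_1,b_2)\in\mu$: $\tilde h_\mu(b)=h^U_\mu(b)$ if $b_2<c$, and $\tilde h_\mu(b)=h^L_\mu(b)$ if $b_2\ge c$. (ii) For $b\in\bar\sigma$: $\tilde h_{\bar\sigma}(b)=h^U_{\bar\sigma}(b)$. (iii) For $b=(b_1,b_2)\in\lambda$: $\tilde h_\lambda(b)=h^L_\lambda(b)$ if $b_2<c$; $\tilde h_\lambda(b)=h^U_\lambda(b)$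 if $b_2\ge c$ and $b\notin K$; and if $b\in K$, then $\tilde h_\lambda(b)=h^U_\lambda(b)$ if $(b_1,\,n-1+c-b_2)\in\mu$, and $\tilde h_\lambda(b)=h^L_\lambda(b)$ otherwise.
   Context: Young diagrams are in French notation: a partition $\lambda=(\lambda_1\ge\lambda_2\ge\dots)$ is identified with the set of boxes $(i,j)$, $j\ge 0$, $0\le i<\lambda_{j+1}$ ($i$ is the column, $j$ the row, row $0$ at the bottom). Union and intersection of partitions are those of the sets of boxes. For $\sigma\subseteq m^n$, the complement partition is $\bar\sigma=(m-\sigma_n,m-\sigma_{n-1},\dots,m-\sigma_1)$. Let $\alpha$ be an indeterminate. For a box $b\in\lambda$, $\mathrm{arm}(b)$ is the number of boxes of $\lambda$ to the right of $b$ in its row and $\mathrm{leg}(b)$ the number of boxes of $\lambda$ above $b$ in its column. The upper and lower hook values are $h^U_\lambda(b)=\alpha(\mathrm{arm}(b)+1)+\mathrm{leg}(b)$ and $h^L_\lambda(b)=\alpha\,\mathrm{arm}(b)+\mathrm{leg}(b)+1$. $J_\lambda=J_\lambda(\mathbf x;\alpha)$ is the integral form Jack symmetric function: the $J_\lambda$ are orthogonal for the inner product on symmetric functions given by $\langle p_\lambda,p_\mu\rangle=\delta_{\lambda\mu}z_\lambda\alpha^{\ell(\lambda)}$ ($p_\lambda$ power sums, $n!/z_\lambda$ the number of permutations of $n=|\lambda|$ elements of cycle type $\lambda$), $J_\lambda$ is a combination of monomial symmetric functions $m_\nu$ with $\nu\le\lambda$ in dominance order, and the coefficient of $m_{1^n}$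 in $J_\lambda$ with $|\lambda|=n$ is $n!$. In particular $J_\emptyset=1$. *)

theory Defs
  imports
    "HOL-Library.Poly_Mapping"
    "HOL-Library.Multiset"
    "HOL-Combinatorics.Orbits"
    "HOL-Combinatorics.Permutations"
    "HOL-Computational_Algebra.Polynomial_Factorial"
begin

section \<open>Formal power series in countably many variables\<close>

text \<open>
  A series in variables \<open>x\<^sub>0, x\<^sub>1, \<dots>\<close> is given by its coefficients, indexed by the finitely
  supported exponent vectors. The ring of symmetric functions is the subring of the symmetric
  series of bounded degree; all the symmetric functions below live in this type.
\<close>

typedef 'a mseries = "UNIV :: ((nat \<Rightarrow>\<^sub>0 nat) \<Rightarrow> 'a) set"
  morphisms mcoeff Abs_mseries by simp

setup_lifting type_definition_mseries

lemma mseries_eqI: "(\<And>e. mcoeff f e = mcoeff g e) \<Longrightarrow> f = g"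
  by transfer auto

lemma finite_add_decomp: "finite {(a, b). a + b = (e :: nat \<Rightarrow>\<^sub>0 nat)}"
proof -
  define M where "M = Max (Poly_Mapping.lookup e ` Poly_Mapping.keys e)"
  define B where "B = {f :: nat \<Rightarrow> nat. \<forall>x. (x \<in> Poly_Mapping.keys e \<longrightarrow> f x \<in> {..M}) \<and>
    (x \<notin> Poly_Mapping.keys e \<longrightarrow> f x = 0)}"
  define A where "A = {a. \<forall>x. Poly_Mapping.lookup a x \<le> Poly_Mapping.lookup e x}"
  have "finite B"
    unfolding B_def by (rule finite_set_of_finite_funs) auto
  moreover have "Poly_Mapping.lookup ` A \<subseteq> B"
  proof (rule image_subsetI)
    fix a assume "a \<in> A"
    then have le: "Poly_Mapping.lookup a x \<le> Poly_Mapping.lookup e x" for x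
      by (simp add: A_def)
    have "Poly_Mapping.lookup e x \<le> M" if "x \<in> Poly_Mapping.keys e" for x
      unfolding M_def using that by (intro Max_ge) auto
    then have "Poly_Mapping.lookup a x \<le> M" if "x \<in> Poly_Mapping.keys e" for x
      using that le le_trans by blast
    moreover have "Poly_Mapping.lookup a x = 0" if "x \<notin> Poly_Mapping.keys e" for x
      using le[of x] that by (simp add: in_keys_iff)
    ultimately show "Poly_Mapping.lookup a \<in> B"
      by (simp add: B_def)
  qed
  moreover have "inj_on Poly_Mapping.lookup A"
    by (rule inj_onI) (simp add: lookup_inject)
  ultimately have "finite A"
    using finite_subset finite_imageD by blast
  moreover have "{(a, b). a + b = e} \<subseteq> A \<times> A"
    by (auto simp: A_def lookup_add)
  ultimately show ?thesis
    using finite_subset by blast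
qed

instantiation mseries :: (comm_ring_1) comm_ring_1
begin

lift_definition zero_mseries :: "'a mseries" is "\<lambda>_. 0" .
lift_definition one_mseries :: "'a mseries" is "\<lambda>e. if e = 0 then 1 else 0" .
lift_definition plus_mseries :: "'a mseries \<Rightarrow> 'a mseries \<Rightarrow> 'a mseries"
  is "\<lambda>f g e. f e + g e" .
lift_definition minus_mseries :: "'a mseries \<Rightarrow> 'a mseries \<Rightarrow> 'a mseries"
  is "\<lambda>f g e. f e - g e" .
lift_definition uminus_mseries :: "'a mseries \<Rightarrow> 'a mseries"
  is "\<lambda>f e. - f e" .
lift_definition times_mseries :: "'a mseries \<Rightarrow> 'a mseries \<Rightarrow> 'a mseries"
  is "\<lambda>f g e. \<Sum>(a, b) | a + b = e. f a * g b" .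

instance
proof
  fix f g h :: "'a mseries"
  show "f + g + h = f + (g + h)" by transfer (simp add: add.assoc)
  show "f + g = g + f" by transfer (simp add: add.commute)
  show "0 + f = f" by transfer simp
  show "- f + f = 0" by transfer simp
  show "f - g = f + - g" by transfer simp
  show "(0 :: 'a mseries) \<noteq> 1" by transfer (metis zero_neq_one)
  show "f * g = g * f"
    by transfer (rule ext, rule sum.reindex_bij_witness[where i = prod.swap and j = prod.swap],
      auto simp: mult.commute add.commute)
  show "1 * f = f"
  proof (transfer, rule ext)
    fix f :: "(nat \<Rightarrow>\<^sub>0 nat) \<Rightarrow> 'a" and e
    have "(\<Sum>(a, b) | a + b = e. (if a = 0 then 1 else 0) * f b) =
          (\<Sum>(a, b) \<in> {(0 :: nat \<Rightarrow>\<^sub>0 nat, e)}. (if a = 0 then 1 else 0) * f b)"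
      by (rule sum.mono_neutral_right) (auto simp: finite_add_decomp split: if_splits)
    then show "(\<Sum>(a, b) | a + b = e. (if a = 0 then 1 else 0) * f b) = f e"
      by simp
  qed
  show "(f + g) * h = f * h + g * h"
    by transfer (simp add: distrib_right sum.distrib case_prod_unfold)
  show "f * g * h = f * (g * h)"
  proof (transfer, rule ext)
    fix f g h :: "(nat \<Rightarrow>\<^sub>0 nat) \<Rightarrow> 'a" and e
    have "(\<Sum>(u, c) | u + c = e. (\<Sum>(a, b) | a + b = u. f a * g b) * h c) =
      (\<Sum>p \<in> {(u, c). u + c = e}. \<Sum>q \<in> {(a, b). a + b = fst p}. f (fst q) * g (snd q) * h (snd p))"
      by (simp add: sum_distrib_right case_prod_unfold)
    also have "\<dots> = (\<Sum>(p, q) \<in> (SIGMA p:{(u, c). u + c = e}. {(a, b). a + b = fst p}).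
        f (fst q) * g (snd q) * h (snd p))"
      by (rule sum.Sigma) (auto simp: finite_add_decomp)
    also have "\<dots> = (\<Sum>(p, q) \<in> (SIGMA p:{(a, v). a + v = e}. {(b, c). b + c = snd p}).
        f (fst p) * (g (fst q) * h (snd q)))"
      by (rule sum.reindex_bij_witness[where
            i = "\<lambda>((a, v), (b, c)). ((a + b, c), (a, b))" and
            j = "\<lambda>((u, c), (a, b)). ((a, b + c), (b, c))"])
         (auto simp: add.assoc mult.assoc)
    also have "\<dots> = (\<Sum>p \<in> {(a, v). a + v = e}. \<Sum>q \<in> {(b, c). b + c = snd p}.
        f (fst p) * (g (fst q) * h (snd q)))"
      by (rule sum.Sigma[symmetric]) (auto simp: finite_add_decomp)
    also have "\<dots> = (\<Sum>(a, v) | a + v = e. f a * (\<Sum>(b, c) | b + c = v. g b * h c))"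
      by (simp add: sum_distrib_left case_prod_unfold)
    finally show "(\<Sum>(u, c) | u + c = e. (\<Sum>(a, b) | a + b = u. f a * g b) * h c) =
      (\<Sum>(a, v) | a + v = e. f a * (\<Sum>(b, c) | b + c = v. g b * h c))" .
  qed
qed

end

lift_definition mscale :: "'a::comm_ring_1 \<Rightarrow> 'a mseries \<Rightarrow> 'a mseries"
  is "\<lambda>c f e. c * f e" .


section \<open>Partitions and Young diagrams\<close>

definition int_partition :: "nat list \<Rightarrow> bool" where
  "int_partition l \<longleftrightarrow> sorted_wrt (\<ge>) l \<and> (\<forall>x \<in> set l. x > 0)"

text \<open>Indices start at 0: \<open>part l j\<close> is \<open>l\<^bsub>j+1\<^esub>\<close> in the usual numbering.\<close>

definition part :: "nat list \<Rightarrow> nat \<Rightarrow> nat" where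
  "part l j = (if j < length l then l ! j else 0)"

text \<open>Boxes are pairs (column, row), with row 0 at the bottom.\<close>

definition diagram :: "nat list \<Rightarrow> (nat \<times> nat) set" where
  "diagram l = {(i, j). i < part l j}"

definition conj_part :: "nat list \<Rightarrow> nat list" where
  "conj_part l = map (\<lambda>i. card {j. (i, j) \<in> diagram l}) [0..<part l 0]"

definition rect :: "nat \<Rightarrow> nat \<Rightarrow> nat list" where
  "rect m n = replicate n m"

text \<open>\<open>(m - s\<^sub>n, \<dots>, m - s\<^sub>1)\<close>, without its vanishing entries; meant for
  \<open>diagram s \<subseteq> diagram (rect m n)\<close>.\<close>

definition complement :: "nat \<Rightarrow> nat \<Rightarrow> nat list \<Rightarrow> nat list" where
  "complement m n s = filter (\<lambda>x. x > 0) (map (\<lambda>j. m - part s j) (rev [0..<n]))"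

definition dominated :: "nat list \<Rightarrow> nat list \<Rightarrow> bool" where
  "dominated k l \<longleftrightarrow> sum_list k = sum_list l \<and> (\<forall>i. sum_list (take i k) \<le> sum_list (take i l))"


section \<open>The coefficient field \<open>\<rat>(\<alpha>)\<close> and hook values\<close>

type_synonym ratfun = "rat poly fract"

definition alpha :: ratfun where
  "alpha = to_fract [:0, 1:]"

fun arm :: "nat list \<Rightarrow> nat \<times> nat \<Rightarrow> nat" where
  "arm l (i, j) = card {k. k > i \<and> (k, j) \<in> diagram l}"

fun leg :: "nat list \<Rightarrow> nat \<times> nat \<Rightarrow> nat" where
  "leg l (i, j) = card {k. k > j \<and> (i, k) \<in> diagram l}"

definition upper_hook :: "nat list \<Rightarrow> nat \<times> nat \<Rightarrow> ratfun" where
  "upper_hook l b = alpha * (of_nat (arm l b) + 1) + of_nat (leg l b)"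

definition lower_hook :: "nat list \<Rightarrow> nat \<times> nat \<Rightarrow> ratfun" where
  "lower_hook l b = alpha * of_nat (arm l b) + of_nat (leg l b) + 1"

text \<open>The choice of hooks in a diagram is recorded by the set \<open>U\<close> of boxes with upper hook.\<close>

definition chosen_hook :: "(nat \<times> nat) set \<Rightarrow> nat list \<Rightarrow> nat \<times> nat \<Rightarrow> ratfun" where
  "chosen_hook U l b = (if b \<in> U then upper_hook l b else lower_hook l b)"


section \<open>Power sums, monomial symmetric functions, and the inner product\<close>

text \<open>\<open>power_sum k\<close> is \<open>\<Sum>i. x\<^sub>i^k\<close>, for \<open>k \<ge> 1\<close>.\<close>

definition power_sum :: "nat \<Rightarrow> ratfun mseries" where
  "power_sum k = Abs_mseries (\<lambda>e. if \<exists>i. e = Poly_Mapping.single i k then 1 else 0)"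

definition power_sum_part :: "nat list \<Rightarrow> ratfun mseries" where
  "power_sum_part l = prod_list (map power_sum l)"

definition monomial_sym :: "nat list \<Rightarrow> ratfun mseries" where
  "monomial_sym l =
     Abs_mseries (\<lambda>e. if image_mset (Poly_Mapping.lookup e) (mset_set (Poly_Mapping.keys e)) = mset l then 1 else 0)"

definition cycle_type :: "nat \<Rightarrow> (nat \<Rightarrow> nat) \<Rightarrow> nat multiset" where
  "cycle_type n p = image_mset card (mset_set (orbit p ` {..<n}))"

definition zee :: "nat list \<Rightarrow> ratfun" where
  "zee l = of_nat (fact (sum_list l)) /
     of_nat (card {p. p permutes {..<sum_list l} \<and> cycle_type (sum_list l) p = mset l})"

text \<open>
  The coefficients of a symmetric function in the basis \<open>power_sum_part l\<close>, \<open>l\<close> a partition,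
  of the ring of symmetric functions over \<open>\<rat>(\<alpha>)\<close>. They are meaningless for series
  outside the span of the \<open>power_sum_part l\<close>.
\<close>

definition power_sum_coeff :: "ratfun mseries \<Rightarrow> nat list \<Rightarrow> ratfun" where
  "power_sum_coeff f = (THE c. finite {l. c l \<noteq> 0} \<and> (\<forall>l. c l \<noteq> 0 \<longrightarrow> int_partition l) \<and>
     f = (\<Sum>l | c l \<noteq> 0. mscale (c l) (power_sum_part l)))"

text \<open>The bilinear form with \<open>\<langle>p\<^sub>k, p\<^sub>l\<rangle> = \<delta>\<^sub>k\<^sub>l z\<^sub>l \<alpha>^length l\<close>.\<close>

definition jack_inner :: "ratfun mseries \<Rightarrow> ratfun mseries \<Rightarrow> ratfun" where
  "jack_inner f g = (\<Sum>l | power_sum_coeff f l \<noteq> 0.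
     power_sum_coeff f l * power_sum_coeff g l * zee l * alpha ^ length l)"


section \<open>Integral form Jack symmetric functions\<close>

text \<open>
  \<open>c\<close> is the coefficient vector of \<open>J l\<close> in the monomial basis. These conditions determine
  \<open>J\<close> uniquely on partitions, and the Jack symmetric functions satisfy them. The values of \<open>J\<close> on lists that are not partitions are irrelevant.
\<close>

definition jack_family :: "(nat list \<Rightarrow> ratfun mseries) \<Rightarrow> bool" where
  "jack_family J \<longleftrightarrow>
     (\<forall>k l. int_partition k \<longrightarrow> int_partition l \<longrightarrow> k \<noteq> l \<longrightarrow> jack_inner (J k) (J l) = 0) \<and>
     (\<forall>l. int_partition l \<longrightarrow>
        (\<exists>c. J l = (\<Sum>k | int_partition k \<and> dominated k l. mscale (c k) (monomial_sym k)) \<and>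
             c (replicate (sum_list l) 1) = of_nat (fact (sum_list l))))"

end

(*
  Fix lambda = mu \<union> m^n and let kappa range over the partitions that differ from lambda only inside
  the box K. Complementation in m^n reverses this interval. Let X(kappa) be the claimed product with
  kappa in place of mu. For every symmetric function F, the coefficient of J_kappa' in F J_kappa
  times X(kappa') equals X(kappa) times the coefficient of J_(bar kappa) in F J_(bar kappa').
  For F = p_1 this is an identity between Pieri coefficients, in which the hooks telescope along the
  boundary of kappa. It passes to products, and to p_(k+1), which is a double commutator of the
  Laplace--Beltrami operator with p_1 and p_k: a box and its opposite have contents of constant sum.
  The theorem is the case F = J_(bar mu), kappa = mu, kappa' = lambda, since bar lambda is empty and
  X(lambda) is the squared norm of J_lambda.

  The Pieri coefficients and the norms are obtained from the Cherednik operator of one variable.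
  Splitting J_kappa into its eigenvectors gives the Pieri rule with unknown coefficients; these are
  the solution of a Lagrange interpolation problem at the contents of the addable boxes.
*)

theory Submission
  imports Defs "HOL-Combinatorics.Transposition"
begin

section \<open>Coefficients of series\<close>

text \<open>The identity is linear in F, and it can be proved for every F because it compares
  matrices: up to the weights X, complementation turns multiplication by F into its transpose. It
  therefore survives products as soon as the intermediate partitions stay in the interval, which
  holds since multiplication only enlarges diagrams. Transposition reverses the order of factors,
  harmlessly in a commutative ring; the same commutativity absorbs the constant sum of the two
  contents in the double commutator. No structure constants beyond those of p_1 are ever computed.
  Adding a box to kappa flips exactly one hook of lambda, in the reflected row, and this is the
  origin of the reflection in the choice of hooks on K. The defining conditions give orthogonality,
  triangularity and one normalised coefficient; eigenfunctions, Pieri coefficients and norms have to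
  be derived from them. Operators on infinitely many variables are normalised so that every
  coefficient is a finite sum. Ordering the field with \<alpha> infinitely large makes the inner
  product positive definite and the relevant contents distinct.\<close>

definition supp :: "(nat \<Rightarrow> nat) \<Rightarrow> nat set" where
  "supp u = {i. u i \<noteq> 0}"

abbreviation fs :: "(nat \<Rightarrow> nat) \<Rightarrow> bool" where
  "fs u \<equiv> finite (supp u)"

text \<open>Exponent vectors are plain functions here, so that they can be updated and permuted
  directly. \<open>Abs_poly_mapping u\<close> is unspecified when the support is infinite, hence the
  premises \<open>fs u\<close> below.\<close>

definition coef :: "ratfun mseries \<Rightarrow> (nat \<Rightarrow> nat) \<Rightarrow> ratfun" where
  "coef g u = mcoeff g (Abs_poly_mapping u)"

definition of_coef :: "((nat \<Rightarrow> nat) \<Rightarrow> ratfun) \<Rightarrow> ratfun mseries" where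
  "of_coef F = Abs_mseries (\<lambda>e. F (Poly_Mapping.lookup e))"

lemma in_supp [simp]: "i \<in> supp u \<longleftrightarrow> u i \<noteq> 0"
  by (simp add: supp_def)

lemma supp_lookup: "supp (Poly_Mapping.lookup e) = Poly_Mapping.keys e"
  by (auto simp: supp_def in_keys_iff)

lemma fs_upd [simp]: "fs (u(i := a)) \<longleftrightarrow> fs u"
proof -
  have "supp (u(i := a)) \<subseteq> insert i (supp u)" "supp u \<subseteq> insert i (supp (u(i := a)))"
    by (auto split: if_splits)
  then show ?thesis
    by (meson finite_insert finite_subset)
qed

lemma lookup_Abs [simp]: "fs u \<Longrightarrow> Poly_Mapping.lookup (Abs_poly_mapping u) = u"
  by (simp add: supp_def)

lemma coef_of_coef [simp]: "fs u \<Longrightarrow> coef (of_coef F) u = F u"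
  by (simp add: coef_def of_coef_def Abs_mseries_inverse)

lemma mcoeff_eq_coef: "mcoeff g e = coef g (Poly_Mapping.lookup e)"
  by (simp add: coef_def)

lemma coef_eqI: "(\<And>u. fs u \<Longrightarrow> coef f u = coef g u) \<Longrightarrow> f = g"
  by (rule mseries_eqI) (simp add: mcoeff_eq_coef supp_lookup)

lemma coef_add [simp]: "coef (f + g) u = coef f u + coef g u"
  by (simp add: coef_def plus_mseries.rep_eq)

lemma coef_diff [simp]: "coef (f - g) u = coef f u - coef g u"
  by (simp add: coef_def minus_mseries.rep_eq)

lemma coef_uminus [simp]: "coef (- f) u = - coef f u"
  by (simp add: coef_def uminus_mseries.rep_eq)

lemma coef_zero [simp]: "coef 0 u = 0"
  by (simp add: coef_def zero_mseries.rep_eq)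

lemma coef_mscale [simp]: "coef (mscale c f) u = c * coef f u"
  by (simp add: coef_def mscale.rep_eq)

lemma coef_sum [simp]: "coef (sum f A) u = (\<Sum>a\<in>A. coef (f a) u)"
  by (induction A rule: infinite_finite_induct) auto

lemma coef_one: "fs u \<Longrightarrow> coef 1 u = (if u = (\<lambda>_. 0) then 1 else 0)"
proof -
  assume "fs u"
  then have "Abs_poly_mapping u = 0 \<longleftrightarrow> u = (\<lambda>_. 0)"
    by (metis lookup_Abs lookup_zero poly_mapping_eqI ext)
  then show ?thesis
    by (simp add: coef_def one_mseries.rep_eq)
qed


interpretation mv: vector_space "mscale :: ratfun \<Rightarrow> ratfun mseries \<Rightarrow> ratfun mseries"
  by unfold_locales (auto intro!: coef_eqI simp: algebra_simps)

lemma mscale_mult_left: "mscale c f * g = mscale c (f * g :: ratfun mseries)"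
  by transfer (simp add: sum_distrib_left mult.assoc case_prod_unfold)

lemma mscale_mult_right: "f * mscale c g = mscale c (f * g :: ratfun mseries)"
  by (metis mscale_mult_left mult.commute)

text \<open>A formal sum of distinct monomials, with a possibly infinite index set \<open>I\<close>,
  is multiplied coefficientwise: only monomials dividing that of \<open>u\<close> contribute, and
  \<open>S\<close> is any finite set containing their indices. Injectivity of \<open>d\<close> keeps
  a monomial from being counted twice.\<close>

lemma coef_indicator_mult:
  assumes inj: "inj_on d I" and u: "fs u" and S: "finite S" "S \<subseteq> I"
    and d: "\<And>i. i \<in> I \<Longrightarrow> fs (d i)"
    and le: "\<And>i. i \<in> I \<Longrightarrow> (\<forall>j. d i j \<le> u j) \<Longrightarrow> i \<in> S"
  shows "coef (of_coef (\<lambda>v. if v \<in> d ` I then 1 else 0) * g) u =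
    (\<Sum>i\<in>S. if \<forall>j. d i j \<le> u j then coef g (\<lambda>j. u j - d i j) else 0)"
proof -
  let ?L = "Poly_Mapping.lookup"
  let ?P = "\<lambda>i. Abs_poly_mapping (d i) :: nat \<Rightarrow>\<^sub>0 nat"
  let ?e = "Abs_poly_mapping u :: nat \<Rightarrow>\<^sub>0 nat"
  let ?R = "\<lambda>i. Abs_poly_mapping (\<lambda>j. u j - d i j) :: nat \<Rightarrow>\<^sub>0 nat"
  let ?S = "{i \<in> S. \<forall>j. d i j \<le> u j}"
  have fsr: "fs (\<lambda>j. u j - d i j)" for i
    by (rule finite_subset[OF _ u]) auto
  have "coef (of_coef (\<lambda>v. if v \<in> d ` I then 1 else 0) * g) u =
     (\<Sum>(a, b) | a + b = ?e. (if ?L a \<in> d ` I then 1 else 0) * mcoeff g b)"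
    by (simp add: coef_def times_mseries.rep_eq of_coef_def Abs_mseries_inverse)
  also have "\<dots> = (\<Sum>(a, b) \<in> (\<lambda>i. (?P i, ?R i)) ` ?S. (if ?L a \<in> d ` I then 1 else 0) * mcoeff g b)"
  proof (rule sum.mono_neutral_right)
    show "finite {(a, b). a + b = ?e}"
      by (rule finite_add_decomp)
    show "(\<lambda>i. (?P i, ?R i)) ` ?S \<subseteq> {(a, b). a + b = ?e}"
      using S d u fsr by (auto intro!: poly_mapping_eqI simp: lookup_add)
    show "\<forall>p\<in>{(a, b). a + b = ?e} - (\<lambda>i. (?P i, ?R i)) ` ?S.
       (case p of (a, b) \<Rightarrow> (if ?L a \<in> d ` I then 1 else 0) * mcoeff g b) = 0"
    proof (clarsimp)
      fix a b i assume ab: "a + b = ?e" and i: "i \<in> I" "?L a = d i"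
        and n: "(a, b) \<notin> (\<lambda>i. (?P i, ?R i)) ` ?S"
      have sum: "?L a j + ?L b j = u j" for j
        using arg_cong[OF ab, of "\<lambda>x. ?L x j"] u by (simp add: lookup_add)
      have l: "\<forall>j. d i j \<le> u j"
        using sum i(2) by (metis le_add1)
      have "i \<in> ?S"
        using le[OF i(1) l] l by simp
      moreover have "a = ?P i"
        by (simp add: i(2)[symmetric])
      moreover have "b = ?R i"
        using fsr[of i] sum i(2) by (intro poly_mapping_eqI) (metis add_diff_cancel_left' lookup_Abs)
      ultimately show "mcoeff g b = 0"
        using n by blast
    qed
  qed
  also have "\<dots> = (\<Sum>i\<in>?S. (if ?L (?P i) \<in> d ` I then 1 else 0) * mcoeff g (?R i))"
  proof (subst sum.reindex)
    show "inj_on (\<lambda>i. (?P i, ?R i)) ?S"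
      using inj S d by (auto simp: inj_on_def) (metis lookup_Abs subsetD)
  qed simp
  also have "\<dots> = (\<Sum>i\<in>?S. coef g (\<lambda>j. u j - d i j))"
    using S d by (intro sum.cong) (auto simp: coef_def subset_iff)
  also have "\<dots> = (\<Sum>i\<in>S. if \<forall>j. d i j \<le> u j then coef g (\<lambda>j. u j - d i j) else 0)"
    using S by (intro sum.mono_neutral_cong_left) auto
  finally show ?thesis .
qed

definition var0 :: "ratfun mseries" where
  "var0 = of_coef (\<lambda>v. if v = (\<lambda>_. 0)(0 := 1) then 1 else 0)"

lemma coef_var0_mult:
  assumes "fs u"
  shows "coef (var0 * g) u = (if u 0 = 0 then 0 else coef g (u(0 := u 0 - 1)))"
proof -
  have "coef (of_coef (\<lambda>v. if v \<in> (\<lambda>i. (\<lambda>_. 0)(i := 1)) ` {0} then 1 else 0) * g) u =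
    (\<Sum>i\<in>{0}. if \<forall>j. ((\<lambda>_. 0)(i := 1)) j \<le> u j then coef g (\<lambda>j. u j - ((\<lambda>_. 0)(i := 1)) j) else 0)"
    using assms by (intro coef_indicator_mult) (auto simp: supp_def)
  moreover have "(\<lambda>j. u j - ((\<lambda>_. 0)(0 := 1)) j) = u(0 := u 0 - 1)"
    by auto
  ultimately show ?thesis
    by (auto simp: var0_def)
qed

lemma coef_power_sum_mult:
  assumes u: "fs u" and S: "finite S" "supp u \<subseteq> S" and k: "k \<ge> 1"
  shows "coef (power_sum k * g) u = (\<Sum>i\<in>S. if k \<le> u i then coef g (u(i := u i - k)) else 0)"
proof -
  let ?d = "\<lambda>i. (\<lambda>_. 0)(i := k)"
  have eq: "power_sum k = of_coef (\<lambda>v. if v \<in> range ?d then 1 else 0)"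
  proof -
    have "(\<exists>i. e = Poly_Mapping.single i k) \<longleftrightarrow> Poly_Mapping.lookup e \<in> range ?d" for e :: "nat \<Rightarrow>\<^sub>0 nat"
    proof -
      have "e = Poly_Mapping.single i k \<longleftrightarrow> Poly_Mapping.lookup e = ?d i" for i
        unfolding poly_mapping_eq_iff by (rule arg_cong[where f = "\<lambda>x. Poly_Mapping.lookup e = x"])
           (auto simp: lookup_single when_def)
      then show ?thesis
        by blast
    qed
    then show ?thesis
      by (simp add: power_sum_def of_coef_def)
  qed
  have "coef (power_sum k * g) u =
    (\<Sum>i\<in>S. if \<forall>j. ?d i j \<le> u j then coef g (\<lambda>j. u j - ?d i j) else 0)"
    unfolding eq
  proof (rule coef_indicator_mult)
    show "inj ?d"
      using k by (auto simp: inj_def fun_eq_iff)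
    show "fs (?d i)" for i
      by (simp add: supp_def)
    show "i \<in> S" if "\<forall>j. ?d i j \<le> u j" for i
    proof -
      have "u i \<noteq> 0"
        using that k by (auto dest!: spec[of _ i])
      then show ?thesis
        using S by auto
    qed
  qed (use assms in auto)
  also have "\<dots> = (\<Sum>i\<in>S. if k \<le> u i then coef g (u(i := u i - k)) else 0)"
  proof (rule sum.cong[OF refl])
    fix i
    have "(\<lambda>j. u j - ?d i j) = u(i := u i - k)" "(\<forall>j. ?d i j \<le> u j) \<longleftrightarrow> k \<le> u i"
      by auto
    then show "(if \<forall>j. ?d i j \<le> u j then coef g (\<lambda>j. u j - ?d i j) else 0) =
        (if k \<le> u i then coef g (u(i := u i - k)) else 0)"
      by simp
  qed
  finally show ?thesis .
qed

section \<open>The Laplace--Beltrami and Cherednik operators\<close>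

text \<open>The subtracted term is the sum of \<open>min (u i) (u j)\<close> over unordered pairs of
  positions, which is n(u) for a decreasing \<open>u\<close>. Halving the full double sum after
  removing its diagonal makes the permutation invariance visible without ordering the
  support.\<close>

definition eps :: "(nat \<Rightarrow> nat) \<Rightarrow> ratfun" where
  "eps u = (\<Sum>i\<in>supp u. alpha * (of_nat (u i) * (of_nat (u i) - 1)) / 2)
     - (of_nat (\<Sum>i\<in>supp u. \<Sum>j\<in>supp u. min (u i) (u j)) - of_nat (\<Sum>i\<in>supp u. u i)) / 2"

text \<open>The content of the box that the sorted shape of \<open>u\<close> gains when the exponent
  of x_0 grows by one: its column is \<open>u 0\<close>, its row the number of strictly larger
  exponents.\<close>

definition cont :: "(nat \<Rightarrow> nat) \<Rightarrow> ratfun" where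
  "cont u = alpha * of_nat (u 0) - of_nat (card {j. u j > u 0})"

text \<open>Only monomials whose exponents at \<open>i\<close> and \<open>j\<close> lie strictly
  further apart, with the same sum, feed into the coefficient at \<open>u\<close>. This is the
  source of triangularity for dominance.\<close>

definition Dterm :: "((nat \<Rightarrow> nat) \<Rightarrow> ratfun) \<Rightarrow> (nat \<Rightarrow> nat) \<Rightarrow> nat \<Rightarrow> nat \<Rightarrow> ratfun" where
  "Dterm F u i j = (\<Sum>a | u i < a \<and> u j < a \<and> a \<le> u i + u j.
      (of_nat a - of_nat (u j)) * F (u(i := a, j := u i + u j - a)))"

text \<open>The first sum admits a = \<open>u j\<close> when \<open>u j\<close> exceeds
  \<open>u 0\<close>: the vector with the two exponents exchanged. It is the only term that does not
  spread the exponents further apart, and it decides how \<open>opL\<close> acts on leading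
  coefficients.\<close>

definition Lterm :: "((nat \<Rightarrow> nat) \<Rightarrow> ratfun) \<Rightarrow> (nat \<Rightarrow> nat) \<Rightarrow> nat \<Rightarrow> ratfun" where
  "Lterm F u j = (\<Sum>a | u 0 < a \<and> u j \<le> a \<and> a \<le> u 0 + u j. F (u(0 := a, j := u 0 + u j - a)))
      - (\<Sum>a | u 0 < a \<and> u j < a \<and> a \<le> u 0 + u j. F (u(0 := u 0 + u j - a, j := a)))"

text \<open>
  \<open>opD\<close> is the Laplace--Beltrami operator, stabilised in the number of variables (its diagonal entry
  \<open>eps u\<close> is \<open>\<alpha> n(u') - n(u)\<close>), \<open>opL\<close> is the Cherednik operator of the variable \<open>x\<^sub>0\<close>,
  and \<open>opA g\<close> symmetrises \<open>x\<^sub>0 g\<close>. Multiplication by \<open>x\<^sub>0\<close> intertwines \<open>opD\<close> with \<open>opD + opL\<close>,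
  and so does \<open>opA\<close>.
\<close>

definition opD :: "ratfun mseries \<Rightarrow> ratfun mseries" where
  "opD g = of_coef (\<lambda>u. eps u * coef g u
     + (\<Sum>i\<in>supp u. \<Sum>j\<in>supp u - {i}. Dterm (coef g) u i j))"

definition opL :: "ratfun mseries \<Rightarrow> ratfun mseries" where
  "opL g = of_coef (\<lambda>u. cont u * coef g u + (\<Sum>j\<in>supp u - {0}. Lterm (coef g) u j))"

definition opA :: "ratfun mseries \<Rightarrow> ratfun mseries" where
  "opA g = of_coef (\<lambda>u. \<Sum>i\<in>supp u. coef g (u(i := u i - 1) \<circ> transpose 0 i))"

lemma supp_comp_transpose: "supp (u \<circ> transpose i j) = transpose i j ` supp u"
proof (intro set_eqI iffI)
  fix x assume "x \<in> supp (u \<circ> transpose i j)"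
  then have "transpose i j (transpose i j x) \<in> transpose i j ` supp u"
    by (intro imageI) simp
  then show "x \<in> transpose i j ` supp u"
    by simp
qed auto

lemma fs_comp_transpose [simp]: "fs (u \<circ> transpose i j) \<longleftrightarrow> fs u"
  by (simp add: supp_comp_transpose finite_image_iff)

text \<open>The range of summation in \<open>Dterm\<close> is empty as soon as one of the two
  exponents is 0, so any finite superset of the support may index the sum. A common index set is
  what allows two vectors to be compared.\<close>

lemma coef_opD:
  assumes u: "fs u" and S: "finite S" "supp u \<subseteq> S"
  shows "coef (opD g) u = eps u * coef g u + (\<Sum>i\<in>S. \<Sum>j\<in>S - {i}. Dterm (coef g) u i j)"
proof -
  have 0: "Dterm (coef g) u i j = 0" if "u i = 0 \<or> u j = 0" for i j
    unfolding Dterm_def using that by (intro sum.neutral) auto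
  have "(\<Sum>i\<in>supp u. \<Sum>j\<in>supp u - {i}. Dterm (coef g) u i j) =
     (\<Sum>i\<in>supp u. \<Sum>j\<in>S - {i}. Dterm (coef g) u i j)"
    using assms by (intro sum.cong[OF refl] sum.mono_neutral_left) (auto intro!: 0)
  also have "\<dots> = (\<Sum>i\<in>S. \<Sum>j\<in>S - {i}. Dterm (coef g) u i j)"
    using assms by (intro sum.mono_neutral_left) (auto intro!: 0 sum.neutral)
  finally show ?thesis
    using u by (simp add: opD_def)
qed

lemma coef_opL:
  assumes u: "fs u" and S: "finite S" "supp u \<subseteq> S"
  shows "coef (opL g) u = cont u * coef g u + (\<Sum>j\<in>S - {0}. Lterm (coef g) u j)"
proof -
  have 0: "Lterm (coef g) u j = 0" if "u j = 0" for j
    unfolding Lterm_def using that by (simp add: sum.neutral)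
  have "(\<Sum>j\<in>supp u - {0}. Lterm (coef g) u j) = (\<Sum>j\<in>S - {0}. Lterm (coef g) u j)"
    using assms by (intro sum.mono_neutral_left) (auto intro!: 0)
  then show ?thesis
    using u by (simp add: opL_def)
qed

lemma coef_opA:
  assumes u: "fs u"
  shows "coef (opA g) u = (\<Sum>i\<in>supp u. coef g (u(i := u i - 1) \<circ> transpose 0 i))"
  using u by (simp add: opA_def)

lemma opD_add: "opD (f + g) = opD f + opD g"
  by (rule coef_eqI) (simp add: opD_def Dterm_def distrib_left sum.distrib ac_simps)

lemma opD_mscale: "opD (mscale c f) = mscale c (opD f)"
  by (rule coef_eqI) (simp add: opD_def Dterm_def algebra_simps sum_distrib_left)

lemma opL_add: "opL (f + g) = opL f + opL g"
  by (rule coef_eqI) (simp add: opL_def Lterm_def algebra_simps sum.distrib sum_subtractf)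

lemma opL_mscale: "opL (mscale c f) = mscale c (opL f)"
  by (rule coef_eqI) (simp add: opL_def Lterm_def algebra_simps sum_distrib_left sum_subtractf)

lemma opA_add: "opA (f + g) = opA f + opA g"
  by (rule coef_eqI) (simp add: opA_def algebra_simps sum.distrib)

lemma opA_mscale: "opA (mscale c f) = mscale c (opA f)"
  by (rule coef_eqI) (simp add: opA_def algebra_simps sum_distrib_left)

lemma eps_superset:
  assumes u: "fs u" and S: "finite S" "supp u \<subseteq> S"
  shows "eps u = (\<Sum>i\<in>S. alpha * (of_nat (u i) * (of_nat (u i) - 1)) / 2)
     - (of_nat (\<Sum>i\<in>S. \<Sum>j\<in>S. min (u i) (u j)) - of_nat (\<Sum>i\<in>S. u i)) / 2"
proof -
  have 1: "(\<Sum>i\<in>supp u. alpha * (of_nat (u i) * (of_nat (u i) - 1)) / 2)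
      = (\<Sum>i\<in>S. alpha * (of_nat (u i) * (of_nat (u i) - 1)) / 2)"
    using S by (intro sum.mono_neutral_left) auto
  have 2: "(\<Sum>i\<in>supp u. u i) = (\<Sum>i\<in>S. u i)"
    using S by (intro sum.mono_neutral_left) auto
  have "(\<Sum>i\<in>supp u. \<Sum>j\<in>supp u. min (u i) (u j)) = (\<Sum>i\<in>supp u. \<Sum>j\<in>S. min (u i) (u j))"
    using S by (intro sum.cong[OF refl] sum.mono_neutral_left) auto
  also have "\<dots> = (\<Sum>i\<in>S. \<Sum>j\<in>S. min (u i) (u j))"
    using S by (intro sum.mono_neutral_left) auto
  finally show ?thesis
    unfolding eps_def 1 2 by simp
qed

text \<open>Raising \<open>u 0\<close> by one raises \<open>min (u 0) (u j)\<close> exactly at the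
  positions with \<open>u j > u 0\<close>, and it raises the \<alpha>-term by \<alpha> times
  \<open>u 0\<close>.\<close>

lemma eps_step:
  assumes u: "fs u"
  shows "eps (u(0 := Suc (u 0))) = eps u + cont u"
proof -
  define T where "T = supp u - {0}"
  define v where "v = u(0 := Suc (u 0))"
  have T: "finite T" "0 \<notin> T" "supp u \<subseteq> insert 0 T" "supp v \<subseteq> insert 0 T"
    using u by (auto simp: T_def v_def split: if_splits)
  have E: "eps w = (\<Sum>i\<in>T. alpha * (of_nat (w i) * (of_nat (w i) - 1)) / 2)
      + alpha * (of_nat (w 0) * (of_nat (w 0) - 1)) / 2
      - of_nat (\<Sum>j\<in>T. min (w 0) (w j))
      - (of_nat (\<Sum>i\<in>T. \<Sum>j\<in>T. min (w i) (w j)) - of_nat (\<Sum>i\<in>T. w i)) / 2"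
    if w: "fs w" "supp w \<subseteq> insert 0 T" for w
  proof -
    have "(\<Sum>i\<in>insert 0 T. \<Sum>j\<in>insert 0 T. min (w i) (w j)) =
       w 0 + (\<Sum>j\<in>T. min (w 0) (w j)) + ((\<Sum>i\<in>T. min (w i) (w 0)) + (\<Sum>i\<in>T. \<Sum>j\<in>T. min (w i) (w j)))"
      using T by (simp add: sum.distrib)
    also have "(\<Sum>i\<in>T. min (w i) (w 0)) = (\<Sum>j\<in>T. min (w 0) (w j))"
      by (simp add: min.commute)
    finally have "(\<Sum>i\<in>insert 0 T. \<Sum>j\<in>insert 0 T. min (w i) (w j)) =
       w 0 + 2 * (\<Sum>j\<in>T. min (w 0) (w j)) + (\<Sum>i\<in>T. \<Sum>j\<in>T. min (w i) (w j))"
      by simp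
    then show ?thesis
      using T w by (subst eps_superset[of w "insert 0 T"]) (simp_all add: field_simps)
  qed
  have vT: "v i = u i" if "i \<in> T" for i
    using that T(2) by (metis fun_upd_other v_def)
  have v0: "v 0 = Suc (u 0)" and fsv: "fs v"
    using u by (auto simp: v_def)
  have "(\<Sum>j\<in>T. min (Suc (u 0)) (u j)) = (\<Sum>j\<in>T. min (u 0) (u j) + (if u j > u 0 then 1 else 0))"
    by (intro sum.cong) auto
  also have "\<dots> = (\<Sum>j\<in>T. min (u 0) (u j)) + card {j \<in> T. u j > u 0}"
    using T(1) by (simp add: sum.distrib sum.If_cases Int_def)
  also have "{j \<in> T. u j > u 0} = {j. u j > u 0}"
    unfolding T_def by (auto intro: gr0I)
  finally have m: "(\<Sum>j\<in>T. min (Suc (u 0)) (u j)) = (\<Sum>j\<in>T. min (u 0) (u j)) + card {j. u j > u 0}" .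
  have "eps v - eps u = cont u"
    unfolding E[OF fsv T(4)] E[OF u T(3)] cont_def
    by (simp add: vT v0 m field_simps cong: sum.cong)
  then show ?thesis
    by (simp add: v_def algebra_simps)
qed

lemma sum_pairs_split:
  fixes t :: "nat \<Rightarrow> nat \<Rightarrow> 'a::comm_monoid_add"
  assumes "finite T" "0 \<notin> T"
  shows "(\<Sum>i\<in>insert 0 T. \<Sum>j\<in>insert 0 T - {i}. t i j) =
    (\<Sum>i\<in>T. \<Sum>j\<in>T - {i}. t i j) + (\<Sum>j\<in>T. t 0 j + t j 0)"
proof -
  have 1: "(\<Sum>j\<in>insert 0 T - {i}. t i j) = (\<Sum>j\<in>T - {i}. t i j) + t i 0" if "i \<in> T" for i
  proof -
    have "insert 0 T - {i} = insert 0 (T - {i})"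
      using that assms by auto
    then show ?thesis
      using assms by (simp add: add.commute)
  qed
  have "(\<Sum>i\<in>insert 0 T. \<Sum>j\<in>insert 0 T - {i}. t i j) =
     (\<Sum>j\<in>T. t 0 j) + (\<Sum>i\<in>T. (\<Sum>j\<in>T - {i}. t i j) + t i 0)"
    using assms by (simp add: 1)
  then show ?thesis
    by (simp add: sum.distrib ac_simps)
qed

text \<open>Shifting the summation index by one increases the weight a - \<open>u j\<close> by 1,
  and the surplus is the first sum of \<open>Lterm\<close>. The additional index a =
  \<open>u j\<close> carries weight 0 in \<open>Dterm\<close>.\<close>

lemma Dterm_var0_left:
  assumes u: "fs u" and u0: "u 0 = Suc k" and j: "j \<noteq> 0"
  shows "Dterm (coef (var0 * g)) u 0 j = Dterm (coef g) (u(0 := k)) 0 j +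
    (\<Sum>a | k < a \<and> u j \<le> a \<and> a \<le> k + u j. coef g (u(0 := a, j := k + u j - a)))"
proof -
  let ?R = "{a. k < a \<and> u j \<le> a \<and> a \<le> k + u j}"
  have "Dterm (coef (var0 * g)) u 0 j =
      (\<Sum>a | Suc k < a \<and> u j < a \<and> a \<le> Suc (k + u j).
         (of_nat a - of_nat (u j)) * coef g (u(0 := a - 1, j := Suc (k + u j) - a)))"
    unfolding Dterm_def u0
  proof (intro sum.cong)
    fix a assume a: "a \<in> {a. Suc k < a \<and> u j < a \<and> a \<le> Suc (k + u j)}"
    have "u(0 := a, j := Suc (k + u j) - a, 0 := a - 1) = u(0 := a - 1, j := Suc (k + u j) - a)"
      using j by (auto simp: fun_eq_iff)
    then show "(of_nat a - of_nat (u j)) * coef (var0 * g) (u(0 := a, j := Suc k + u j - a)) =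
        (of_nat a - of_nat (u j)) * coef g (u(0 := a - 1, j := Suc (k + u j) - a))"
      using a j u by (simp add: coef_var0_mult)
  qed auto
  also have "\<dots> = (\<Sum>a\<in>?R. (of_nat a + 1 - of_nat (u j)) * coef g (u(0 := a, j := k + u j - a)))"
    by (rule sum.reindex_bij_witness[where i = Suc and j = "\<lambda>a. a - 1"]) auto
  also have "\<dots> = (\<Sum>a\<in>?R. (of_nat a - of_nat (u j)) * coef g (u(0 := a, j := k + u j - a))) +
      (\<Sum>a\<in>?R. coef g (u(0 := a, j := k + u j - a)))"
    by (simp add: algebra_simps sum.distrib sum_subtractf)
  also have "(\<Sum>a\<in>?R. (of_nat a - of_nat (u j)) * coef g (u(0 := a, j := k + u j - a))) =
     Dterm (coef g) (u(0 := k)) 0 j"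
    using j unfolding Dterm_def by (intro sum.mono_neutral_cong_right) (auto simp: not_less)
  finally show ?thesis .
qed

text \<open>Here the weight decreases by 1, which yields the second sum of \<open>Lterm\<close> with
  its minus sign. The largest a drops out because it would leave exponent 0 at x_0.\<close>

lemma Dterm_var0_right:
  assumes u: "fs u" and u0: "u 0 = Suc k" and j: "j \<noteq> 0"
  shows "Dterm (coef (var0 * g)) u j 0 = Dterm (coef g) (u(0 := k)) j 0 -
    (\<Sum>a | k < a \<and> u j < a \<and> a \<le> k + u j. coef g (u(0 := k + u j - a, j := a)))"
proof -
  let ?R = "{a. k < a \<and> u j < a \<and> a \<le> k + u j}"
  have "Dterm (coef (var0 * g)) u j 0 =
      (\<Sum>a | Suc k < a \<and> u j < a \<and> a \<le> k + u j.
         (of_nat a - of_nat (Suc k)) * coef g (u(0 := k + u j - a, j := a)))"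
    unfolding Dterm_def u0
  proof (rule sum.mono_neutral_cong_right)
    show "\<forall>a\<in>{a. u j < a \<and> Suc k < a \<and> a \<le> u j + Suc k} - {a. Suc k < a \<and> u j < a \<and> a \<le> k + u j}.
       (of_nat a - of_nat (Suc k)) * coef (var0 * g) (u(j := a, 0 := u j + Suc k - a)) = 0"
      using u by (auto simp: coef_var0_mult)
    fix a assume a: "a \<in> {a. Suc k < a \<and> u j < a \<and> a \<le> k + u j}"
    have "u(j := a, 0 := u j + Suc k - a, 0 := u j + Suc k - a - 1) = u(0 := k + u j - a, j := a)"
      using j by (auto simp: fun_eq_iff)
    then show "(of_nat a - of_nat (Suc k)) * coef (var0 * g) (u(j := a, 0 := u j + Suc k - a)) =
        (of_nat a - of_nat (Suc k)) * coef g (u(0 := k + u j - a, j := a))"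
      using a j u by (auto simp: coef_var0_mult)
  qed auto
  also have "\<dots> = (\<Sum>a\<in>?R. (of_nat a - of_nat k - 1) * coef g (u(0 := k + u j - a, j := a)))"
  proof (intro sum.mono_neutral_cong_left ballI)
    fix a assume "a \<in> ?R - {a. Suc k < a \<and> u j < a \<and> a \<le> k + u j}"
    then have "a = Suc k"
      by auto
    then show "(of_nat a - of_nat k - 1) * coef g (u(0 := k + u j - a, j := a)) = 0"
      by simp
  qed auto
  also have "\<dots> = (\<Sum>a\<in>?R. (of_nat a - of_nat k) * coef g (u(0 := k + u j - a, j := a))) -
      (\<Sum>a\<in>?R. coef g (u(0 := k + u j - a, j := a)))"
    by (simp add: algebra_simps sum.distrib sum_subtractf)
  also have "(\<Sum>a\<in>?R. (of_nat a - of_nat k) * coef g (u(0 := k + u j - a, j := a))) =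
     Dterm (coef g) (u(0 := k)) j 0"
    using j unfolding Dterm_def by (intro sum.cong) (auto simp: fun_upd_twist add.commute)
  finally show ?thesis .
qed

lemma opD_var0: "opD (var0 * g) = var0 * (opD g + opL g)"
proof (rule coef_eqI)
  fix u assume u: "fs u"
  define T where "T = supp u - {0}"
  have T: "finite T" "0 \<notin> T" "supp u \<subseteq> insert 0 T"
    using u by (auto simp: T_def)
  show "coef (opD (var0 * g)) u = coef (var0 * (opD g + opL g)) u"
  proof (cases "u 0")
    case 0
    have "Dterm (coef (var0 * g)) u i j = 0" if "i \<in> supp u" "j \<in> supp u" for i j
    proof -
      have "i \<noteq> 0" "j \<noteq> 0"
        using that 0 by (metis in_supp)+
      then show ?thesis
        using u 0 by (auto simp: Dterm_def coef_var0_mult intro!: sum.neutral)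
    qed
    then show ?thesis
      using u 0 by (simp add: coef_opD[OF u _ order_refl] coef_var0_mult sum.neutral)
  next
    case (Suc k)
    define v where "v = u(0 := k)"
    have v: "fs v" "supp v \<subseteq> insert 0 T" "v 0 = k" "eps u = eps v + cont v"
    proof -
      show "fs v" "v 0 = k"
        using u by (auto simp: v_def)
      show "supp v \<subseteq> insert 0 T"
        by (auto simp: v_def T_def split: if_splits)
      have "u = v(0 := Suc (v 0))"
        using Suc by (auto simp: v_def)
      then show "eps u = eps v + cont v"
        using eps_step[OF \<open>fs v\<close>] by simp
    qed
    have X: "coef (var0 * h) u = coef h v" for h
      using u Suc by (simp add: coef_var0_mult v_def)
    have TT: "Dterm (coef (var0 * g)) u i j = Dterm (coef g) v i j" if "i \<in> T" "j \<in> T" "i \<noteq> j" for i j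
    proof -
      have n0: "i \<noteq> 0" "j \<noteq> 0"
        using that T by metis+
      have "u(i := a, j := b, 0 := u 0 - 1) = v(i := a, j := b)" for a b
        using n0 Suc by (auto simp: v_def fun_eq_iff)
      then show ?thesis
        using n0 u Suc by (simp add: Dterm_def coef_var0_mult v_def)
    qed
    have Lt: "Lterm (coef g) v j =
        (\<Sum>a | k < a \<and> u j \<le> a \<and> a \<le> k + u j. coef g (u(0 := a, j := k + u j - a))) -
        (\<Sum>a | k < a \<and> u j < a \<and> a \<le> k + u j. coef g (u(0 := k + u j - a, j := a)))"
      if "j \<in> T" for j
      using that T(2) by (cases "j = 0") (auto simp: Lterm_def v_def)
    have 0: "Dterm (coef (var0 * g)) u 0 j + Dterm (coef (var0 * g)) u j 0 =
        (Dterm (coef g) v 0 j + Dterm (coef g) v j 0) + Lterm (coef g) v j" if "j \<in> T" for j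
    proof -
      have "j \<noteq> 0"
        using that T by metis
      then show ?thesis
        using Dterm_var0_left[OF u Suc, of j g] Dterm_var0_right[OF u Suc, of j g] Lt[OF that]
        by (simp add: v_def)
    qed
    have "coef (opD (var0 * g)) u = eps u * coef g v + ((\<Sum>i\<in>T. \<Sum>j\<in>T - {i}. Dterm (coef g) v i j)
        + (\<Sum>j\<in>T. (Dterm (coef g) v 0 j + Dterm (coef g) v j 0) + Lterm (coef g) v j))"
    proof -
      have 1: "(\<Sum>i\<in>T. \<Sum>j\<in>T - {i}. Dterm (coef (var0 * g)) u i j) = (\<Sum>i\<in>T. \<Sum>j\<in>T - {i}. Dterm (coef g) v i j)"
        by (intro sum.cong refl TT) auto
      have 2: "(\<Sum>j\<in>T. Dterm (coef (var0 * g)) u 0 j + Dterm (coef (var0 * g)) u j 0) =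
          (\<Sum>j\<in>T. (Dterm (coef g) v 0 j + Dterm (coef g) v j 0) + Lterm (coef g) v j)"
        by (intro sum.cong refl 0)
      show ?thesis
        unfolding coef_opD[OF u, of "insert 0 T" "var0 * g", OF finite.insertI[OF T(1)] T(3)] X
          sum_pairs_split[OF T(1,2)] 1 2 ..
    qed
    also have "\<dots> = coef (opD g) v + coef (opL g) v"
    proof -
      have "insert 0 T - {0} = T"
        using T(2) by auto
      then show ?thesis
        unfolding coef_opD[OF v(1), of "insert 0 T" g, OF finite.insertI[OF T(1)] v(2)]
          coef_opL[OF v(1), of "insert 0 T" g, OF finite.insertI[OF T(1)] v(2)]
          sum_pairs_split[OF T(1,2)] v(4)
        by (simp add: sum.distrib algebra_simps)
    qed
    finally show ?thesis
      by (simp add: X)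
  qed
qed

section \<open>Orbits of exponent vectors, and equivariance under exchanging variables\<close>

definition shape :: "(nat \<Rightarrow> nat) \<Rightarrow> nat multiset" where
  "shape u = image_mset u (mset_set (supp u))"

lemma sum_supp_shape: "(\<Sum>i\<in>supp u. f (u i)) = (\<Sum>a\<in>#shape u. f a)"
  by (simp add: shape_def multiset.map_comp comp_def sum_unfold_sum_mset)

lemma shape_comp_bij:
  assumes "bij \<tau>"
  shows "shape (u \<circ> \<tau>) = shape u"
proof -
  have "bij_betw \<tau> (supp (u \<circ> \<tau>)) (supp u)"
    unfolding bij_betw_def
  proof
    show "inj_on \<tau> (supp (u \<circ> \<tau>))"
      using assms by (auto simp: bij_def inj_on_def)
    show "\<tau> ` supp (u \<circ> \<tau>) = supp u"
    proof (intro set_eqI iffI)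
      fix y assume "y \<in> supp u"
      moreover obtain x where "y = \<tau> x"
        using assms by (meson bij_pointE)
      ultimately show "y \<in> \<tau> ` supp (u \<circ> \<tau>)"
        by simp
    qed auto
  qed
  then have "image_mset \<tau> (mset_set (supp (u \<circ> \<tau>))) = mset_set (supp u)"
    using image_mset_mset_set[of \<tau> "supp (u \<circ> \<tau>)"] by (simp only: bij_betw_def)
  then have "image_mset u (image_mset \<tau> (mset_set (supp (u \<circ> \<tau>)))) = image_mset u (mset_set (supp u))"
    by simp
  then show ?thesis
    by (simp only: shape_def multiset.map_comp)
qed

lemma shape_upd:
  assumes "fs u"
  shows "shape (u(i := a)) = (if a = 0 then {#} else {#a#}) + (shape u - (if u i = 0 then {#} else {#u i#}))"
proof -
  have 1: "supp (u(i := a)) - {i} = supp u - {i}"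
    by (auto split: if_splits)
  have 2: "shape w = (if w i = 0 then {#} else {#w i#}) + image_mset w (mset_set (supp w - {i}))"
    if "fs w" for w
    using that by (cases "i \<in> supp w") (auto simp: shape_def mset_set.remove)
  have 3: "image_mset (u(i := a)) (mset_set (supp u - {i})) = image_mset u (mset_set (supp u - {i}))"
    using assms by (intro image_mset_cong) auto
  show ?thesis
    unfolding 2[of "u(i := a)", unfolded fs_upd, OF assms] 2[OF assms] 1 3 by simp
qed

lemma eps_shape: "eps u = (\<Sum>a\<in>#shape u. alpha * (of_nat a * (of_nat a - 1)) / 2)
   - (of_nat (\<Sum>a\<in>#shape u. \<Sum>b\<in>#shape u. min a b) - of_nat (\<Sum>a\<in>#shape u. a)) / 2"
  unfolding eps_def sum_supp_shape[of "\<lambda>b. min _ b"] 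
   sum_supp_shape[of "\<lambda>x. x" u]
   sum_supp_shape[of "\<lambda>x. alpha * (of_nat x * (of_nat x - 1)) / 2"]
   sum_supp_shape[of "\<lambda>x. (\<Sum>b\<in>#shape u. min x b)"] ..

lemma eps_cong_shape: "shape u = shape v \<Longrightarrow> eps u = eps v"
  by (simp add: eps_shape)

definition swap0 :: "nat \<Rightarrow> ratfun mseries \<Rightarrow> ratfun mseries" where
  "swap0 l g = of_coef (\<lambda>u. coef g (u \<circ> transpose 0 l))"

lemma coef_swap0 [simp]: "fs u \<Longrightarrow> coef (swap0 l g) u = coef g (u \<circ> transpose 0 l)"
  by (simp add: swap0_def)

lemma upd_comp_transpose: "u(i := a) \<circ> transpose p q = (u \<circ> transpose p q)(transpose p q i := a)"
proof
  fix x
  have "transpose p q x = i \<longleftrightarrow> x = transpose p q i"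
    by (metis transpose_involutory)
  then show "(u(i := a) \<circ> transpose p q) x = ((u \<circ> transpose p q)(transpose p q i := a)) x"
    by simp
qed

lemma opD_swap0: "opD (swap0 l g) = swap0 l (opD g)"
proof (rule coef_eqI)
  fix u assume u: "fs u"
  let ?t = "transpose 0 l"
  have t: "Dterm (coef (swap0 l g)) u i j = Dterm (coef g) (u \<circ> ?t) (?t i) (?t j)" for i j
  proof -
    have "coef (swap0 l g) (u(i := a, j := b)) = coef g ((u \<circ> ?t)(?t i := a, ?t j := b))" for a b
      using u by (simp only: coef_swap0 fs_upd upd_comp_transpose)
    moreover have "(u \<circ> ?t) (?t i) = u i" "(u \<circ> ?t) (?t j) = u j"
      by simp_all
    ultimately show ?thesis
      unfolding Dterm_def by simp
  qed
  have s: "supp (u \<circ> ?t) = ?t ` supp u"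
    by (rule supp_comp_transpose)
  have "(\<Sum>i\<in>supp (u \<circ> ?t). \<Sum>j\<in>supp (u \<circ> ?t) - {i}. Dterm (coef g) (u \<circ> ?t) i j) =
    (\<Sum>i\<in>supp u. \<Sum>j\<in>?t ` supp u - {?t i}. Dterm (coef g) (u \<circ> ?t) (?t i) j)"
    unfolding s by (subst sum.reindex) auto
  also have "\<dots> = (\<Sum>i\<in>supp u. \<Sum>j\<in>supp u - {i}. Dterm (coef g) (u \<circ> ?t) (?t i) (?t j))"
  proof (rule sum.cong[OF refl])
    fix i
    have "?t ` supp u - {?t i} = ?t ` (supp u - {i})"
      using image_set_diff[OF inj_transpose[of 0 l], of "supp u" "{i}"] by simp
    then show "(\<Sum>j\<in>?t ` supp u - {?t i}. Dterm (coef g) (u \<circ> ?t) (?t i) j) =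
       (\<Sum>j\<in>supp u - {i}. Dterm (coef g) (u \<circ> ?t) (?t i) (?t j))"
      by (simp only: sum.reindex[OF inj_on_subset[OF inj_transpose subset_UNIV]] comp_def)
  qed
  finally have "(\<Sum>i\<in>supp u. \<Sum>j\<in>supp u - {i}. Dterm (coef (swap0 l g)) u i j) =
     (\<Sum>i\<in>supp (u \<circ> ?t). \<Sum>j\<in>supp (u \<circ> ?t) - {i}. Dterm (coef g) (u \<circ> ?t) i j)"
    by (simp only: t)
  moreover have "eps (u \<circ> ?t) = eps u"
    by (rule eps_cong_shape[OF shape_comp_bij[OF bij_transpose]])
  ultimately show "coef (opD (swap0 l g)) u = coef (swap0 l (opD g)) u"
    using u by (simp only: coef_opD[OF u u order_refl] coef_swap0
      coef_opD[of "u \<circ> ?t", unfolded fs_comp_transpose, OF u _ order_refl, unfolded fs_comp_transpose, OF u])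
qed

lemma coef_opA_swap0:
  assumes u: "fs u" and S: "finite S" "supp u \<subseteq> S"
  shows "coef (opA g) u = (\<Sum>i\<in>S. coef (swap0 i (var0 * g)) u)"
proof -
  have "coef (swap0 i (var0 * g)) u = (if u i = 0 then 0 else coef g (u(i := u i - 1) \<circ> transpose 0 i))" for i
    using u by (simp add: coef_var0_mult upd_comp_transpose)
  then show ?thesis
    using u S by (simp add: coef_opA) (rule sum.mono_neutral_cong_left, auto)
qed

text \<open>Locally \<open>opA g\<close> is the finite sum of the images of x_0 g under exchanging
  x_0 with each variable of the support, and the moves of \<open>Dterm\<close> keep the support
  inside the same set. Equivariance of \<open>opD\<close> under these exchanges reduces the claim to
  \<open>opD_var0\<close>.\<close>

lemma opD_opA: "opD (opA g) = opA (opD g + opL g)"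
proof (rule coef_eqI)
  fix u assume u: "fs u"
  let ?S = "supp u"
  have "Dterm (coef (opA g)) u i j = (\<Sum>l\<in>?S. Dterm (coef (swap0 l (var0 * g))) u i j)"
    if ij: "i \<in> ?S" "j \<in> ?S" for i j
  proof -
    have "coef (opA g) (u(i := a, j := b)) = (\<Sum>l\<in>?S. coef (swap0 l (var0 * g)) (u(i := a, j := b)))" for a b
    proof (rule coef_opA_swap0)
      show "supp (u(i := a, j := b)) \<subseteq> ?S"
        using ij by (auto split: if_splits)
    qed (use u in auto)
    then show ?thesis
      by (simp add: Dterm_def sum_distrib_left del: coef_swap0) (rule sum.swap)
  qed
  then have "(\<Sum>i\<in>?S. \<Sum>j\<in>?S - {i}. Dterm (coef (opA g)) u i j) =
     (\<Sum>i\<in>?S. \<Sum>j\<in>?S - {i}. \<Sum>l\<in>?S. Dterm (coef (swap0 l (var0 * g))) u i j)"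
    by (intro sum.cong) auto
  also have "\<dots> = (\<Sum>i\<in>?S. \<Sum>l\<in>?S. \<Sum>j\<in>?S - {i}. Dterm (coef (swap0 l (var0 * g))) u i j)"
    by (rule sum.cong[OF refl], rule sum.swap)
  also have "\<dots> = (\<Sum>l\<in>?S. \<Sum>i\<in>?S. \<Sum>j\<in>?S - {i}. Dterm (coef (swap0 l (var0 * g))) u i j)"
    by (rule sum.swap)
  finally have "coef (opD (opA g)) u = (\<Sum>l\<in>?S. coef (opD (swap0 l (var0 * g))) u)"
    using u by (simp add: coef_opD[OF _ _ order_refl] coef_opA_swap0[OF u _ order_refl] sum.distrib
        sum_distrib_left del: coef_swap0)
  also have "\<dots> = coef (opA (opD g + opL g)) u"
    using u by (simp add: coef_opA_swap0[OF u _ order_refl] opD_swap0 opD_var0 del: coef_swap0)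
  finally show "coef (opD (opA g)) u = coef (opA (opD g + opL g)) u" .
qed

text \<open>The ranges belonging to \<open>u 0\<close> and to \<open>u 0 - 1\<close> agree up to one
  boundary term: it sits in the first sum if \<open>u j > u 0\<close> and in the second if
  \<open>u j < u 0\<close>, and in both cases it is the coefficient at the exchanged vector.\<close>

lemma Lterm_var0:
  assumes u: "fs u" and u0: "u 0 = Suc k" and j: "j \<noteq> 0"
  shows "Lterm (coef (var0 * g)) u j = Lterm (coef g) (u(0 := k)) j
     + (if u j = 0 \<or> u j = Suc k then 0 else coef g (u(0 := u j - 1, j := Suc k)))"
proof -
  let ?G = "\<lambda>a. coef g (u(0 := a, j := k + u j - a))"
  let ?H = "\<lambda>a. coef g (u(0 := k + u j - a, j := a))"
  let ?e = "coef g (u(0 := u j - 1, j := Suc k))"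
  have "(\<Sum>a | Suc k < a \<and> u j \<le> a \<and> a \<le> Suc k + u j. coef (var0 * g) (u(0 := a, j := Suc k + u j - a)))
      = (\<Sum>a | k < a \<and> u j \<le> Suc a \<and> a \<le> k + u j. ?G a)"
  proof (rule sum.reindex_bij_witness[where i = Suc and j = "\<lambda>a. a - 1"])
    fix a assume a: "a \<in> {a. Suc k < a \<and> u j \<le> a \<and> a \<le> Suc k + u j}"
    have "u(0 := a, j := Suc (k + u j) - a, 0 := a - 1) = u(0 := a - 1, j := Suc (k + u j) - a)"
      using j by (auto simp: fun_eq_iff)
    then show "coef g (u(0 := a - 1, j := k + u j - (a - 1))) = coef (var0 * g) (u(0 := a, j := Suc k + u j - a))"
      using a j u by (simp add: coef_var0_mult)
  qed auto
  also have "\<dots> = (\<Sum>a | k < a \<and> u j \<le> a \<and> a \<le> k + u j. ?G a) + (if Suc k < u j then ?e else 0)"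
  proof (cases "Suc k < u j")
    case True
    then have "{a. k < a \<and> u j \<le> Suc a \<and> a \<le> k + u j} = insert (u j - 1) {a. k < a \<and> u j \<le> a \<and> a \<le> k + u j}"
      by auto
    moreover have "u j - 1 \<notin> {a. k < a \<and> u j \<le> a \<and> a \<le> k + u j}"
      using True by auto
    moreover have "k + u j - (u j - 1) = Suc k"
      using True by auto
    ultimately show ?thesis
      using True by (simp add: add.commute)
  next
    case False
    then have "{a. k < a \<and> u j \<le> Suc a \<and> a \<le> k + u j} = {a. k < a \<and> u j \<le> a \<and> a \<le> k + u j}"
      by auto
    then show ?thesis
      using False by simp
  qed
  finally have 1: "(\<Sum>a | Suc k < a \<and> u j \<le> a \<and> a \<le> Suc k + u j. coef (var0 * g) (u(0 := a, j := Suc k + u j - a)))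
      = (\<Sum>a | k < a \<and> u j \<le> a \<and> a \<le> k + u j. ?G a) + (if Suc k < u j then ?e else 0)" .
  have "(\<Sum>a | Suc k < a \<and> u j < a \<and> a \<le> Suc k + u j. coef (var0 * g) (u(0 := Suc k + u j - a, j := a)))
      = (\<Sum>a | Suc k < a \<and> u j < a \<and> a \<le> k + u j. ?H a)" (is "?s = ?t")
  proof (rule sum.mono_neutral_cong_right)
    show "\<forall>a\<in>{a. Suc k < a \<and> u j < a \<and> a \<le> Suc k + u j} - {a. Suc k < a \<and> u j < a \<and> a \<le> k + u j}.
       coef (var0 * g) (u(0 := Suc k + u j - a, j := a)) = 0"
      using u j by (auto simp: coef_var0_mult)
    fix a assume a: "a \<in> {a. Suc k < a \<and> u j < a \<and> a \<le> k + u j}"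
    have "u(0 := Suc k + u j - a, j := a, 0 := Suc k + u j - a - 1) = u(0 := k + u j - a, j := a)"
      using j by (auto simp: fun_eq_iff)
    then show "coef (var0 * g) (u(0 := Suc k + u j - a, j := a)) = ?H a"
      using a j u by (auto simp: coef_var0_mult)
  qed auto
  moreover have "(\<Sum>a | k < a \<and> u j < a \<and> a \<le> k + u j. ?H a) =
     (\<Sum>a | Suc k < a \<and> u j < a \<and> a \<le> k + u j. ?H a) + (if 0 < u j \<and> u j \<le> k then ?e else 0)"
  proof (cases "0 < u j \<and> u j \<le> k")
    case True
    then have "{a. k < a \<and> u j < a \<and> a \<le> k + u j} = insert (Suc k) {a. Suc k < a \<and> u j < a \<and> a \<le> k + u j}"
      by auto
    then show ?thesis
      using True by (simp add: add.commute)
  next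
    case False
    then have "{a. k < a \<and> u j < a \<and> a \<le> k + u j} = {a. Suc k < a \<and> u j < a \<and> a \<le> k + u j}"
      by auto
    then show ?thesis
      using False by (simp only: if_False add_0_right)
  qed
  ultimately have 2: "?s = (\<Sum>a | k < a \<and> u j < a \<and> a \<le> k + u j. ?H a) - (if 0 < u j \<and> u j \<le> k then ?e else 0)"
    by simp
  have "Lterm (coef (var0 * g)) u j = (\<Sum>a | k < a \<and> u j \<le> a \<and> a \<le> k + u j. ?G a) + (if Suc k < u j then ?e else 0)
     - ((\<Sum>a | k < a \<and> u j < a \<and> a \<le> k + u j. ?H a) - (if 0 < u j \<and> u j \<le> k then ?e else 0))"
    unfolding Lterm_def u0 1 2 ..
  moreover have "Lterm (coef g) (u(0 := k)) j =
     (\<Sum>a | k < a \<and> u j \<le> a \<and> a \<le> k + u j. ?G a) - (\<Sum>a | k < a \<and> u j < a \<and> a \<le> k + u j. ?H a)"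
    using j by (simp add: Lterm_def)
  ultimately show ?thesis
    by (cases "Suc k < u j"; cases "0 < u j \<and> u j \<le> k") (auto simp: not_less)
qed

text \<open>The boundary terms of \<open>Lterm_var0\<close> are the summands of \<open>opA g\<close>
  at the positions other than 0; the summand at 0 is x_0 g itself and accounts for the -1 in
  \<alpha> - 1. Ties \<open>u j = u 0\<close>, which have no boundary term, are compensated by the
  change of the count in \<open>cont\<close>.\<close>

lemma opL_var0: "opL (var0 * g) = var0 * opL g + mscale (alpha - 1) (var0 * g) + opA g"
proof (rule coef_eqI)
  fix u assume u: "fs u"
  define T where "T = supp u - {0}"
  have T: "finite T" "0 \<notin> T" "supp u \<subseteq> insert 0 T" "insert 0 T - {0} = T"
    using u by (auto simp: T_def)
  have Tn: "j \<noteq> 0 \<and> u j \<noteq> 0" if "j \<in> T" for j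
    using that by (simp add: T_def)
  have sw: "coef (swap0 j (var0 * g)) u = coef g (u(0 := u j - 1, j := u 0))" if "j \<in> T" for j
  proof -
    have "(u \<circ> transpose 0 j)(0 := u j - 1) = u(0 := u j - 1, j := u 0)"
      using Tn[OF that] by (auto simp: fun_eq_iff transpose_def)
    then show ?thesis
      using u Tn[OF that] by (simp add: coef_var0_mult)
  qed
  have A: "coef (opA g) u = coef (var0 * g) u + (\<Sum>j\<in>T. coef g (u(0 := u j - 1, j := u 0)))"
  proof -
    have "coef (opA g) u = coef (swap0 0 (var0 * g)) u + (\<Sum>j\<in>T. coef (swap0 j (var0 * g)) u)"
      unfolding coef_opA_swap0[OF u, of "insert 0 T" g, OF finite.insertI[OF T(1)] T(3)]
      by (rule sum.insert[OF T(1,2)])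
    moreover have "coef (swap0 0 (var0 * g)) u = coef (var0 * g) u"
      using u by simp
    ultimately show ?thesis
      using sum.cong[OF refl sw, of T] by simp
  qed
  have opL1: "coef (opL (var0 * g)) u = cont u * coef (var0 * g) u + (\<Sum>j\<in>T. Lterm (coef (var0 * g)) u j)"
    unfolding coef_opL[OF u, of "insert 0 T" "var0 * g", OF finite.insertI[OF T(1)] T(3)] T(4) ..
  show "coef (opL (var0 * g)) u = coef (var0 * opL g + mscale (alpha - 1) (var0 * g) + opA g) u"
  proof (cases "u 0")
    case 0
    have "Lterm (coef (var0 * g)) u j = coef g (u(0 := u j - 1, j := u 0))" if "j \<in> T" for j
    proof -
      have s: "{a. u 0 < a \<and> u j \<le> a \<and> a \<le> u 0 + u j} = {u j}" "{a. u 0 < a \<and> u j < a \<and> a \<le> u 0 + u j} = {}"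
        using Tn[OF that] 0 by auto
      have "u(0 := u j, j := 0, 0 := u j - 1) = u(0 := u j - 1, j := 0)"
        using Tn[OF that] by (auto simp: fun_eq_iff)
      then show ?thesis
        unfolding Lterm_def s using 0 u Tn[OF that] by (simp add: coef_var0_mult)
    qed
    then have "(\<Sum>j\<in>T. Lterm (coef (var0 * g)) u j) = (\<Sum>j\<in>T. coef g (u(0 := u j - 1, j := u 0)))"
      by (intro sum.cong) auto
    moreover have "coef (var0 * h) u = 0" for h
      using 0 u by (simp add: coef_var0_mult)
    ultimately show ?thesis
      unfolding coef_add coef_mscale A opL1 by simp
  next
    case (Suc k)
    define v where "v = u(0 := k)"
    have X: "coef (var0 * h) u = coef h v" for h
      using u Suc by (simp add: coef_var0_mult v_def)
    have v: "fs v" "supp v \<subseteq> insert 0 T"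
      using u T by (auto simp: v_def T_def split: if_splits)
    have c: "cont u = cont v + alpha + of_nat (card {j\<in>T. u j = Suc k})"
    proof -
      have "{j. v j > v 0} = {j. u j > u 0} \<union> {j\<in>T. u j = Suc k}"
        unfolding v_def T_def using Suc by (auto intro: gr0I)
      moreover have "{j. u j > u 0} \<inter> {j\<in>T. u j = Suc k} = {}"
        using Suc by auto
      moreover have "finite {j. u j > u 0}"
        by (rule finite_subset[OF _ u]) auto
      ultimately have "card {j. v j > v 0} = card {j. u j > u 0} + card {j\<in>T. u j = Suc k}"
        using T(1) by (simp add: card_Un_disjoint)
      then show ?thesis
        using Suc by (simp add: cont_def v_def algebra_simps)
    qed
    have "(\<Sum>j\<in>T. Lterm (coef (var0 * g)) u j) = (\<Sum>j\<in>T. Lterm (coef g) v j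
       + ((coef g (u(0 := u j - 1, j := Suc k))) - (if u j = Suc k then coef g v else 0)))"
    proof (intro sum.cong refl)
      fix j assume j: "j \<in> T"
      have "u(0 := k, j := Suc k) = v" if "u j = Suc k"
        using that Tn[OF j] by (auto simp: v_def)
      then show "Lterm (coef (var0 * g)) u j = Lterm (coef g) v j
         + ((coef g (u(0 := u j - 1, j := Suc k))) - (if u j = Suc k then coef g v else 0))"
        using Lterm_var0[OF u Suc, of j g] Tn[OF j] by (auto simp: v_def)
    qed
    also have "\<dots> = (\<Sum>j\<in>T. Lterm (coef g) v j) + (\<Sum>j\<in>T. coef g (u(0 := u j - 1, j := Suc k)))
       - of_nat (card {j\<in>T. u j = Suc k}) * coef g v"
      using T(1) by (simp add: sum.distrib sum_subtractf sum.If_cases Int_def)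
    finally have "coef (opL (var0 * g)) u = cont u * coef g v + ((\<Sum>j\<in>T. Lterm (coef g) v j)
       + (\<Sum>j\<in>T. coef g (u(0 := u j - 1, j := Suc k))) - of_nat (card {j\<in>T. u j = Suc k}) * coef g v)"
      unfolding opL1 X by simp
    moreover have "coef (opL g) v = cont v * coef g v + (\<Sum>j\<in>T. Lterm (coef g) v j)"
      unfolding coef_opL[OF v(1), of "insert 0 T" g, OF finite.insertI[OF T(1)] v(2)] T(4) ..
    ultimately show ?thesis
      unfolding coef_add coef_mscale A X c Suc by (simp add: algebra_simps)
  qed
qed

section \<open>Symmetric functions\<close>

definition is_sym :: "ratfun mseries \<Rightarrow> bool" where
  "is_sym f \<longleftrightarrow> (\<forall>u v. fs u \<longrightarrow> fs v \<longrightarrow> shape u = shape v \<longrightarrow> coef f u = coef f v)"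

text \<open>The Euler operator of the variable x_0.\<close>

definition theta :: "ratfun mseries \<Rightarrow> ratfun mseries" where
  "theta g = of_coef (\<lambda>u. of_nat (u 0) * coef g u)"

lemma symD: "is_sym f \<Longrightarrow> fs u \<Longrightarrow> fs v \<Longrightarrow> shape u = shape v \<Longrightarrow> coef f u = coef f v"
  unfolding is_sym_def by blast

lemma coef_theta [simp]: "fs u \<Longrightarrow> coef (theta g) u = of_nat (u 0) * coef g u"
  by (simp add: theta_def)

lemma theta_add: "theta (f + g) = theta f + theta g"
  by (rule coef_eqI) (simp add: algebra_simps)

lemma theta_mscale: "theta (mscale c f) = mscale c (theta f)"
  by (rule coef_eqI) (simp add: algebra_simps)

lemma sym_swap:
  assumes "is_sym f" "fs u" "i \<noteq> j"
  shows "coef f (u(i := a, j := b)) = coef f (u(i := b, j := a))"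
proof (rule symD[OF assms(1)])
  have "u(i := b, j := a) = u(i := a, j := b) \<circ> transpose i j"
    using assms(3) by (auto simp: fun_eq_iff transpose_def)
  then show "shape (u(i := a, j := b)) = shape (u(i := b, j := a))"
    by (simp only: shape_comp_bij[OF bij_transpose])
qed (use assms in auto)

lemma sym_add: "is_sym f \<Longrightarrow> is_sym g \<Longrightarrow> is_sym (f + g)"
  unfolding is_sym_def coef_add by (intro allI impI arg_cong2[where f = "(+)"]) blast+

lemma sym_mscale: "is_sym f \<Longrightarrow> is_sym (mscale c f)"
  unfolding is_sym_def coef_mscale by (intro allI impI arg_cong2[where f = "(*)"] refl) blast

lemma sym_0: "is_sym 0"
  by (simp add: is_sym_def)

lemma sym_power_sum_mult:
  assumes f: "is_sym f" and k: "k \<ge> 1"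
  shows "is_sym (power_sum k * f)"
proof -
  \<comment> \<open>The coefficients of \<open>f\<close> as a function of the multiset of exponents;
    any representative serves. The coefficient of the product then becomes a sum over the multiset
    \<open>shape u\<close>, so it depends on that multiset alone.\<close>
  define F where "F M = coef f (SOME u. fs u \<and> shape u = M)" for M
  have F: "coef f u = F (shape u)" if "fs u" for u
  proof -
    have "\<exists>v. fs v \<and> shape v = shape u"
      using that by blast
    then have "fs (SOME v. fs v \<and> shape v = shape u) \<and> shape (SOME v. fs v \<and> shape v = shape u) = shape u"
      by (rule someI_ex)
    then show ?thesis
      unfolding F_def by (intro symD[OF f that]) simp_all
  qed
  have "coef (power_sum k * f) u = (\<Sum>a\<in>#shape u. if k \<le> a then
      F ((if a - k = 0 then {#} else {#a - k#}) + (shape u - {#a#})) else 0)" if u: "fs u" for u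
  proof -
    have "coef (power_sum k * f) u = (\<Sum>i\<in>supp u. if k \<le> u i then
      F ((if u i - k = 0 then {#} else {#u i - k#}) + (shape u - {#u i#})) else 0)"
      unfolding coef_power_sum_mult[OF u u order_refl k]
      by (intro sum.cong refl if_cong) (simp add: F u shape_upd)
    then show ?thesis
      unfolding sum_supp_shape[of "\<lambda>a. if k \<le> a then
        F ((if a - k = 0 then {#} else {#a - k#}) + (shape u - {#a#})) else 0" u] .
  qed
  then show ?thesis
    unfolding is_sym_def by presburger
qed

lemma shape_eq_empty_iff: "fs u \<Longrightarrow> shape u = {#} \<longleftrightarrow> u = (\<lambda>_. 0)"
  by (auto simp: shape_def mset_set_empty_iff fun_eq_iff supp_def)

lemma sym_one: "is_sym 1"
proof -
  have "coef 1 u = (if shape u = {#} then 1 else 0)" if "fs u" for u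
    using that by (simp add: coef_one shape_eq_empty_iff)
  then show ?thesis
    by (simp add: is_sym_def)
qed

section \<open>The ring of symmetric functions, and its extension by one variable\<close>

definition pm :: "nat multiset \<Rightarrow> ratfun mseries" where
  "pm M = (\<Prod>k\<in>#M. power_sum k)"

text \<open>Index 0 is excluded because \<open>power_sum 0\<close> is the series 1, which would
  spoil the independence of the products.\<close>

definition Lam :: "ratfun mseries set" where
  "Lam = mv.span (pm ` {M. 0 \<notin># M})"

text \<open>The series that are symmetric in all variables but \<open>x\<^sub>0\<close>.\<close>

definition Lamx :: "ratfun mseries set" where
  "Lamx = mv.span {var0 ^ k * pm M | k M. 0 \<notin># M}"

lemma pm_empty [simp]: "pm {#} = 1"
  and pm_add: "pm (add_mset k M) = power_sum k * pm M"
  by (simp_all add: pm_def)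

lemma sym_pm: "0 \<notin># M \<Longrightarrow> is_sym (pm M)"
  by (induction M) (auto simp: pm_add intro!: sym_one sym_power_sum_mult)

lemma Lam_induct [consumes 1, case_names zero step]:
  assumes "f \<in> Lam" "P 0" "\<And>c M g. 0 \<notin># M \<Longrightarrow> g \<in> Lam \<Longrightarrow> P g \<Longrightarrow> P (mscale c (pm M) + g)"
  shows "P f"
proof -
  have "f \<in> Lam \<and> P f"
    using assms(1) unfolding Lam_def
  proof (induction rule: mv.span_induct_alt)
    case base
    then show ?case
      using assms(2) by (simp add: mv.span_zero)
  next
    case (step c x y)
    then show ?case
      using assms(3) unfolding Lam_def by (auto intro: mv.span_add mv.span_scale mv.span_base)
  qed
  then show ?thesis ..
qed

lemma Lamx_induct [consumes 1, case_names zero step]: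
  assumes "f \<in> Lamx" "P 0" "\<And>c k M g. 0 \<notin># M \<Longrightarrow> g \<in> Lamx \<Longrightarrow> P g \<Longrightarrow> P (mscale c (var0 ^ k * pm M) + g)"
  shows "P f"
proof -
  have "f \<in> Lamx \<and> P f"
    using assms(1) unfolding Lamx_def
  proof (induction rule: mv.span_induct_alt)
    case base
    then show ?case
      using assms(2) by (simp add: mv.span_zero)
  next
    case (step c x y)
    then obtain k M where x: "x = var0 ^ k * pm M" "0 \<notin># M"
      by blast
    have "mscale c x + y \<in> mv.span {var0 ^ k * pm M |k M. 0 \<notin># M}"
      using step(2) x by (intro mv.span_add[OF mv.span_scale[OF mv.span_base]]) auto
    moreover have "P (mscale c x + y)"
      unfolding x(1) using step x(2) by (intro assms(3)) (auto simp: Lamx_def)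
    ultimately show ?case
      by blast
  qed
  then show ?thesis ..
qed

lemma Lam_0: "0 \<in> Lam" and Lam_add: "f \<in> Lam \<Longrightarrow> g \<in> Lam \<Longrightarrow> f + g \<in> Lam"
  and Lam_mscale: "f \<in> Lam \<Longrightarrow> mscale c f \<in> Lam" and Lam_diff: "f \<in> Lam \<Longrightarrow> g \<in> Lam \<Longrightarrow> f - g \<in> Lam"
  and Lam_pm: "0 \<notin># M \<Longrightarrow> pm M \<in> Lam" and Lam_sum: "(\<And>x. x \<in> X \<Longrightarrow> h x \<in> Lam) \<Longrightarrow> sum h X \<in> Lam"
  unfolding Lam_def by (auto intro: mv.span_zero mv.span_add mv.span_scale mv.span_diff mv.span_base mv.span_sum)

lemma Lamx_0: "0 \<in> Lamx" and Lamx_add: "f \<in> Lamx \<Longrightarrow> g \<in> Lamx \<Longrightarrow> f + g \<in> Lamx"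
  and Lamx_mscale: "f \<in> Lamx \<Longrightarrow> mscale c f \<in> Lamx"
  and Lamx_base: "0 \<notin># M \<Longrightarrow> var0 ^ k * pm M \<in> Lamx"
  unfolding Lamx_def
  by (blast intro: mv.span_zero mv.span_add mv.span_scale mv.span_diff mv.span_base mv.span_sum)+

lemma Lam_one: "1 \<in> Lam"
  using Lam_pm[of "{#}"] by simp

lemma sym_Lam: "f \<in> Lam \<Longrightarrow> is_sym f"
  by (induction rule: Lam_induct) (auto intro!: sym_0 sym_add sym_mscale sym_pm)

lemma Lam_power_sum_mult:
  assumes "f \<in> Lam" "k \<ge> 1"
  shows "power_sum k * f \<in> Lam"
  using assms(1)
proof (induction rule: Lam_induct)
  case (step c M g)
  have "power_sum k * (mscale c (pm M) + g) = mscale c (pm (add_mset k M)) + power_sum k * g"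
    by (simp add: distrib_left mscale_mult_right pm_add)
  then show ?case
    using step assms(2) by (auto intro!: Lam_add Lam_mscale Lam_pm)
qed (simp add: Lam_0)

lemma Lam_mult:
  assumes "f \<in> Lam" "g \<in> Lam"
  shows "f * g \<in> Lam"
  using assms(1)
proof (induction rule: Lam_induct)
  case (step c M h)
  have "pm M * g \<in> Lam"
    using step(1)
  proof (induction M)
    case (add k M)
    then show ?case
      by (auto simp: pm_add mult.assoc intro!: Lam_power_sum_mult)
  qed (simp add: assms)
  then show ?case
    using step by (auto simp: distrib_right mscale_mult_left intro!: Lam_add Lam_mscale)
qed (simp add: Lam_0)

lemma Lamx_power_sum_mult:
  assumes "f \<in> Lamx" "k \<ge> 1"
  shows "power_sum k * f \<in> Lamx"
  using assms(1)
proof (induction rule: Lamx_induct)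
  case (step c j M g)
  have "power_sum k * (mscale c (var0 ^ j * pm M) + g) = mscale c (var0 ^ j * pm (add_mset k M)) + power_sum k * g"
    by (simp add: distrib_left mscale_mult_right pm_add ac_simps)
  then show ?case
    using step assms(2) by (auto intro!: Lamx_add Lamx_mscale Lamx_base)
qed (simp add: Lamx_0)

lemma Lamx_var0_mult:
  assumes "f \<in> Lamx"
  shows "var0 * f \<in> Lamx"
  using assms
proof (induction rule: Lamx_induct)
  case (step c j M g)
  have "var0 * (mscale c (var0 ^ j * pm M) + g) = mscale c (var0 ^ Suc j * pm M) + var0 * g"
    by (simp add: distrib_left mscale_mult_right ac_simps)
  then show ?case
    using step Lamx_base by (auto intro!: Lamx_add Lamx_mscale simp del: power_Suc)
qed (simp add: Lamx_0)

lemma Lamx_var0_power_mult: "f \<in> Lamx \<Longrightarrow> var0 ^ k * f \<in> Lamx"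
  by (induction k) (auto simp: mult.assoc intro!: Lamx_var0_mult)

lemma Lam_Lamx: "f \<in> Lam \<Longrightarrow> f \<in> Lamx"
proof (induction rule: Lam_induct)
  case (step c M g)
  then show ?case
    using Lamx_base[of M 0] by (auto intro!: Lamx_add Lamx_mscale)
qed (rule Lamx_0)

lemma coef_var0_power_mult:
  assumes "fs u"
  shows "coef (var0 ^ k * g) u = (if u 0 < k then 0 else coef g (u(0 := u 0 - k)))"
  using assms
proof (induction k arbitrary: u)
  case (Suc k)
  have "coef (var0 ^ Suc k * g) u = coef (var0 * (var0 ^ k * g)) u"
    by (simp add: mult.assoc)
  also have "\<dots> = (if u 0 = 0 then 0 else coef (var0 ^ k * g) (u(0 := u 0 - 1)))"
    using Suc.prems by (rule coef_var0_mult)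
  also have "\<dots> = (if u 0 < Suc k then 0 else coef g (u(0 := u 0 - Suc k)))"
  proof -
    have "fs (u(0 := u 0 - 1))"
      using Suc.prems by (simp only: fs_upd)
    from Suc.IH[OF this] have "coef (var0 ^ k * g) (u(0 := u 0 - 1)) =
        (if u 0 - 1 < k then 0 else coef g (u(0 := u 0 - 1 - k)))"
      by (simp only: fun_upd_same fun_upd_upd)
    moreover have "u 0 - 1 - k = u 0 - Suc k"
      by simp
    ultimately show ?thesis
      by (cases "u 0 = 0"; cases "u 0 - 1 < k") simp_all
  qed
  finally show ?case .
qed simp

section \<open>The operators on symmetric functions and their commutation relations\<close>

lemma opA_var0_power:
  assumes f: "is_sym f"
  shows "opA (var0 ^ k * f) = power_sum (Suc k) * f"
proof (rule coef_eqI)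
  fix u assume u: "fs u"
  have "coef (var0 ^ k * f) (u(i := u i - 1) \<circ> transpose 0 i) =
     (if Suc k \<le> u i then coef f (u(i := u i - Suc k)) else 0)" if "i \<in> supp u" for i
  proof -
    have "coef f ((u(i := u i - 1) \<circ> transpose 0 i)(0 := u i - 1 - k)) = coef f (u(i := u i - Suc k))"
    proof (rule symD[OF f])
      have "(u(i := u i - 1) \<circ> transpose 0 i)(0 := u i - 1 - k) = u(i := u i - Suc k) \<circ> transpose 0 i"
        unfolding upd_comp_transpose by simp
      then show "shape ((u(i := u i - 1) \<circ> transpose 0 i)(0 := u i - 1 - k)) = shape (u(i := u i - Suc k))"
        by (metis shape_comp_bij bij_transpose)
    qed (use u in auto)
    moreover have "(u(i := u i - 1) \<circ> transpose 0 i) 0 = u i - 1"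
      by simp
    ultimately show ?thesis
      using u that by (subst coef_var0_power_mult) (auto simp del: comp_apply)
  qed
  then show "coef (opA (var0 ^ k * f)) u = coef (power_sum (Suc k) * f) u"
    using u unfolding coef_opA[OF u] by (subst coef_power_sum_mult[OF u u order_refl]) (auto intro!: sum.cong simp del: comp_apply)
qed

lemma opA_sym: "is_sym f \<Longrightarrow> opA f = power_sum 1 * f"
  using opA_var0_power[of f 0] by simp

lemma opD_0 [simp]: "opD 0 = 0"
  using opD_mscale[of 0 0] by simp

lemma opL_0 [simp]: "opL 0 = 0"
  using opL_mscale[of 0 0] by simp

lemma opA_0 [simp]: "opA 0 = 0"
  using opA_mscale[of 0 0] by simp

lemma theta_0 [simp]: "theta 0 = 0"
  using theta_mscale[of 0 0] by simp

lemma opA_Lamx: "g \<in> Lamx \<Longrightarrow> opA g \<in> Lam"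
  by (induction rule: Lamx_induct)
    (auto simp: opA_add opA_mscale opA_var0_power sym_pm intro!: Lam_0 Lam_add Lam_mscale Lam_power_sum_mult Lam_pm)

lemma theta_power_sum_mult:
  assumes k: "k \<ge> 1"
  shows "theta (power_sum k * g) = mscale (of_nat k) (var0 ^ k * g) + power_sum k * theta g"
proof (rule coef_eqI)
  fix u assume u: "fs u"
  have "coef (power_sum k * theta g) u = (\<Sum>i\<in>insert 0 (supp u). if k \<le> u i then
      of_nat ((u(i := u i - k)) 0) * coef g (u(i := u i - k)) else 0)"
    using u k by (subst coef_power_sum_mult[of u "insert 0 (supp u)"]) (auto simp del: fun_upd_apply intro!: sum.cong)
  also have "\<dots> = (\<Sum>i\<in>insert 0 (supp u). of_nat (u 0) * (if k \<le> u i then coef g (u(i := u i - k)) else 0) -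
      (if i = 0 then (if k \<le> u 0 then of_nat k * coef g (u(0 := u 0 - k)) else 0) else 0))"
    by (intro sum.cong refl) (auto simp: of_nat_diff algebra_simps)
  also have "\<dots> = of_nat (u 0) * (\<Sum>i\<in>insert 0 (supp u). if k \<le> u i then coef g (u(i := u i - k)) else 0) -
      (if k \<le> u 0 then of_nat k * coef g (u(0 := u 0 - k)) else 0)"
    unfolding sum_subtractf sum_distrib_left[symmetric] using u by (subst sum.delta) auto
  also have "(\<Sum>i\<in>insert 0 (supp u). if k \<le> u i then coef g (u(i := u i - k)) else 0) = coef (power_sum k * g) u"
    using u k by (subst coef_power_sum_mult[of u "insert 0 (supp u)"]) auto
  finally show "coef (theta (power_sum k * g)) u = coef (mscale (of_nat k) (var0 ^ k * g) + power_sum k * theta g) u"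
    using u by (simp add: coef_var0_power_mult)
qed

lemma theta_one: "theta 1 = 0"
  by (rule coef_eqI) (auto simp: coef_one)

lemma theta_pm: "0 \<notin># M \<Longrightarrow> theta (pm M) \<in> Lamx"
proof (induction M)
  case (add k M)
  then have "k \<ge> 1"
    by (cases k) auto
  then show ?case
    using add by (auto simp: pm_add theta_power_sum_mult intro!: Lamx_add Lamx_mscale Lamx_base Lamx_power_sum_mult)
qed (simp add: theta_one Lamx_0)

text \<open>For symmetric \<open>f\<close> the two sums of \<open>Lterm\<close> cancel except for
  the exchanged vector, which contributes \<open>coef f u\<close> once for each
  \<open>u j > u 0\<close>. This is exactly the count subtracted in \<open>cont\<close>, so that
  \<alpha> times the Euler operator remains.\<close>

lemma opL_sym:
  assumes f: "is_sym f"
  shows "opL f = mscale alpha (theta f)"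
proof (rule coef_eqI)
  fix u assume u: "fs u"
  have L: "Lterm (coef f) u j = (if u 0 < u j then coef f u else 0)" if "j \<noteq> 0" for j
  proof -
    let ?h = "\<lambda>a. coef f (u(0 := u 0 + u j - a, j := a))"
    let ?A = "{a. u 0 < a \<and> u j \<le> a \<and> a \<le> u 0 + u j}" and ?B = "{a. u 0 < a \<and> u j < a \<and> a \<le> u 0 + u j}"
    have "(\<Sum>a\<in>?A. coef f (u(0 := a, j := u 0 + u j - a))) = (\<Sum>a\<in>?A. ?h a)"
      using that by (intro sum.cong refl sym_swap[OF f u]) simp
    moreover have "?A = (if u 0 < u j then insert (u j) ?B else ?B)"
      by auto
    moreover have "finite ?B"
      by simp
    moreover have "u(0 := u 0, j := u j) = u"
      by simp
    ultimately show ?thesis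
      unfolding Lterm_def by (simp del: fun_upd_triv)
  qed
  have "coef (opL f) u = cont u * coef f u + (\<Sum>j\<in>supp u - {0}. if u 0 < u j then coef f u else 0)"
    unfolding coef_opL[OF u u order_refl] using L by (auto intro!: sum.cong)
  also have "(\<Sum>j\<in>supp u - {0}. if u 0 < u j then coef f u else 0) = (\<Sum>j | u 0 < u j. coef f u)"
    using u by (intro sum.mono_neutral_cong_right) (auto intro: gr0I)
  finally show "coef (opL f) u = coef (mscale alpha (theta f)) u"
    using u by (simp add: cont_def algebra_simps)
qed

text \<open>Only pairs of positions containing 0 matter, and the two orders of such a pair have to
  be taken together. After an exchange by symmetry, with p = \<open>u 0\<close> and q =
  \<open>u j\<close>, the weights satisfy (a - q) a + (a - p)(p + q - a) = p ((a - q) + (a -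
  p)).\<close>

lemma opD_theta:
  assumes f: "is_sym f"
  shows "opD (theta f) = theta (opD f)"
proof (rule coef_eqI)
  fix u assume u: "fs u"
  define T where "T = supp u - {0}"
  have T: "finite T" "0 \<notin> T" "supp u \<subseteq> insert 0 T"
    using u by (auto simp: T_def)
  have 1: "Dterm (coef (theta f)) u i j = of_nat (u 0) * Dterm (coef f) u i j" if "i \<in> T" "j \<in> T - {i}" for i j
  proof -
    have "i \<noteq> 0" "j \<noteq> 0"
      using that T(2) by (metis Diff_iff)+
    then show ?thesis
      using u unfolding Dterm_def sum_distrib_left by (intro sum.cong refl) simp
  qed
  have 2: "Dterm (coef (theta f)) u 0 j + Dterm (coef (theta f)) u j 0 =
     of_nat (u 0) * (Dterm (coef f) u 0 j + Dterm (coef f) u j 0)" if "j \<in> T" for j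
  proof -
    let ?B = "{a. u 0 < a \<and> u j < a \<and> a \<le> u 0 + u j}"
    have j: "j \<noteq> 0"
      using that T(2) by metis
    have e: "u(j := a, 0 := b) = u(0 := b, j := a)" for a b
      using j by auto
    have B: "{a. u j < a \<and> u 0 < a \<and> a \<le> u j + u 0} = ?B"
      by auto
    have s: "coef f (u(0 := b, j := a)) = coef f (u(0 := a, j := b))" for a b
      using j by (intro sym_swap[OF f u]) simp
    have "Dterm (coef (theta f)) u 0 j + Dterm (coef (theta f)) u j 0 =
      (\<Sum>a\<in>?B. (of_nat a - of_nat (u j)) * (of_nat a * coef f (u(0 := a, j := u 0 + u j - a)))
        + (of_nat a - of_nat (u 0)) * (of_nat (u 0 + u j - a) * coef f (u(0 := a, j := u 0 + u j - a))))"
      using j u unfolding Dterm_def sum.distrib B e by (simp add: add.commute[of "u j"] s)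
    also have "\<dots> = (\<Sum>a\<in>?B. of_nat (u 0) * ((of_nat a - of_nat (u j)) * coef f (u(0 := a, j := u 0 + u j - a))
        + (of_nat a - of_nat (u 0)) * coef f (u(0 := a, j := u 0 + u j - a))))"
      by (intro sum.cong refl) (auto simp: of_nat_diff algebra_simps)
    also have "\<dots> = of_nat (u 0) * (Dterm (coef f) u 0 j + Dterm (coef f) u j 0)"
      using j u unfolding Dterm_def sum.distrib[symmetric] B e sum_distrib_left
      by (simp add: add.commute[of "u j"] s sum.distrib[symmetric] distrib_left)
    finally show ?thesis .
  qed
  have "(\<Sum>i\<in>T. \<Sum>j\<in>T - {i}. Dterm (coef (theta f)) u i j) = of_nat (u 0) * (\<Sum>i\<in>T. \<Sum>j\<in>T - {i}. Dterm (coef f) u i j)"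
    unfolding sum_distrib_left by (rule sum.cong[OF refl], rule sum.cong[OF refl], rule 1)
  moreover have "(\<Sum>j\<in>T. Dterm (coef (theta f)) u 0 j + Dterm (coef (theta f)) u j 0) =
     of_nat (u 0) * (\<Sum>j\<in>T. Dterm (coef f) u 0 j + Dterm (coef f) u j 0)"
    unfolding sum_distrib_left by (rule sum.cong[OF refl], rule 2)
  moreover have "coef (opD h) u = eps u * coef h u + ((\<Sum>i\<in>T. \<Sum>j\<in>T - {i}. Dterm (coef h) u i j)
       + (\<Sum>j\<in>T. Dterm (coef h) u 0 j + Dterm (coef h) u j 0))" for h
    unfolding coef_opD[OF u, of "insert 0 T" h, OF finite.insertI[OF T(1)] T(3)] sum_pairs_split[OF T(1,2)] ..
  ultimately show "coef (opD (theta f)) u = coef (theta (opD f)) u"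
    unfolding coef_theta[OF u] by (simp add: u algebra_simps)
qed

lemma opL_var0_power: "opL (var0 ^ Suc k * g) = var0 * opL (var0 ^ k * g) + mscale (alpha - 1) (var0 ^ Suc k * g) + opA (var0 ^ k * g)"
  using opL_var0[of "var0 ^ k * g"] by (simp add: mult.assoc)

lemma opL_Lamx: "g \<in> Lamx \<Longrightarrow> opL g \<in> Lamx"
proof (induction rule: Lamx_induct)
  case (step c k M g)
  have "opL (var0 ^ k * pm M) \<in> Lamx"
  proof (induction k)
    case 0
    then show ?case
      using step(1) by (auto simp: opL_sym sym_pm intro!: Lamx_mscale theta_pm)
  next
    case (Suc k)
    then show ?case
      unfolding opL_var0_power using step(1)
      by (intro Lamx_add Lamx_mscale Lamx_var0_mult Lam_Lamx[OF opA_Lamx] Lamx_base)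
  qed
  then show ?case
    using step by (auto simp: opL_add opL_mscale intro!: Lamx_add Lamx_mscale)
qed (simp add: Lamx_0)

lemma opD_one: "opD 1 = 0"
proof (rule coef_eqI)
  fix u assume u: "fs u"
  have "Dterm (coef 1) u i j = 0" if "i \<in> supp u" "j \<in> supp u - {i}" for i j
  proof -
    have "coef 1 (u(i := a, j := b)) = 0" if "a \<noteq> 0" for a b
      using u \<open>j \<in> supp u - {i}\<close> that by (subst coef_one) (auto simp: fun_eq_iff)
    then show ?thesis
      unfolding Dterm_def by (intro sum.neutral) auto
  qed
  then have "coef (opD 1) u = eps u * coef 1 u"
    unfolding coef_opD[OF u u order_refl] by simp
  also have "\<dots> = 0"
    using u by (auto simp: coef_one eps_def)
  finally show "coef (opD 1) u = coef 0 u"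
    by simp
qed

lemma opD_var0_power_Lam:
  assumes "opD f \<in> Lam" "f \<in> Lam"
  shows "opD (var0 ^ k * f) \<in> Lamx"
proof (induction k)
  case (Suc k)
  have "opD (var0 ^ Suc k * f) = var0 * (opD (var0 ^ k * f) + opL (var0 ^ k * f))"
    using opD_var0[of "var0 ^ k * f"] by (simp add: mult.assoc)
  moreover have "var0 * (opD (var0 ^ k * f) + opL (var0 ^ k * f)) \<in> Lamx"
    by (intro Lamx_var0_mult Lamx_add[OF Suc] opL_Lamx Lamx_var0_power_mult Lam_Lamx assms(2))
  ultimately show ?case
    by (simp only:)
qed (use assms Lam_Lamx in auto)

text \<open>A factor p_k is obtained by applying \<open>opA\<close> to the power k - 1 of x_0, and
  \<open>opD\<close> passes through \<open>opA\<close> at the price of \<open>opL\<close>. Both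
  operators keep the argument in \<open>Lamx\<close>, and \<open>opA\<close> leads back to
  \<open>Lam\<close>.\<close>

lemma opD_pm: "0 \<notin># M \<Longrightarrow> opD (pm M) \<in> Lam"
proof (induction M)
  case (add k M)
  then obtain j where j: "k = Suc j"
    by (cases k) auto
  have "opD (pm (add_mset k M)) = opA (opD (var0 ^ j * pm M) + opL (var0 ^ j * pm M))"
    using add(2) by (simp add: j pm_add opA_var0_power[symmetric] sym_pm opD_opA)
  then show ?case
    using add by (auto intro!: opA_Lamx Lamx_add opD_var0_power_Lam Lam_pm opL_Lamx Lamx_base)
qed (simp add: opD_one Lam_0)

lemma opD_Lam: "f \<in> Lam \<Longrightarrow> opD f \<in> Lam"
  by (induction rule: Lam_induct) (auto simp: opD_add opD_mscale intro!: Lam_0 Lam_add Lam_mscale opD_pm)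

text \<open>Induction on the power of x_0. On symmetric functions \<open>opL\<close> is \<alpha>
  times \<open>theta\<close>, which commutes with \<open>opD\<close>; in the step the intertwining
  relations rewrite both sides to the same expression.\<close>

lemma opD_opL_comm: "g \<in> Lamx \<Longrightarrow> opD (opL g) = opL (opD g)"
proof (induction rule: Lamx_induct)
  case (step c k M g)
  have "opD (opL (var0 ^ k * pm M)) = opL (opD (var0 ^ k * pm M))"
  proof (induction k)
    case 0
    have "is_sym (opD (pm M))"
      using step(1) by (intro sym_Lam opD_pm)
    then show ?case
      using step(1) by (simp add: opL_sym sym_pm opD_mscale opD_theta)
  next
    case (Suc k)
    let ?g = "var0 ^ k * pm M"
    have e: "var0 ^ Suc k * pm M = var0 * ?g"
      by (simp add: mult.assoc)
    show ?case
      unfolding e opL_var0 opD_var0 opD_add opL_add opD_mscale opD_opA opA_add Suc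
      by (simp add: algebra_simps opL_mscale mv.scale_right_distrib mv.scale_left_distrib)
  qed
  then show ?case
    using step by (simp add: opD_add opD_mscale opL_add opL_mscale)
qed simp

text \<open>The composite of \<open>theta\<close> and \<open>opA\<close> is the derivation sending
  p_k to k p_(k+1), so a further commutator with p_k isolates p_(k+1).\<close>

lemma opD_comm_p1:
  assumes "f \<in> Lam"
  shows "opD (power_sum 1 * f) = power_sum 1 * opD f + mscale alpha (opA (theta f))"
proof -
  have "opD (power_sum 1 * f) = opA (opD f) + opA (opL f)"
    using opD_opA[of f] unfolding opA_sym[OF sym_Lam[OF assms]] opA_add .
  then show ?thesis
    using assms by (simp add: opA_sym opL_sym sym_Lam opD_Lam opA_mscale)
qed

lemma opA_power_sum_mult:
  assumes "g \<in> Lamx" "k \<ge> 1"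
  shows "opA (power_sum k * g) = power_sum k * opA g"
  using assms(1)
proof (induction rule: Lamx_induct)
  case (step c j M g)
  have "opA (var0 ^ j * pm (add_mset k M)) = power_sum k * opA (var0 ^ j * pm M)"
    using step(1) assms(2) by (subst (1 2) opA_var0_power) (auto simp: sym_pm pm_add ac_simps intro!: sym_power_sum_mult)
  moreover have "power_sum k * (var0 ^ j * pm M) = var0 ^ j * pm (add_mset k M)"
    by (simp add: pm_add ac_simps)
  ultimately show ?case
    using step by (simp add: distrib_left opA_add opA_mscale mscale_mult_right)
qed simp

lemma theta_Lam: "f \<in> Lam \<Longrightarrow> theta f \<in> Lamx"
  by (induction rule: Lam_induct) (auto simp: theta_add theta_mscale intro!: Lamx_0 Lamx_add Lamx_mscale theta_pm)

text \<open>The double commutator of \<open>opD\<close> with \<open>p\<^sub>1\<close> and \<open>p\<^sub>k\<close> is \<open>\<alpha> k p\<^bsub>k+1\<^esub>\<close>.\<close>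

lemma power_sum_Suc_commutator:
  assumes f: "f \<in> Lam" and k: "k \<ge> 1"
  shows "mscale (alpha * of_nat k) (power_sum (Suc k) * f) =
    opD (power_sum 1 * (power_sum k * f)) - power_sum 1 * opD (power_sum k * f)
    - power_sum k * (opD (power_sum 1 * f) - power_sum 1 * opD f)"
proof -
  have "opA (theta (power_sum k * f)) = mscale (of_nat k) (power_sum (Suc k) * f) + power_sum k * opA (theta f)"
    using f k by (simp add: theta_power_sum_mult opA_add opA_mscale opA_var0_power sym_Lam opA_power_sum_mult theta_Lam)
  then show ?thesis
    unfolding opD_comm_p1[OF f] opD_comm_p1[OF Lam_power_sum_mult[OF f k]]
    by (simp add: mscale_mult_right mv.scale_right_distrib algebra_simps)
qed

section \<open>The ordered field of rational functions\<close>

text \<open>In the order of the fraction field \<alpha> is infinitely large. This one fact yields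
  the positivity of hooks and of the inner product as well as the independence of 1 and \<alpha>
  over the integers.\<close>

lemma alpha_gt_of_nat: "of_nat n < alpha"
proof -
  have "of_nat n = (to_fract (of_nat n) :: ratfun)"
    by (induction n) (simp_all add: to_fract_add)
  moreover have "to_fract (of_nat n) < (to_fract [:0, 1:] :: ratfun)"
  proof -
    have "[:0, 1:] - of_nat n = ([:- of_nat n, 1:] :: rat poly)"
      by (simp add: of_nat_poly)
    then have "(of_nat n :: rat poly) < [:0, 1:]"
      by (simp add: less_poly_def pos_poly_def)
    then show ?thesis
      by (simp add: to_fract_def less_fract_def)
  qed
  ultimately show ?thesis
    by (simp add: alpha_def)
qed

lemma alpha_pos: "0 < alpha"
  using alpha_gt_of_nat[of 0] by simp

lemma alpha_generic:
  assumes "alpha * of_int a = of_int b"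
  shows "a = 0 \<and> b = 0"
proof (cases "a = 0")
  case False
  have "(of_nat (nat \<bar>b\<bar>) :: ratfun) = \<bar>of_int b\<bar>"
    by (simp add: of_nat_nat)
  also have "\<dots> = alpha * \<bar>of_int a\<bar>"
    using assms[symmetric] alpha_pos by (simp add: abs_mult)
  also have "\<dots> \<ge> alpha * 1"
    using False alpha_pos by (intro mult_left_mono) (simp_all, metis abs_ge_zero int_one_le_iff_zero_less of_int_1_le_iff of_int_abs zero_less_abs_iff)
  finally show ?thesis
    using alpha_gt_of_nat[of "nat \<bar>b\<bar>"] by simp
qed (use assms in simp)

section \<open>Partitions as functions, and dominance\<close>

definition ptn :: "(nat \<Rightarrow> nat) \<Rightarrow> bool" where
  "ptn f \<longleftrightarrow> antimono f \<and> fs f"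

definition partial_sum :: "(nat \<Rightarrow> nat) \<Rightarrow> nat \<Rightarrow> nat" where
  "partial_sum f r = (\<Sum>j<r. f j)"

definition deg :: "(nat \<Rightarrow> nat) \<Rightarrow> nat" where
  "deg u = (\<Sum>i\<in>supp u. u i)"

definition sqsum :: "(nat \<Rightarrow> nat) \<Rightarrow> nat" where
  "sqsum u = (\<Sum>i\<in>supp u. u i ^ 2)"

text \<open>Dominance between the partition to which \<open>u\<close> sorts and the partition
  \<open>f\<close>, stated without sorting: the largest sum of \<open>u\<close> over r positions is
  what partial sums of the sorted vector measure.\<close>

definition dom :: "(nat \<Rightarrow> nat) \<Rightarrow> (nat \<Rightarrow> nat) \<Rightarrow> bool" where
  "dom u f \<longleftrightarrow> deg u = deg f \<and> (\<forall>S. finite S \<longrightarrow> sum u S \<le> partial_sum f (card S))"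

lemma ptn_fs: "ptn f \<Longrightarrow> fs f"
  by (simp add: ptn_def)

lemma ptn_le: "ptn f \<Longrightarrow> i \<le> j \<Longrightarrow> f j \<le> f i"
  by (simp add: ptn_def antimono_def)

lemma deg_superset: "fs u \<Longrightarrow> finite S \<Longrightarrow> supp u \<subseteq> S \<Longrightarrow> deg u = sum u S"
  unfolding deg_def by (intro sum.mono_neutral_left) auto

lemma sum_squeeze:
  fixes h :: "nat \<Rightarrow> nat"
  assumes u: "fs u" and ij: "i \<noteq> j" and h: "h 0 = 0"
  shows "(\<Sum>l\<in>supp (u(i := a, j := b)). h ((u(i := a, j := b)) l)) + h (u i) + h (u j) =
    (\<Sum>l\<in>supp u. h (u l)) + h a + h b"
proof -
  define T where "T = supp u - {i, j}"
  have T: "finite T" "i \<notin> T" "j \<notin> T"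
    using u by (auto simp: T_def)
  have "(\<Sum>l\<in>supp v. h (v l)) = h (v i) + h (v j) + (\<Sum>l\<in>T. h (v l))"
    if v: "fs v" "supp v \<subseteq> insert i (insert j T)" for v
  proof -
    have "(\<Sum>l\<in>supp v. h (v l)) = (\<Sum>l\<in>insert i (insert j T). h (v l))"
      using v T h by (intro sum.mono_neutral_left) (auto simp: h)
    then show ?thesis
      using T ij by simp
  qed
  note * = this
  have "supp (u(i := a, j := b)) \<subseteq> insert i (insert j T)" "supp u \<subseteq> insert i (insert j T)"
    unfolding T_def by (auto split: if_splits)
  moreover have "(\<Sum>l\<in>T. h ((u(i := a, j := b)) l)) = (\<Sum>l\<in>T. h (u l))"
    using T by (intro sum.cong) auto
  ultimately show ?thesis
    using *[of u] *[of "u(i := a, j := b)"] u ij by simp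
qed

lemma deg_squeeze:
  assumes "fs u" "i \<noteq> j" "a \<le> u i + u j"
  shows "deg (u(i := a, j := u i + u j - a)) = deg u"
  using sum_squeeze[OF assms(1,2), of "\<lambda>x. x" a "u i + u j - a"] assms(3) by (simp add: deg_def)

lemma square_sum_mono:
  fixes p q a b :: nat
  assumes "a + b = p + q" "p \<le> a" "q \<le> a"
  shows "p ^ 2 + q ^ 2 \<le> a ^ 2 + b ^ 2" "p < a \<Longrightarrow> q < a \<Longrightarrow> p ^ 2 + q ^ 2 < a ^ 2 + b ^ 2"
proof -
  have "int (a ^ 2 + b ^ 2) - int (p ^ 2 + q ^ 2) = 2 * (int a - int p) * (int a - int q)"
  proof -
    have b: "int b = int p + int q - int a"
      using assms(1) by linarith
    show ?thesis
      unfolding of_nat_add of_nat_power b by (simp add: power2_eq_square algebra_simps)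
  qed
  moreover have "2 * (int a - int p) * (int a - int q) \<ge> 0"
    using assms by simp
  moreover have "2 * (int a - int p) * (int a - int q) > 0" if "p < a" "q < a"
    using that by simp
  ultimately show "p ^ 2 + q ^ 2 \<le> a ^ 2 + b ^ 2" "p < a \<Longrightarrow> q < a \<Longrightarrow> p ^ 2 + q ^ 2 < a ^ 2 + b ^ 2"
    by linarith+
qed

lemma sqsum_squeeze:
  assumes "fs u" "i \<noteq> j" "u i \<le> a" "u j \<le> a" "a \<le> u i + u j"
  shows "sqsum u \<le> sqsum (u(i := a, j := u i + u j - a))"
    and "u i < a \<Longrightarrow> u j < a \<Longrightarrow> sqsum u < sqsum (u(i := a, j := u i + u j - a))"
  using sum_squeeze[OF assms(1,2), of "\<lambda>x. x ^ 2" a "u i + u j - a"] assms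
    square_sum_mono[of a "u i + u j - a" "u i" "u j"] by (simp_all add: sqsum_def)

lemma dom_squeeze:
  assumes u: "fs u" and ij: "i \<noteq> j" and a: "u i \<le> a" "u j \<le> a" "a \<le> u i + u j"
    and d: "dom (u(i := a, j := u i + u j - a)) f"
  shows "dom u f"
  unfolding dom_def
proof (intro conjI allI impI)
  let ?v = "u(i := a, j := u i + u j - a)"
  show "deg u = deg f"
    using d deg_squeeze[OF u ij a(3)] by (simp add: dom_def)
  fix S :: "nat set" assume S: "finite S"
  have v: "sum ?v T \<le> partial_sum f (card T)" if "finite T" for T
    using d that by (simp add: dom_def)
  have same: "sum u T = sum ?v T" if "i \<notin> T" "j \<notin> T" for T
    using that by (intro sum.cong) auto
  consider "i \<in> S" "j \<in> S" | "i \<notin> S" "j \<notin> S" | "i \<in> S" "j \<notin> S" | "i \<notin> S" "j \<in> S"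
    by blast
  then show "sum u S \<le> partial_sum f (card S)"
  proof cases
    case 1
    have "sum g S = g i + g j + sum g (S - {i, j})" for g :: "nat \<Rightarrow> nat"
    proof -
      have "S = insert i (insert j (S - {i, j}))"
        using 1 by auto
      then have "sum g S = sum g (insert i (insert j (S - {i, j})))"
        by (rule arg_cong)
      then show ?thesis
        using S ij by simp
    qed
    then have "sum u S = sum ?v S"
      using same[of "S - {i, j}"] ij a by simp
    then show ?thesis
      using v[OF S] by simp
  next
    case 2
    then show ?thesis
      using v[OF S] same by metis
  next
    case 3
    have "sum u S \<le> sum ?v S"
      using 3 a by (intro sum_mono) auto
    then show ?thesis
      using v[OF S] by simp
  next
    case 4
    \<comment> \<open>A set containing j but not i is compared with the one in which i replaces j,
      since the larger exponent of the spread vector sits at i.\<close>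
    let ?S = "insert i (S - {j})"
    have "sum u S = u j + sum u (S - {j})"
      using 4 S by (simp add: sum.remove)
    also have "\<dots> \<le> a + sum ?v (S - {j})"
      using 4 a same[of "S - {j}"] by simp
    also have "\<dots> = sum ?v ?S"
      using 4 S ij by simp
    also have "\<dots> \<le> partial_sum f (card ?S)"
      using S by (intro v) simp
    also have "card ?S = card S"
      using 4 S by (metis Diff_iff card.remove card_insert_disjoint finite_Diff)
    finally show ?thesis .
  qed
qed

lemma sqsum_le: "fs u \<Longrightarrow> sqsum u \<le> deg u ^ 2"
proof -
  assume u: "fs u"
  have "sqsum u \<le> (\<Sum>i\<in>supp u. u i * deg u)"
    unfolding sqsum_def deg_def power2_eq_square using u by (intro sum_mono mult_left_mono member_le_sum) auto
  then show ?thesis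
    by (simp add: deg_def sum_distrib_right[symmetric] power2_eq_square)
qed

lemma le_deg: "fs u \<Longrightarrow> u i \<le> deg u"
  unfolding deg_def by (cases "u i = 0") (auto intro!: member_le_sum)

text \<open>The \<alpha>-part of twice \<open>eps v\<close> is \<open>sqsum v - deg v\<close>, and
  integers attached to 1 and to \<alpha> are determined separately.\<close>

lemma eps_eq_imp_sqsum_eq:
  assumes uf: "fs u" "fs f" "deg u = deg f" "eps u = eps f"
  shows "sqsum u = sqsum f"
proof -
  define m where "m v = (\<Sum>i\<in>supp v. \<Sum>j\<in>supp v. min (v i) (v j))" for v
  have q: "int (sqsum v) - int (deg v) = (\<Sum>i\<in>supp v. int (v i) * (int (v i) - 1))" for v
    by (simp add: sqsum_def deg_def power2_eq_square algebra_simps sum_subtractf)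
  have "2 * eps v = alpha * of_int (int (sqsum v) - int (deg v)) - of_int (int (m v) - int (deg v))" for v
  proof -
    have E: "(\<Sum>i\<in>supp v. alpha * (of_nat (v i) * (of_nat (v i) - 1)) / 2) =
        alpha * of_int (int (sqsum v) - int (deg v)) / 2"
      unfolding q by (simp add: sum_divide_distrib[symmetric] sum_distrib_left)
    show ?thesis
      unfolding eps_def E m_def deg_def by (simp add: field_simps)
  qed
  from this[of u] this[of f] have "alpha * of_int (int (sqsum u) - int (sqsum f)) = of_int (int (m u) - int (m f))"
    using uf by (simp add: algebra_simps)
  then show ?thesis
    using alpha_generic by fastforce
qed

lemma count_shape: "fs u \<Longrightarrow> a \<noteq> 0 \<Longrightarrow> count (shape u) a = card {i. u i = a}"
proof -
  assume u: "fs u" and a: "a \<noteq> 0"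
  have "count (shape u) a = card (u -` {a} \<inter> supp u)"
    using u by (simp add: shape_def count_image_mset)
  also have "u -` {a} \<inter> supp u = {i. u i = a}"
    using a by auto
  finally show ?thesis .
qed

lemma zero_notin_shape [simp]: "0 \<notin># shape u"
  by (cases "fs u") (auto simp: shape_def)

lemma layer_cake: "m \<le> T \<Longrightarrow> 2 * (\<Sum>t<T. m - t) = m ^ 2 + (m::nat)"
proof (induction m arbitrary: T)
  case (Suc m)
  then obtain T' where T: "T = Suc T'"
    by (cases T) auto
  have "(\<Sum>t<T. Suc m - t) = Suc m + (\<Sum>t<T'. m - t)"
    unfolding T by (subst sum.lessThan_Suc_shift) simp
  then show ?case
    using Suc.IH[of T'] Suc.prems T by (simp add: power2_eq_square)
qed simp

text \<open>The number of boxes in the columns from t on, when the entries of \<open>v\<close> are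
  read as row lengths. Summed over all t it gives half of \<open>sqsum v + deg v\<close>, which
  links dominance with square sums.\<close>

definition excess :: "(nat \<Rightarrow> nat) \<Rightarrow> nat \<Rightarrow> nat" where
  "excess v t = (\<Sum>i\<in>supp v. v i - t)"

lemma excess_dom:
  assumes u: "fs u" and f: "fs f" and d: "dom u f"
  shows "excess u t \<le> excess f t"
proof -
  define S where "S = {i \<in> supp u. t < u i}"
  have S: "finite S"
    by (rule finite_subset[OF _ u]) (auto simp: S_def)
  have "excess u t = (\<Sum>i\<in>S. u i - t)"
    unfolding excess_def S_def using u by (intro sum.mono_neutral_right) auto
  then have "excess u t + t * card S = (\<Sum>i\<in>S. (u i - t) + t)"
    by (simp add: sum.distrib)
  also have "\<dots> = sum u S"
    by (intro sum.cong) (auto simp: S_def)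
  also have "\<dots> \<le> partial_sum f (card S)"
    using d S by (simp add: dom_def)
  also have "\<dots> \<le> (\<Sum>j<card S. (f j - t) + t)"
    unfolding partial_sum_def by (intro sum_mono) simp
  also have "\<dots> = (\<Sum>j<card S. f j - t) + t * card S"
    by (simp add: sum.distrib mult.commute)
  also have "(\<Sum>j<card S. f j - t) = (\<Sum>j\<in>{..<card S} \<inter> supp f. f j - t)"
    by (intro sum.mono_neutral_right) auto
  also have "\<dots> \<le> excess f t"
    unfolding excess_def using f by (intro sum_mono2) auto
  finally show ?thesis
    by simp
qed

lemma sum_excess:
  assumes "fs v" "deg v \<le> T"
  shows "2 * (\<Sum>t<T. excess v t) = sqsum v + deg v"
proof -
  have "2 * (\<Sum>t<T. excess v t) = (\<Sum>i\<in>supp v. 2 * (\<Sum>t<T. v i - t))"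
    unfolding excess_def by (subst sum.swap) (simp add: sum_distrib_left)
  also have "\<dots> = (\<Sum>i\<in>supp v. v i ^ 2 + v i)"
    using assms(2) le_deg[OF assms(1)] by (intro sum.cong refl layer_cake) (auto intro: order_trans)
  finally show ?thesis
    by (simp add: sqsum_def deg_def sum.distrib)
qed

lemma dom_sqsum_le:
  assumes u: "fs u" and f: "fs f" and d: "dom u f"
  shows "sqsum u \<le> sqsum f"
proof -
  have "(\<Sum>t<deg f. excess u t) \<le> (\<Sum>t<deg f. excess f t)"
    by (intro sum_mono excess_dom assms)
  then show ?thesis
    using sum_excess[OF u, of "deg f"] sum_excess[OF f, of "deg f"] d by (simp add: dom_def)
qed

text \<open>Dominance bounds every excess, and equal square sums make the totals equal, so all
  excesses agree. Their second differences count how often each exponent occurs.\<close>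

lemma dom_sqsum_imp_shape:
  assumes u: "fs u" and f: "fs f" and d: "dom u f" and q: "sqsum u = sqsum f"
  shows "shape u = shape f"
proof -
  note le = excess_dom[OF u f d]
  have dg: "deg u = deg f"
    using d by (simp add: dom_def)
  define T where "T = deg f"
  have "(\<Sum>t<T. excess u t) = (\<Sum>t<T. excess f t)"
    using sum_excess[OF u, of T] sum_excess[OF f, of T] q dg by (simp add: T_def)
  then have "excess u t = excess f t" if "t < T" for t
    by (rule sum_mono_inv) (use le that in auto)
  moreover have "excess v t = 0" if "t \<ge> T" "fs v" "deg v = deg f" for t v
    unfolding excess_def using le_deg[OF that(2)] that by (intro sum.neutral) (auto simp: T_def intro: order_trans)
  ultimately have eq: "excess u t = excess f t" for t
    using u f dg by (cases "t < T") auto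
  have gt: "card {i. t < v i} = excess v t - excess v (Suc t)" if v: "fs v" for v t
  proof -
    have fin: "finite {i. t < v i}"
      by (rule finite_subset[OF _ v]) auto
    have "excess v t = (\<Sum>i\<in>supp v. (v i - Suc t) + (if t < v i then 1 else 0))"
      unfolding excess_def by (intro sum.cong) auto
    also have "\<dots> = excess v (Suc t) + card {i \<in> supp v. t < v i}"
      using v by (simp add: excess_def sum.distrib sum.If_cases Int_def)
    also have "{i \<in> supp v. t < v i} = {i. t < v i}"
      by auto
    finally show ?thesis
      by simp
  qed
  have cnt: "card {i. v i = Suc t} = card {i. t < v i} - card {i. Suc t < v i}" if v: "fs v" for v t
  proof -
    have "finite {i. v i = Suc t}" "finite {i. Suc t < v i}"
      by (rule finite_subset[OF _ v], auto)+
    then have "card ({i. v i = Suc t} \<union> {i. Suc t < v i}) = card {i. v i = Suc t} + card {i. Suc t < v i}"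
      by (intro card_Un_disjoint) auto
    moreover have "{i. v i = Suc t} \<union> {i. Suc t < v i} = {i. t < v i}"
      by auto
    ultimately have "card {i. t < v i} = card {i. v i = Suc t} + card {i. Suc t < v i}"
      by (simp only:)
    then show ?thesis
      by simp
  qed
  show ?thesis
  proof (rule multiset_eqI)
    fix a
    show "count (shape u) a = count (shape f) a"
    proof (cases a)
      case 0
      then show ?thesis
        using zero_notin_shape[of u] zero_notin_shape[of f] by (simp only: not_in_iff)
    next
      case (Suc t)
      then show ?thesis
        using u f by (simp add: count_shape cnt gt eq)
    qed
  qed
qed

lemma dom_eps_imp_shape: "fs u \<Longrightarrow> fs f \<Longrightarrow> dom u f \<Longrightarrow> eps u = eps f \<Longrightarrow> shape u = shape f"
  by (intro dom_sqsum_imp_shape eps_eq_imp_sqsum_eq) (auto simp: dom_def)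

section \<open>Eigenfunctions of the Laplace--Beltrami operator and their leading vectors\<close>

definition below :: "(nat \<Rightarrow> nat) \<Rightarrow> ratfun mseries \<Rightarrow> bool" where
  "below f g \<longleftrightarrow> (\<forall>u. fs u \<longrightarrow> coef g u \<noteq> 0 \<longrightarrow> dom u f)"

lemma belowD: "below f g \<Longrightarrow> fs u \<Longrightarrow> coef g u \<noteq> 0 \<Longrightarrow> dom u f"
  by (simp add: below_def)

lemma below_add: "below f g \<Longrightarrow> below f h \<Longrightarrow> below f (g + h)"
  unfolding below_def by (metis add.right_neutral coef_add)

lemma below_mscale: "below f g \<Longrightarrow> below f (mscale c g)"
  unfolding below_def by (metis coef_mscale mult_zero_right)

lemma eigen_coef:
  assumes u: "fs u" and g: "opD g = mscale c g" "coef g u \<noteq> 0"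
    and 0: "\<And>i j a. i \<noteq> j \<Longrightarrow> u i < a \<Longrightarrow> u j < a \<Longrightarrow> a \<le> u i + u j \<Longrightarrow>
      coef g (u(i := a, j := u i + u j - a)) = 0"
  shows "eps u = c"
proof -
  have "Dterm (coef g) u i j = 0" if "j \<in> supp u - {i}" for i j
    unfolding Dterm_def using that by (intro sum.neutral ballI) (auto simp: 0)
  then have "coef (opD g) u = eps u * coef g u"
    unfolding coef_opD[OF u u order_refl] by simp
  then show ?thesis
    using g by simp
qed

text \<open>At a vector of \<open>g\<close> with maximal square sum the off-diagonal terms vanish,
  so its diagonal entry is the eigenvalue. Together with dominance this forces the shape of
  \<open>f\<close>, where \<open>g\<close> is assumed to vanish. The bound by the squared degree
  provides the maximum.\<close>

lemma eigen_zero: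
  assumes f: "fs f" and b: "below f g" and g: "opD g = mscale (eps f) g"
    and 0: "\<And>u. fs u \<Longrightarrow> shape u = shape f \<Longrightarrow> coef g u = 0"
  shows "g = 0"
proof (rule ccontr)
  let ?P = "\<lambda>u. fs u \<and> coef g u \<noteq> 0"
  assume "g \<noteq> 0"
  then obtain u0 where "?P u0"
    using coef_eqI[of g 0] by auto
  moreover have "\<forall>u. ?P u \<longrightarrow> sqsum u \<le> deg f ^ 2"
    using belowD[OF b] sqsum_le by (metis dom_def)
  ultimately obtain u where u: "?P u" and max: "\<forall>v. ?P v \<longrightarrow> sqsum v \<le> sqsum u"
    using ex_has_greatest_nat[of ?P u0 sqsum "Suc (deg f ^ 2)"] by (auto simp: less_Suc_eq_le)
  have "eps u = eps f"
  proof (rule eigen_coef[OF _ g])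
    fix i j a assume *: "i \<noteq> j" "u i < a" "u j < a" "a \<le> u i + u j"
    then have "sqsum u < sqsum (u(i := a, j := u i + u j - a))"
      using u by (intro sqsum_squeeze) auto
    then show "coef g (u(i := a, j := u i + u j - a)) = 0"
      using max u by (metis fs_upd leD)
  qed (use u in auto)
  then have "shape u = shape f"
    using belowD[OF b] u f by (intro dom_eps_imp_shape) auto
  then show False
    using 0 u by blast
qed

lemma partial_sum_upd: "partial_sum (f(y := Suc (f y))) r = partial_sum f r + (if y < r then 1 else 0)"
proof -
  have "partial_sum (f(y := Suc (f y))) r = (\<Sum>j<r. f j + (if j = y then 1 else 0))"
    unfolding partial_sum_def by (intro sum.cong) auto
  then show ?thesis
    by (simp add: partial_sum_def sum.distrib)
qed

lemma deg_upd_Suc: "fs u \<Longrightarrow> deg (u(i := Suc (u i))) = Suc (deg u)"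
proof -
  assume u: "fs u"
  let ?S = "insert i (supp u)"
  have "deg (u(i := Suc (u i))) = sum (u(i := Suc (u i))) ?S"
    using u by (intro deg_superset) (auto split: if_splits)
  also have "\<dots> = (\<Sum>j\<in>?S. u j + (if j = i then 1 else 0))"
    by (intro sum.cong) auto
  also have "\<dots> = Suc (sum u ?S)"
    using u by (simp add: sum.distrib sum.delta)
  also have "sum u ?S = deg u"
    using u by (intro deg_superset[symmetric]) auto
  finally show ?thesis .
qed

text \<open>Only sets that contain 0 and have at most y elements are at risk. For such a set the
  raised exponent of x_0 is at most \<open>f y + 1\<close>, hence at most the length of the row of
  \<open>f\<close> whose index is the number of remaining elements.\<close>

lemma dom_var0:
  assumes d: "dom u f" and u: "fs u" and f: "ptn f" and y: "\<And>j. j < y \<Longrightarrow> f y < f j" and u0: "u 0 \<le> f y"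
  shows "dom (u(0 := Suc (u 0))) (f(y := Suc (f y)))"
  unfolding dom_def
proof (intro conjI allI impI)
  show "deg (u(0 := Suc (u 0))) = deg (f(y := Suc (f y)))"
    using d u f by (simp add: deg_upd_Suc dom_def ptn_fs)
  fix S :: "nat set" assume S: "finite S"
  have d: "sum u T \<le> partial_sum f (card T)" if "finite T" for T
    using d that by (simp add: dom_def)
  show "sum (u(0 := Suc (u 0))) S \<le> partial_sum (f(y := Suc (f y))) (card S)"
  proof (cases "0 \<in> S")
    case False
    then have "sum (u(0 := Suc (u 0))) S = sum u S"
      by (intro sum.cong refl) (metis fun_upd_other)
    then show ?thesis
      using d[OF S] unfolding partial_sum_upd by simp
  next
    case True
    define T where "T = S - {0}"
    have T: "finite T" "0 \<notin> T" "S = insert 0 T"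
      using S True by (auto simp: T_def)
    have cS: "card S = Suc (card T)"
      using T by simp
    have s: "sum (u(0 := Suc (u 0))) S = Suc (u 0) + sum u T"
    proof -
      have "sum (u(0 := Suc (u 0))) T = sum u T"
        using T(2) by (intro sum.cong refl) (metis fun_upd_other)
      then show ?thesis
        unfolding T(3) using T(1,2) by simp
    qed
    show ?thesis
    proof (cases "y < card S")
      case True
      have "sum (u(0 := Suc (u 0))) S = Suc (sum u S)"
        unfolding s using T by simp
      then show ?thesis
        using True d[OF S] unfolding partial_sum_upd by simp
    next
      case False
      then have "Suc (f y) \<le> f (card T)"
        using y[of "card T"] cS by simp
      then have "sum (u(0 := Suc (u 0))) S \<le> f (card T) + partial_sum f (card T)"
        using u0 d[OF T(1)] unfolding s by linarith
      also have "\<dots> = partial_sum f (card S)"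
        unfolding cS by (simp add: partial_sum_def)
      finally show ?thesis
        unfolding partial_sum_upd by simp
    qed
  qed
qed

text \<open>Spreading exponents of \<open>u\<close> also spreads those of the vector with one more
  x_0, with a single exception: for \<open>j = 0\<close> and a = \<open>u 0 + 1\<close> the two
  raised vectors differ by an exchange. There the square sum stays the same and only the exponent of
  x_0 drops.\<close>

lemma dom_upd_Suc_mono:
  assumes u: "fs u" and ij: "i \<noteq> j" and a: "u i < a" "u j < a" "a \<le> u i + u j"
  defines "v \<equiv> u(i := a, j := u i + u j - a)"
  defines "w \<equiv> u(0 := Suc (u 0))" and "w' \<equiv> v(0 := Suc (v 0))"
  shows "dom w' h \<Longrightarrow> dom w h" and "sqsum w < sqsum w' \<or> (sqsum w \<le> sqsum w' \<and> v 0 < u 0)"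
proof -
  have w: "fs w"
    using u by (simp add: w_def)
  have "(dom w' h \<longrightarrow> dom w h) \<and> (sqsum w < sqsum w' \<or> (sqsum w \<le> sqsum w' \<and> v 0 < u 0))"
  proof -
    consider "i \<noteq> 0" "j \<noteq> 0" | "i = 0" | "j = 0"
      by blast
    then show ?thesis
    proof cases
      case 1
      then have e: "w' = w(i := a, j := w i + w j - a)" "w i = u i" "w j = u j"
        by (auto simp: w'_def w_def v_def fun_eq_iff)
      show ?thesis
        unfolding e(1) using dom_squeeze[OF w ij, of a h] sqsum_squeeze(2)[OF w ij, of a] a e(2,3) by auto
    next
      case 2
      then have e: "w' = w(i := Suc a, j := w i + w j - Suc a)" "w i = Suc (u i)" "w j = u j"
        using ij by (auto simp: w'_def w_def v_def fun_eq_iff)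
      show ?thesis
        unfolding e(1) using dom_squeeze[OF w ij, of "Suc a" h] sqsum_squeeze(2)[OF w ij, of "Suc a"] a e(2,3) by auto
    next
      case 3
      then have e: "w' = w(i := a, j := w i + w j - a)" "w i = u i" "w j = Suc (u j)"
        using ij a by (auto simp: w'_def w_def v_def fun_eq_iff)
      have "v 0 < u 0 \<or> w j < a"
        using 3 a e(3) by (cases "a = Suc (u j)") (auto simp: v_def)
      moreover have "w i < a" "w j \<le> a" "w i \<le> a" "a \<le> w i + w j"
        using a e by auto
      ultimately show ?thesis
        unfolding e(1) using dom_squeeze[OF w ij, of a h] sqsum_squeeze[OF w ij, of a] by blast
    qed
  qed
  then show "dom w' h \<Longrightarrow> dom w h" and "sqsum w < sqsum w' \<or> (sqsum w \<le> sqsum w' \<and> v 0 < u 0)"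
    by auto
qed

text \<open>A bound on the leading vectors controls all vectors of an eigenfunction. At a maximal
  offending vector the off-diagonal terms of \<open>opD\<close> vanish, so the vector has the
  leading shape, and there \<open>dom_var0\<close> excludes it.\<close>

lemma eigen_below_var0:
  assumes f: "ptn f" and b: "below f g" and g: "opD g = mscale (eps f) g"
    and y: "\<And>j. j < y \<Longrightarrow> f y < f j"
    and top: "\<And>u. fs u \<Longrightarrow> shape u = shape f \<Longrightarrow> coef g u \<noteq> 0 \<Longrightarrow> u 0 \<le> f y"
    and u: "fs u" "coef g u \<noteq> 0"
  shows "dom (u(0 := Suc (u 0))) (f(y := Suc (f y)))"
proof (rule ccontr)
  let ?h = "f(y := Suc (f y))"
  let ?w = "\<lambda>v. v(0 := Suc (v 0)) :: nat \<Rightarrow> nat"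
  let ?P = "\<lambda>v. fs v \<and> coef g v \<noteq> 0 \<and> \<not> dom (?w v) ?h"
  define N where "N = deg f"
  \<comment> \<open>A lexicographic key: the square sum after raising the exponent of x_0, then a
    smaller exponent of x_0. The second entry breaks the tie left by
    \<open>dom_upd_Suc_mono\<close>.\<close>
  define key where "key v = sqsum (?w v) * Suc N + (N - v 0)" for v :: "nat \<Rightarrow> nat"
  assume "\<not> dom (?w u) ?h"
  then have "?P u"
    using u by simp
  moreover have "\<forall>v. ?P v \<longrightarrow> key v \<le> (Suc N) ^ 2 * Suc N + N"
  proof (intro allI impI)
    fix v assume v: "?P v"
    have "deg v = N"
      using belowD[OF b, of v] v by (simp add: dom_def N_def)
    then have "sqsum (?w v) \<le> (Suc N) ^ 2"
      using v sqsum_le[of "?w v"] deg_upd_Suc[of v 0] by simp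
    then show "key v \<le> (Suc N) ^ 2 * Suc N + N"
      unfolding key_def by (intro add_mono mult_right_mono) auto
  qed
  ultimately obtain v where v: "?P v" and max: "\<forall>v'. ?P v' \<longrightarrow> key v' \<le> key v"
    using ex_has_greatest_nat[of ?P u key "Suc ((Suc N) ^ 2 * Suc N + N)"] by (auto simp: less_Suc_eq_le)
  have dv: "dom v f"
    using belowD[OF b] v by blast
  have "eps v = eps f"
  proof (rule eigen_coef[OF _ g])
    fix i j a assume *: "i \<noteq> j" "v i < a" "v j < a" "a \<le> v i + v j"
    let ?v = "v(i := a, j := v i + v j - a)"
    have fv: "fs ?v"
      using v by simp
    show "coef g ?v = 0"
    proof (rule ccontr)
      assume "coef g ?v \<noteq> 0"
      then have "?P ?v"
        using v fv dom_upd_Suc_mono(1)[of v i j a, OF _ *] by metis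
      then have le: "key ?v \<le> key v"
        using max by blast
      have "v 0 \<le> N"
        using le_deg[of v 0] v dv by (simp add: N_def dom_def)
      moreover have "sqsum (?w v) < sqsum (?w ?v) \<or> (sqsum (?w v) \<le> sqsum (?w ?v) \<and> ?v 0 < v 0)"
        using v dom_upd_Suc_mono(2)[of v i j a, OF _ *] by blast
      moreover have "q * Suc N + (N - x) < q' * Suc N + (N - y)"
        if "x \<le> N" "q < q' \<or> q \<le> q' \<and> y < x" for q q' x y
        using that(2)
      proof
        assume "q < q'"
        then have "Suc q * Suc N \<le> q' * Suc N"
          by (intro mult_right_mono) auto
        then show ?thesis
          by simp
      next
        assume "q \<le> q' \<and> y < x"
        then have "q * Suc N \<le> q' * Suc N" "N - x < N - y"
          using that(1) by (auto intro: mult_le_mono1 simp del: mult_Suc_right)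
        then show ?thesis
          by linarith
      qed
      ultimately have "key v < key ?v"
        unfolding key_def by blast
      then show False
        using le by simp
    qed
  qed (use v in auto)
  then have "shape v = shape f"
    using v f dv by (intro dom_eps_imp_shape) (auto simp: ptn_fs)
  then have "v 0 \<le> f y"
    using v by (intro top) auto
  then have "dom (?w v) ?h"
    using v y by (intro dom_var0[OF dv _ f]) auto
  then show False
    using v by simp
qed

section \<open>Counting permutations by cycle type\<close>

definition ctype :: "'a set \<Rightarrow> ('a \<Rightarrow> 'a) \<Rightarrow> nat multiset" where
  "ctype S p = image_mset card (mset_set (orbit p ` S))"

lemma orbit_self:
  assumes "p permutes S" "finite S"
  shows "x \<in> orbit p x"
  using assms by (intro permutation_self_in_orbit) (auto simp: permutation_permutes)

lemma orbit_eq_iff: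
  assumes "p permutes S" "finite S"
  shows "y \<in> orbit p x \<longleftrightarrow> orbit p y = orbit p x"
proof
  assume "y \<in> orbit p x"
  then show "orbit p y = orbit p x"
    using cyclic_on_orbit[OF assms, of x] unfolding cyclic_on_alldef by blast
qed (use orbit_self[OF assms, of y] in simp)

text \<open>Composing with the transposition inserts \<open>a\<close> into the cycle of
  \<open>b\<close>, immediately before \<open>b\<close>: the former predecessor of \<open>b\<close>
  now goes to \<open>a\<close>, and \<open>a\<close> goes to \<open>b\<close>.\<close>

lemma orbit_insert_point:
  assumes q: "q permutes S" "finite S" and a: "a \<notin> S" and b: "b \<in> S"
  defines "p \<equiv> transpose a b \<circ> q"
  shows "orbit p b = insert a (orbit q b)" "orbit p a = insert a (orbit q b)"
    and "x \<in> S \<Longrightarrow> x \<notin> orbit q b \<Longrightarrow> orbit p x = orbit q x"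
proof -
  have p: "p permutes insert a S"
    unfolding p_def using permutes_subset[OF q(1), of "insert a S"] b
    by (intro permutes_compose permutes_swap_id) auto
  have fin: "finite (insert a S)"
    using q by simp
  have qS: "orbit q b \<subseteq> S"
    using permutes_orbit_subset[OF q(1) b] .
  have qa: "q a = a"
    using q(1) a by (simp add: permutes_not_in)
  have pa: "p a = b"
    by (simp add: p_def qa)
  have p_b: "p y = a" if "q y = b" for y
    using that by (simp add: p_def)
  have p_other: "p y = q y" if "y \<in> S" "q y \<noteq> b" for y
  proof -
    have "q y \<noteq> a"
      using that a permutes_in_image[OF q(1), of y] by auto
    then show ?thesis
      using that by (simp add: p_def transpose_def)
  qed
  have q_in: "q y \<in> orbit q b" if "y \<in> orbit q b" for y
    using that by (rule orbit.step)
  have sub1: "orbit p b \<subseteq> insert a (orbit q b)"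
  proof
    fix y assume "y \<in> orbit p b"
    then show "y \<in> insert a (orbit q b)"
    proof induction
      case base
      have "q b \<in> orbit q b"
        by (rule orbit.base)
      then show ?case
        using p_b[of b] p_other[OF b] by (cases "q b = b") auto
    next
      case (step y)
      show ?case
      proof (cases "y = a")
        case True
        then show ?thesis
          using pa orbit_self[OF q, of b] by simp
      next
        case False
        then have y: "y \<in> orbit q b"
          using step by simp
        then show ?thesis
          using p_b[of y] p_other[of y] q_in[OF y] qS by (cases "q y = b") auto
      qed
    qed
  qed
  have b_in: "b \<in> orbit p b"
    by (rule orbit_self[OF p fin])
  have sub2: "orbit q b \<subseteq> orbit p b"
  proof
    fix y assume y: "y \<in> orbit q b"
    have "y = b \<or> y \<in> orbit p b"
      using y
    proof induction
      case base
      show ?case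
        using p_other[OF b] orbit.base[of p b] by (cases "q b = b") auto
    next
      case (step y)
      then have "y \<in> S" "y \<in> orbit p b"
        using b_in qS by auto
      then show ?case
        using p_other[of y] orbit.step[of y p b] by (cases "q y = b") auto
    qed
    then show "y \<in> orbit p b"
      using b_in by blast
  qed
  obtain y where y: "q y = b" "y \<in> orbit q b"
  proof -
    have "b \<in> orbit q b"
      by (rule orbit_self[OF q])
    then have "\<exists>y. q y = b \<and> (y \<in> orbit q b \<or> y = b)"
    proof cases
      case base
      then show ?thesis
        by (intro exI[of _ b]) simp
    next
      case (step y)
      then show ?thesis
        by (intro exI[of _ y]) simp
    qed
    then obtain y where y: "q y = b" "y \<in> orbit q b \<or> y = b"
      by (elim exE conjE)
    from y(2) have "y \<in> orbit q b"
      using orbit_self[OF q, of b] by (elim disjE) simp_all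
    with y(1) show ?thesis
      by (rule that)
  qed
  have "a \<in> orbit p b"
    using orbit.step[OF subsetD[OF sub2 y(2)]] p_b[OF y(1)] by simp
  then show pb: "orbit p b = insert a (orbit q b)"
    using sub1 sub2 by blast
  then show "orbit p a = insert a (orbit q b)"
    using orbit_eq_iff[OF p fin, of a b] by simp
  show "orbit p x = orbit q x" if x: "x \<in> S" "x \<notin> orbit q b"
  proof (rule orbit_cong)
    show "x \<in> orbit q x"
      by (rule orbit_self[OF q])
    fix s assume s: "s \<in> orbit q x"
    have "q s \<noteq> b"
    proof
      assume "q s = b"
      then have "b \<in> orbit q x"
        using orbit.step[OF s] by simp
      then show False
        using x(2) orbit_self[OF q, of x] orbit_eq_iff[OF q, of b x] by simp
    qed
    moreover have "s \<in> S"
      using s permutes_orbit_subset[OF q(1) x(1)] by blast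
    ultimately show "p s = q s"
      by (rule p_other[rotated])
  qed
qed

lemma ctype_insert_point:
  assumes q: "q permutes S" "finite S" and a: "a \<notin> S" and b: "b \<in> S"
  shows "ctype (insert a S) (transpose a b \<circ> q) =
    add_mset (Suc (card (orbit q b))) (ctype S q - {#card (orbit q b)#})"
proof -
  let ?p = "transpose a b \<circ> q"
  let ?O = "orbit q ` S"
  note orb = orbit_insert_point[OF q a b]
  have fO: "finite ?O"
    using q by simp
  have bO: "orbit q b \<in> ?O"
    using b by simp
  have sub: "X \<subseteq> S" if "X \<in> ?O" for X
    using that permutes_orbit_subset[OF q(1)] by auto
  have "orbit ?p ` insert a S = insert (insert a (orbit q b)) (?O - {orbit q b})"
  proof (intro set_eqI iffI)
    fix X assume "X \<in> orbit ?p ` insert a S"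
    then obtain x where x: "x \<in> insert a S" "X = orbit ?p x"
      by blast
    show "X \<in> insert (insert a (orbit q b)) (?O - {orbit q b})"
    proof (cases "x = a")
      case False
      then have xS: "x \<in> S"
        using x by simp
      show ?thesis
      proof (cases "x \<in> orbit q b")
        case True
        have "?p permutes insert a S" "finite (insert a S)"
          using permutes_subset[OF q(1), of "insert a S"] q(2) b
          by (auto intro!: permutes_compose permutes_swap_id)
        then have "orbit ?p x = orbit ?p b"
          using True orb(1) orbit_eq_iff[of ?p "insert a S" x b] by blast
        then show ?thesis
          using x orb(1) by simp
      next
        case False
        then have "orbit q x \<noteq> orbit q b"
          using orbit_eq_iff[OF q, of x b] by simp
        then show ?thesis
          using x xS orb(3)[OF xS False] by simp
      qed
    qed (use x orb in simp)
  next
    fix X assume X: "X \<in> insert (insert a (orbit q b)) (?O - {orbit q b})"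
    show "X \<in> orbit ?p ` insert a S"
    proof (cases "X = insert a (orbit q b)")
      case True
      then show ?thesis
        using orb(2) by (intro image_eqI[of _ _ a]) simp_all
    next
      case False
      then obtain x where x: "x \<in> S" "X = orbit q x" "X \<noteq> orbit q b"
        using X by blast
      then have "x \<notin> orbit q b"
        using orbit_eq_iff[OF q, of x b] by simp
      then show ?thesis
        using x orb(3)[OF x(1)] by (intro image_eqI[of _ _ x]) simp_all
    qed
  qed
  moreover have "insert a (orbit q b) \<notin> ?O - {orbit q b}"
    using sub a by blast
  moreover have "card (insert a (orbit q b)) = Suc (card (orbit q b))"
    using sub[OF bO] a q(2) by (intro card_insert_disjoint) (auto intro: finite_subset)
  ultimately have "ctype (insert a S) ?p = add_mset (Suc (card (orbit q b))) (image_mset card (mset_set (?O - {orbit q b})))"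
    using fO by (simp add: ctype_def)
  also have "image_mset card (mset_set (?O - {orbit q b})) = ctype S q - {#card (orbit q b)#}"
    using fO bO by (simp add: ctype_def mset_set.remove)
  finally show ?thesis .
qed

lemma ctype_insert_fixed:
  assumes q: "q permutes S" "finite S" and a: "a \<notin> S"
  shows "ctype (insert a S) q = add_mset 1 (ctype S q)"
proof -
  have qa: "q a = a"
    using q(1) a by (simp add: permutes_not_in)
  have oa: "orbit q a = {a}"
  proof -
    have "y = a" if "y \<in> orbit q a" for y
      using that by induction (auto simp: qa)
    then show ?thesis
      using orbit_self[OF q, of a] by blast
  qed
  have "{a} \<notin> orbit q ` S"
    using permutes_orbit_subset[OF q(1)] a by blast
  then show ?thesis
    using q by (simp add: ctype_def oa)
qed

lemma card_points_orbit_size: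
  assumes q: "q permutes S" "finite S"
  shows "card {b \<in> S. card (orbit q b) = j} = j * count (ctype S q) j"
proof -
  let ?O = "{X \<in> orbit q ` S. card X = j}"
  have "{b \<in> S. card (orbit q b) = j} = \<Union> ?O"
  proof (intro set_eqI iffI)
    fix b assume "b \<in> {b \<in> S. card (orbit q b) = j}"
    then show "b \<in> \<Union> ?O"
      using orbit_self[OF q, of b] by blast
  next
    fix b assume "b \<in> \<Union> ?O"
    then obtain x where x: "x \<in> S" "b \<in> orbit q x" "card (orbit q x) = j"
      by blast
    then show "b \<in> {b \<in> S. card (orbit q b) = j}"
      using orbit_eq_iff[OF q, of b x] permutes_orbit_subset[OF q(1) x(1)] by auto
  qed
  also have "card \<dots> = (\<Sum>X\<in>?O. card X)"
  proof (rule card_Union_disjoint)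
    show "pairwise disjnt ?O"
      unfolding pairwise_def disjnt_def using orbit_eq_iff[OF q] by auto
    show "finite X" if "X \<in> ?O" for X
      using that permutes_orbit_subset[OF q(1)] q(2) by (auto intro: finite_subset)
  qed
  also have "\<dots> = j * card ?O"
    by simp
  also have "card ?O = count (ctype S q) j"
  proof -
    have "count (ctype S q) j = card (card -` {j} \<inter> orbit q ` S)"
      using q(2) by (simp add: ctype_def count_image_mset)
    also have "card -` {j} \<inter> orbit q ` S = ?O"
      by auto
    finally show ?thesis
      by simp
  qed
  finally show ?thesis .
qed

text \<open>The classical product formula for z, to be matched with \<open>zee\<close>, which is
  defined by counting permutations.\<close>

definition zfact :: "nat multiset \<Rightarrow> nat" where
  "zfact M = (\<Prod>k\<in>set_mset M. k ^ count M k * fact (count M k))"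

lemma zfact_add: "zfact (add_mset k M) = k * Suc (count M k) * zfact M"
proof -
  let ?t = "\<lambda>M k. k ^ count M k * fact (count M k) :: nat"
  have "zfact (add_mset k M) = ?t (add_mset k M) k * (\<Prod>j\<in>set_mset M - {k}. ?t (add_mset k M) j)"
    unfolding zfact_def by (subst prod.remove[of _ k]) auto
  also have "(\<Prod>j\<in>set_mset M - {k}. ?t (add_mset k M) j) = (\<Prod>j\<in>set_mset M - {k}. ?t M j)"
    by (intro prod.cong) auto
  also have "?t (add_mset k M) k = k * Suc (count M k) * ?t M k"
    by (simp add: algebra_simps)
  finally have "zfact (add_mset k M) = k * Suc (count M k) * (?t M k * (\<Prod>j\<in>set_mset M - {k}. ?t M j))"
    by (simp only: mult.assoc)
  also have "?t M k * (\<Prod>j\<in>set_mset M - {k}. ?t M j) = zfact M"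
  proof (cases "k \<in># M")
    case True
    then show ?thesis
      unfolding zfact_def by (simp add: prod.remove)
  next
    case False
    then have "count M k = 0" "set_mset M - {k} = set_mset M"
      by (auto simp: not_in_iff)
    then show ?thesis
      unfolding zfact_def by simp
  qed
  finally show ?thesis .
qed

lemma zfact_remove: "k \<in># M \<Longrightarrow> zfact M = k * count M k * zfact (M - {#k#})"
  using zfact_add[of k "M - {#k#}"] by (simp del: count_single)

lemma zfact_pos: "0 \<notin># M \<Longrightarrow> zfact M > 0"
  unfolding zfact_def by (intro prod_pos) (auto intro: gr0I)

lemma sum_mset_count: "(\<Sum>k\<in>set_mset M. k * count M k) = sum_mset (M :: nat multiset)"
proof -
  have "(\<Sum>k\<in>A. k * count M k) = sum_mset M" if "finite A" "set_mset M \<subseteq> A" for A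
    using that(2)
  proof (induction M)
    case (add x M)
    have "(\<Sum>k\<in>A. k * count (add_mset x M) k) = (\<Sum>k\<in>A. k * count M k + (if k = x then x else 0))"
      by (intro sum.cong) auto
    then show ?case
      using add that(1) by (simp add: sum.distrib)
  qed simp
  then show ?thesis
    by simp
qed

definition nperm :: "'a set \<Rightarrow> nat multiset \<Rightarrow> nat" where
  "nperm S M = card {p. p permutes S \<and> ctype S p = M}"

text \<open>A permutation of \<open>insert a S\<close> either fixes \<open>a\<close> or arises by
  inserting \<open>a\<close> into a cycle of some length j. A permutation of the shorter type has j
  times the number of its j-cycles as possible insertion points, which is the last factor.\<close>

lemma nperm_insert:
  assumes S: "finite S" "a \<notin> S"
  shows "nperm (insert a S) M = (if 1 \<in># M then nperm S (M - {#1#}) else 0) +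
    (\<Sum>j\<in>{j. j \<ge> 1 \<and> Suc j \<in># M}. nperm S (add_mset j (M - {#Suc j#})) * (j * Suc (count (M - {#Suc j#}) j)))"
proof -
  let ?P = "{q. q permutes S}"
  let ?f = "\<lambda>(b, q). transpose a b \<circ> q"
  have finP: "finite ?P"
    using S finite_permutations by blast
  have inj: "inj_on ?f (insert a S \<times> ?P)"
  proof (rule inj_onI, clarsimp)
    fix b q c r assume *: "b = a \<or> b \<in> S" "q permutes S" "c = a \<or> c \<in> S" "r permutes S"
      "transpose a b \<circ> q = transpose a c \<circ> r"
    have "q a = a" "r a = a"
      using * S by (auto simp: permutes_not_in)
    then have bc: "b = c"
      using fun_cong[OF *(5), of a] by simp
    have "transpose a b \<circ> (transpose a b \<circ> q) = transpose a b \<circ> (transpose a b \<circ> r)"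
      using *(5) bc by simp
    then show "b = c \<and> q = r"
      using bc by (simp add: comp_assoc[symmetric])
  qed
  have eq: "{p. p permutes insert a S \<and> ctype (insert a S) p = M} =
      ?f ` {(b, q). b \<in> insert a S \<and> q permutes S \<and> ctype (insert a S) (transpose a b \<circ> q) = M}"
  proof -
    have "{p. p permutes insert a S \<and> ctype (insert a S) p = M} =
       {p \<in> {p. p permutes insert a S}. ctype (insert a S) p = M}"
      by blast
    then show ?thesis
      unfolding permutes_insert by auto
  qed
  have "nperm (insert a S) M = card {(b, q). b \<in> insert a S \<and> q permutes S \<and> ctype (insert a S) (transpose a b \<circ> q) = M}"
    unfolding nperm_def eq by (intro card_image inj_on_subset[OF inj]) auto
  also have "{(b, q). b \<in> insert a S \<and> q permutes S \<and> ctype (insert a S) (transpose a b \<circ> q) = M} =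
     Pair a ` {q. q permutes S \<and> add_mset 1 (ctype S q) = M} \<union>
     (\<Union>j\<in>{j. j \<ge> 1 \<and> Suc j \<in># M}. SIGMA q:{q. q permutes S \<and> ctype S q = add_mset j (M - {#Suc j#})}. {b\<in>S. card (orbit q b) = j})\<inverse>"
    (is "?A = ?B \<union> ?C")
  proof (intro set_eqI iffI)
    fix bq assume "bq \<in> ?A"
    then obtain b q where bq: "bq = (b, q)" "b \<in> insert a S" "q permutes S" "ctype (insert a S) (transpose a b \<circ> q) = M"
      by auto
    show "bq \<in> ?B \<union> ?C"
    proof (cases "b = a")
      case True
      then have "add_mset 1 (ctype S q) = M"
        using bq(4) ctype_insert_fixed[OF bq(3) S] by simp
      then show ?thesis
        using bq True by auto
    next
      case False
      then have bS: "b \<in> S"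
        using bq(2) by simp
      define j where "j = card (orbit q b)"
      have M: "M = add_mset (Suc j) (ctype S q - {#j#})"
        using bq(4) ctype_insert_point[OF bq(3) S bS] by (simp add: j_def)
      have "orbit q b \<in># mset_set (orbit q ` S)"
        using S bS by simp
      then have jct: "j \<in># ctype S q"
        unfolding ctype_def j_def by (metis imageI set_image_mset)
      have "finite (orbit q b)"
        using permutes_orbit_subset[OF bq(3) bS] S finite_subset by blast
      then have "j \<ge> 1"
        unfolding j_def using orbit_nonempty[of q b] by (simp add: Suc_le_eq card_gt_0_iff)
      moreover have "Suc j \<in># M" "ctype S q = add_mset j (M - {#Suc j#})"
        using M jct by simp_all
      ultimately show ?thesis
        using bq bS j_def by auto
    qed
  next
    fix bq assume "bq \<in> ?B \<union> ?C"
    then show "bq \<in> ?A"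
    proof
      assume "bq \<in> ?B"
      then show ?thesis
        using ctype_insert_fixed[OF _ S] by auto
    next
      assume "bq \<in> ?C"
      then obtain j b q where *: "j \<ge> 1" "Suc j \<in># M" "bq = (b, q)" "q permutes S"
        "ctype S q = add_mset j (M - {#Suc j#})" "b \<in> S" "card (orbit q b) = j"
        by auto
      have "ctype (insert a S) (transpose a b \<circ> q) = M"
        using ctype_insert_point[OF *(4) S *(6)] * by simp
      then show ?thesis
        using * by simp
    qed
  qed
  also have "card (?B \<union> ?C) = card ?B + card ?C"
  proof (rule card_Un_disjoint)
    have fin: "finite (insert a S \<times> ?P)"
      using S finP by simp
    have sub: "?B \<subseteq> insert a S \<times> ?P" "?C \<subseteq> insert a S \<times> ?P"
      by auto
    show "finite ?B" "finite ?C"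
      by (rule finite_subset[OF sub(1) fin], rule finite_subset[OF sub(2) fin])
    show "?B \<inter> ?C = {}"
      using S by auto
  qed
  also have "card ?B = (if 1 \<in># M then nperm S (M - {#1#}) else 0)"
  proof -
    have 1: "card ?B = card {q. q permutes S \<and> add_mset 1 (ctype S q) = M}"
      by (intro card_image) (auto simp: inj_on_def)
    have 2: "{q. q permutes S \<and> add_mset 1 (ctype S q) = M} = (if 1 \<in># M then {q. q permutes S \<and> ctype S q = M - {#1#}} else {})"
      by auto
    show ?thesis
      unfolding 1 unfolding 2 by (simp add: nperm_def)
  qed
  also have "card ?C = (\<Sum>j\<in>{j. j \<ge> 1 \<and> Suc j \<in># M}. nperm S (add_mset j (M - {#Suc j#})) * (j * Suc (count (M - {#Suc j#}) j)))"
  proof -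
    let ?Q = "\<lambda>j. {q. q permutes S \<and> ctype S q = add_mset j (M - {#Suc j#})}"
    let ?X = "\<lambda>j. (SIGMA q:?Q j. {b\<in>S. card (orbit q b) = j})"
    have finQ: "finite (?Q j)" for j
      using finP by (rule rev_finite_subset) auto
    have "card ?C = card (\<Union>j\<in>{j. j \<ge> 1 \<and> Suc j \<in># M}. ?X j)"
      by (rule card_inverse)
    also have "\<dots> = (\<Sum>j\<in>{j. j \<ge> 1 \<and> Suc j \<in># M}. card (?X j))"
    proof (rule card_UN_disjoint)
      have "{j. j \<ge> 1 \<and> Suc j \<in># M} \<subseteq> (\<lambda>x. x - 1) ` set_mset M"
        by (auto intro: image_eqI[of _ _ "Suc _"])
      then show "finite {j. j \<ge> 1 \<and> Suc j \<in># M}"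
        using finite_subset by blast
      show "\<forall>j\<in>{j. j \<ge> 1 \<and> Suc j \<in># M}. finite (?X j)"
        using finQ S by auto
      show "\<forall>i\<in>{j. j \<ge> 1 \<and> Suc j \<in># M}. \<forall>j\<in>{j. j \<ge> 1 \<and> Suc j \<in># M}. i \<noteq> j \<longrightarrow> ?X i \<inter> ?X j = {}"
        by auto
    qed
    also have "\<dots> = (\<Sum>j\<in>{j. j \<ge> 1 \<and> Suc j \<in># M}.
        nperm S (add_mset j (M - {#Suc j#})) * (j * Suc (count (M - {#Suc j#}) j)))"
    proof (rule sum.cong[OF refl])
      fix j
      have "card (?X j) = (\<Sum>q\<in>?Q j. card {b\<in>S. card (orbit q b) = j})"
        using finQ S by (intro card_SigmaI) auto
      also have "\<dots> = (\<Sum>q\<in>?Q j. j * Suc (count (M - {#Suc j#}) j))"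
        using S by (intro sum.cong refl) (auto simp: card_points_orbit_size)
      finally show "card (?X j) = nperm S (add_mset j (M - {#Suc j#})) * (j * Suc (count (M - {#Suc j#}) j))"
        by (simp add: nperm_def)
    qed
    finally show ?thesis .
  qed
  finally show ?thesis .
qed

text \<open>After multiplication by \<open>zfact M\<close>, each part size k contributes
  \<open>fact (card S)\<close> times k times its multiplicity in the recursion, and these numbers
  add up to the sum of \<open>M\<close>.\<close>

lemma nperm_zfact:
  assumes "finite S" "0 \<notin># M" "sum_mset M = card S"
  shows "nperm S M * zfact M = fact (card S)"
  using assms
proof (induction S arbitrary: M rule: finite_induct)
  case empty
  then have "M = {#}"
    by (metis card.empty multiset_nonemptyE sum_mset_0_iff)
  moreover have "{p. p permutes ({} :: 'a set) \<and> ctype {} p = {#}} = {id}"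
    by (auto simp: ctype_def)
  then have "nperm ({} :: 'a set) {#} = 1"
    unfolding nperm_def by simp
  ultimately show ?case
    by (simp add: zfact_def)
next
  case (insert a S)
  let ?n = "fact (card S) :: nat"
  let ?J = "{j. j \<ge> 1 \<and> Suc j \<in># M}"
  have 1: "nperm S (M - {#1#}) * zfact M = ?n * count M 1" if "1 \<in># M"
  proof -
    have "nperm S (M - {#1#}) * zfact (M - {#1#}) = ?n"
      using insert that by (intro insert.IH) (auto dest: in_diffD simp: sum_mset_diff)
    then show ?thesis
      using zfact_remove[OF that] by simp
  qed
  have 2: "nperm S (add_mset j (M - {#Suc j#})) * (j * Suc (count (M - {#Suc j#}) j)) * zfact M
      = ?n * (Suc j * count M (Suc j))" if "j \<in> ?J" for j
  proof -
    let ?M = "add_mset j (M - {#Suc j#})"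
    have "sum_mset (add_mset (Suc j) (M - {#Suc j#})) = Suc (card S)"
      using insert that by simp
    then have "nperm S ?M * zfact ?M = ?n"
      using insert(4) that by (intro insert.IH) (auto dest: in_diffD simp del: insert_DiffM)
    moreover have "zfact ?M = j * Suc (count (M - {#Suc j#}) j) * zfact (M - {#Suc j#})"
      by (rule zfact_add)
    moreover have "zfact M = Suc j * count M (Suc j) * zfact (M - {#Suc j#})"
      using that by (intro zfact_remove) simp
    moreover have "N * (x * y) * (z * w * Z) = N * (x * y * Z) * (z * w)" for N x y z w Z :: nat
      by (simp only: ac_simps)
    ultimately show ?thesis
      by (simp only:)
  qed
  have fin: "finite ?J"
    by (rule finite_subset[of _ "(\<lambda>x. x - 1) ` set_mset M"]) (auto intro: image_eqI[of _ _ "Suc _"])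
  have "nperm (insert a S) M * zfact M = ?n * count M 1 + (\<Sum>j\<in>?J. ?n * (Suc j * count M (Suc j)))"
  proof -
    have "nperm (insert a S) M * zfact M = (if 1 \<in># M then nperm S (M - {#1#}) * zfact M else 0) +
        (\<Sum>j\<in>?J. nperm S (add_mset j (M - {#Suc j#})) * (j * Suc (count (M - {#Suc j#}) j)) * zfact M)"
      unfolding nperm_insert[OF insert(1,2)] by (simp add: distrib_right sum_distrib_right)
    moreover have "(if 1 \<in># M then nperm S (M - {#1#}) * zfact M else 0) = ?n * count M 1"
      using 1 by (auto simp: not_in_iff)
    ultimately show ?thesis
      using 2 by simp
  qed
  also have "\<dots> = ?n * (count M 1 + (\<Sum>j\<in>?J. Suc j * count M (Suc j)))"
    by (simp add: distrib_left sum_distrib_left)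
  also have "(\<Sum>j\<in>?J. Suc j * count M (Suc j)) = (\<Sum>k\<in>set_mset M - {1}. k * count M k)"
    using insert(4) by (intro sum.reindex_bij_witness[where i = "\<lambda>k. k - 1" and j = Suc])
      (auto simp: Suc_le_eq intro: gr0I, (metis not_gr0 neq0_conv One_nat_def Suc_pred Suc_lessI diff_is_0_eq' less_one not_le)+)
  also have "count M 1 + \<dots> = (\<Sum>k\<in>set_mset M. k * count M k)"
    by (cases "1 \<in># M") (simp_all add: sum.remove not_in_iff)
  also have "\<dots> = Suc (card S)"
    using insert by (simp add: sum_mset_count)
  finally show ?case
    using insert by simp
qed

lemma zee_eq:
  assumes "int_partition l"
  shows "zee l = of_nat (zfact (mset l))"
proof -
  have "nperm {..<sum_list l} (mset l) * zfact (mset l) = fact (card {..<sum_list l})"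
    using assms by (intro nperm_zfact) (auto simp: int_partition_def sum_mset_sum_list)
  moreover have "nperm {..<sum_list l} (mset l) = card {p. p permutes {..<sum_list l} \<and> cycle_type (sum_list l) p = mset l}"
    by (simp add: nperm_def cycle_type_def ctype_def)
  ultimately have *: "card {p. p permutes {..<sum_list l} \<and> cycle_type (sum_list l) p = mset l} * zfact (mset l) = fact (sum_list l)"
    by simp
  then have "card {p. p permutes {..<sum_list l} \<and> cycle_type (sum_list l) p = mset l} \<noteq> 0"
    by (metis fact_nonzero mult_zero_left)
  then show ?thesis
    unfolding zee_def *[symmetric] by simp
qed

section \<open>The power sum basis and the inner product\<close>

lemma size_shape: "size (shape u) = card (supp u)"
  by (simp add: shape_def)

lemma sum_mset_shape: "sum_mset (shape u) = deg u"
  using sum_supp_shape[of "\<lambda>x. x" u] by (simp add: deg_def)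

lemma coef_pm_nonneg: "fs u \<Longrightarrow> 0 \<notin># M \<Longrightarrow> coef (pm M) u \<ge> 0"
proof (induction M arbitrary: u)
  case (add k M)
  then have "k \<ge> 1"
    by (cases k) auto
  moreover have "0 \<le> coef (pm M) (u(i := u i - k))" for i
    using add.prems by (intro add.IH) (simp_all only: fs_upd, auto)
  ultimately show ?case
    unfolding pm_add by (subst coef_power_sum_mult[OF add(2) add(2) order_refl]) (auto intro!: sum_nonneg)
qed (simp add: coef_one)

lemma coef_pm_pos: "fs u \<Longrightarrow> shape u = M \<Longrightarrow> coef (pm M) u > 0"
proof (induction M arbitrary: u)
  case empty
  then show ?case
    by (simp add: coef_one shape_eq_empty_iff)
next
  case (add k M)
  have 0: "0 \<notin># add_mset k M"
    using zero_notin_shape[of u] add(3) by simp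
  then have k: "k \<ge> 1"
    by (cases k) auto
  have "k \<in># shape u"
    using add by simp
  then obtain i where i: "i \<in> supp u" "u i = k"
    using add(2) by (auto simp: shape_def)
  let ?t = "\<lambda>i. if k \<le> u i then coef (pm M) (u(i := u i - k)) else 0"
  have "shape (u(i := u i - k)) = M"
    using i add k by (simp add: shape_upd)
  then have "0 < coef (pm M) (u(i := u i - k))"
    using add.prems by (intro add.IH) (simp_all only: fs_upd)
  then have "0 < ?t i"
    using i by simp
  also have "\<dots> \<le> (\<Sum>i\<in>supp u. ?t i)"
    using add i 0 by (intro member_le_sum) (auto intro!: coef_pm_nonneg)
  also have "\<dots> = coef (pm (add_mset k M)) u"
    unfolding pm_add by (rule coef_power_sum_mult[OF add(2) add(2) order_refl k, symmetric])
  finally show ?case .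
qed

text \<open>Multiplying by a power sum either creates a new exponent or enlarges an existing one.
  Hence the number of variables never exceeds the number of factors, and it reaches that number only
  if every factor created its own exponent.\<close>

lemma coef_pm_nonzero:
  assumes "fs u" "0 \<notin># M" "coef (pm M) u \<noteq> 0"
  shows "deg u = sum_mset M \<and> size (shape u) \<le> size M \<and> (size (shape u) = size M \<longrightarrow> shape u = M)"
  using assms
proof (induction M arbitrary: u)
  case empty
  then show ?case
    by (auto simp: coef_one deg_def supp_def size_shape shape_eq_empty_iff split: if_splits)
next
  case (add k M)
  have k: "k \<ge> 1"
    using add(3) by (cases k) auto
  have "(\<Sum>i\<in>supp u. if k \<le> u i then coef (pm M) (u(i := u i - k)) else 0) \<noteq> 0"
    using add(4) unfolding pm_add coef_power_sum_mult[OF add(2) add(2) order_refl k] .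
  then obtain i where i: "i \<in> supp u" "(if k \<le> u i then coef (pm M) (u(i := u i - k)) else 0) \<noteq> 0"
    by (rule sum.not_neutral_contains_not_neutral)
  define v where "v = u(i := u i - k)"
  have ki: "k \<le> u i" and "coef (pm M) v \<noteq> 0"
    using i by (auto simp: v_def split: if_splits)
  moreover have fv: "fs v"
    using add.prems by (simp add: v_def)
  ultimately have IH: "deg v = sum_mset M" "size (shape v) \<le> size M" "size (shape v) = size M \<longrightarrow> shape v = M"
    using add.IH[of v] add.prems by auto
  have ui: "u i \<in># shape u"
    using i(1) add.prems by (auto simp: shape_def)
  have sv: "shape v = (if u i - k = 0 then {#} else {#u i - k#}) + (shape u - {#u i#})"
    using add.prems i(1) by (simp add: v_def shape_upd)
  have su: "shape u = add_mset (u i) (shape u - {#u i#})"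
    using ui by simp
  show ?case
  proof (cases "u i = k")
    case True
    then have e: "shape u = add_mset k (shape v)"
      using sv su by simp
    have "deg u = k + deg v"
      unfolding sum_mset_shape[symmetric] e by simp
    then show ?thesis
      using IH unfolding e by simp
  next
    case False
    then have e: "shape v = add_mset (u i - k) (shape u - {#u i#})"
      using sv ki by simp
    have "deg u + (u i - k) = u i + deg v"
    proof -
      have "sum_mset (shape u) = u i + sum_mset (shape u - {#u i#})"
        by (subst su) simp
      then show ?thesis
        unfolding sum_mset_shape[symmetric] e by simp
    qed
    then have "deg u = sum_mset (add_mset k M)"
      using IH(1) ki by simp
    moreover have "size (shape u) = size (shape v)"
      unfolding e by (subst su) simp
    ultimately show ?thesis
      using IH(2) by simp
  qed
qed

lemma mset_part:
  assumes "0 \<notin> set l"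
  shows "fs (part l)" "shape (part l) = mset l"
proof -
  have s: "supp (part l) = {..<length l}"
    using assms by (auto simp: supp_def part_def intro!: gr0I) (metis nth_mem)
  then show "fs (part l)"
    by simp
  have "image_mset (part l) (mset_set {..<length l}) = image_mset (\<lambda>i. l ! i) (mset_set {..<length l})"
    by (intro image_mset_cong) (auto simp: part_def)
  also have "\<dots> = mset (map ((!) l) [0..<length l])"
    by (simp flip: mset_upt add: lessThan_atLeast0)
  finally show "shape (part l) = mset l"
    unfolding shape_def s by (simp add: map_nth)
qed

lemma ex_shape: "0 \<notin># M \<Longrightarrow> \<exists>u. fs u \<and> shape u = M"
  using mset_part[of "sorted_list_of_multiset M"] by (metis mset_sorted_list_of_multiset set_sorted_list_of_multiset)

definition plist :: "nat multiset \<Rightarrow> nat list" where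
  "plist M = rev (sorted_list_of_multiset M)"

lemma mset_plist [simp]: "mset (plist M) = M"
  by (simp add: plist_def)

lemma set_plist [simp]: "set (plist M) = set_mset M"
  by (metis mset_plist set_mset_mset)

lemma int_partition_plist: "0 \<notin># M \<Longrightarrow> int_partition (plist M)"
  unfolding int_partition_def by (auto simp: plist_def sorted_wrt_rev intro!: gr0I)

lemma plist_mset: "int_partition l \<Longrightarrow> plist (mset l) = l"
proof -
  assume "int_partition l"
  then have "sorted (rev l)"
    by (simp add: int_partition_def sorted_wrt_rev)
  then have "sorted_list_of_multiset (mset l) = rev l"
    by (metis mset_rev sorted_list_of_multiset_mset sorted_sort_id)
  then show ?thesis
    by (simp add: plist_def)
qed

lemma power_sum_part_pm: "power_sum_part l = pm (mset l)"
  by (simp add: power_sum_part_def pm_def prod_mset_prod_list flip: mset_map)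

lemma int_partition_zero: "int_partition l \<Longrightarrow> 0 \<notin># mset l"
  by (auto simp: int_partition_def)

text \<open>A relation is evaluated at a vector whose shape is a longest multiset with nonzero
  coefficient; by \<open>coef_pm_nonzero\<close> no other term contributes there.\<close>

lemma pm_independent:
  assumes X: "finite X" "\<And>M. M \<in> X \<Longrightarrow> 0 \<notin># M"
    and 0: "(\<Sum>M\<in>X. mscale (c M) (pm M)) = 0" and M: "M \<in> X"
  shows "c M = 0"
proof (rule ccontr)
  assume "c M \<noteq> 0"
  define Y where "Y = {M \<in> X. c M \<noteq> 0}"
  have Y: "finite Y" "Y \<noteq> {}"
    using X M \<open>c M \<noteq> 0\<close> by (auto simp: Y_def)
  have "Max (size ` Y) \<in> size ` Y"
    using Y by simp
  then obtain L where "L \<in> Y" "size L = Max (size ` Y)"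
    by auto
  then have L: "L \<in> Y" "\<And>N. N \<in> Y \<Longrightarrow> size N \<le> size L"
    using Y by simp_all
  obtain u where u: "fs u" "shape u = L"
    using ex_shape X L by (auto simp: Y_def)
  have "0 = coef (\<Sum>M\<in>X. mscale (c M) (pm M)) u"
    by (simp add: 0)
  also have "\<dots> = (\<Sum>N\<in>X. c N * coef (pm N) u)"
    by simp
  also have "\<dots> = (\<Sum>N\<in>{L}. c N * coef (pm N) u)"
  proof (rule sum.mono_neutral_right)
    show "\<forall>N\<in>X - {L}. c N * coef (pm N) u = 0"
    proof
      fix N assume N: "N \<in> X - {L}"
      show "c N * coef (pm N) u = 0"
      proof (rule ccontr)
        assume *: "c N * coef (pm N) u \<noteq> 0"
        then have "size L \<le> size N \<and> (size L = size N \<longrightarrow> L = N)"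
          using coef_pm_nonzero[OF u(1), of N] N X(2)[of N] u(2) by auto
        moreover have "size N \<le> size L"
          using L(2)[of N] N * by (auto simp: Y_def)
        ultimately show False
          using N by auto
      qed
    qed
  qed (use X L in \<open>auto simp: Y_def\<close>)
  also have "\<dots> = c L * coef (pm L) u"
    by simp
  finally show False
    using coef_pm_pos[OF u] L(1) by (simp add: Y_def)
qed

text \<open>The property inside the definite description of \<open>power_sum_coeff\<close>. Its
  uniqueness, and its existence on \<open>Lam\<close>, give that description a meaning.\<close>

definition pexp :: "(nat list \<Rightarrow> ratfun) \<Rightarrow> ratfun mseries \<Rightarrow> bool" where
  "pexp c f \<longleftrightarrow> finite {l. c l \<noteq> 0} \<and> (\<forall>l. c l \<noteq> 0 \<longrightarrow> int_partition l) \<and>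
     f = (\<Sum>l | c l \<noteq> 0. mscale (c l) (power_sum_part l))"

lemma pexp_superset:
  assumes "pexp c f" "finite X" "{l. c l \<noteq> 0} \<subseteq> X"
  shows "f = (\<Sum>l\<in>X. mscale (c l) (power_sum_part l))"
proof -
  have "f = (\<Sum>l | c l \<noteq> 0. mscale (c l) (power_sum_part l))"
    using assms by (simp add: pexp_def)
  also have "\<dots> = (\<Sum>l\<in>X. mscale (c l) (power_sum_part l))"
    using assms by (intro sum.mono_neutral_left) auto
  finally show ?thesis .
qed

lemma pexp_add: "pexp c f \<Longrightarrow> pexp d g \<Longrightarrow> pexp (\<lambda>l. c l + d l) (f + g)"
proof -
  assume *: "pexp c f" "pexp d g"
  let ?X = "{l. c l \<noteq> 0} \<union> {l. d l \<noteq> 0}"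
  have X: "finite ?X" "{l. c l + d l \<noteq> 0} \<subseteq> ?X"
    using * by (auto simp: pexp_def)
  have "f + g = (\<Sum>l\<in>?X. mscale (c l) (power_sum_part l)) + (\<Sum>l\<in>?X. mscale (d l) (power_sum_part l))"
    by (intro arg_cong2[where f = "(+)"] pexp_superset[OF *(1)] pexp_superset[OF *(2)] X) auto
  also have "\<dots> = (\<Sum>l\<in>?X. mscale (c l + d l) (power_sum_part l))"
    by (simp add: mv.scale_left_distrib sum.distrib)
  also have "\<dots> = (\<Sum>l | c l + d l \<noteq> 0. mscale (c l + d l) (power_sum_part l))"
    using X by (intro sum.mono_neutral_right) auto
  finally show ?thesis
    using * X finite_subset[OF X(2) X(1)] unfolding pexp_def by auto
qed

lemma pexp_mscale: "pexp c f \<Longrightarrow> pexp (\<lambda>l. a * c l) (mscale a f)"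
proof -
  assume *: "pexp c f"
  let ?X = "{l. c l \<noteq> 0}"
  have X: "finite ?X" "{l. a * c l \<noteq> 0} \<subseteq> ?X"
    using * by (auto simp: pexp_def)
  have "mscale a f = (\<Sum>l\<in>?X. mscale (a * c l) (power_sum_part l))"
    using * by (simp add: pexp_def mv.scale_sum_right)
  also have "\<dots> = (\<Sum>l | a * c l \<noteq> 0. mscale (a * c l) (power_sum_part l))"
    using X by (intro sum.mono_neutral_right) auto
  finally show ?thesis
    using * X finite_subset[OF X(2) X(1)] unfolding pexp_def by auto
qed

lemma pexp_pm: "0 \<notin># M \<Longrightarrow> pexp (\<lambda>l. if l = plist M then 1 else 0) (pm M)"
  by (auto simp: pexp_def int_partition_plist power_sum_part_pm split: if_splits)

lemma pexp_zero: "pexp (\<lambda>_. 0) 0"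
  by (simp add: pexp_def)

lemma pexp_unique:
  assumes "pexp c f" "pexp d f"
  shows "c = d"
proof
  fix l
  define e where "e l = c l + (-1) * d l" for l
  have e: "pexp e 0"
    unfolding e_def using pexp_add[OF assms(1) pexp_mscale[OF assms(2), of "-1"]]
    by simp
  let ?X = "{l. e l \<noteq> 0}"
  have X: "finite ?X" "\<And>l. l \<in> ?X \<Longrightarrow> int_partition l"
    using e by (auto simp: pexp_def)
  have inj: "inj_on mset ?X"
    by (rule inj_on_inverseI[where g = plist]) (use X plist_mset in auto)
  have "(\<Sum>M\<in>mset ` ?X. mscale (e (plist M)) (pm M)) = (\<Sum>l\<in>?X. mscale (e l) (power_sum_part l))"
    unfolding sum.reindex[OF inj] by (intro sum.cong) (auto simp: power_sum_part_pm plist_mset X)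
  also have "\<dots> = 0"
    using e by (simp add: pexp_def)
  finally have 0: "e (plist M) = 0" if "M \<in> mset ` ?X" for M
    using X that int_partition_zero by (intro pm_independent[of "mset ` ?X"]) auto
  have "e l = 0"
  proof (rule ccontr)
    assume l: "e l \<noteq> 0"
    then have "plist (mset l) = l"
      using X plist_mset by blast
    then show False
      using 0[of "mset l"] l by simp
  qed
  then show "c l = d l"
    by (simp add: e_def)
qed

lemma power_sum_coeff_eq: "pexp c f \<Longrightarrow> power_sum_coeff f = c"
  unfolding power_sum_coeff_def pexp_def[symmetric] by (intro the_equality) (auto intro: pexp_unique)

lemma pexp_Lam: "f \<in> Lam \<Longrightarrow> pexp (power_sum_coeff f) f"
proof -
  assume "f \<in> Lam"
  then have "\<exists>c. pexp c f"
  proof (induction rule: Lam_induct)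
    case zero
    then show ?case
      using pexp_zero by blast
  next
    case (step c M g)
    then show ?case
      using pexp_add[OF pexp_mscale[OF pexp_pm]] by blast
  qed
  then show ?thesis
    using power_sum_coeff_eq by auto
qed

lemma power_sum_coeff_add: "f \<in> Lam \<Longrightarrow> g \<in> Lam \<Longrightarrow> power_sum_coeff (f + g) l = power_sum_coeff f l + power_sum_coeff g l"
  using power_sum_coeff_eq[OF pexp_add[OF pexp_Lam pexp_Lam]] by simp

lemma power_sum_coeff_mscale: "f \<in> Lam \<Longrightarrow> power_sum_coeff (mscale a f) l = a * power_sum_coeff f l"
  using power_sum_coeff_eq[OF pexp_mscale[OF pexp_Lam]] by simp

lemma power_sum_coeff_pm: "0 \<notin># M \<Longrightarrow> power_sum_coeff (pm M) l = (if l = plist M then 1 else 0)"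
  using power_sum_coeff_eq[OF pexp_pm] by simp

lemma finite_power_sum_coeff: "f \<in> Lam \<Longrightarrow> finite {l. power_sum_coeff f l \<noteq> 0}"
  using pexp_Lam by (simp add: pexp_def)

section \<open>The inner product: bilinearity, positivity, adjoints\<close>

lemma jack_inner_superset:
  assumes "finite X" "{l. power_sum_coeff f l \<noteq> 0} \<subseteq> X"
  shows "jack_inner f g = (\<Sum>l\<in>X. power_sum_coeff f l * power_sum_coeff g l * zee l * alpha ^ length l)"
  unfolding jack_inner_def using assms by (intro sum.mono_neutral_left) auto

lemma jack_inner_add_left:
  assumes "f \<in> Lam" "g \<in> Lam" "h \<in> Lam"
  shows "jack_inner (f + g) h = jack_inner f h + jack_inner g h"
proof -
  let ?X = "{l. power_sum_coeff f l \<noteq> 0} \<union> {l. power_sum_coeff g l \<noteq> 0}"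
  have X: "finite ?X"
    using assms by (simp add: finite_power_sum_coeff)
  show ?thesis
    using X assms by (subst (1 2 3) jack_inner_superset[of ?X])
      (auto simp: power_sum_coeff_add sum.distrib[symmetric] algebra_simps intro!: sum.cong)
qed

lemma jack_inner_mscale_left: "f \<in> Lam \<Longrightarrow> jack_inner (mscale a f) h = a * jack_inner f h"
  by (subst (1 2) jack_inner_superset[of "{l. power_sum_coeff f l \<noteq> 0}"])
    (auto simp: power_sum_coeff_mscale finite_power_sum_coeff sum_distrib_left mult.assoc intro!: sum.cong)

lemma jack_inner_commute:
  assumes "f \<in> Lam" "g \<in> Lam"
  shows "jack_inner f g = jack_inner g f"
proof -
  let ?X = "{l. power_sum_coeff f l \<noteq> 0} \<union> {l. power_sum_coeff g l \<noteq> 0}"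
  have X: "finite ?X"
    using assms by (simp add: finite_power_sum_coeff)
  show ?thesis
    using X by (subst (1 2) jack_inner_superset[of ?X]) (auto simp: mult.commute intro!: sum.cong)
qed

lemma jack_inner_zero_left: "jack_inner 0 g = 0"
proof -
  have "power_sum_coeff 0 = (\<lambda>_. 0)"
    using power_sum_coeff_eq[OF pexp_zero] .
  then show ?thesis
    by (simp add: jack_inner_def)
qed

lemma jack_inner_add_right: "f \<in> Lam \<Longrightarrow> g \<in> Lam \<Longrightarrow> h \<in> Lam \<Longrightarrow> jack_inner h (f + g) = jack_inner h f + jack_inner h g"
  by (simp add: jack_inner_commute[of h] jack_inner_add_left Lam_add)

lemma jack_inner_mscale_right: "f \<in> Lam \<Longrightarrow> h \<in> Lam \<Longrightarrow> jack_inner h (mscale a f) = a * jack_inner h f"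
  by (simp add: jack_inner_commute[of h] jack_inner_mscale_left Lam_mscale)

lemma jack_inner_zero_right: "h \<in> Lam \<Longrightarrow> jack_inner h 0 = 0"
  by (simp add: jack_inner_commute[of h] jack_inner_zero_left Lam_0)

lemma jack_inner_sum_left:
  assumes "\<And>x. x \<in> X \<Longrightarrow> f x \<in> Lam" "h \<in> Lam"
  shows "jack_inner (sum f X) h = (\<Sum>x\<in>X. jack_inner (f x) h)"
  using assms by (induction X rule: infinite_finite_induct)
    (auto simp: jack_inner_zero_left jack_inner_add_left Lam_sum)

lemma jack_inner_sum_right:
  assumes "\<And>x. x \<in> X \<Longrightarrow> f x \<in> Lam" "h \<in> Lam"
  shows "jack_inner h (sum f X) = (\<Sum>x\<in>X. jack_inner h (f x))"
  using assms by (simp add: jack_inner_commute[of h] Lam_sum jack_inner_sum_left)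

lemma jack_inner_pm:
  assumes "0 \<notin># M" "0 \<notin># N"
  shows "jack_inner (pm M) (pm N) = (if M = N then of_nat (zfact M) * alpha ^ size M else 0)"
proof -
  have "jack_inner (pm M) (pm N) = (\<Sum>l\<in>{plist M}. power_sum_coeff (pm M) l * power_sum_coeff (pm N) l * zee l * alpha ^ length l)"
    using assms by (intro jack_inner_superset) (auto simp: power_sum_coeff_pm)
  also have "\<dots> = (if plist M = plist N then zee (plist M) * alpha ^ length (plist M) else 0)"
    using assms by (simp add: power_sum_coeff_pm)
  also have "\<dots> = (if M = N then of_nat (zfact M) * alpha ^ size M else 0)"
    using assms by (metis int_partition_plist mset_plist size_mset zee_eq)
  finally show ?thesis .
qed

text \<open>In the power sum basis the form is diagonal with positive entries. It serves below as
  the vanishing criterion: a symmetric function orthogonal to itself is 0.\<close>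

lemma jack_inner_pos:
  assumes f: "f \<in> Lam" "f \<noteq> 0"
  shows "jack_inner f f > 0"
proof -
  let ?c = "power_sum_coeff f"
  have e: "pexp ?c f"
    by (rule pexp_Lam[OF f(1)])
  have "{l. ?c l \<noteq> 0} \<noteq> {}"
  proof
    assume "{l. ?c l \<noteq> 0} = {}"
    then have "f = 0"
      using e by (simp add: pexp_def)
    then show False
      using f(2) by simp
  qed
  moreover have "?c l * ?c l * zee l * alpha ^ length l > 0" if "?c l \<noteq> 0" for l
  proof -
    have "int_partition l"
      using that e by (simp add: pexp_def)
    then have "zee l > 0"
      using zfact_pos[OF int_partition_zero] by (simp add: zee_eq)
    moreover have "?c l * ?c l > 0"
      using that by (metis linorder_neqE_linordered_idom mult_pos_pos mult_neg_neg)
    ultimately show ?thesis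
      using alpha_pos by simp
  qed
  ultimately show ?thesis
    unfolding jack_inner_def using finite_power_sum_coeff[OF f(1)] by (intro sum_pos) auto
qed

text \<open>\<open>\<alpha> k \<partial>/\<partial>p\<^sub>k\<close>, the adjoint of multiplication by \<open>p\<^sub>k\<close>.\<close>

definition dps :: "nat \<Rightarrow> ratfun mseries \<Rightarrow> ratfun mseries" where
  "dps k f = (\<Sum>l | power_sum_coeff f l \<noteq> 0.
     mscale (power_sum_coeff f l * (alpha * of_nat (k * count (mset l) k))) (pm (mset l - {#k#})))"

lemma dps_superset:
  assumes "finite X" "{l. power_sum_coeff f l \<noteq> 0} \<subseteq> X"
  shows "dps k f = (\<Sum>l\<in>X. mscale (power_sum_coeff f l * (alpha * of_nat (k * count (mset l) k))) (pm (mset l - {#k#})))"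
  unfolding dps_def using assms by (intro sum.mono_neutral_left) auto

lemma dps_add:
  assumes "f \<in> Lam" "g \<in> Lam"
  shows "dps k (f + g) = dps k f + dps k g"
proof -
  let ?X = "{l. power_sum_coeff f l \<noteq> 0} \<union> {l. power_sum_coeff g l \<noteq> 0}"
  have X: "finite ?X"
    using assms by (simp add: finite_power_sum_coeff)
  show ?thesis
    using X assms by (subst (1 2 3) dps_superset[of ?X])
      (auto simp: power_sum_coeff_add sum.distrib[symmetric] distrib_right mv.scale_left_distrib intro!: sum.cong)
qed

lemma dps_mscale: "f \<in> Lam \<Longrightarrow> dps k (mscale a f) = mscale a (dps k f)"
  by (subst (1 2) dps_superset[of "{l. power_sum_coeff f l \<noteq> 0}"])
    (auto simp: power_sum_coeff_mscale finite_power_sum_coeff mv.scale_sum_right mult.assoc intro!: sum.cong)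

lemma dps_pm: "0 \<notin># M \<Longrightarrow> dps k (pm M) = mscale (alpha * of_nat (k * count M k)) (pm (M - {#k#}))"
  by (subst dps_superset[of "{plist M}"]) (auto simp: power_sum_coeff_pm)

lemma dps_zero: "dps k 0 = 0"
  using dps_mscale[OF Lam_0, of k 0] by simp

lemma dps_Lam: "f \<in> Lam \<Longrightarrow> dps k f \<in> Lam"
  by (induction rule: Lam_induct)
    (auto simp: dps_add dps_mscale dps_pm dps_zero Lam_mscale Lam_pm dest: in_diffD intro!: Lam_0 Lam_add Lam_mscale Lam_pm)

lemma dps_power_sum_mult:
  assumes f: "f \<in> Lam" and j: "j \<ge> 1"
  shows "dps k (power_sum j * f) = power_sum j * dps k f + (if j = k then mscale (alpha * of_nat k) f else 0)"
  using f
proof (induction rule: Lam_induct)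
  case zero
  then show ?case
    by (simp add: dps_zero)
next
  case (step c M g)
  have M: "0 \<notin># add_mset j M"
    using step(1) j by auto
  have 1: "dps k (power_sum j * pm M) = power_sum j * dps k (pm M) + (if j = k then mscale (alpha * of_nat k) (pm M) else 0)"
  proof (cases "j = k")
    case True
    have "power_sum k * mscale (alpha * of_nat (k * count M k)) (pm (M - {#k#})) = mscale (alpha * of_nat (k * count M k)) (pm M)"
    proof (cases "k \<in># M")
      case True
      then have "power_sum k * pm (M - {#k#}) = pm M"
        by (metis insert_DiffM pm_add)
      then show ?thesis
        by (simp add: mscale_mult_right)
    qed (simp add: not_in_iff)
    moreover have "alpha * of_nat (k * Suc (count M k)) = alpha * of_nat (k * count M k) + alpha * of_nat k"
      by (simp add: algebra_simps)
    moreover have "dps k (pm (add_mset k M)) = mscale (alpha * of_nat (k * Suc (count M k))) (pm M)"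
      using dps_pm[OF M, of k] unfolding True by simp
    ultimately show ?thesis
      unfolding True pm_add[symmetric] dps_pm[OF step(1)] by (simp only: mv.scale_left_distrib simp_thms if_True)
  next
    case False
    then have "add_mset j M - {#k#} = add_mset j (M - {#k#})"
      by (intro diff_add_mset_swap) simp
    moreover have "count (add_mset j M) k = count M k"
      using False by simp
    ultimately have "dps k (pm (add_mset j M)) = mscale (alpha * of_nat (k * count M k)) (pm (add_mset j (M - {#k#})))"
      unfolding dps_pm[OF M] by (simp only:)
    then show ?thesis
      using False unfolding dps_pm[OF step(1)] pm_add mscale_mult_right by (simp only: if_False add_0_right)
  qed
  have "dps k (power_sum j * (mscale c (pm M) + g)) = mscale c (dps k (power_sum j * pm M)) + dps k (power_sum j * g)"
  proof -
    have "power_sum j * pm M \<in> Lam" "power_sum j * g \<in> Lam"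
      using step j by (auto intro!: Lam_power_sum_mult Lam_pm)
    then show ?thesis
      unfolding distrib_left mscale_mult_right by (simp only: dps_add dps_mscale Lam_mscale)
  qed
  also have "\<dots> = power_sum j * (mscale c (dps k (pm M)) + dps k g) + (if j = k then mscale (alpha * of_nat k) (mscale c (pm M) + g) else 0)"
    unfolding 1 step by (simp add: algebra_simps mv.scale_right_distrib mscale_mult_right)
  also have "mscale c (dps k (pm M)) + dps k g = dps k (mscale c (pm M) + g)"
    using step by (simp add: dps_add dps_mscale Lam_mscale Lam_pm)
  finally show ?case .
qed

lemma jack_inner_power_sum:
  assumes f: "f \<in> Lam" and g: "g \<in> Lam" and k: "k \<ge> 1"
  shows "jack_inner (power_sum k * f) g = jack_inner f (dps k g)"
  using f
proof (induction rule: Lam_induct)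
  case zero
  then show ?case
    by (simp add: jack_inner_zero_left)
next
  case (step c M h)
  have M: "0 \<notin># add_mset k M"
    using step(1) k by auto
  have "jack_inner (power_sum k * pm M) g = jack_inner (pm M) (dps k g)"
    using g
  proof (induction rule: Lam_induct)
    case zero
    then show ?case
      using Lam_pm[OF M] Lam_pm[OF step(1)] by (simp add: dps_zero jack_inner_zero_right pm_add)
  next
    case (step d N g')
    have N': "0 \<notin># N - {#k#}"
      using step(1) by (auto dest: in_diffD)
    have "jack_inner (pm (add_mset k M)) (pm N) = alpha * of_nat (k * count N k) * jack_inner (pm M) (pm (N - {#k#}))"
    proof (cases "k \<in># N")
      case True
      then have eq: "add_mset k M = N \<longleftrightarrow> M = N - {#k#}"
        by auto
      show ?thesis
      proof (cases "M = N - {#k#}")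
        case c: True
        have N: "N = add_mset k M"
          unfolding c by (rule insert_DiffM[OF True, symmetric])
        have cN: "count N k = Suc (count M k)"
          unfolding N by (rule trans[OF count_add_mset]) (rule if_P, rule refl)
        have "of_nat (zfact (add_mset k M)) * alpha ^ size (add_mset k M) =
           alpha * of_nat (k * Suc (count M k)) * (of_nat (zfact M) * alpha ^ size M)"
          unfolding zfact_add by simp
        then show ?thesis
          unfolding jack_inner_pm[OF M step(1)] jack_inner_pm[OF \<open>0 \<notin># M\<close> N'] eq cN
          by (simp only: c[symmetric] if_True simp_thms)
      next
        case False
        then show ?thesis
          unfolding jack_inner_pm[OF M step(1)] jack_inner_pm[OF \<open>0 \<notin># M\<close> N'] eq
          by (simp only: if_False mult_zero_right simp_thms)
      qed
    next
      case False
      then have "add_mset k M \<noteq> N"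
        by auto
      then show ?thesis
        using False M step(1) by (simp add: jack_inner_pm not_in_iff)
    qed
    then have 1: "jack_inner (power_sum k * pm M) (pm N) = jack_inner (pm M) (dps k (pm N))"
      using step(1) \<open>0 \<notin># M\<close> by (simp add: dps_pm pm_add jack_inner_mscale_right Lam_pm N')
    show ?case
      using 1 step \<open>0 \<notin># M\<close> k
      by (simp add: jack_inner_add_right jack_inner_mscale_right Lam_pm Lam_power_sum_mult Lam_mscale dps_add dps_mscale dps_Lam)
  qed
  then show ?case
    using step k g by (simp add: distrib_left mscale_mult_right jack_inner_add_left jack_inner_mscale_left
       Lam_pm Lam_power_sum_mult Lam_mscale dps_Lam)
qed

lemma jack_inner_dps: "f \<in> Lam \<Longrightarrow> g \<in> Lam \<Longrightarrow> k \<ge> 1 \<Longrightarrow> jack_inner (dps k f) g = jack_inner f (power_sum k * g)"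
  by (metis jack_inner_power_sum jack_inner_commute Lam_power_sum_mult dps_Lam)

section \<open>The Laplace--Beltrami operator in terms of power sums\<close>

lemma opD_sum: "opD (sum h X) = (\<Sum>x\<in>X. opD (h x))"
  by (induction X rule: infinite_finite_induct) (auto simp: opD_add)

lemma opL_sum: "opL (sum h X) = (\<Sum>x\<in>X. opL (h x))"
  by (induction X rule: infinite_finite_induct) (auto simp: opL_add)

lemma opA_sum: "opA (sum h X) = (\<Sum>x\<in>X. opA (h x))"
  by (induction X rule: infinite_finite_induct) (auto simp: opA_add)

lemma opL_var0_power_eq:
  assumes f: "f \<in> Lam"
  shows "opL (var0 ^ k * f) = mscale alpha (var0 ^ k * theta f) + mscale ((alpha - 1) * of_nat k) (var0 ^ k * f)
    + (\<Sum>j<k. var0 ^ (k - 1 - j) * (power_sum (Suc j) * f))"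
proof (induction k)
  case 0
  then show ?case
    using f by (simp add: opL_sym sym_Lam)
next
  case (Suc k)
  have s: "(\<Sum>j<Suc k. var0 ^ (Suc k - 1 - j) * (power_sum (Suc j) * f)) =
     var0 * (\<Sum>j<k. var0 ^ (k - 1 - j) * (power_sum (Suc j) * f)) + power_sum (Suc k) * f"
  proof -
    have "var0 ^ (k - j) * (power_sum (Suc j) * f) = var0 * (var0 ^ (k - 1 - j) * (power_sum (Suc j) * f))" if "j < k" for j
    proof -
      have "k - j = Suc (k - 1 - j)"
        using that by simp
      then show ?thesis
        by (simp add: mult.assoc)
    qed
    then have "(\<Sum>j<k. var0 ^ (k - j) * (power_sum (Suc j) * f)) = (\<Sum>j<k. var0 * (var0 ^ (k - 1 - j) * (power_sum (Suc j) * f)))"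
      by (intro sum.cong) auto
    then show ?thesis
      by (simp add: sum_distrib_left)
  qed
  have c: "(alpha - 1) * of_nat (Suc k) = (alpha - 1) * of_nat k + (alpha - 1)"
    by (simp add: algebra_simps)
  have a: "var0 ^ Suc k * g = var0 * (var0 ^ k * g)" for g
    by (simp add: mult.assoc)
  show ?case
    unfolding opL_var0_power opA_var0_power[OF sym_Lam[OF f]] Suc s c mv.scale_left_distrib
    unfolding a distrib_left mscale_mult_right
    by (simp only: add_ac)
qed

lemma opD_var0_power_eq:
  assumes f: "f \<in> Lam"
  shows "opD (var0 ^ k * f) = var0 ^ k * opD f + mscale (alpha * of_nat k) (var0 ^ k * theta f)
    + mscale ((alpha - 1) * of_nat k * (of_nat k - 1) / 2) (var0 ^ k * f)
    + (\<Sum>j<k. mscale (of_nat (k - 1 - j)) (var0 ^ (k - 1 - j) * (power_sum (Suc j) * f)))"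
proof (induction k)
  case (Suc k)
  have s: "(\<Sum>j<Suc k. mscale (of_nat (Suc k - 1 - j)) (var0 ^ (Suc k - 1 - j) * (power_sum (Suc j) * f))) =
     var0 * (\<Sum>j<k. mscale (of_nat (k - 1 - j)) (var0 ^ (k - 1 - j) * (power_sum (Suc j) * f)))
     + var0 * (\<Sum>j<k. var0 ^ (k - 1 - j) * (power_sum (Suc j) * f))"
  proof -
    have "mscale (of_nat (k - j)) (var0 ^ (k - j) * (power_sum (Suc j) * f)) =
      var0 * (mscale (of_nat (k - 1 - j)) (var0 ^ (k - 1 - j) * (power_sum (Suc j) * f)) + var0 ^ (k - 1 - j) * (power_sum (Suc j) * f))"
      if "j < k" for j
    proof -
      have i: "k - j = Suc (k - 1 - j)"
        using that by simp
      show ?thesis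
        unfolding i by (simp add: mult.assoc mscale_mult_right mv.scale_left_distrib distrib_left add.commute)
    qed
    then have "(\<Sum>j<k. mscale (of_nat (k - j)) (var0 ^ (k - j) * (power_sum (Suc j) * f))) =
       (\<Sum>j<k. var0 * (mscale (of_nat (k - 1 - j)) (var0 ^ (k - 1 - j) * (power_sum (Suc j) * f)) + var0 ^ (k - 1 - j) * (power_sum (Suc j) * f)))"
      by (intro sum.cong) auto
    then show ?thesis
      by (simp add: sum_distrib_left[symmetric] sum.distrib distrib_left)
  qed
  have a: "var0 ^ Suc k * g = var0 * (var0 ^ k * g)" for g
    by (simp add: mult.assoc)
  have c: "alpha * of_nat (Suc k) = alpha * of_nat k + alpha"
    "(alpha - 1) * of_nat (Suc k) * (of_nat (Suc k) - 1) / 2 = (alpha - 1) * of_nat k * (of_nat k - 1) / 2 + (alpha - 1) * of_nat k"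
    by (simp_all add: field_simps)
  show ?case
    unfolding s c a opD_var0 Suc opL_var0_power_eq[OF f] mv.scale_left_distrib distrib_left mscale_mult_right
    by (simp only: ac_simps)
qed simp

text \<open>The products are invariant under reversing the index j, while the weights k - j and j +
  1 are exchanged; averaging replaces them by half of their sum k + 1.\<close>

lemma sum_power_sum_symmetrize:
  "(\<Sum>j<k. mscale (of_nat (k - j)) (power_sum (k - j) * (power_sum (Suc j) * f))) =
     mscale (of_nat (Suc k) / 2) (\<Sum>j<k. power_sum (Suc j) * (power_sum (k - j) * f))"
proof -
  let ?t = "\<lambda>j. power_sum (Suc j) * (power_sum (k - j) * f)"
  have 1: "(\<Sum>j<k. mscale (of_nat (k - j)) (power_sum (k - j) * (power_sum (Suc j) * f))) = (\<Sum>j<k. mscale (of_nat (k - j)) (?t j))"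
    by (simp only: mult.left_commute)
  have "(\<Sum>j<k. mscale (of_nat (k - j)) (?t j)) = (\<Sum>j<k. mscale (of_nat (Suc j)) (?t j))"
    by (rule sum.reindex_bij_witness[where i = "\<lambda>j. k - 1 - j" and j = "\<lambda>j. k - 1 - j"])
      (auto simp: Suc_diff_Suc mult.left_commute)
  then have "(\<Sum>j<k. mscale (of_nat (k - j)) (?t j)) + (\<Sum>j<k. mscale (of_nat (k - j)) (?t j)) =
     (\<Sum>j<k. mscale (of_nat (k - j)) (?t j) + mscale (of_nat (Suc j)) (?t j))"
    by (simp only: sum.distrib)
  also have "\<dots> = (\<Sum>j<k. mscale (of_nat (Suc k)) (?t j))"
  proof (intro sum.cong refl)
    fix j assume "j \<in> {..<k}"
    then have "of_nat (k - j) + of_nat (Suc j) = (of_nat (Suc k) :: ratfun)"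
      by (simp add: of_nat_diff)
    then show "mscale (of_nat (k - j)) (?t j) + mscale (of_nat (Suc j)) (?t j) = mscale (of_nat (Suc k)) (?t j)"
      unfolding mv.scale_left_distrib[symmetric] by (simp only:)
  qed
  also have "\<dots> = mscale (of_nat (Suc k)) (\<Sum>j<k. ?t j)"
    by (simp only: mv.scale_sum_right)
  finally have h: "mscale (1/2) ((\<Sum>j<k. mscale (of_nat (k - j)) (?t j)) + (\<Sum>j<k. mscale (of_nat (k - j)) (?t j))) =
     mscale (1/2) (mscale (of_nat (Suc k)) (\<Sum>j<k. ?t j))"
    by (rule arg_cong)
  have half: "mscale (1/2) (x + x) = x" for x :: "ratfun mseries"
  proof -
    have "mscale (1/2) (x + x) = mscale (1/2 + 1/2) x"
      unfolding mv.scale_right_distrib by (rule mv.scale_left_distrib[symmetric])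
    then show ?thesis
      by simp
  qed
  show ?thesis
    using h unfolding 1 half by (simp del: of_nat_Suc)
qed

lemma opD_power_sum_mult:
  assumes f: "f \<in> Lam"
  shows "opD (power_sum (Suc k) * f) = power_sum (Suc k) * opD f + mscale (alpha * of_nat (Suc k)) (opA (var0 ^ k * theta f))
    + mscale ((alpha - 1) * of_nat (Suc k) * of_nat k / 2) (power_sum (Suc k) * f)
    + mscale (of_nat (Suc k) / 2) (\<Sum>j<k. power_sum (Suc j) * (power_sum (k - j) * f))"
proof -
  have fp: "power_sum (Suc j) * f \<in> Lam" for j
    using f by (intro Lam_power_sum_mult) auto
  have A: "opA (var0 ^ (k - 1 - j) * (power_sum (Suc j) * f)) = power_sum (k - j) * (power_sum (Suc j) * f)" if "j < k" for j
  proof -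
    have "Suc (k - 1 - j) = k - j"
      using that by simp
    then show ?thesis
      using opA_var0_power[OF sym_Lam[OF fp], of "k - 1 - j" j] by simp
  qed
  have "opD (power_sum (Suc k) * f) = opA (opD (var0 ^ k * f) + opL (var0 ^ k * f))"
    unfolding opA_var0_power[OF sym_Lam[OF f], symmetric] opD_opA ..
  also have "\<dots> = power_sum (Suc k) * opD f + (mscale (alpha * of_nat k) (opA (var0 ^ k * theta f)) + mscale alpha (opA (var0 ^ k * theta f)))
     + (mscale ((alpha - 1) * of_nat k * (of_nat k - 1) / 2) (power_sum (Suc k) * f) + mscale ((alpha - 1) * of_nat k) (power_sum (Suc k) * f))
     + ((\<Sum>j<k. mscale (of_nat (k - 1 - j)) (power_sum (k - j) * (power_sum (Suc j) * f))) + (\<Sum>j<k. power_sum (k - j) * (power_sum (Suc j) * f)))"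
    unfolding opD_var0_power_eq[OF f] opL_var0_power_eq[OF f] opA_add opA_mscale opA_sum
      opA_var0_power[OF sym_Lam[OF f]] opA_var0_power[OF sym_Lam[OF opD_Lam[OF f]]]
    using A by (simp add: algebra_simps)
  also have "mscale (alpha * of_nat k) (opA (var0 ^ k * theta f)) + mscale alpha (opA (var0 ^ k * theta f)) =
     mscale (alpha * of_nat (Suc k)) (opA (var0 ^ k * theta f))"
    unfolding mv.scale_left_distrib[symmetric] by (simp add: algebra_simps)
  also have "mscale ((alpha - 1) * of_nat k * (of_nat k - 1) / 2) (power_sum (Suc k) * f) + mscale ((alpha - 1) * of_nat k) (power_sum (Suc k) * f)
     = mscale ((alpha - 1) * of_nat (Suc k) * of_nat k / 2) (power_sum (Suc k) * f)"
  proof -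
    have "(alpha - 1) * of_nat k * (of_nat k - 1) / 2 + (alpha - 1) * of_nat k = (alpha - 1) * of_nat (Suc k) * of_nat k / 2"
      by (simp add: field_simps)
    then show ?thesis
      unfolding mv.scale_left_distrib[symmetric] by (simp only:)
  qed
  also have "(\<Sum>j<k. mscale (of_nat (k - 1 - j)) (power_sum (k - j) * (power_sum (Suc j) * f))) + (\<Sum>j<k. power_sum (k - j) * (power_sum (Suc j) * f))
     = (\<Sum>j<k. mscale (of_nat (k - j)) (power_sum (k - j) * (power_sum (Suc j) * f)))"
    unfolding sum.distrib[symmetric]
  proof (intro sum.cong refl)
    fix j assume "j \<in> {..<k}"
    then have "(of_nat (k - j) :: ratfun) = of_nat (k - 1 - j) + 1"
      by (simp add: of_nat_diff)
    then show "mscale (of_nat (k - 1 - j)) (power_sum (k - j) * (power_sum (Suc j) * f)) + power_sum (k - j) * (power_sum (Suc j) * f)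
       = mscale (of_nat (k - j)) (power_sum (k - j) * (power_sum (Suc j) * f))"
      by (simp only: mv.scale_left_distrib mv.scale_one)
  qed
  finally show ?thesis
    unfolding sum_power_sum_symmetrize .
qed

text \<open>The chain rule: the Euler operator of x_0 sends p_j to j times the j-th power of x_0.
  The bound N ensures that every p_j occurring is among those summed.\<close>

lemma theta_pm_eq:
  assumes "0 \<notin># M" "sum_mset M \<le> N"
  shows "mscale alpha (theta (pm M)) = (\<Sum>j\<in>{1..N}. var0 ^ j * dps j (pm M))"
  using assms
proof (induction M)
  case empty
  have "dps j 1 = 0" for j
    using dps_pm[of "{#}" j] by simp
  then show ?case
    by (simp add: theta_one)
next
  case (add k M)
  then have k: "k \<ge> 1" "k \<le> N" and M: "0 \<notin># M" "sum_mset M \<le> N"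
    by (cases k, auto)
  have "(\<Sum>j\<in>{1..N}. var0 ^ j * dps j (pm (add_mset k M))) =
     (\<Sum>j\<in>{1..N}. power_sum k * (var0 ^ j * dps j (pm M)) + (if j = k then mscale (alpha * of_nat k) (var0 ^ k * pm M) else 0))"
    unfolding pm_add dps_power_sum_mult[OF Lam_pm[OF M(1)] k(1)]
    by (intro sum.cong) (auto simp: distrib_left mscale_mult_right mult.left_commute)
  also have "\<dots> = power_sum k * mscale alpha (theta (pm M)) + mscale (alpha * of_nat k) (var0 ^ k * pm M)"
    using k add.IH[OF M] by (simp add: sum.distrib sum_distrib_left[symmetric])
  also have "\<dots> = mscale alpha (theta (pm (add_mset k M)))"
    unfolding pm_add theta_power_sum_mult[OF k(1)] by (simp add: mv.scale_right_distrib mscale_mult_right)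
  finally show ?case ..
qed

text \<open>\<open>opD\<close> as a differential operator in \<open>p\<^sub>1, \<dots>, p\<^sub>N\<close>, which makes its self-adjointness visible.\<close>

definition Dp :: "nat \<Rightarrow> ratfun mseries \<Rightarrow> ratfun mseries" where
  "Dp N f = mscale (1 / (2 * alpha)) ((\<Sum>i\<in>{1..N}. \<Sum>j\<in>{1..N}. power_sum (i + j) * dps i (dps j f))
     + (\<Sum>i\<in>{1..N}. \<Sum>j\<in>{1..N}. power_sum i * (power_sum j * dps (i + j) f))
     + (\<Sum>k\<in>{1..N}. mscale ((alpha - 1) * of_nat (k - 1)) (power_sum k * dps k f)))"

text \<open>Each of the three sums contributes boundary terms from the Leibniz rule for
  \<open>dps\<close>. The derivative with respect to the new factor must be among those summed,
  hence the bound on N.\<close>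

lemma Dp_power_sum_mult:
  assumes f: "f \<in> Lam" and k: "Suc k \<le> N"
  shows "Dp N (power_sum (Suc k) * f) = power_sum (Suc k) * Dp N f
    + mscale (of_nat (Suc k)) (\<Sum>i\<in>{1..N}. power_sum (Suc k + i) * dps i f)
    + mscale ((alpha - 1) * of_nat (Suc k) * of_nat k / 2) (power_sum (Suc k) * f)
    + mscale (of_nat (Suc k) / 2) (\<Sum>j<k. power_sum (Suc j) * (power_sum (k - j) * f))"
proof -
  let ?k = "Suc k" and ?I = "{1..N}"
  let ?c = "alpha * of_nat ?k"
  have kI: "?k \<in> ?I" "1 \<le> ?k"
    using k by auto
  have d1: "dps j (power_sum ?k * g) = power_sum ?k * dps j g + (if j = ?k then mscale ?c g else 0)" if "g \<in> Lam" for j g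
    using dps_power_sum_mult[OF that kI(2), of j] by (simp add: eq_commute)
  have d2: "dps i (dps j (power_sum ?k * f)) = power_sum ?k * dps i (dps j f) + (if i = ?k then mscale ?c (dps j f) else 0)
     + (if j = ?k then mscale ?c (dps i f) else 0)" for i j
    using f by (simp add: d1 dps_add dps_Lam Lam_power_sum_mult Lam_mscale dps_mscale)
  have s1: "(\<Sum>i\<in>?I. \<Sum>j\<in>?I. power_sum (i + j) * dps i (dps j (power_sum ?k * f))) =
     power_sum ?k * (\<Sum>i\<in>?I. \<Sum>j\<in>?I. power_sum (i + j) * dps i (dps j f))
      + mscale ?c (\<Sum>i\<in>?I. power_sum (?k + i) * dps i f) + mscale ?c (\<Sum>i\<in>?I. power_sum (?k + i) * dps i f)"
  proof -
    let ?X = "\<lambda>i j. mscale ?c (power_sum (i + j) * dps j f)"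
    have "power_sum (i + j) * dps i (dps j (power_sum ?k * f)) = power_sum ?k * (power_sum (i + j) * dps i (dps j f))
        + (if i = ?k then ?X i j else 0) + (if j = ?k then ?X j i else 0)" for i j
      unfolding d2 by (simp add: distrib_left mscale_mult_right ac_simps)
    then have "(\<Sum>i\<in>?I. \<Sum>j\<in>?I. power_sum (i + j) * dps i (dps j (power_sum ?k * f))) =
       power_sum ?k * (\<Sum>i\<in>?I. \<Sum>j\<in>?I. power_sum (i + j) * dps i (dps j f))
       + (\<Sum>i\<in>?I. \<Sum>j\<in>?I. if i = ?k then ?X i j else 0) + (\<Sum>i\<in>?I. \<Sum>j\<in>?I. if j = ?k then ?X j i else 0)"
      by (simp only: sum.distrib sum_distrib_left)
    also have "(\<Sum>i\<in>?I. \<Sum>j\<in>?I. if i = ?k then ?X i j else 0) = (\<Sum>i\<in>?I. if i = ?k then (\<Sum>j\<in>?I. ?X i j) else 0)"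
      by (intro sum.cong) auto
    also have "\<dots> = (\<Sum>j\<in>?I. ?X ?k j)"
      using kI(1) by (subst sum.delta) auto
    also have "(\<Sum>i\<in>?I. \<Sum>j\<in>?I. if j = ?k then ?X j i else 0) = (\<Sum>i\<in>?I. ?X ?k i)"
      using kI(1) by (intro sum.cong refl) (subst sum.delta, auto)
    finally show ?thesis
      by (simp only: mv.scale_sum_right)
  qed
  have s2: "(\<Sum>i\<in>?I. \<Sum>j\<in>?I. power_sum i * (power_sum j * dps (i + j) (power_sum ?k * f))) =
     power_sum ?k * (\<Sum>i\<in>?I. \<Sum>j\<in>?I. power_sum i * (power_sum j * dps (i + j) f))
      + mscale ?c (\<Sum>j<k. power_sum (Suc j) * (power_sum (k - j) * f))"
  proof -
    let ?X = "\<lambda>i j. mscale ?c (power_sum i * (power_sum j * f))"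
    have "power_sum i * (power_sum j * dps (i + j) (power_sum ?k * f)) = power_sum ?k * (power_sum i * (power_sum j * dps (i + j) f))
        + (if i + j = ?k then ?X i j else 0)" for i j
      unfolding d1[OF f] by (simp add: distrib_left mscale_mult_right ac_simps)
    then have "(\<Sum>i\<in>?I. \<Sum>j\<in>?I. power_sum i * (power_sum j * dps (i + j) (power_sum ?k * f))) =
       power_sum ?k * (\<Sum>i\<in>?I. \<Sum>j\<in>?I. power_sum i * (power_sum j * dps (i + j) f))
       + (\<Sum>i\<in>?I. \<Sum>j\<in>?I. if i + j = ?k then ?X i j else 0)"
      by (simp only: sum.distrib sum_distrib_left)
    also have "(\<Sum>i\<in>?I. \<Sum>j\<in>?I. if i + j = ?k then ?X i j else 0) = (\<Sum>i\<in>?I. if i < ?k then ?X i (?k - i) else 0)"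
    proof (intro sum.cong refl)
      fix i assume i: "i \<in> ?I"
      have "(\<Sum>j\<in>?I. if i + j = ?k then ?X i j else 0) = (\<Sum>j\<in>?I. if j = ?k - i then (if i < ?k then ?X i (?k - i) else 0) else 0)"
        using i by (intro sum.cong refl) auto
      also have "\<dots> = (if i < ?k then ?X i (?k - i) else 0)"
        using i k by (subst sum.delta) auto
      finally show "(\<Sum>j\<in>?I. if i + j = ?k then ?X i j else 0) = (if i < ?k then ?X i (?k - i) else 0)" .
    qed
    also have "\<dots> = (\<Sum>i\<in>{1..k}. ?X i (?k - i))"
      using k by (intro sum.mono_neutral_cong_right) auto
    also have "\<dots> = (\<Sum>j<k. ?X (Suc j) (k - j))"
      by (rule sum.reindex_bij_witness[where i = Suc and j = "\<lambda>i. i - 1"]) auto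
    finally show ?thesis
      by (simp only: mv.scale_sum_right)
  qed
  have s3: "(\<Sum>j\<in>?I. mscale ((alpha - 1) * of_nat (j - 1)) (power_sum j * dps j (power_sum ?k * f))) =
     power_sum ?k * (\<Sum>j\<in>?I. mscale ((alpha - 1) * of_nat (j - 1)) (power_sum j * dps j f))
      + mscale ((alpha - 1) * of_nat k) (mscale ?c (power_sum ?k * f))"
  proof -
    have "mscale ((alpha - 1) * of_nat (j - 1)) (power_sum j * dps j (power_sum ?k * f)) =
       power_sum ?k * mscale ((alpha - 1) * of_nat (j - 1)) (power_sum j * dps j f)
       + (if j = ?k then mscale ((alpha - 1) * of_nat k) (mscale ?c (power_sum ?k * f)) else 0)" for j
      unfolding d1[OF f] by (simp add: distrib_left mscale_mult_right mv.scale_right_distrib ac_simps)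
    then have "(\<Sum>j\<in>?I. mscale ((alpha - 1) * of_nat (j - 1)) (power_sum j * dps j (power_sum ?k * f))) =
     power_sum ?k * (\<Sum>j\<in>?I. mscale ((alpha - 1) * of_nat (j - 1)) (power_sum j * dps j f))
      + (\<Sum>j\<in>?I. if j = ?k then mscale ((alpha - 1) * of_nat k) (mscale ?c (power_sum ?k * f)) else 0)"
      by (simp only: sum.distrib sum_distrib_left)
    then show ?thesis
      using kI(1) by (subst (asm) sum.delta) auto
  qed
  define A B C X Y Z where "A = (\<Sum>i\<in>?I. \<Sum>j\<in>?I. power_sum (i + j) * dps i (dps j f))"
    and "B = (\<Sum>i\<in>?I. \<Sum>j\<in>?I. power_sum i * (power_sum j * dps (i + j) f))"
    and "C = (\<Sum>j\<in>?I. mscale ((alpha - 1) * of_nat (j - 1)) (power_sum j * dps j f))"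
    and "X = (\<Sum>i\<in>?I. power_sum (?k + i) * dps i f)"
    and "Y = (\<Sum>j<k. power_sum (Suc j) * (power_sum (k - j) * f))"
    and "Z = power_sum ?k * f"
  have a0: "alpha \<noteq> 0"
    using alpha_pos by simp
  have "Dp N (power_sum ?k * f) = mscale (1 / (2 * alpha)) ((power_sum ?k * A + mscale ?c X + mscale ?c X)
     + (power_sum ?k * B + mscale ?c Y) + (power_sum ?k * C + mscale ((alpha - 1) * of_nat k) (mscale ?c Z)))"
    unfolding Dp_def s1 s2 s3 A_def B_def C_def X_def Y_def Z_def ..
  also have "\<dots> = power_sum ?k * mscale (1 / (2 * alpha)) (A + B + C) + (mscale (1 / (2 * alpha) * ?c) X + mscale (1 / (2 * alpha) * ?c) X)
     + mscale (1 / (2 * alpha) * ?c) Y + mscale (1 / (2 * alpha) * ((alpha - 1) * of_nat k * ?c)) Z"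
    by (simp only: mv.scale_right_distrib mv.scale_scale distrib_left mscale_mult_right ac_simps)
  also have "mscale (1 / (2 * alpha) * ?c) X + mscale (1 / (2 * alpha) * ?c) X = mscale (of_nat ?k) X"
  proof -
    have "1 / (2 * alpha) * ?c + 1 / (2 * alpha) * ?c = of_nat ?k"
      using a0 by (simp add: field_simps)
    then show ?thesis
      unfolding mv.scale_left_distrib[symmetric] by (simp only:)
  qed
  also have "1 / (2 * alpha) * ?c = of_nat ?k / 2"
    using a0 by (simp add: field_simps)
  also have "1 / (2 * alpha) * ((alpha - 1) * of_nat k * ?c) = (alpha - 1) * of_nat ?k * of_nat k / 2"
    using a0 by (simp add: field_simps)
  finally have "Dp N (power_sum ?k * f) = power_sum ?k * Dp N f + mscale (of_nat ?k) X + mscale (of_nat ?k / 2) Y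
     + mscale ((alpha - 1) * of_nat ?k * of_nat k / 2) Z"
    unfolding Dp_def A_def B_def C_def .
  then show ?thesis
    unfolding X_def Y_def Z_def by (simp only: ac_simps)
qed

text \<open>Both operators annihilate 1 and obey the same rule for multiplication by a power sum, so
  they agree on products by induction on the factors.\<close>

lemma opD_pm_eq_Dp:
  assumes "0 \<notin># M" "sum_mset M \<le> N"
  shows "opD (pm M) = Dp N (pm M)"
  using assms
proof (induction M)
  case empty
  have "dps j 1 = 0" for j
    using dps_pm[of "{#}" j] by simp
  then show ?case
    by (simp add: opD_one Dp_def dps_zero)
next
  case (add k' M)
  then obtain k where k': "k' = Suc k"
    by (cases k') auto
  have kN: "Suc k \<le> N" and M: "0 \<notin># M" "sum_mset M \<le> N"
    using add by (auto simp: k')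
  let ?f = "pm M"
  have f: "?f \<in> Lam"
    by (rule Lam_pm[OF M(1)])
  have "mscale (alpha * of_nat (Suc k)) (opA (var0 ^ k * theta ?f)) = mscale (of_nat (Suc k)) (opA (var0 ^ k * mscale alpha (theta ?f)))"
    by (simp add: mscale_mult_right opA_mscale mult.commute)
  also have "var0 ^ k * mscale alpha (theta ?f) = (\<Sum>j\<in>{1..N}. var0 ^ (k + j) * dps j ?f)"
    unfolding theta_pm_eq[OF M] by (simp add: sum_distrib_left power_add mult.assoc)
  also have "opA \<dots> = (\<Sum>j\<in>{1..N}. power_sum (Suc k + j) * dps j ?f)"
    unfolding opA_sum using opA_var0_power[OF sym_Lam[OF dps_Lam[OF f]]] by simp
  finally have "opD (power_sum (Suc k) * ?f) = Dp N (power_sum (Suc k) * ?f)"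
    unfolding opD_power_sum_mult[OF f] Dp_power_sum_mult[OF f kN] add.IH[OF M] by (simp only:)
  then show ?case
    by (simp only: k' pm_add)
qed

lemma Dp_add: "f \<in> Lam \<Longrightarrow> g \<in> Lam \<Longrightarrow> Dp N (f + g) = Dp N f + Dp N g"
  unfolding Dp_def by (simp only: dps_add dps_Lam distrib_left sum.distrib mv.scale_right_distrib add_ac)

lemma Dp_mscale: "f \<in> Lam \<Longrightarrow> Dp N (mscale c f) = mscale c (Dp N f)"
  unfolding Dp_def by (simp add: dps_mscale dps_Lam mscale_mult_right mv.scale_sum_right mv.scale_right_distrib mult.commute)

lemma opD_eventually_Dp:
  assumes "f \<in> Lam"
  shows "\<exists>N0. \<forall>N\<ge>N0. opD f = Dp N f"
  using assms
proof (induction rule: Lam_induct)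
  case zero
  then show ?case
    by (simp add: Dp_def dps_zero)
next
  case (step c M g)
  then obtain N0 where "\<forall>N\<ge>N0. opD g = Dp N g"
    by blast
  then have "\<forall>N\<ge>max N0 (sum_mset M). opD (mscale c (pm M) + g) = Dp N (mscale c (pm M) + g)"
    using step opD_pm_eq_Dp[OF step(1)] by (auto simp: opD_add opD_mscale Dp_add Dp_mscale Lam_pm Lam_mscale)
  then show ?case
    by blast
qed

text \<open>The first two sums in \<open>Dp\<close> are adjoint to each other, since multiplication
  by p_k and \<open>dps k\<close> are; the third sum is its own adjoint.\<close>

lemma jack_inner_Dp:
  assumes f: "f \<in> Lam" and g: "g \<in> Lam"
  shows "jack_inner (Dp N f) g = jack_inner f (Dp N g)"
proof -
  let ?I = "{1..N}"
  define A B C where "A h = (\<Sum>i\<in>?I. \<Sum>j\<in>?I. power_sum (i + j) * dps i (dps j h))"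
    and "B h = (\<Sum>i\<in>?I. \<Sum>j\<in>?I. power_sum i * (power_sum j * dps (i + j) h))"
    and "C h = (\<Sum>k\<in>?I. mscale ((alpha - 1) * of_nat (k - 1)) (power_sum k * dps k h))" for h
  have L: "power_sum (i + j) * dps i (dps j h) \<in> Lam" "power_sum i * (power_sum j * dps (i + j) h) \<in> Lam"
    if "h \<in> Lam" "i \<in> ?I" "j \<in> ?I" for i j h
    using that by (auto intro!: Lam_power_sum_mult dps_Lam)
  have L3: "power_sum i * dps i h \<in> Lam" if "h \<in> Lam" "i \<in> ?I" for i h
    using that by (auto intro!: Lam_power_sum_mult dps_Lam)
  have LA: "A h \<in> Lam" "B h \<in> Lam" "C h \<in> Lam" if "h \<in> Lam" for h
    unfolding A_def B_def C_def using that L L3 by (auto intro!: Lam_sum Lam_mscale)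
  have 1: "jack_inner (power_sum (i + j) * dps i (dps j f)) g = jack_inner f (power_sum j * (power_sum i * dps (i + j) g))"
    "jack_inner (power_sum i * (power_sum j * dps (i + j) f)) g = jack_inner f (power_sum (i + j) * dps j (dps i g))"
    if "i \<in> ?I" "j \<in> ?I" for i j
    using that f g by (simp_all add: jack_inner_power_sum jack_inner_dps dps_Lam Lam_power_sum_mult)
  have 3: "jack_inner (power_sum i * dps i f) g = jack_inner f (power_sum i * dps i g)" if "i \<in> ?I" for i
    using that f g by (simp add: jack_inner_power_sum jack_inner_dps dps_Lam)
  have sl: "jack_inner (\<Sum>i\<in>?I. \<Sum>j\<in>?I. F i j) h = (\<Sum>i\<in>?I. \<Sum>j\<in>?I. jack_inner (F i j) h)"
    "jack_inner h (\<Sum>i\<in>?I. \<Sum>j\<in>?I. F i j) = (\<Sum>i\<in>?I. \<Sum>j\<in>?I. jack_inner h (F i j))"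
    if F: "\<And>i j. i \<in> ?I \<Longrightarrow> j \<in> ?I \<Longrightarrow> F i j \<in> Lam" and h: "h \<in> Lam" for F h
  proof -
    have S: "(\<Sum>j\<in>?I. F i j) \<in> Lam" if "i \<in> ?I" for i
      using F[OF that] by (rule Lam_sum)
    show "jack_inner (\<Sum>i\<in>?I. \<Sum>j\<in>?I. F i j) h = (\<Sum>i\<in>?I. \<Sum>j\<in>?I. jack_inner (F i j) h)"
      by (rule trans[OF jack_inner_sum_left sum.cong[OF refl jack_inner_sum_left]]) (use S F h in auto)
    show "jack_inner h (\<Sum>i\<in>?I. \<Sum>j\<in>?I. F i j) = (\<Sum>i\<in>?I. \<Sum>j\<in>?I. jack_inner h (F i j))"
      by (rule trans[OF jack_inner_sum_right sum.cong[OF refl jack_inner_sum_right]]) (use S F h in auto)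
  qed
  have "jack_inner (A f) g = (\<Sum>i\<in>?I. \<Sum>j\<in>?I. jack_inner f (power_sum j * (power_sum i * dps (i + j) g)))"
    unfolding A_def by (rule trans[OF sl(1)[OF L(1)[OF f] g]]) (auto intro!: sum.cong 1)
  also have "\<dots> = (\<Sum>j\<in>?I. \<Sum>i\<in>?I. jack_inner f (power_sum j * (power_sum i * dps (j + i) g)))"
    by (subst sum.swap) (simp only: add.commute)
  also have "\<dots> = jack_inner f (B g)"
    unfolding B_def by (rule sl(2)[OF L(2)[OF g] f, symmetric])
  finally have AB: "jack_inner (A f) g = jack_inner f (B g)" .
  have "jack_inner (B f) g = (\<Sum>i\<in>?I. \<Sum>j\<in>?I. jack_inner f (power_sum (i + j) * dps j (dps i g)))"
    unfolding B_def by (rule trans[OF sl(1)[OF L(2)[OF f] g]]) (auto intro!: sum.cong 1)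
  also have "\<dots> = (\<Sum>j\<in>?I. \<Sum>i\<in>?I. jack_inner f (power_sum (j + i) * dps j (dps i g)))"
    by (subst sum.swap) (simp only: add.commute)
  also have "\<dots> = jack_inner f (A g)"
    unfolding A_def by (rule sl(2)[OF L(1)[OF g] f, symmetric])
  finally have BA: "jack_inner (B f) g = jack_inner f (A g)" .
  have "jack_inner (C f) g = (\<Sum>k\<in>?I. (alpha - 1) * of_nat (k - 1) * jack_inner (power_sum k * dps k f) g)"
    unfolding C_def using L3[OF f] g
    by (subst jack_inner_sum_left) (auto intro!: Lam_mscale jack_inner_mscale_left sum.cong)
  also have "\<dots> = (\<Sum>k\<in>?I. (alpha - 1) * of_nat (k - 1) * jack_inner f (power_sum k * dps k g))"
    using 3 by (intro sum.cong) auto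
  also have "\<dots> = jack_inner f (C g)"
    unfolding C_def using L3[OF g] f
    by (subst jack_inner_sum_right) (auto intro!: Lam_mscale jack_inner_mscale_right[symmetric] sum.cong)
  finally have CC: "jack_inner (C f) g = jack_inner f (C g)" .
  have "Dp N h = mscale (1 / (2 * alpha)) (A h + B h + C h)" for h
    unfolding Dp_def A_def B_def C_def ..
  then show ?thesis
    using LA[OF f] LA[OF g] f g AB BA CC
    by (simp add: jack_inner_mscale_left jack_inner_mscale_right jack_inner_add_left jack_inner_add_right Lam_add)
qed

lemma jack_inner_opD:
  assumes f: "f \<in> Lam" and g: "g \<in> Lam"
  shows "jack_inner (opD f) g = jack_inner f (opD g)"
proof -
  obtain N1 N2 where N1: "\<forall>N\<ge>N1. opD f = Dp N f" and N2: "\<forall>N\<ge>N2. opD g = Dp N g"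
    using opD_eventually_Dp[OF f] opD_eventually_Dp[OF g] by blast
  have "opD f = Dp (max N1 N2) f" "opD g = Dp (max N1 N2) g"
    using N1 N2 by auto
  then show ?thesis
    using jack_inner_Dp[OF f g] by simp
qed

section \<open>Monomial symmetric functions\<close>

lemma coef_monomial_sym: "fs u \<Longrightarrow> coef (monomial_sym l) u = (if shape u = mset l then 1 else 0)"
  by (simp add: coef_def monomial_sym_def Abs_mseries_inverse shape_def flip: supp_lookup)

lemma sym_monomial_sym: "is_sym (monomial_sym l)"
  by (simp add: is_sym_def coef_monomial_sym)

lemma part_facts:
  assumes "int_partition l"
  shows "fs (part l)" "shape (part l) = mset l"
  using mset_part[of l] int_partition_zero[OF assms] by simp_all

lemma sym_eqI:
  assumes "is_sym f" "is_sym g" "\<And>l. int_partition l \<Longrightarrow> coef f (part l) = coef g (part l)"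
  shows "f = g"
proof (rule coef_eqI)
  fix u assume u: "fs u"
  define l where "l = plist (shape u)"
  have l: "int_partition l" "mset l = shape u"
    by (simp_all add: l_def int_partition_plist)
  have p: "fs (part l)" "shape (part l) = shape u"
    using part_facts[OF l(1)] l(2) by simp_all
  have "coef f u = coef f (part l)" "coef g (part l) = coef g u"
    by (rule symD[OF assms(1)], use u p in simp_all) (rule symD[OF assms(2)], use u p in simp_all)
  then show "coef f u = coef g u"
    using assms(3)[OF l(1)] by simp
qed

lemma is_sym_sum: "(\<And>x. x \<in> X \<Longrightarrow> is_sym (h x)) \<Longrightarrow> is_sym (sum h X)"
  by (induction X rule: infinite_finite_induct) (auto intro: sym_0 sym_add)

lemma mset_eq_iff_int_partition: "int_partition k \<Longrightarrow> int_partition l \<Longrightarrow> mset k = mset l \<longleftrightarrow> k = l"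
  using plist_mset by (metis (mono_tags))

lemma monomial_expansion:
  assumes f: "is_sym f" and X: "finite X" "\<And>l. l \<in> X \<Longrightarrow> int_partition l"
    and sub: "\<And>l. int_partition l \<Longrightarrow> coef f (part l) \<noteq> 0 \<Longrightarrow> l \<in> X"
  shows "f = (\<Sum>l\<in>X. mscale (coef f (part l)) (monomial_sym l))"
proof (rule sym_eqI[OF f])
  show "is_sym (\<Sum>l\<in>X. mscale (coef f (part l)) (monomial_sym l))"
    by (intro is_sym_sum sym_mscale sym_monomial_sym)
  fix l assume l: "int_partition l"
  have "coef (\<Sum>l\<in>X. mscale (coef f (part l)) (monomial_sym l)) (part l) =
     (\<Sum>k\<in>X. if k = l then coef f (part k) else 0)"
    unfolding coef_sum coef_mscale using l X(2)
    by (intro sum.cong refl) (auto simp: coef_monomial_sym part_facts mset_eq_iff_int_partition)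
  also have "\<dots> = coef f (part l)"
    using X(1) sub[OF l] by (auto simp: sum.delta)
  finally show "coef f (part l) = coef (\<Sum>l\<in>X. mscale (coef f (part l)) (monomial_sym l)) (part l)" ..
qed

lemma finite_int_partitions: "finite {l. int_partition l \<and> sum_list l = n}"
proof (rule finite_subset)
  show "{l. int_partition l \<and> sum_list l = n} \<subseteq> {l. set l \<subseteq> {..n} \<and> length l \<le> n}"
  proof clarify
    fix l assume l: "int_partition l" "n = sum_list l"
    have "x \<in> {..sum_list l}" if "x \<in> set l" for x
      using member_le_sum_list[OF that] by simp
    moreover have "length l \<le> sum_list l"
      using l(1) by (induction l) (auto simp: int_partition_def Suc_le_eq add_mono intro: add_less_le_mono)
    ultimately show "set l \<subseteq> {..sum_list l} \<and> length l \<le> sum_list l"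
      by blast
  qed
  show "finite {l. set l \<subseteq> {..n} \<and> length l \<le> n}"
    by (rule finite_lists_length_le) simp
qed

lemma deg_part: "int_partition l \<Longrightarrow> deg (part l) = sum_list l"
  using part_facts[of l] sum_mset_shape[of "part l"] by (simp add: sum_mset_sum_list)

text \<open>The product of power sums indexed by l contains \<open>monomial_sym l\<close> with
  nonzero coefficient and otherwise only monomial functions of shorter partitions. Induction on the
  length inverts this triangular system.\<close>

lemma monomial_sym_Lam: "int_partition l \<Longrightarrow> monomial_sym l \<in> Lam"
proof (induction "length l" arbitrary: l rule: less_induct)
  case less
  have z: "0 \<notin># mset l"
    by (rule int_partition_zero[OF less.prems])
  define X where "X = {k. int_partition k \<and> sum_list k = sum_list l}"
  define f where "f = pm (mset l)"
  have X: "finite X" "l \<in> X"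
    using finite_int_partitions less.prems by (simp_all add: X_def)
  have sub: "k \<in> X \<and> (k = l \<or> length k < length l)" if "int_partition k" "coef f (part k) \<noteq> 0" for k
  proof -
    have "deg (part k) = sum_mset (mset l) \<and> size (mset k) \<le> size (mset l) \<and> (size (mset k) = size (mset l) \<longrightarrow> mset k = mset l)"
      using coef_pm_nonzero[OF part_facts(1)[OF that(1)] z] that(2) part_facts(2)[OF that(1)] by (simp add: f_def)
    then show ?thesis
      using that(1) less.prems mset_eq_iff_int_partition[of k l] by (auto simp: X_def deg_part sum_mset_sum_list)
  qed
  have "f = (\<Sum>k\<in>X. mscale (coef f (part k)) (monomial_sym k))"
    using sub sym_pm[OF z] by (intro monomial_expansion X) (auto simp: f_def X_def)
  also have "\<dots> = mscale (coef f (part l)) (monomial_sym l) + (\<Sum>k\<in>X - {l}. mscale (coef f (part k)) (monomial_sym k))"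
    using X by (rule sum.remove)
  finally have eq: "mscale (coef f (part l)) (monomial_sym l) = f - (\<Sum>k\<in>X - {l}. mscale (coef f (part k)) (monomial_sym k))"
    by (simp add: algebra_simps)
  have nz: "coef f (part l) \<noteq> 0"
    using coef_pm_pos[OF part_facts[OF less.prems]] by (simp add: f_def)
  have "mscale (coef f (part k)) (monomial_sym k) \<in> Lam" if "k \<in> X - {l}" for k
  proof (cases "coef f (part k) = 0")
    case False
    then have "monomial_sym k \<in> Lam"
      using that sub[of k] by (intro less.hyps) (auto simp: X_def)
    then show ?thesis
      by (rule Lam_mscale)
  qed (simp add: Lam_0)
  then have "mscale (coef f (part l)) (monomial_sym l) \<in> Lam"
    unfolding eq using Lam_pm[OF z] by (intro Lam_diff Lam_sum) (auto simp: f_def)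
  then have "mscale (1 / coef f (part l)) (mscale (coef f (part l)) (monomial_sym l)) \<in> Lam"
    by (rule Lam_mscale)
  then show ?case
    using nz by simp
qed

lemma sum_mset_le_take:
  assumes "sorted_wrt (\<ge>) l" "N \<subseteq># mset l"
  shows "sum_mset N \<le> sum_list (take (size N) (l :: nat list))"
  using assms
proof (induction l arbitrary: N)
  case (Cons x l)
  show ?case
  proof (cases "x \<in># N")
    case True
    then obtain N' where N: "N = add_mset x N'"
      by (metis insert_DiffM)
    then have "sum_mset N' \<le> sum_list (take (size N') l)"
      using Cons.prems by (intro Cons.IH) auto
    then show ?thesis
      by (simp add: N)
  next
    case False
    have "count N a \<le> count (mset l) a" for a
      using mset_subset_eq_count[OF Cons.prems(2), of a] False by (cases "a = x") (auto simp: not_in_iff)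
    then have "N \<subseteq># mset l"
      by (simp add: subseteq_mset_def)
    then have le: "sum_mset N \<le> sum_list (take (size N) l)"
      using Cons.prems by (intro Cons.IH) auto
    have "sum_list (take r l) \<le> sum_list (take r (x # l))" for r
    proof (cases "r \<le> length l")
      case True
      show ?thesis
      proof (cases r)
        case (Suc s)
        then have s: "s < length l"
          using True by simp
        then have "take (Suc s) l = take s l @ [l ! s]" "l ! s \<le> x"
          using Cons.prems(1) by (auto simp: take_Suc_conv_app_nth)
        then show ?thesis
          using Suc by simp
      qed simp
    next
      case False
      then have "take r (x # l) = x # l" "take r l = l"
        by simp_all
      then show ?thesis
        by simp
    qed
    then show ?thesis
      using le le_trans by blast
  qed
qed simp

lemma partial_sum_part: "partial_sum (part l) r = sum_list (take r l)"
proof (induction l arbitrary: r)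
  case (Cons x l)
  have "part (x # l) (Suc j) = part l j" "part (x # l) 0 = x" for j
    by (simp_all add: part_def)
  then show ?case
    using Cons by (cases r) (simp_all add: partial_sum_def sum.lessThan_Suc_shift del: sum.lessThan_Suc)
qed (simp add: partial_sum_def part_def)

lemma dominated_imp_dom:
  assumes u: "fs u" "shape u = mset k" and k: "int_partition k" and l: "int_partition l" and d: "dominated k l"
  shows "dom u (part l)"
  unfolding dom_def
proof (intro conjI allI impI)
  have "deg u = sum_list k"
    using u(2) sum_mset_shape[of u] by (simp add: sum_mset_sum_list)
  then show "deg u = deg (part l)"
    using d by (simp add: deg_part[OF l] dominated_def)
  fix S :: "nat set" assume S: "finite S"
  define T where "T = S \<inter> supp u"
  have T: "finite T" "T \<subseteq> supp u" "card T \<le> card S"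
    using S by (auto simp: T_def card_mono)
  have "mset_set T \<subseteq># mset_set (supp u)"
    using T u(1) by (simp add: subset_imp_msubset_mset_set)
  then have "image_mset u (mset_set T) \<subseteq># mset k"
    unfolding u(2)[symmetric] shape_def by (rule image_mset_subseteq_mono)
  then have "sum_mset (image_mset u (mset_set T)) \<le> sum_list (take (card T) k)"
    using sum_mset_le_take[of k "image_mset u (mset_set T)"] k by (simp add: int_partition_def)
  moreover have "sum_mset (image_mset u (mset_set T)) = sum u T"
    by (simp add: sum_unfold_sum_mset)
  moreover have "sum u T = sum u S"
    unfolding T_def using S by (intro sum.mono_neutral_left) auto
  moreover have "sum_list (take (card T) k) \<le> sum_list (take (card T) l)"
    using d by (simp add: dominated_def)
  moreover have "sum_list (take (card T) l) \<le> sum_list (take (card S) l)"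
    unfolding partial_sum_part[symmetric] partial_sum_def using T(3) by (intro sum_mono2) auto
  ultimately show "sum u S \<le> partial_sum (part l) (card S)"
    unfolding partial_sum_part by linarith
qed

lemma dominated_refl: "dominated l l"
  by (simp add: dominated_def)

lemma dominated_trans: "dominated j k \<Longrightarrow> dominated k l \<Longrightarrow> dominated j l"
  unfolding dominated_def using order_trans by metis

text \<open>Makes the square sum a measure for induction along dominance.\<close>

lemma dominated_sqsum_less:
  assumes "int_partition k" "int_partition l" "dominated k l" "k \<noteq> l"
  shows "sqsum (part k) < sqsum (part l)"
proof -
  have d: "dom (part k) (part l)"
    using assms part_facts[OF assms(1)] by (intro dominated_imp_dom[of _ k]) auto
  have "sqsum (part k) \<noteq> sqsum (part l)"
  proof
    assume "sqsum (part k) = sqsum (part l)"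
    then have "mset k = mset l"
      using dom_sqsum_imp_shape[OF _ _ d] part_facts[OF assms(1)] part_facts[OF assms(2)] by simp
    then show False
      using assms mset_eq_iff_int_partition by blast
  qed
  then show ?thesis
    using dom_sqsum_le[OF _ _ d] part_facts[OF assms(1)] part_facts[OF assms(2)] by simp
qed

lemma dom_imp_dominated:
  assumes l: "int_partition l" and k: "int_partition k" and d: "dom (part k) (part l)"
  shows "dominated k l"
  unfolding dominated_def
proof (intro conjI allI)
  show "sum_list k = sum_list l"
    using d by (simp add: dom_def deg_part k l)
  fix i
  have "sum (part k) {..<i} \<le> partial_sum (part l) (card {..<i})"
    using d unfolding dom_def by blast
  then show "sum_list (take i k) \<le> sum_list (take i l)"
    unfolding partial_sum_part[symmetric] by (simp add: partial_sum_def)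
qed

lemma opD_below:
  assumes b: "below f g" and f: "fs f"
  shows "below f (opD g)"
  unfolding below_def
proof (intro allI impI)
  fix u assume u: "fs u" "coef (opD g) u \<noteq> 0"
  show "dom u f"
  proof (rule ccontr)
    assume nd: "\<not> dom u f"
    have "coef g u = 0"
      using belowD[OF b u(1)] nd by blast
    moreover have "Dterm (coef g) u i j = 0" if "j \<in> supp u - {i}" for i j
      unfolding Dterm_def
    proof (intro sum.neutral ballI)
      fix a assume a: "a \<in> {a. u i < a \<and> u j < a \<and> a \<le> u i + u j}"
      have "coef g (u(i := a, j := u i + u j - a)) = 0"
      proof (rule ccontr)
        assume "coef g (u(i := a, j := u i + u j - a)) \<noteq> 0"
        then have "dom (u(i := a, j := u i + u j - a)) f"
          using u(1) by (intro belowD[OF b]) simp_all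
        then show False
          using nd a that by (auto dest!: dom_squeeze[OF u(1), rotated 4])
      qed
      then show "(of_nat a - of_nat (u j)) * coef g (u(i := a, j := u i + u j - a)) = 0"
        by simp
    qed
    ultimately have "coef (opD g) u = 0"
      unfolding coef_opD[OF u(1) u(1) order_refl] by simp
    then show False
      using u(2) by simp
  qed
qed

lemma opL_below:
  assumes b: "below f g" and f: "fs f"
  shows "below f (opL g)"
  unfolding below_def
proof (intro allI impI)
  fix u assume u: "fs u" "coef (opL g) u \<noteq> 0"
  show "dom u f"
  proof (rule ccontr)
    assume nd: "\<not> dom u f"
    have "coef g u = 0"
      using belowD[OF b u(1)] nd by blast
    moreover have "Lterm (coef g) u j = 0" if j: "j \<in> supp u - {0}" for j
    proof -
      have 1: "coef g (u(0 := a, j := u 0 + u j - a)) = 0" if "u 0 < a" "u j \<le> a" "a \<le> u 0 + u j" for a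
      proof (rule ccontr)
        assume "coef g (u(0 := a, j := u 0 + u j - a)) \<noteq> 0"
        then have "dom (u(0 := a, j := u 0 + u j - a)) f"
          using u(1) by (intro belowD[OF b]) simp_all
        then show False
          using nd dom_squeeze[OF u(1), of 0 j a f] j that by auto
      qed
      have 2: "coef g (u(0 := u 0 + u j - a, j := a)) = 0" if "u 0 < a" "u j < a" "a \<le> u 0 + u j" for a
      proof (rule ccontr)
        assume "coef g (u(0 := u 0 + u j - a, j := a)) \<noteq> 0"
        then have "dom (u(0 := u 0 + u j - a, j := a)) f"
          using u(1) by (intro belowD[OF b]) simp_all
        moreover have "u(0 := u 0 + u j - a, j := a) = u(j := a, 0 := u j + u 0 - a)"
          using j by (auto simp: add.commute)
        ultimately show False
          using nd dom_squeeze[OF u(1), of j 0 a f] j that by auto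
      qed
      show ?thesis
        unfolding Lterm_def using 1 2 by (simp add: sum.neutral)
    qed
    ultimately have "coef (opL g) u = 0"
      unfolding coef_opL[OF u(1) u(1) order_refl] by simp
    then show False
      using u(2) by simp
  qed
qed

text \<open>Spreading the exponents of a vector of shape \<open>f\<close> raises its square sum
  beyond that of \<open>f\<close>, so the result is no longer dominated and only the diagonal entry
  survives.\<close>

lemma coef_opD_top:
  assumes b: "below f g" and f: "fs f" and u: "fs u" "shape u = shape f"
  shows "coef (opD g) u = eps f * coef g u"
proof -
  have qe: "sqsum u = sqsum f"
    using sum_supp_shape[of "\<lambda>x. x ^ 2" u] sum_supp_shape[of "\<lambda>x. x ^ 2" f] u(2) by (simp add: sqsum_def)
  have "Dterm (coef g) u i j = 0" if "j \<in> supp u - {i}" for i j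
    unfolding Dterm_def
  proof (intro sum.neutral ballI)
    fix a assume a: "a \<in> {a. u i < a \<and> u j < a \<and> a \<le> u i + u j}"
    have "coef g (u(i := a, j := u i + u j - a)) = 0"
    proof (rule ccontr)
      assume "coef g (u(i := a, j := u i + u j - a)) \<noteq> 0"
      then have "dom (u(i := a, j := u i + u j - a)) f"
        using u(1) by (intro belowD[OF b]) simp_all
      then have "sqsum (u(i := a, j := u i + u j - a)) \<le> sqsum f"
        using u(1) f by (intro dom_sqsum_le) simp_all
      moreover have "sqsum u < sqsum (u(i := a, j := u i + u j - a))"
        using sqsum_squeeze(2)[OF u(1), of i j a] a that by simp
      ultimately show False
        using qe by simp
    qed
    then show "(of_nat a - of_nat (u j)) * coef g (u(i := a, j := u i + u j - a)) = 0"
      by simp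
  qed
  then show ?thesis
    unfolding coef_opD[OF u(1) u(1) order_refl] using eps_cong_shape[OF u(2)] by simp
qed

section \<open>Jack functions as eigenfunctions\<close>

definition lst :: "(nat \<Rightarrow> nat) \<Rightarrow> nat list" where
  "lst f = plist (shape f)"

definition ones :: "nat \<Rightarrow> nat \<Rightarrow> nat" where
  "ones n = (\<lambda>i. if i < n then 1 else 0)"

definition ptns :: "nat \<Rightarrow> (nat \<Rightarrow> nat) set" where
  "ptns n = {f. ptn f \<and> deg f = n}"

lemma ptn_part:
  assumes "int_partition l"
  shows "ptn (part l)"
proof -
  have "part l j \<le> part l i" if "i \<le> j" for i j
    using assms that unfolding int_partition_def part_def by (cases "i = j") (auto simp: sorted_wrt_iff_nth_less)
  then show ?thesis
    using part_facts(1)[OF assms] by (simp add: ptn_def antimono_def)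
qed

lemma int_partition_lst: "int_partition (lst f)"
  by (simp add: lst_def int_partition_plist)

lemma lst_part: "int_partition l \<Longrightarrow> lst (part l) = l"
  by (simp add: lst_def part_facts plist_mset)

lemma supp_ptn:
  assumes "ptn f"
  shows "supp f = {..<card (supp f)}"
proof -
  have down: "i \<in> supp f" if "j \<in> supp f" "i \<le> j" for i j
    using ptn_le[OF assms that(2)] that(1) by simp
  have fin: "finite (supp f)"
    using assms by (simp add: ptn_def)
  show ?thesis
  proof (cases "supp f = {}")
    case False
    define m where "m = Max (supp f)"
    have m: "m \<in> supp f" "\<And>j. j \<in> supp f \<Longrightarrow> j \<le> m"
      unfolding m_def using Max_in[OF fin False] Max_ge[OF fin] by blast+
    have "supp f = {..<Suc m}"
    proof (intro set_eqI iffI)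
      fix i assume "i \<in> {..<Suc m}"
      then show "i \<in> supp f"
        using down[OF m(1)] by (simp only: lessThan_iff less_Suc_eq_le)
    next
      fix i assume "i \<in> supp f"
      then show "i \<in> {..<Suc m}"
        using m(2) by (simp only: lessThan_iff less_Suc_eq_le)
    qed
    then show ?thesis
      by (simp only: card_lessThan)
  qed simp
qed

lemma part_lst:
  assumes "ptn f"
  shows "part (lst f) = f"
proof -
  define n where "n = card (supp f)"
  define l where "l = map f [0..<n]"
  have s: "supp f = {..<n}"
    using supp_ptn[OF assms] by (simp add: n_def)
  have nz: "f i \<noteq> 0 \<longleftrightarrow> i < n" for i
  proof -
    have "i \<in> supp f \<longleftrightarrow> i \<in> {..<n}"
      by (simp only: s)
    then show ?thesis
      by simp
  qed
  have l: "int_partition l"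
    using ptn_le[OF assms] nz unfolding int_partition_def l_def sorted_wrt_iff_nth_less by auto
  have p: "part l = f"
  proof
    fix j
    show "part l j = f j"
      using nz[of j] by (auto simp: part_def l_def)
  qed
  show ?thesis
    using lst_part[OF l] p by simp
qed

lemma mset_lst: "mset (lst f) = shape f"
  by (simp add: lst_def)

lemma sum_list_lst: "sum_list (lst f) = deg f"
  using sum_mset_shape[of f] by (simp add: mset_lst flip: sum_mset_sum_list)

lemma lst_inj: "ptn f \<Longrightarrow> ptn g \<Longrightarrow> lst f = lst g \<Longrightarrow> f = g"
  by (metis part_lst)

lemma finite_ptns: "finite (ptns n)"
proof -
  have "ptns n \<subseteq> part ` {l. int_partition l \<and> sum_list l = n}"
  proof
    fix f assume "f \<in> ptns n"
    then show "f \<in> part ` {l. int_partition l \<and> sum_list l = n}"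
      by (intro image_eqI[of _ _ "lst f"]) (simp_all add: ptns_def part_lst int_partition_lst sum_list_lst)
  qed
  then show ?thesis
    using finite_int_partitions finite_subset by blast
qed

lemma supp_ones: "supp (ones n) = {..<n}"
  by (auto simp: ones_def split: if_splits)

lemma fs_ones [simp]: "fs (ones n)"
  by (simp add: supp_ones)

lemma ones_power_sum_1:
  assumes f: "is_sym f"
  shows "coef (power_sum 1 * f) (ones (Suc n)) = of_nat (Suc n) * coef f (ones n)"
proof -
  have "shape ((ones (Suc n))(i := 0)) = shape (ones n)" if "i < Suc n" for i
  proof -
    have "ones (Suc n) i = 1"
      using that by (simp add: ones_def)
    then have "shape ((ones (Suc n))(i := 0)) = shape (ones (Suc n)) - {#1#}"
      using shape_upd[OF fs_ones, of "Suc n" i 0] by simp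
    moreover have "shape (ones m) = replicate_mset m 1" for m
    proof -
      have "shape (ones m) = image_mset (\<lambda>_. 1) (mset_set {..<m})"
        unfolding shape_def supp_ones by (intro image_mset_cong) (auto simp: ones_def)
      then show ?thesis
        by (simp add: image_mset_const_eq)
    qed
    ultimately show ?thesis
      by simp
  qed
  then have "coef f ((ones (Suc n))(i := 0)) = coef f (ones n)" if "i < Suc n" for i
    using that by (intro symD[OF f]) simp_all
  then have "(\<Sum>i\<in>{..<Suc n}. if 1 \<le> ones (Suc n) i then coef f ((ones (Suc n))(i := ones (Suc n) i - 1)) else 0) =
      (\<Sum>i\<in>{..<Suc n}. coef f (ones n))"
    by (intro sum.cong refl) (auto simp: ones_def)
  then show ?thesis
    using coef_power_sum_mult[of "ones (Suc n)" "{..<Suc n}" 1 f] by (simp add: supp_ones)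
qed

lemma ones_power_sum_ge_2:
  assumes "k \<ge> 2"
  shows "coef (power_sum k * f) (ones n) = 0"
proof -
  have "\<not> k \<le> ones n i" for i
    using assms by (simp add: ones_def)
  then show ?thesis
    using coef_power_sum_mult[of "ones n" "{..<n}" k f] assms by (simp add: supp_ones)
qed

text \<open>Here a multiple of the square of x_0 is symmetrised, and none of its monomials is
  squarefree.\<close>

lemma ones_opA_var0: "coef (opA (var0 * g)) (ones n) = 0"
proof -
  have "coef (var0 * g) ((ones n)(i := ones n i - 1) \<circ> transpose 0 i) = 0" for i
  proof -
    have "fs ((ones n)(i := ones n i - 1) \<circ> transpose 0 i)"
      by (simp only: fs_comp_transpose fs_upd fs_ones)
    moreover have "((ones n)(i := ones n i - 1) \<circ> transpose 0 i) 0 = 0"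
      by (simp add: ones_def)
    ultimately show ?thesis
      by (subst coef_var0_mult) (simp_all only: if_True simp_thms)
  qed
  then show ?thesis
    by (simp add: coef_opA)
qed

section \<open>Consequences of the defining conditions of the Jack functions\<close>

locale jack =
  fixes J :: "nat list \<Rightarrow> ratfun mseries"
  assumes J: "jack_family J"
begin

lemma J_expansion:
  assumes l: "int_partition l"
  obtains c where "J l = (\<Sum>k | int_partition k \<and> dominated k l. mscale (c k) (monomial_sym k))"
    "c (replicate (sum_list l) 1) = of_nat (fact (sum_list l))"
  using J l unfolding jack_family_def by blast

lemma finite_dominated: "finite {k. int_partition k \<and> dominated k l}"
  by (rule finite_subset[OF _ finite_int_partitions[of "sum_list l"]]) (auto simp: dominated_def)

lemma J_Lam: "int_partition l \<Longrightarrow> J l \<in> Lam"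
  by (erule J_expansion) (auto intro!: Lam_sum Lam_mscale monomial_sym_Lam)

lemma J_below:
  assumes l: "int_partition l"
  shows "below (part l) (J l)"
  unfolding below_def
proof (intro allI impI)
  fix u assume u: "fs u" "coef (J l) u \<noteq> 0"
  obtain c where "J l = (\<Sum>k | int_partition k \<and> dominated k l. mscale (c k) (monomial_sym k))"
    using J_expansion[OF l] .
  then have "(\<Sum>k | int_partition k \<and> dominated k l. c k * coef (monomial_sym k) u) \<noteq> 0"
    using u(2) by simp
  then obtain k where "k \<in> {k. int_partition k \<and> dominated k l}" "c k * coef (monomial_sym k) u \<noteq> 0"
    by (rule sum.not_neutral_contains_not_neutral)
  then show "dom u (part l)"
    using u(1) l by (intro dominated_imp_dom[of u k l]) (auto simp: coef_monomial_sym split: if_splits)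
qed

lemma J_ones:
  assumes l: "int_partition l"
  shows "coef (J l) (ones (sum_list l)) = of_nat (fact (sum_list l))"
proof -
  let ?n = "sum_list l"
  let ?k = "replicate ?n 1 :: nat list"
  obtain c where c: "J l = (\<Sum>k | int_partition k \<and> dominated k l. mscale (c k) (monomial_sym k))"
    "c ?k = of_nat (fact ?n)"
    using J_expansion[OF l] .
  have k: "int_partition ?k"
    by (auto simp: int_partition_def sorted_wrt_iff_nth_less)
  have pk: "part ?k = ones ?n"
    by (auto simp: part_def ones_def fun_eq_iff)
  have len: "i \<le> length l \<Longrightarrow> i \<le> sum_list (take i l)" for i
    using l
  proof (induction i arbitrary: l)
    case (Suc i)
    then obtain x xs where "l = x # xs"
      by (cases l) auto
    moreover from this have "x \<ge> 1" "int_partition xs"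
      using Suc.prems by (auto simp: int_partition_def)
    ultimately show ?case
      using Suc.IH[of xs] Suc.prems(1) by simp
  qed simp
  have "dominated ?k l"
    unfolding dominated_def
  proof (intro conjI allI)
    show "sum_list ?k = sum_list l"
      by (simp add: sum_list_replicate)
    fix i
    show "sum_list (take i ?k) \<le> sum_list (take i l)"
      using len[of i] by (cases "i \<le> length l") (auto simp: sum_list_replicate min_def)
  qed
  have "coef (J l) (ones ?n) = (\<Sum>j | int_partition j \<and> dominated j l. if j = ?k then c j else 0)"
    unfolding c(1) coef_sum coef_mscale
  proof (intro sum.cong refl)
    fix j assume "j \<in> {k. int_partition k \<and> dominated k l}"
    then have "mset ?k = mset j \<longleftrightarrow> ?k = j"
      using k mset_eq_iff_int_partition[of ?k j] by blast
    then show "c j * coef (monomial_sym j) (ones ?n) = (if j = ?k then c j else 0)"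
      using part_facts[OF k] unfolding pk by (auto simp: coef_monomial_sym)
  qed
  also have "\<dots> = c ?k"
    using finite_dominated k \<open>dominated ?k l\<close> by (subst sum.delta) auto
  finally show ?thesis
    using c(2) by simp
qed

lemma J_nonzero: "int_partition l \<Longrightarrow> J l \<noteq> 0"
  using J_ones[of l] by (auto simp: fact_nonzero)

lemma J_orth: "int_partition k \<Longrightarrow> int_partition l \<Longrightarrow> k \<noteq> l \<Longrightarrow> jack_inner (J k) (J l) = 0"
  using J unfolding jack_family_def by blast

lemma orth_span:
  assumes X: "X \<subseteq> Collect int_partition" and f: "f \<in> mv.span (J ` X)" and g: "g \<in> Lam"
    and o: "\<And>k. k \<in> X \<Longrightarrow> jack_inner (J k) g = 0"
  shows "jack_inner f g = 0"
proof -
  have "f \<in> Lam \<and> jack_inner f g = 0"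
    using f
  proof (induction rule: mv.span_induct_alt)
    case base
    then show ?case
      by (simp add: Lam_0 jack_inner_zero_left)
  next
    case (step c x y)
    then obtain k where k: "k \<in> X" "x = J k"
      by blast
    then have "x \<in> Lam"
      using X J_Lam by blast
    then show ?case
      using step k o g by (auto simp: jack_inner_add_left jack_inner_mscale_left Lam_mscale Lam_add)
  qed
  then show ?thesis ..
qed

definition Dn :: "nat list \<Rightarrow> nat list set" where
  "Dn l = {k. int_partition k \<and> dominated k l}"

lemma span_J_mono: "X \<subseteq> Y \<Longrightarrow> f \<in> mv.span (J ` X) \<Longrightarrow> f \<in> mv.span (J ` Y)"
  using mv.span_mono[of "J ` X" "J ` Y"] by blast

text \<open>The definition normalises the coefficient at the all-ones partition and says nothing
  about the leading one. If the latter vanished, \<open>J l\<close> would lie in the span of the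
  Jack functions of smaller partitions, all orthogonal to it, against positivity. Triangularity is
  then inverted by induction on the square sum.\<close>

lemma J_lead_and_monomial:
  assumes "int_partition l"
  shows "coef (J l) (part l) \<noteq> 0 \<and> monomial_sym l \<in> mv.span (J ` Dn l)"
  using assms
proof (induction "sqsum (part l)" arbitrary: l rule: less_induct)
  case less
  obtain c where c: "J l = (\<Sum>k\<in>Dn l. mscale (c k) (monomial_sym k))"
    using J_expansion[OF less.prems] unfolding Dn_def by metis
  have fin: "finite (Dn l)" and lD: "l \<in> Dn l"
    using finite_dominated less.prems by (simp_all add: Dn_def dominated_refl)
  define R where "R = (\<Sum>k\<in>Dn l - {l}. mscale (c k) (monomial_sym k))"
  have eq: "J l = mscale (c l) (monomial_sym l) + R"
    unfolding c R_def using fin lD by (rule sum.remove)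
  have sub: "Dn k \<subseteq> Dn l - {l}" if k: "k \<in> Dn l - {l}" for k
  proof
    fix j assume j: "j \<in> Dn k"
    have "sqsum (part j) \<le> sqsum (part k)"
      using j k dominated_sqsum_less[of j k] by (cases "j = k") (auto simp: Dn_def)
    also have "\<dots> < sqsum (part l)"
      using k less.prems by (intro dominated_sqsum_less) (auto simp: Dn_def)
    finally show "j \<in> Dn l - {l}"
      using j k dominated_trans[of j k l] by (auto simp: Dn_def)
  qed
  have R: "R \<in> mv.span (J ` (Dn l - {l}))"
    unfolding R_def
  proof (intro mv.span_sum mv.span_scale)
    fix k assume k: "k \<in> Dn l - {l}"
    then have "sqsum (part k) < sqsum (part l)" "int_partition k"
      using less.prems by (auto simp: Dn_def intro: dominated_sqsum_less)
    then have "monomial_sym k \<in> mv.span (J ` Dn k)"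
      using less.hyps by blast
    then show "monomial_sym k \<in> mv.span (J ` (Dn l - {l}))"
      by (rule span_J_mono[OF sub[OF k]])
  qed
  have X: "Dn l - {l} \<subseteq> Collect int_partition"
    by (auto simp: Dn_def)
  have cl: "c l \<noteq> 0"
  proof
    assume "c l = 0"
    then have "J l \<in> mv.span (J ` (Dn l - {l}))"
      using R eq by simp
    then have "jack_inner (J l) (J l) = 0"
    proof (rule orth_span[OF X _ J_Lam[OF less.prems]])
      fix k assume "k \<in> Dn l - {l}"
      then have "int_partition k" "k \<noteq> l"
        by (simp_all add: Dn_def)
      then show "jack_inner (J k) (J l) = 0"
        using less.prems by (intro J_orth)
    qed
    then show False
      using jack_inner_pos[OF J_Lam[OF less.prems] J_nonzero[OF less.prems]] by simp
  qed
  have "coef R (part l) = 0"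
  proof -
    have z: "c k * coef (monomial_sym k) (part l) = 0" if k: "k \<in> Dn l - {l}" for k
    proof -
      have "mset l \<noteq> mset k"
        using k less.prems mset_eq_iff_int_partition[of l k] unfolding Dn_def by blast
      then show ?thesis
        using part_facts[OF less.prems] by (simp add: coef_monomial_sym)
    qed
    show ?thesis
      unfolding R_def coef_sum coef_mscale by (rule sum.neutral, rule ballI, rule z)
  qed
  then have "coef (J l) (part l) = c l"
    unfolding eq using part_facts[OF less.prems] by (simp add: coef_monomial_sym)
  moreover have "monomial_sym l \<in> mv.span (J ` Dn l)"
  proof -
    have "J l - R \<in> mv.span (J ` Dn l)"
    proof (rule mv.span_diff)
      show "J l \<in> mv.span (J ` Dn l)"
        using lD by (intro mv.span_base) blast
      show "R \<in> mv.span (J ` Dn l)"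
        by (rule span_J_mono[OF _ R]) blast
    qed
    then have "mscale (1 / c l) (J l - R) \<in> mv.span (J ` Dn l)"
      by (rule mv.span_scale)
    moreover have "mscale (1 / c l) (J l - R) = monomial_sym l"
      unfolding eq using cl by simp
    ultimately show ?thesis
      by simp
  qed
  ultimately show ?case
    using cl by simp
qed

lemma in_span_J:
  assumes f: "is_sym f" and X: "finite X" "\<And>l. l \<in> X \<Longrightarrow> int_partition l"
    and sub: "\<And>l. int_partition l \<Longrightarrow> coef f (part l) \<noteq> 0 \<Longrightarrow> l \<in> X"
    and down: "\<And>l. l \<in> X \<Longrightarrow> Dn l \<subseteq> X"
  shows "f \<in> mv.span (J ` X)"
proof -
  have "(\<Sum>l\<in>X. mscale (coef f (part l)) (monomial_sym l)) \<in> mv.span (J ` X)"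
    using J_lead_and_monomial X(2) span_J_mono[OF down] by (intro mv.span_sum mv.span_scale) blast
  then show ?thesis
    using monomial_expansion[OF f X sub] by simp
qed

lemma below_in_span_J:
  assumes f: "is_sym f" and b: "below (part l) f" and l: "int_partition l"
  shows "f \<in> mv.span (J ` Dn l)"
proof (rule in_span_J[OF f])
  show "finite (Dn l)"
    using finite_dominated by (simp add: Dn_def)
  fix k assume k: "int_partition k" "coef f (part k) \<noteq> 0"
  then have "dom (part k) (part l)"
    by (intro belowD[OF b] part_facts)
  then show "k \<in> Dn l"
    using dom_imp_dominated[OF l k(1)] k by (simp add: Dn_def)
qed (use dominated_trans in \<open>auto simp: Dn_def\<close>)

text \<open>The difference of the two sides has no leading term, so it lies in the span of the Jack
  functions strictly below l. Self-adjointness and triangularity of \<open>opD\<close> make it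
  orthogonal to these; hence it is orthogonal to itself.\<close>

lemma J_eigen:
  assumes l: "int_partition l"
  shows "opD (J l) = mscale (eps (part l)) (J l)"
proof -
  let ?e = "eps (part l)"
  define g where "g = opD (J l) - mscale ?e (J l)"
  have pf: "fs (part l)"
    by (rule part_facts[OF l])
  have gL: "g \<in> Lam"
    unfolding g_def by (intro Lam_diff opD_Lam Lam_mscale J_Lam l)
  have b: "below (part l) g"
  proof -
    have "below (part l) (opD (J l) + mscale (- ?e) (J l))"
      by (intro below_add below_mscale opD_below J_below l pf)
    then show ?thesis
      by (simp add: g_def)
  qed
  have top: "coef g (part l) = 0"
    using coef_opD_top[OF J_below[OF l] pf pf refl] by (simp add: g_def)
  have X: "Dn l - {l} \<subseteq> Collect int_partition"
    by (auto simp: Dn_def)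
  have nl: "l \<notin> Dn k" if "k \<in> Dn l - {l}" for k
    using that l dominated_sqsum_less[of k l] dominated_sqsum_less[of l k] by (auto simp: Dn_def)
  have gs: "g \<in> mv.span (J ` (Dn l - {l}))"
  proof (rule in_span_J[OF sym_Lam[OF gL]])
    show "finite (Dn l - {l})"
      using finite_dominated by (simp add: Dn_def)
    fix k assume k: "int_partition k" "coef g (part k) \<noteq> 0"
    then have "dom (part k) (part l)"
      by (intro belowD[OF b] part_facts)
    then show "k \<in> Dn l - {l}"
      using dom_imp_dominated[OF l k(1)] k top by (auto simp: Dn_def)
  next
    fix k assume k: "k \<in> Dn l - {l}"
    then show "Dn k \<subseteq> Dn l - {l}"
      using nl[OF k] dominated_trans[of _ k l] by (auto simp: Dn_def)
  qed (auto simp: Dn_def)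
  have "jack_inner (J k) g = 0" if k: "k \<in> Dn l - {l}" for k
  proof -
    have kp: "int_partition k" "k \<noteq> l"
      using k by (auto simp: Dn_def)
    have oD: "opD (J k) \<in> mv.span (J ` Dn k)"
      by (intro below_in_span_J sym_Lam opD_Lam J_Lam opD_below J_below part_facts kp)
    have "jack_inner (opD (J k)) (J l) = 0"
    proof (rule orth_span[OF _ oD J_Lam[OF l]])
      show "Dn k \<subseteq> Collect int_partition"
        by (auto simp: Dn_def)
      fix j assume "j \<in> Dn k"
      then have "int_partition j" "j \<noteq> l"
        using nl[OF k] by (auto simp: Dn_def)
      then show "jack_inner (J j) (J l) = 0"
        using l by (intro J_orth)
    qed
    then have "jack_inner (J k) (opD (J l)) = 0"
      using jack_inner_opD[OF J_Lam J_Lam] kp l by simp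
    moreover have "jack_inner (J k) g = jack_inner (J k) (opD (J l)) + (- ?e) * jack_inner (J k) (J l)"
    proof -
      have "g = opD (J l) + mscale (- ?e) (J l)"
        by (simp add: g_def)
      then show ?thesis
        using l kp by (simp only: jack_inner_add_right jack_inner_mscale_right opD_Lam Lam_mscale J_Lam)
    qed
    ultimately show ?thesis
      using J_orth[OF kp(1) l kp(2)] by simp
  qed
  then have "jack_inner g g = 0"
    by (intro orth_span[OF X gs gL])
  then have "g = 0"
    using jack_inner_pos[OF gL] by fastforce
  then show ?thesis
    by (simp add: g_def)
qed

definition JJ :: "(nat \<Rightarrow> nat) \<Rightarrow> ratfun mseries" where
  "JJ f = J (lst f)"

definition jack_norm :: "(nat \<Rightarrow> nat) \<Rightarrow> ratfun" where
  "jack_norm f = jack_inner (JJ f) (JJ f)"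

lemma JJ_Lam: "JJ f \<in> Lam"
  by (simp add: JJ_def J_Lam int_partition_lst)

lemma JJ_sym: "is_sym (JJ f)"
  by (intro sym_Lam JJ_Lam)

lemma JJ_below: "ptn f \<Longrightarrow> below f (JJ f)"
  using J_below[OF int_partition_lst, of f] by (simp add: JJ_def part_lst)

lemma JJ_ones: "coef (JJ f) (ones (deg f)) = of_nat (fact (deg f))"
  using J_ones[OF int_partition_lst, of f] by (simp add: JJ_def sum_list_lst)

lemma JJ_eigen: "ptn f \<Longrightarrow> opD (JJ f) = mscale (eps f) (JJ f)"
  using J_eigen[OF int_partition_lst, of f] by (simp add: JJ_def part_lst)

lemma JJ_lead: "ptn f \<Longrightarrow> coef (JJ f) f \<noteq> 0"
  using J_lead_and_monomial[OF int_partition_lst, of f] by (simp add: JJ_def part_lst)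

lemma JJ_orth: "ptn f \<Longrightarrow> ptn g \<Longrightarrow> f \<noteq> g \<Longrightarrow> jack_inner (JJ f) (JJ g) = 0"
  unfolding JJ_def using lst_inj by (intro J_orth int_partition_lst) blast

lemma jack_norm_pos: "jack_norm f > 0"
  unfolding jack_norm_def using J_nonzero[OF int_partition_lst] by (intro jack_inner_pos JJ_Lam) (simp add: JJ_def)

lemma JJ_expansion:
  assumes F: "F \<in> Lam" and h: "\<And>u. fs u \<Longrightarrow> coef F u \<noteq> 0 \<Longrightarrow> deg u = n"
  shows "F = (\<Sum>g\<in>ptns n. mscale (jack_inner F (JJ g) / jack_norm g) (JJ g))"
proof -
  define X where "X = {l. int_partition l \<and> sum_list l = n}"
  define G where "G = (\<Sum>g\<in>ptns n. mscale (jack_inner F (JJ g) / jack_norm g) (JJ g))"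
  have XC: "X \<subseteq> Collect int_partition"
    by (auto simp: X_def)
  have Xp: "part l \<in> ptns n" "J l = JJ (part l)" if "l \<in> X" for l
    using that by (auto simp: X_def ptns_def ptn_part deg_part JJ_def lst_part)
  have Fs: "F \<in> mv.span (J ` X)"
  proof (rule in_span_J[OF sym_Lam[OF F]])
    show "finite X"
      unfolding X_def by (rule finite_int_partitions)
    fix l assume "int_partition l" "coef F (part l) \<noteq> 0"
    then show "l \<in> X"
      using h[of "part l"] by (simp add: X_def part_facts deg_part)
  qed (auto simp: X_def Dn_def dominated_def)
  have GL: "G \<in> Lam"
    unfolding G_def by (intro Lam_sum Lam_mscale JJ_Lam)
  have Gs: "G \<in> mv.span (J ` X)"
    unfolding G_def
  proof (intro mv.span_sum mv.span_scale mv.span_base)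
    fix g assume "g \<in> ptns n"
    then have "lst g \<in> X"
      by (simp add: X_def ptns_def int_partition_lst sum_list_lst)
    then show "JJ g \<in> J ` X"
      by (auto simp: JJ_def)
  qed
  have dL: "F - G \<in> Lam"
    by (intro Lam_diff F GL)
  have o: "jack_inner (JJ f) (F - G) = 0" if f: "f \<in> ptns n" for f
  proof -
    have "jack_inner (JJ f) G = (\<Sum>g\<in>ptns n. jack_inner F (JJ g) / jack_norm g * jack_inner (JJ f) (JJ g))"
      unfolding G_def by (subst jack_inner_sum_right)
        (auto intro!: JJ_Lam Lam_mscale sum.cong jack_inner_mscale_right simp del: times_divide_eq_left)
    also have "\<dots> = (\<Sum>g\<in>ptns n. if g = f then jack_inner F (JJ f) else 0)"
    proof (intro sum.cong refl)
      fix g assume g: "g \<in> ptns n"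
      show "jack_inner F (JJ g) / jack_norm g * jack_inner (JJ f) (JJ g) = (if g = f then jack_inner F (JJ f) else 0)"
        using f g jack_norm_pos[of f] JJ_orth[of f g] by (auto simp: ptns_def jack_norm_def)
    qed
    also have "\<dots> = jack_inner F (JJ f)"
      using f finite_ptns by (subst sum.delta) auto
    finally have "jack_inner (JJ f) G = jack_inner (JJ f) F"
      using jack_inner_commute[OF F JJ_Lam] by simp
    moreover have "jack_inner (JJ f) (F - G) = jack_inner (JJ f) F + (-1) * jack_inner (JJ f) G"
    proof -
      have "F - G = F + mscale (-1) G"
        by simp
      then show ?thesis
        using F GL by (simp only: jack_inner_add_right jack_inner_mscale_right JJ_Lam Lam_mscale)
    qed
    ultimately show ?thesis
      by simp
  qed
  have "jack_inner (F - G) (F - G) = 0"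
  proof (rule orth_span[OF XC _ dL])
    show "F - G \<in> mv.span (J ` X)"
      by (intro mv.span_diff Fs Gs)
    fix k assume "k \<in> X"
    then show "jack_inner (J k) (F - G) = 0"
      using o Xp by simp
  qed
  then have "F - G = 0"
    using jack_inner_pos[OF dL] by fastforce
  then show ?thesis
    by (simp add: G_def)
qed

end

section \<open>The Pieri rule\<close>

definition addable :: "(nat \<Rightarrow> nat) \<Rightarrow> nat \<Rightarrow> bool" where
  "addable f y \<longleftrightarrow> (\<forall>j<y. f y < f j)"

definition add_box :: "(nat \<Rightarrow> nat) \<Rightarrow> nat \<Rightarrow> nat \<Rightarrow> nat" where
  "add_box f y = f(y := Suc (f y))"

text \<open>The content of the box (\<open>f y\<close>, y), the one following row y.\<close>

definition ct :: "(nat \<Rightarrow> nat) \<Rightarrow> nat \<Rightarrow> ratfun" where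
  "ct f y = alpha * of_nat (f y) - of_nat y"

text \<open>The space in which \<open>JJ f\<close> is split: \<open>opL\<close> preserves it because
  it commutes with \<open>opD\<close> and respects dominance, and its elements are determined by
  their coefficients at vectors of shape \<open>f\<close>.\<close>

definition eigsp :: "(nat \<Rightarrow> nat) \<Rightarrow> ratfun mseries set" where
  "eigsp f = {g \<in> Lamx. below f g \<and> opD g = mscale (eps f) g}"

lemma addable_le: "addable f y \<Longrightarrow> f L = 0 \<Longrightarrow> y \<le> L"
  unfolding addable_def by (metis not_less_zero not_le)

lemma ptn_add:
  assumes f: "ptn f" and y: "addable f y"
  shows "ptn (add_box f y)"
  unfolding ptn_def
proof
  show "antimono (add_box f y)"
  proof (rule antimonoI)
    fix i j :: nat assume ij: "i \<le> j"
    have "add_box f y j \<le> f j + (if j = y then 1 else 0)" "f i \<le> add_box f y i"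
      by (simp_all add: add_box_def)
    moreover have "f j \<le> f i"
      using ptn_le[OF f ij] .
    moreover have "f y < f i" if "i < y"
      using y that by (simp add: addable_def)
    ultimately show "add_box f y j \<le> add_box f y i"
      using ij by (cases "i = j"; cases "j = y") auto
  qed
  show "fs (add_box f y)"
    using ptn_fs[OF f] by (simp add: add_box_def)
qed

definition rem_box :: "(nat \<Rightarrow> nat) \<Rightarrow> nat \<Rightarrow> nat \<Rightarrow> nat" where
  "rem_box f r = f(r := f r - 1)"

lemma rem_box:
  assumes f: "ptn f" and r: "f (Suc r) < f r"
  shows ptn_rem: "ptn (rem_box f r)" and addable_rem: "addable (rem_box f r) r" and add_rem: "add_box (rem_box f r) r = f"
proof -
  show "add_box (rem_box f r) r = f"
    using r by (auto simp: rem_box_def add_box_def)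
  show "addable (rem_box f r) r"
    unfolding addable_def
  proof (intro allI impI)
    fix i assume i: "i < r"
    then have "f r \<le> f i"
      using ptn_le[OF f] by simp
    then show "rem_box f r r < rem_box f r i"
      using i r by (simp add: rem_box_def)
  qed
  show "ptn (rem_box f r)"
    unfolding ptn_def
  proof
    show "antimono (rem_box f r)"
    proof (rule antimonoI)
      fix a b :: nat assume ab: "a \<le> b"
      have "f b \<le> f a" "r < b \<Longrightarrow> f b \<le> f (Suc r)"
        using ptn_le[OF f] ab by auto
      then show "rem_box f r b \<le> rem_box f r a"
        using ab r by (auto simp: rem_box_def)
    qed
    show "fs (rem_box f r)"
      using ptn_fs[OF f] by (simp add: rem_box_def)
  qed
qed

text \<open>Distinct rows have distinct contents, so the eigenvalues of \<open>opL\<close> belonging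
  to different rows can be separated.\<close>

lemma ct_inj:
  assumes "ct f x = ct g y"
  shows "f x = g y \<and> x = y"
proof -
  have "alpha * of_int (int (f x) - int (g y)) = of_int (int x - int y)"
    using assms by (simp add: ct_def algebra_simps)
  from alpha_generic[OF this] show ?thesis
    by linarith
qed

lemma card_shape:
  assumes "fs u" "fs v" "shape u = shape v"
  shows "card {j. u j > a} = card {j. v j > a}"
proof -
  have "card {j. w j > a} = size (filter_mset (\<lambda>b. b > a) (shape w))" if "fs w" for w
  proof -
    have "{j. w j > a} = {j \<in> supp w. w j > a}"
      by auto
    then show ?thesis
      using that by (simp add: shape_def filter_mset_image_mset)
  qed
  then show ?thesis
    using assms by simp
qed

text \<open>The exponent of x_0 is assigned to the lowest row of \<open>f\<close> having that
  length, and the lowest row of each length is the addable one.\<close>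

lemma row_shape:
  assumes f: "ptn f" and u: "fs u" "shape u = shape f"
  defines "y \<equiv> card {j. u j > u 0}"
  shows "f y = u 0" "addable f y" "cont u = ct f y"
proof -
  have fin: "finite {j. f j > u 0}"
    by (rule finite_subset[OF _ ptn_fs[OF f]]) auto
  have y: "y = card {j. f j > u 0}"
    unfolding y_def by (rule card_shape[OF u(1) ptn_fs[OF f] u(2)])
  have iff: "f j > u 0 \<longleftrightarrow> j < y" for j
  proof
    assume j: "f j > u 0"
    have "{..j} \<subseteq> {j. f j > u 0}"
    proof
      fix i assume "i \<in> {..j}"
      then show "i \<in> {j. f j > u 0}"
        using j ptn_le[OF f, of i j] by simp
    qed
    then have "card {..j} \<le> y"
      unfolding y by (rule card_mono[OF fin])
    then show "j < y"
      by simp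
  next
    assume "j < y"
    show "f j > u 0"
    proof (rule ccontr)
      assume n: "\<not> f j > u 0"
      have "{j. f j > u 0} \<subseteq> {..<j}"
      proof
        fix i assume "i \<in> {j. f j > u 0}"
        then have "\<not> f i \<le> f j"
          using n by simp
        then show "i \<in> {..<j}"
          using ptn_le[OF f, of j i] by (meson lessThan_iff not_le)
      qed
      then have "y \<le> card {..<j}"
        unfolding y by (intro card_mono) auto
      then show False
        using \<open>j < y\<close> by simp
    qed
  qed
  have "f y \<le> u 0"
    using iff[of y] by simp
  moreover have "u 0 \<le> f y"
  proof (cases "u 0 = 0")
    case False
    have "u 0 \<in># shape u"
      using u(1) False by (auto simp: shape_def)
    then obtain i where i: "f i = u 0"
      unfolding u(2) using ptn_fs[OF f] by (auto simp: shape_def)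
    then have "y \<le> i"
      using iff[of i] by simp
    then show ?thesis
      using ptn_le[OF f] i by metis
  qed simp
  ultimately show *: "f y = u 0"
    by simp
  show "addable f y"
    unfolding addable_def using iff * by simp
  show "cont u = ct f y"
    using * by (simp add: cont_def ct_def y_def)
qed

text \<open>Vectors of shape \<open>f\<close> have the largest square sum possible below
  \<open>f\<close>, so all terms of \<open>Lterm\<close> that spread exponents vanish and only the
  exchanges with larger exponents remain.\<close>

lemma coef_opL_top:
  assumes b: "below f g" and f: "fs f" and u: "fs u" "shape u = shape f"
  shows "coef (opL g) u = cont u * coef g u + (\<Sum>j\<in>{j. u j > u 0}. coef g (u \<circ> transpose 0 j))"
proof -
  have qe: "sqsum u = sqsum f"
    using sum_supp_shape[of "\<lambda>x. x ^ 2" u] sum_supp_shape[of "\<lambda>x. x ^ 2" f] u(2) by (simp add: sqsum_def)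
  have z: "coef g v = 0" if "fs v" "sqsum u < sqsum v" for v
    using that belowD[OF b, of v] dom_sqsum_le[of v f] qe f by auto
  have L: "Lterm (coef g) u j = (if u j > u 0 then coef g (u \<circ> transpose 0 j) else 0)"
    if j: "j \<in> supp u - {0}" for j
  proof -
    have 1: "coef g (u(0 := a, j := u 0 + u j - a)) = 0" if "u 0 < a" "u j < a" "a \<le> u 0 + u j" for a
      using that u j by (intro z sqsum_squeeze) auto
    have 2: "coef g (u(0 := u 0 + u j - a, j := a)) = 0" if "u 0 < a" "u j < a" "a \<le> u 0 + u j" for a
    proof -
      have "u(0 := u 0 + u j - a, j := a) = u(j := a, 0 := u j + u 0 - a)"
        using j by (auto simp: add.commute)
      moreover have "coef g (u(j := a, 0 := u j + u 0 - a)) = 0"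
        using that u j by (intro z sqsum_squeeze) auto
      ultimately show ?thesis
        by simp
    qed
    have "(\<Sum>a | u 0 < a \<and> u j \<le> a \<and> a \<le> u 0 + u j. coef g (u(0 := a, j := u 0 + u j - a)))
       = (\<Sum>a\<in>(if u j > u 0 then {u j} else {}). coef g (u(0 := a, j := u 0 + u j - a)))"
    proof (rule sum.mono_neutral_right)
      show "finite {a. u 0 < a \<and> u j \<le> a \<and> a \<le> u 0 + u j}"
        by (rule finite_subset[of _ "{..u 0 + u j}"]) auto
      show "(if u j > u 0 then {u j} else {}) \<subseteq> {a. u 0 < a \<and> u j \<le> a \<and> a \<le> u 0 + u j}"
        by auto
      show "\<forall>a\<in>{a. u 0 < a \<and> u j \<le> a \<and> a \<le> u 0 + u j} - (if u j > u 0 then {u j} else {}).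
          coef g (u(0 := a, j := u 0 + u j - a)) = 0"
      proof
        fix a assume "a \<in> {a. u 0 < a \<and> u j \<le> a \<and> a \<le> u 0 + u j} - (if u j > u 0 then {u j} else {})"
        then have "u 0 < a" "u j < a" "a \<le> u 0 + u j"
          by (auto split: if_splits intro!: le_neq_implies_less)
        then show "coef g (u(0 := a, j := u 0 + u j - a)) = 0"
          by (rule 1)
      qed
    qed
    moreover have "u(0 := u j, j := u 0) = u \<circ> transpose 0 j"
      by (auto simp: transpose_def fun_eq_iff)
    ultimately show ?thesis
      unfolding Lterm_def using 2 by (simp add: sum.neutral)
  qed
  have "coef (opL g) u = cont u * coef g u + (\<Sum>j\<in>supp u - {0}. Lterm (coef g) u j)"
    by (rule coef_opL[OF u(1) u(1) order_refl])
  also have "(\<Sum>j\<in>supp u - {0}. Lterm (coef g) u j) = (\<Sum>j\<in>supp u - {0}. if u j > u 0 then coef g (u \<circ> transpose 0 j) else 0)"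
    by (intro sum.cong refl L)
  also have "\<dots> = (\<Sum>j\<in>{j \<in> supp u - {0}. u j > u 0}. coef g (u \<circ> transpose 0 j))"
    using u(1) by (intro sum.inter_filter[symmetric]) simp
  also have "{j \<in> supp u - {0}. u j > u 0} = {j. u j > u 0}"
    by (auto intro!: gr0I)
  finally show ?thesis .
qed

section \<open>The spectrum of the Cherednik operator on an eigenspace\<close>

lemma eigsp_opL:
  assumes "ptn f" "g \<in> eigsp f"
  shows "opL g \<in> eigsp f"
proof -
  have "opD (opL g) = opL (opD g)"
    using assms(2) by (intro opD_opL_comm) (simp add: eigsp_def)
  then show ?thesis
    using assms opL_Lamx opL_below ptn_fs by (simp add: eigsp_def opL_mscale)
qed

lemma mscale_add_right: "mscale c (f + g) = mscale c f + mscale c (g :: ratfun mseries)"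
  by (rule coef_eqI) (simp add: algebra_simps)

lemma eigsp_add: "g \<in> eigsp f \<Longrightarrow> h \<in> eigsp f \<Longrightarrow> g + h \<in> eigsp f"
  by (simp add: eigsp_def Lamx_add below_add opD_add mscale_add_right)

lemma eigsp_mscale: "g \<in> eigsp f \<Longrightarrow> mscale c g \<in> eigsp f"
  by (simp add: eigsp_def Lamx_mscale below_mscale opD_mscale mult.commute)

lemma eigsp_0: "0 \<in> eigsp f"
  by (simp add: eigsp_def Lamx_0 below_def)

lemma eigsp_sum: "(\<And>x. x \<in> X \<Longrightarrow> h x \<in> eigsp f) \<Longrightarrow> sum h X \<in> eigsp f"
  by (induction X rule: infinite_finite_induct) (auto simp: eigsp_0 eigsp_add)

lemma eigsp_diff: "g \<in> eigsp f \<Longrightarrow> h \<in> eigsp f \<Longrightarrow> g - h \<in> eigsp f"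
  using eigsp_add[of g f "mscale (-1) h"] eigsp_mscale[of h f "-1"] by simp

text \<open>
  On the leading coefficients of an element of \<open>eigsp f\<close> the operator \<open>opL\<close> is triangular: exponent
  vectors are ordered by the row of \<open>f\<close> that the exponent of \<open>x\<^sub>0\<close> comes from, and the
  diagonal entry for row \<open>y\<close> is \<open>ct f y\<close>. Since elements of \<open>eigsp f\<close> are determined by their leading
  coefficients, \<open>opL\<close> is diagonalisable with these eigenvalues.
\<close>

definition eigsp_from :: "(nat \<Rightarrow> nat) \<Rightarrow> nat \<Rightarrow> ratfun mseries set" where
  "eigsp_from f y = {g \<in> eigsp f. \<forall>u. fs u \<longrightarrow> shape u = shape f \<longrightarrow> coef g u \<noteq> 0 \<longrightarrow> y \<le> card {j. u j > u 0}}"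

lemma shape_transpose: "fs u \<Longrightarrow> shape (u \<circ> transpose i j) = shape u"
  by (intro shape_comp_bij) simp_all

text \<open>The off-diagonal contributions come from vectors in which a larger exponent has been
  exchanged into position 0. Their row number is strictly smaller, so they vanish at the first row
  that is not yet cleared.\<close>

lemma eigsp_from_step:
  assumes f: "ptn f" and g: "g \<in> eigsp_from f y"
  shows "opL g - mscale (ct f y) g \<in> eigsp_from f (Suc y)"
proof -
  let ?r = "\<lambda>u::nat \<Rightarrow> nat. card {j. u j > u 0}"
  have gE: "g \<in> eigsp f" and gz: "\<And>u. fs u \<Longrightarrow> shape u = shape f \<Longrightarrow> ?r u < y \<Longrightarrow> coef g u = 0"
    using g by (auto simp: eigsp_from_def not_le[symmetric])
  have "coef (opL g - mscale (ct f y) g) u = 0" if u: "fs u" "shape u = shape f" "?r u \<le> y" for u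
  proof -
    have "coef g (u \<circ> transpose 0 j) = 0" if j: "u j > u 0" for j
    proof (rule gz)
      have "{i. u i > u j} \<subset> {i. u i > u 0}"
        using j by auto
      then have "card {i. u i > u j} < ?r u"
        using u(1) by (intro psubset_card_mono finite_subset[of "{i. u i > u 0}" "supp u"]) auto
      moreover have "?r (u \<circ> transpose 0 j) = card {i. u i > u j}"
        using card_shape[of "u \<circ> transpose 0 j" u "u j"] u(1) by (simp add: shape_transpose)
      ultimately show "?r (u \<circ> transpose 0 j) < y"
        using u(3) by simp
    qed (use u in \<open>simp_all add: shape_transpose\<close>)
    then have "coef (opL g) u = cont u * coef g u"
      using coef_opL_top[of f g u] gE u f by (simp add: eigsp_def ptn_fs)
    then show ?thesis
      using row_shape(3)[OF f u(1,2)] gz[OF u(1,2)] u(3) by (cases "?r u = y") auto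
  qed
  then show ?thesis
    using gE eigsp_opL[OF f gE] unfolding eigsp_from_def
    by (auto simp: Suc_le_eq not_le[symmetric] intro!: eigsp_diff eigsp_mscale)
qed

lemma eigsp_from_zero:
  assumes f: "ptn f" "f L = 0" and g: "g \<in> eigsp_from f (Suc L)"
  shows "g = 0"
proof (rule eigen_zero[OF ptn_fs[OF f(1)]])
  show "below f g" "opD g = mscale (eps f) g"
    using g by (simp_all add: eigsp_from_def eigsp_def)
  fix u assume u: "fs u" "shape u = shape f"
  have "card {j. u j > u 0} \<le> L"
    using addable_le[OF row_shape(2)[OF f(1) u] f(2)] .
  then show "coef g u = 0"
    using g u by (force simp: eigsp_from_def)
qed

text \<open>Subtracting \<open>ct f y\<close> times g from its image under \<open>opL\<close> leaves
  a vector that starts in a later row and is decomposed inductively. Dividing each of its pieces by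
  the difference of eigenvalues gives a correction of g that turns it into an eigenvector for row
  y.\<close>

lemma eigsp_from_decomp:
  assumes f: "ptn f" "f L = 0"
  shows "y + d = Suc L \<Longrightarrow> g \<in> eigsp_from f y \<Longrightarrow> \<exists>\<psi>. (\<forall>i. \<psi> i \<in> eigsp f \<and> opL (\<psi> i) = mscale (ct f i) (\<psi> i)) \<and> g = (\<Sum>i=y..L. \<psi> i)"
proof (induction d arbitrary: y g)
  case 0
  then have "g = 0"
    using eigsp_from_zero[OF f] by simp
  then show ?case
    using 0 by (intro exI[of _ "\<lambda>_. 0"]) (simp add: eigsp_0)
next
  case (Suc d)
  have "\<exists>\<phi>. (\<forall>i. \<phi> i \<in> eigsp f \<and> opL (\<phi> i) = mscale (ct f i) (\<phi> i)) \<and>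
      opL g - mscale (ct f y) g = (\<Sum>i=Suc y..L. \<phi> i)"
    using Suc.prems by (intro Suc.IH eigsp_from_step f) simp_all
  then obtain \<phi> where \<phi>: "\<And>i. \<phi> i \<in> eigsp f" "\<And>i. opL (\<phi> i) = mscale (ct f i) (\<phi> i)"
      "opL g - mscale (ct f y) g = (\<Sum>i=Suc y..L. \<phi> i)"
    by blast
  define \<chi> where "\<chi> i = mscale (1 / (ct f i - ct f y)) (\<phi> i)" for i
  define S where "S = (\<Sum>i=Suc y..L. \<chi> i)"
  have gE: "g \<in> eigsp f"
    using Suc.prems by (simp add: eigsp_from_def)
  have \<chi>: "\<chi> i \<in> eigsp f" "opL (\<chi> i) = mscale (ct f i) (\<chi> i)" for i
    using \<phi> by (simp_all add: \<chi>_def eigsp_mscale opL_mscale mult.commute)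
  have S: "S \<in> eigsp f"
    unfolding S_def by (intro eigsp_sum \<chi>)
  have "opL S - mscale (ct f y) S = (\<Sum>i=Suc y..L. opL (\<chi> i) - mscale (ct f y) (\<chi> i))"
    by (simp add: S_def opL_sum sum_subtractf mv.scale_sum_right)
  also have "\<dots> = (\<Sum>i=Suc y..L. \<phi> i)"
  proof (intro sum.cong refl)
    fix i assume "i \<in> {Suc y..L}"
    then have "ct f i - ct f y \<noteq> 0"
      using ct_inj[of f i f y] by auto
    then have e: "1 / (ct f i - ct f y) * ct f i - ct f y * (1 / (ct f i - ct f y)) = 1"
      by (simp add: diff_divide_distrib[symmetric])
    show "opL (\<chi> i) - mscale (ct f y) (\<chi> i) = \<phi> i"
      unfolding \<chi>_def opL_mscale \<phi>(2) mv.scale_scale mv.scale_left_diff_distrib[symmetric] e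
      by (rule mv.scale_one)
  qed
  finally have e: "opL S - mscale (ct f y) S = opL g - mscale (ct f y) g"
    by (simp only: \<phi>(3))
  have gS: "opL (g - S) = mscale (ct f y) (g - S)"
  proof -
    have "opL (g - S) = opL g - opL S"
      using opL_add[of "g - S" S] by simp
    also have "\<dots> = mscale (ct f y) g - mscale (ct f y) S"
      using e by (simp add: algebra_simps)
    finally show ?thesis
      by (simp add: mv.scale_right_diff_distrib)
  qed
  show ?case
  proof (intro exI conjI allI)
    let ?\<psi> = "\<chi>(y := g - S)"
    fix i
    show "?\<psi> i \<in> eigsp f" "opL (?\<psi> i) = mscale (ct f i) (?\<psi> i)"
      using \<chi> gS eigsp_diff[OF gE S] by auto
    have "(\<Sum>i=y..L. ?\<psi> i) = ?\<psi> y + (\<Sum>i=Suc y..L. ?\<psi> i)"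
      using Suc.prems by (intro sum.atLeast_Suc_atMost) simp
    also have "(\<Sum>i=Suc y..L. ?\<psi> i) = S"
      unfolding S_def by (intro sum.cong) auto
    finally show "g = (\<Sum>i=y..L. ?\<psi> i)"
      by simp
  qed
qed

text \<open>A leading vector of \<open>g\<close> with the largest exponent of x_0 receives no
  off-diagonal contribution, since these come from still larger exponents at x_0. So the eigenvalue
  is its diagonal entry, the content of an addable row.\<close>

lemma eigen_opL:
  assumes f: "ptn f" and g: "g \<in> eigsp f" "opL g = mscale \<rho> g" "g \<noteq> 0"
  obtains y where "addable f y" "\<rho> = ct f y"
    "\<And>u. fs u \<Longrightarrow> shape u = shape f \<Longrightarrow> coef g u \<noteq> 0 \<Longrightarrow> u 0 \<le> f y"
proof -
  let ?P = "\<lambda>u. fs u \<and> shape u = shape f \<and> coef g u \<noteq> 0"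
  have E: "below f g" "opD g = mscale (eps f) g"
    using g by (simp_all add: eigsp_def)
  obtain u0 where "?P u0"
    using eigen_zero[OF ptn_fs[OF f] E] g(3) by blast
  moreover have "\<forall>u. ?P u \<longrightarrow> u 0 < Suc (deg f)"
    using le_deg belowD[OF E(1)] by (metis dom_def less_Suc_eq_le)
  ultimately obtain u where u: "?P u" and max: "\<forall>v. ?P v \<longrightarrow> v 0 \<le> u 0"
    using ex_has_greatest_nat[of ?P u0 "\<lambda>u. u 0" "Suc (deg f)"] by blast
  let ?y = "card {j. u j > u 0}"
  have "coef g (u \<circ> transpose 0 j) = 0" if j: "u j > u 0" for j
  proof (rule ccontr)
    assume "coef g (u \<circ> transpose 0 j) \<noteq> 0"
    then have "(u \<circ> transpose 0 j) 0 \<le> u 0"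
      using u max by (simp only: fs_comp_transpose shape_transpose simp_thms)
    then show False
      using j by simp
  qed
  then have "coef (opL g) u = cont u * coef g u"
    using coef_opL_top[OF E(1) ptn_fs[OF f], of u] u by simp
  then have "\<rho> = cont u"
    using g(2) u by simp
  show thesis
  proof (rule that)
    show "addable f ?y" "\<rho> = ct f ?y"
      using row_shape(2,3)[OF f] u \<open>\<rho> = cont u\<close> by auto
    fix v assume "fs v" "shape v = shape f" "coef g v \<noteq> 0"
    then show "v 0 \<le> f ?y"
      using max row_shape(1)[OF f] u by simp
  qed
qed

lemma card_addable:
  assumes "ptn f" "addable f y"
  shows "{j. f j > f y} = {..<y}"
proof (intro set_eqI iffI)
  fix j assume "j \<in> {j. f j > f y}"
  then have "\<not> f j \<le> f y"
    by simp
  then show "j \<in> {..<y}"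
    using ptn_le[OF assms(1), of y j] by (meson lessThan_iff not_le)
qed (use assms in \<open>simp add: addable_def\<close>)

lemma eps_add:
  assumes f: "ptn f" and y: "addable f y"
  shows "eps (add_box f y) = eps f + ct f y"
proof -
  \<comment> \<open>Row y is moved to position 0, where \<open>eps_step\<close> applies, and moved
    back afterwards; \<open>eps\<close> depends on the shape alone.\<close>
  let ?u = "f \<circ> transpose 0 y"
  have fs: "fs f"
    by (rule ptn_fs[OF f])
  have "cont ?u = ct f y"
    using card_shape[of ?u f "f y"] card_addable[OF f y] fs by (simp add: cont_def ct_def shape_transpose)
  moreover have "eps ?u = eps f"
    using fs by (intro eps_cong_shape shape_transpose)
  moreover have "?u(0 := Suc (?u 0)) = add_box f y \<circ> transpose 0 y"
    unfolding add_box_def upd_comp_transpose by simp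
  moreover have "eps (add_box f y \<circ> transpose 0 y) = eps (add_box f y)"
    using fs by (intro eps_cong_shape shape_transpose) (simp add: add_box_def)
  moreover have "eps (?u(0 := Suc (?u 0))) = eps ?u + cont ?u"
    using fs by (intro eps_step) simp
  ultimately show ?thesis
    by simp
qed

lemma dom_transpose:
  assumes u: "fs u" and d: "dom (u \<circ> transpose i j) f"
  shows "dom u f"
  unfolding dom_def
proof (intro conjI allI impI)
  have "deg (u \<circ> transpose i j) = deg u"
    using shape_transpose[OF u] by (simp only: flip: sum_mset_shape)
  then show "deg u = deg f"
    using d by (simp add: dom_def)
  fix S :: "nat set" assume S: "finite S"
  have "sum (u \<circ> transpose i j) (transpose i j ` S) = sum u S"
    by (subst sum.reindex) (simp_all add: comp_assoc)
  moreover have "sum (u \<circ> transpose i j) (transpose i j ` S) \<le> partial_sum f (card (transpose i j ` S))"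
    using d S by (simp only: dom_def finite_imageI)
  moreover have "card (transpose i j ` S) = card S"
    by (intro card_image) simp
  ultimately show "sum u S \<le> partial_sum f (card S)"
    by simp
qed

text \<open>On an eigenvector of \<open>opL\<close> the sum of \<open>opD\<close> and
  \<open>opL\<close> acts by the eigenvalue of the enlarged shape, and both x_0 g and its
  symmetrisation inherit that eigenvalue under \<open>opD\<close>. The dominance bound comes from
  \<open>eigen_below_var0\<close>.\<close>

lemma eigsp_add_box:
  assumes f: "ptn f" and g: "g \<in> eigsp f" "opL g = mscale (ct f y) g" "g \<noteq> 0"
  shows "addable f y" "var0 * g \<in> eigsp (add_box f y)"
    and "opA g \<in> Lam" "below (add_box f y) (opA g)" "opD (opA g) = mscale (eps (add_box f y)) (opA g)"
proof -
  have E: "g \<in> Lamx" "below f g" "opD g = mscale (eps f) g"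
    using g by (simp_all add: eigsp_def)
  obtain z where z: "addable f z" "ct f y = ct f z"
      and top: "\<And>u. fs u \<Longrightarrow> shape u = shape f \<Longrightarrow> coef g u \<noteq> 0 \<Longrightarrow> u 0 \<le> f z"
    using eigen_opL[OF f g] by metis
  then have "z = y"
    using ct_inj by metis
  with z top show y: "addable f y"
    by simp
  have d: "dom (u(0 := Suc (u 0))) (add_box f y)" if "fs u" "coef g u \<noteq> 0" for u
    unfolding add_box_def
    by (rule eigen_below_var0[OF f E(2,3) _ _ that])
      (use y top \<open>z = y\<close> in \<open>auto simp: addable_def\<close>)
  have ev: "opD g + opL g = mscale (eps (add_box f y)) g"
    unfolding E(3) g(2) eps_add[OF f y] by (simp add: mv.scale_left_distrib)
  have "below (add_box f y) (var0 * g)"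
    unfolding below_def
  proof (intro allI impI)
    fix u assume u: "fs u" "coef (var0 * g) u \<noteq> 0"
    then have "u 0 \<noteq> 0" "coef g (u(0 := u 0 - 1)) \<noteq> 0"
      by (auto simp: coef_var0_mult split: if_splits)
    then show "dom u (add_box f y)"
      using d[of "u(0 := u 0 - 1)"] u by simp
  qed
  moreover have "opD (var0 * g) = mscale (eps (add_box f y)) (var0 * g)"
    unfolding opD_var0 ev by (rule mscale_mult_right)
  ultimately show "var0 * g \<in> eigsp (add_box f y)"
    using Lamx_var0_mult[OF E(1)] by (simp add: eigsp_def)
  show "opA g \<in> Lam"
    using E(1) by (rule opA_Lamx)
  show "opD (opA g) = mscale (eps (add_box f y)) (opA g)"
    unfolding opD_opA ev by (rule opA_mscale)
  show "below (add_box f y) (opA g)"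
    unfolding below_def
  proof (intro allI impI)
    fix w assume w: "fs w" "coef (opA g) w \<noteq> 0"
    then obtain i where i: "i \<in> supp w" "coef g (w(i := w i - 1) \<circ> transpose 0 i) \<noteq> 0"
      unfolding coef_opA[OF w(1)] by (auto elim: sum.not_neutral_contains_not_neutral)
    let ?u = "w(i := w i - 1) \<circ> transpose 0 i"
    have "?u(0 := Suc (?u 0)) = w \<circ> transpose 0 i"
      using i(1) unfolding upd_comp_transpose by (auto simp: fun_eq_iff transpose_def)
    moreover have "dom (?u(0 := Suc (?u 0))) (add_box f y)"
      by (rule d[OF _ i(2)]) (simp only: fs_comp_transpose fs_upd w(1))
    ultimately show "dom w (add_box f y)"
      using dom_transpose[OF w(1)] by simp
  qed
qed

section \<open>Pieri coefficients as unknowns\<close>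

context jack
begin

lemma eigen_JJ:
  assumes f: "ptn f" and F: "F \<in> Lam" "below f F" "opD F = mscale (eps f) F"
  obtains c where "F = mscale c (JJ f)"
proof -
  define c where "c = coef F f / coef (JJ f) f"
  have "F - mscale c (JJ f) = 0"
  proof (rule eigen_zero[OF ptn_fs[OF f]])
    show "below f (F - mscale c (JJ f))"
      using below_add[OF F(2) below_mscale[OF JJ_below[OF f], of "- c"]] by simp
    have "opD (F - mscale c (JJ f)) = opD F - opD (mscale c (JJ f))"
      using opD_add[of "F - mscale c (JJ f)" "mscale c (JJ f)"] by simp
    then show "opD (F - mscale c (JJ f)) = mscale (eps f) (F - mscale c (JJ f))"
      unfolding opD_mscale F(3) JJ_eigen[OF f] by (simp add: mv.scale_right_diff_distrib mult.commute)
    fix u assume "fs u" "shape u = shape f"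
    then have "coef F u = coef F f" "coef (JJ f) u = coef (JJ f) f"
      using ptn_fs[OF f] by (auto intro!: symD sym_Lam F JJ_Lam)
    then show "coef (F - mscale c (JJ f)) u = 0"
      using JJ_lead[OF f] by (simp add: c_def)
  qed
  then show thesis
    by (intro that[of c]) simp
qed

lemma JJ_eigsp: "ptn f \<Longrightarrow> JJ f \<in> eigsp f"
  by (simp add: eigsp_def JJ_below JJ_eigen Lam_Lamx JJ_Lam)

text \<open>Each piece symmetrises to one term of the Pieri rule. The decomposition is stated for
  every L beyond the last row at once, since addable rows never exceed such an L.\<close>

lemma ex_psi:
  assumes f: "ptn f"
  shows "\<exists>\<psi>. (\<forall>y. \<psi> y \<in> eigsp f \<and> opL (\<psi> y) = mscale (ct f y) (\<psi> y) \<and> (\<not> addable f y \<longrightarrow> \<psi> y = 0)) \<and>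
    (\<forall>L. f L = 0 \<longrightarrow> JJ f = (\<Sum>y\<le>L. \<psi> y))"
proof -
  obtain L where L: "f L = 0"
    using supp_ptn[OF f] by (metis in_supp lessThan_iff less_irrefl)
  have "JJ f \<in> eigsp_from f 0"
    using JJ_eigsp[OF f] by (simp add: eigsp_from_def)
  then obtain \<psi> where \<psi>: "\<And>y. \<psi> y \<in> eigsp f" "\<And>y. opL (\<psi> y) = mscale (ct f y) (\<psi> y)" "JJ f = (\<Sum>y=0..L. \<psi> y)"
    using eigsp_from_decomp[of f L 0 "Suc L" "JJ f"] f L by auto
  have z: "\<psi> y = 0" if "\<not> addable f y" for y
    using eigsp_add_box(1)[OF f \<psi>(1,2)] that by blast
  have "JJ f = (\<Sum>y\<le>M. \<psi> y)" if M: "f M = 0" for M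
  proof -
    have "(\<Sum>y\<le>M. \<psi> y) = (\<Sum>y\<le>max L M. \<psi> y)"
      using addable_le[of f _ M] M z by (intro sum.mono_neutral_left) auto
    also have "\<dots> = (\<Sum>y\<le>L. \<psi> y)"
      using addable_le[of f _ L] L z by (intro sum.mono_neutral_right) auto
    finally show ?thesis
      using \<psi>(3) by (simp add: atLeast0AtMost)
  qed
  then show ?thesis
    using \<psi> z by blast
qed

definition psi :: "(nat \<Rightarrow> nat) \<Rightarrow> nat \<Rightarrow> ratfun mseries" where
  "psi f = (SOME \<psi>. (\<forall>y. \<psi> y \<in> eigsp f \<and> opL (\<psi> y) = mscale (ct f y) (\<psi> y) \<and> (\<not> addable f y \<longrightarrow> \<psi> y = 0)) \<and>
    (\<forall>L. f L = 0 \<longrightarrow> JJ f = (\<Sum>y\<le>L. \<psi> y)))"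

lemma psi:
  assumes "ptn f"
  shows psi_eigsp: "psi f y \<in> eigsp f" and psi_opL: "opL (psi f y) = mscale (ct f y) (psi f y)"
    and psi_nonaddable: "\<not> addable f y \<Longrightarrow> psi f y = 0"
    and JJ_psi: "f L = 0 \<Longrightarrow> JJ f = (\<Sum>y\<le>L. psi f y)"
  using someI_ex[OF ex_psi[OF assms]] unfolding psi_def[symmetric] by blast+

text \<open>Jack functions are normalised at the squarefree monomial, so the multiple of
  \<open>JJ (add_box f y)\<close> contained in \<open>opA (psi f y)\<close> is read off
  there.\<close>

definition pieri :: "(nat \<Rightarrow> nat) \<Rightarrow> nat \<Rightarrow> ratfun" where
  "pieri f y = coef (opA (psi f y)) (ones (Suc (deg f))) / of_nat (fact (Suc (deg f)))"

lemma pieri_nonaddable: "ptn f \<Longrightarrow> \<not> addable f y \<Longrightarrow> pieri f y = 0"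
  by (simp add: pieri_def psi_nonaddable)

lemma deg_add: "ptn f \<Longrightarrow> deg (add_box f y) = Suc (deg f)"
  by (simp add: add_box_def deg_upd_Suc ptn_fs)

lemma opA_psi:
  assumes f: "ptn f"
  shows "opA (psi f y) = mscale (pieri f y) (JJ (add_box f y))"
proof (cases "psi f y = 0")
  case True
  then show ?thesis
    by (simp add: pieri_def)
next
  case False
  note E = eigsp_add_box[OF f psi_eigsp[OF f] psi_opL[OF f] False]
  obtain c where c: "opA (psi f y) = mscale c (JJ (add_box f y))"
    using eigen_JJ[OF ptn_add[OF f E(1)] E(3-5)] .
  have "coef (opA (psi f y)) (ones (Suc (deg f))) = c * of_nat (fact (Suc (deg f)))"
    using JJ_ones[of "add_box f y"] unfolding c coef_mscale deg_add[OF f] by simp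
  then have "pieri f y = c"
    by (simp add: pieri_def fact_nonzero del: fact_Suc)
  then show ?thesis
    using c by simp
qed

lemma p1_JJ:
  assumes f: "ptn f" "f L = 0"
  shows "power_sum 1 * JJ f = (\<Sum>y\<le>L. mscale (pieri f y) (JJ (add_box f y)))"
proof -
  have "opA (JJ f) = (\<Sum>y\<le>L. opA (psi f y))"
    unfolding JJ_psi[of f L, OF f] by (rule opA_sum)
  then show ?thesis
    by (simp only: opA_sym[OF JJ_sym] opA_psi[OF f(1)])
qed

end

section \<open>Lagrange interpolation\<close>

definition root_poly :: "('b \<Rightarrow> 'a) \<Rightarrow> 'b set \<Rightarrow> 'a::field poly" where
  "root_poly c S = (\<Prod>i\<in>S. [:- c i, 1:])"

lemma poly_root_poly: "poly (root_poly c S) x = (\<Prod>i\<in>S. x - c i)"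
  by (simp add: root_poly_def poly_prod algebra_simps)

lemma degree_root_poly: "degree (root_poly c S) = card S"
  unfolding root_poly_def by (subst degree_prod_eq_sum_degree) auto

lemma coeff_root_poly_card: "coeff (root_poly c S) (card S) = 1"
  using lead_coeff_prod[of "\<lambda>i. [:- c i, 1:]" S] degree_root_poly[of c S] by (simp add: root_poly_def)

lemma poly_interp:
  assumes S: "finite S" "inj_on c S" and y: "y \<in> S"
  shows "poly (\<Sum>x\<in>S. smult (B x) (root_poly c (S - {x}))) (c y) = B y * (\<Prod>i\<in>S - {y}. c y - c i)"
proof -
  have "B x * poly (root_poly c (S - {x})) (c y) = 0" if "x \<in> S - {y}" for x
    unfolding poly_root_poly using S y that by (subst prod_zero) auto
  then have "(\<Sum>x\<in>S. B x * poly (root_poly c (S - {x})) (c y)) = (\<Sum>x\<in>{y}. B x * poly (root_poly c (S - {x})) (c y))"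
    using S y by (intro sum.mono_neutral_right) auto
  then show ?thesis
    by (simp add: poly_sum poly_root_poly)
qed

lemma degree_interp:
  assumes "finite S" "card S = Suc k"
  shows "degree (\<Sum>x\<in>S. smult (B x) (root_poly c (S - {x}))) \<le> k"
    and "coeff (\<Sum>x\<in>S. smult (B x) (root_poly c (S - {x}))) k = (\<Sum>x\<in>S. B x)"
proof -
  have k: "card (S - {x}) = k" if "x \<in> S" for x
    using assms that by simp
  show "degree (\<Sum>x\<in>S. smult (B x) (root_poly c (S - {x}))) \<le> k"
    using assms(1) by (rule degree_sum_le) (use k degree_root_poly[of c] degree_smult_le in \<open>metis\<close>)
  have "coeff (root_poly c (S - {x})) k = 1" if "x \<in> S" for x
    using coeff_root_poly_card[of c "S - {x}"] k[OF that] by simp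
  then show "coeff (\<Sum>x\<in>S. smult (B x) (root_poly c (S - {x}))) k = (\<Sum>x\<in>S. B x)"
    by (simp add: coeff_sum)
qed

text \<open>The polynomial with coefficients \<delta> in the Lagrange basis at the nodes c is monic
  of degree L by the first condition and vanishes at the L points b by the second. So it is the
  product over the b, and evaluation at \<open>c y\<close> isolates one coefficient.\<close>

lemma interp_zeros:
  fixes c b \<delta> :: "nat \<Rightarrow> 'a::field"
  assumes c: "inj_on c {..L}" and b: "inj_on b {..<L}" and 1: "(\<Sum>y\<le>L. \<delta> y) = 1"
    and 0: "\<And>j. j < L \<Longrightarrow> (\<Sum>y\<le>L. \<delta> y * (\<Prod>i\<in>{..L} - {y}. b j - c i)) = 0" and y: "y \<le> L"
  shows "\<delta> y * (\<Prod>i\<in>{..L} - {y}. c y - c i) = (\<Prod>j<L. c y - b j)"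
proof -
  let ?Q = "\<Sum>x\<in>{..L}. smult (\<delta> x) (root_poly c ({..L} - {x}))"
  note d = degree_interp[of "{..L}" L \<delta> c]
  have "?Q = root_poly b {..<L}"
  proof (rule poly_eqI_degree_lead_coeff[where n = L and A = "b ` {..<L}"])
    show "coeff ?Q L = coeff (root_poly b {..<L}) L"
      using d(2) 1 coeff_root_poly_card[of b "{..<L}"] by simp
    fix z assume "z \<in> b ` {..<L}"
    then obtain j where j: "j < L" "z = b j"
      by auto
    then have "poly (root_poly b {..<L}) z = 0"
      by (auto simp: poly_root_poly)
    then show "poly ?Q z = poly (root_poly b {..<L}) z"
      using 0[OF j(1)] j(2) by (simp add: poly_sum poly_root_poly)
  qed (use d b in \<open>simp_all add: degree_root_poly card_image\<close>)
  then have "poly ?Q (c y) = (\<Prod>j<L. c y - b j)"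
    by (simp add: poly_root_poly)
  then show ?thesis
    using poly_interp[of "{..L}" c y \<delta>] c y by simp
qed

text \<open>The leading coefficient of the interpolation polynomial, which is R itself by the bound
  on the degree.\<close>

lemma divided_difference:
  fixes c :: "'b \<Rightarrow> 'a::field"
  assumes S: "finite S" "card S = Suc k" and c: "inj_on c S" and R: "degree R \<le> k"
  shows "(\<Sum>y\<in>S. poly R (c y) / (\<Prod>i\<in>S - {y}. c y - c i)) = coeff R k"
proof -
  define B where "B y = poly R (c y) / (\<Prod>i\<in>S - {y}. c y - c i)" for y
  let ?Q = "\<Sum>x\<in>S. smult (B x) (root_poly c (S - {x}))"
  note d = degree_interp[OF S, of B c]
  have "R = ?Q"
  proof (rule poly_eqI_degree[where A = "c ` S"])
    fix z assume "z \<in> c ` S"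
    then obtain y where y: "y \<in> S" "z = c y"
      by auto
    have "(\<Prod>i\<in>S - {y}. c y - c i) \<noteq> 0"
      using S y c by (auto simp: inj_on_def)
    then show "poly R z = poly ?Q z"
      unfolding y(2) poly_interp[OF S(1) c y(1)] by (simp add: B_def)
  qed (use R d c S in \<open>simp_all add: card_image\<close>)
  then have "coeff R k = (\<Sum>y\<in>S. B y)"
    using d(2) by metis
  then show ?thesis
    by (simp add: B_def)
qed

context jack
begin

lemma sum_del:
  assumes f: "ptn f" "f L = 0"
  shows "(\<Sum>y\<le>L. pieri f y) = 1"
proof -
  let ?n = "Suc (deg f)"
  have "coef (power_sum 1 * JJ f) (ones ?n) = of_nat (fact ?n)"
    using ones_power_sum_1[OF JJ_sym, of f "deg f"] JJ_ones[of f] by (simp add: algebra_simps)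
  moreover have "coef (power_sum 1 * JJ f) (ones ?n) = (\<Sum>y\<le>L. pieri f y * of_nat (fact ?n))"
  proof -
    have "coef (JJ (add_box f y)) (ones ?n) = of_nat (fact ?n)" for y
      using JJ_ones[of "add_box f y"] by (simp only: deg_add[OF f(1)])
    then show ?thesis
      unfolding p1_JJ[of f L, OF f] coef_sum coef_mscale by (simp only:)
  qed
  ultimately have "(\<Sum>y\<le>L. pieri f y) * of_nat (fact ?n) = of_nat (fact ?n)"
    by (simp only: sum_distrib_right)
  then show ?thesis
    by (simp add: fact_nonzero del: fact_Suc)
qed

text \<open>
  The series \<open>x\<^sub>0 psi k r\<close> is an eigenvector of \<open>opL\<close> up to a multiple of \<open>JJ f\<close>, which a combination of
  the \<open>psi f y\<close> corrects. The eigenvalue does not occur on \<open>eigsp f\<close>, so the corrected series vanishes,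
  and one reads off the coefficient of \<open>x\<^sub>0 x\<^sub>1 \<cdots>\<close> after applying \<open>opA\<close>.
\<close>

lemma pieri_zero_identity:
  assumes k: "ptn k" "addable k r" "pieri k r \<noteq> 0" and f: "f = add_box k r" "f L = 0"
  shows "(\<Sum>y\<le>L. pieri f y / (ct f r - 1 - ct f y)) = 0"
proof -
  let ?\<rho> = "ct f r - 1"
  define \<phi> where "\<phi> = (\<Sum>y\<le>L. mscale (1 / (?\<rho> - ct f y)) (psi f y))"
  define G where "G = var0 * psi k r + mscale (pieri k r) \<phi>"
  have pf: "ptn f"
    unfolding f(1) by (rule ptn_add[OF k(1,2)])
  \<comment> \<open>A coincidence would force y = r + 1 and \<open>f (Suc r) = f r\<close>, but the
    box just added makes row r of \<open>f\<close> longer than row r + 1.\<close>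
  have ne: "?\<rho> \<noteq> ct f y" for y
  proof
    assume a: "?\<rho> = ct f y"
    then have "alpha * of_int (int (f r) - int (f y)) = of_int (int r + 1 - int y)"
      by (simp add: ct_def algebra_simps)
    from alpha_generic[OF this] have "f r = f y" "y = Suc r"
      by linarith+
    then show False
      using ptn_le[OF k(1), of r "Suc r"] by (simp add: f add_box_def)
  qed
  have nz: "psi k r \<noteq> 0"
    using k(3) by (auto simp: pieri_def)
  have xE: "var0 * psi k r \<in> eigsp f"
    unfolding f(1) by (rule eigsp_add_box(2)[OF k(1) psi_eigsp[OF k(1)] psi_opL[OF k(1)] nz])
  have \<phi>E: "\<phi> \<in> eigsp f"
    unfolding \<phi>_def by (intro eigsp_sum eigsp_mscale psi_eigsp pf)
  have cr: "ct k r + (alpha - 1) = ?\<rho>"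
    by (simp add: f(1) ct_def add_box_def algebra_simps)
  have Lx: "opL (var0 * psi k r) = mscale ?\<rho> (var0 * psi k r) + mscale (pieri k r) (JJ f)"
    unfolding opL_var0 psi_opL[OF k(1)] opA_psi[OF k(1)] mscale_mult_right f(1)[symmetric] cr[symmetric]
    by (simp only: mv.scale_left_distrib)
  have L\<phi>: "opL \<phi> = mscale ?\<rho> \<phi> - JJ f"
  proof -
    have "opL \<phi> = (\<Sum>y\<le>L. mscale (1 / (?\<rho> - ct f y) * ct f y) (psi f y))"
      unfolding \<phi>_def opL_sum opL_mscale psi_opL[OF pf] mv.scale_scale ..
    also have "\<dots> = (\<Sum>y\<le>L. mscale ?\<rho> (mscale (1 / (?\<rho> - ct f y)) (psi f y)) - psi f y)"
    proof (intro sum.cong refl)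
      fix y
      have e: "1 / (?\<rho> - ct f y) * ct f y = ?\<rho> * (1 / (?\<rho> - ct f y)) - 1"
        using ne[of y] by (simp add: divide_simps)
      show "mscale (1 / (?\<rho> - ct f y) * ct f y) (psi f y)
          = mscale ?\<rho> (mscale (1 / (?\<rho> - ct f y)) (psi f y)) - psi f y"
        unfolding e mv.scale_left_diff_distrib mv.scale_scale mv.scale_one ..
    qed
    also have "\<dots> = mscale ?\<rho> \<phi> - JJ f"
      unfolding \<phi>_def JJ_psi[of f L, OF pf f(2)] sum_subtractf mv.scale_sum_right ..
    finally show ?thesis .
  qed
  have LG: "opL G = mscale ?\<rho> G"
    unfolding G_def opL_add opL_mscale Lx L\<phi>
    by (simp add: mv.scale_right_distrib mv.scale_right_diff_distrib mult.commute)
  have "G = 0"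
  proof (rule ccontr)
    assume G: "G \<noteq> 0"
    have "G \<in> eigsp f"
      unfolding G_def by (intro eigsp_add xE eigsp_mscale \<phi>E)
    then obtain y where "?\<rho> = ct f y"
      using eigen_opL[OF pf _ LG G] by metis
    then show False
      using ne by blast
  qed
  have "opA G = opA (var0 * psi k r) + mscale (pieri k r) (opA \<phi>)"
    by (simp only: G_def opA_add opA_mscale)
  then have "coef (opA (var0 * psi k r)) (ones (Suc (deg f))) + pieri k r * coef (opA \<phi>) (ones (Suc (deg f))) = 0"
    using \<open>G = 0\<close> by (metis coef_add coef_mscale coef_zero opA_0)
  then have "coef (opA \<phi>) (ones (Suc (deg f))) = 0"
    using k(3) by (simp add: ones_opA_var0)
  moreover have "coef (opA \<phi>) (ones (Suc (deg f))) =
      (\<Sum>y\<le>L. pieri f y / (?\<rho> - ct f y)) * of_nat (fact (Suc (deg f)))"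
    unfolding \<phi>_def opA_sum coef_sum opA_mscale coef_mscale sum_distrib_right
    by (intro sum.cong refl) (simp add: pieri_def fact_nonzero del: fact_Suc)
  ultimately show ?thesis
    by (simp add: fact_nonzero del: fact_Suc)
qed

text \<open>The interpolation points are the contents reduced by 1. If row j has a removable box,
  the vanishing there is \<open>pieri_zero_identity\<close> for the smaller diagram, whose
  coefficient is nonzero by induction. Otherwise \<open>ct f j - 1\<close> is the content of row j +
  1: it annihilates every product that contains its factor, and the one remaining term belongs to a
  row that is not addable.\<close>

lemma pieri_eq:
  assumes "ptn f" "f L = 0" "y \<le> L"
  shows "pieri f y * (\<Prod>i\<in>{..L} - {y}. ct f y - ct f i) = (\<Prod>j<L. ct f y - (ct f j - 1))"
    and "addable f y \<Longrightarrow> pieri f y \<noteq> 0"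
proof -
  have nz: "(\<Prod>j<L. ct f y - (ct f j - 1)) \<noteq> 0" if a: "addable f y" for f :: "nat \<Rightarrow> nat" and y L
  proof
    assume "(\<Prod>j<L. ct f y - (ct f j - 1)) = 0"
    then obtain j where "ct f y - (ct f j - 1) = 0"
      by auto
    then have "alpha * of_int (int (f y) - int (f j)) = of_int (int y - int j - 1)"
      by (simp add: ct_def algebra_simps)
    from alpha_generic[OF this] have "f y = f j" "y = Suc j"
      by linarith+
    then show False
      using a by (auto simp: addable_def)
  qed
  show *: "pieri f y * (\<Prod>i\<in>{..L} - {y}. ct f y - ct f i) = (\<Prod>j<L. ct f y - (ct f j - 1))"
    using assms
  proof (induction "deg f" arbitrary: f y rule: less_induct)
    case less
    note f = less.prems(1,2)
    show ?case
    proof (rule interp_zeros)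
      show "inj_on (ct f) {..L}" "inj_on (\<lambda>j. ct f j - 1) {..<L}"
        using ct_inj by (auto simp: inj_on_def)
      show "(\<Sum>y\<le>L. pieri f y) = 1"
        by (rule sum_del[of f L, OF f])
      show "y \<le> L"
        by fact
      fix j assume j: "j < L"
      show "(\<Sum>y\<le>L. pieri f y * (\<Prod>i\<in>{..L} - {y}. ct f j - 1 - ct f i)) = 0"
      proof (cases "f (Suc j) = f j")
        case True
        have c: "ct f j - 1 = ct f (Suc j)"
          using True by (simp add: ct_def)
        have "pieri f x * (\<Prod>i\<in>{..L} - {x}. ct f j - 1 - ct f i) = 0" if "x \<le> L" for x
        proof (cases "x = Suc j")
          case True
          then show ?thesis
            using \<open>f (Suc j) = f j\<close> pieri_nonaddable[OF f(1), of x] by (auto simp: addable_def)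
        next
          case False
          have "(\<Prod>i\<in>{..L} - {x}. ct f (Suc j) - ct f i) = 0"
            using j False by (intro prod_zero bexI[of _ "Suc j"]) auto
          then show ?thesis
            unfolding c by simp
        qed
        then show ?thesis
          by (intro sum.neutral) auto
      next
        case False
        then have lt: "f (Suc j) < f j"
          using ptn_le[OF f(1), of j "Suc j"] by simp
        define k where "k = rem_box f j"
        have k: "ptn k" "addable k j" "f = add_box k j"
          using rem_box[OF f(1) lt] by (simp_all add: k_def)
        have kL: "k L = 0"
          using f(2) j by (simp add: k_def rem_box_def)
        have "deg k < deg f"
          using deg_add[OF k(1), of j] k(3) by simp
        then have "pieri k j * (\<Prod>i\<in>{..L} - {j}. ct k j - ct k i) = (\<Prod>i<L. ct k j - (ct k i - 1))"
          using k(1) kL j by (intro less.hyps) auto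
        then have "pieri k j \<noteq> 0"
          using nz[OF k(2), of L] by auto
        then have z: "(\<Sum>y\<le>L. pieri f y / (ct f j - 1 - ct f y)) = 0"
          using k f(2) by (intro pieri_zero_identity)
        have ne: "ct f j - 1 - ct f y \<noteq> 0" for y
        proof
          assume "ct f j - 1 - ct f y = 0"
          then have "alpha * of_int (int (f j) - int (f y)) = of_int (int j + 1 - int y)"
            by (simp add: ct_def algebra_simps)
          from alpha_generic[OF this] have "f j = f y" "y = Suc j"
            by linarith+
          then show False
            using lt by simp
        qed
        have "(\<Sum>y\<le>L. pieri f y * (\<Prod>i\<in>{..L} - {y}. ct f j - 1 - ct f i)) =
            (\<Sum>y\<le>L. pieri f y / (ct f j - 1 - ct f y)) * (\<Prod>i\<le>L. ct f j - 1 - ct f i)"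
          unfolding sum_distrib_right
        proof (intro sum.cong refl)
          fix y assume "y \<in> {..L}"
          then have "(\<Prod>i\<le>L. ct f j - 1 - ct f i) = (ct f j - 1 - ct f y) * (\<Prod>i\<in>{..L} - {y}. ct f j - 1 - ct f i)"
            by (intro prod.remove) auto
          then show "pieri f y * (\<Prod>i\<in>{..L} - {y}. ct f j - 1 - ct f i) =
              pieri f y / (ct f j - 1 - ct f y) * (\<Prod>i\<le>L. ct f j - 1 - ct f i)"
            using ne[of y] by simp
        qed
        then show ?thesis
          using z by simp
      qed
    qed
  qed
  show "pieri f y \<noteq> 0" if "addable f y"
    using * nz[OF that, of L] by auto
qed

end

section \<open>Lattice paths and hook products\<close>

lemma sum_telescope_up:
  fixes \<psi> :: "nat \<Rightarrow> 'b::comm_monoid_add"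
  shows "u \<le> w \<Longrightarrow> (\<Sum>i=u..<w. \<psi> (Suc i)) + \<psi> u = \<psi> w + (\<Sum>i=u..<w. \<psi> i)"
proof (induction w rule: dec_induct)
  case (step w)
  have "(\<Sum>i=u..<Suc w. \<psi> (Suc i)) + \<psi> u = ((\<Sum>i=u..<w. \<psi> (Suc i)) + \<psi> u) + \<psi> (Suc w)"
    using step.hyps by (simp add: ac_simps)
  then show ?case
    unfolding step.IH using step.hyps by (simp add: ac_simps)
qed simp

text \<open>The boundary of a Young diagram, traversed from \<open>(u, q)\<close> to \<open>(v, p)\<close>: every lattice point is the
  end of one step and the start of the next.\<close>

lemma path_sum:
  fixes \<psi> :: "nat \<Rightarrow> nat \<Rightarrow> 'b::cancel_comm_monoid_add"
  assumes "p \<le> q" "u \<le> v"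
    and "\<And>j. p \<le> j \<Longrightarrow> j < q \<Longrightarrow> u \<le> k j \<and> k j \<le> v"
    and "\<And>i j. p \<le> i \<Longrightarrow> i \<le> j \<Longrightarrow> j < q \<Longrightarrow> k j \<le> k i"
  shows "(\<Sum>i=u..<v. \<psi> (Suc i) (p + card {j \<in> {p..<q}. i < k j})) + (\<Sum>j=p..<q. \<psi> (k j) j) + \<psi> u q
      = \<psi> v p + (\<Sum>i=u..<v. \<psi> i (p + card {j \<in> {p..<q}. i < k j})) + (\<Sum>j=p..<q. \<psi> (k j) (Suc j))"
  using assms
proof (induction q rule: dec_induct)
  case base
  then show ?case
    using sum_telescope_up[of u v "\<lambda>i. \<psi> i p"] by simp
next
  case (step q)
  \<comment> \<open>Column heights when only the rows below q are present. The new row q is the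
    shortest, so it raises exactly the columns left of its end, from q to q + 1.\<close>
  define h where "h q i = p + card {j \<in> {p..<q}. i < k j}" for q i
  have uk: "u \<le> k q" "k q \<le> v"
    using step.prems step.hyps by auto
  have lo: "h q i = q" "h (Suc q) i = Suc q" if i: "i < k q" for i
  proof -
    have lt: "i < k j" if "p \<le> j" "j < Suc q" for j
      using step.prems(3)[of j q] that i by simp
    have "{j \<in> {p..<q}. i < k j} = {p..<q}" "{j \<in> {p..<Suc q}. i < k j} = {p..<Suc q}"
      using lt by auto
    then show "h q i = q" "h (Suc q) i = Suc q"
      using step.hyps by (auto simp: h_def)
  qed
  have hi: "h (Suc q) i = h q i" if i: "k q \<le> i" for i
  proof -
    have "{j \<in> {p..<Suc q}. i < k j} = {j \<in> {p..<q}. i < k j}"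
      using i by (auto simp: less_Suc_eq)
    then show ?thesis
      by (simp only: h_def)
  qed
  define A where "A q' = (\<Sum>i=u..<k q. \<psi> (Suc i) q')" for q'
  define C where "C q' = (\<Sum>i=u..<k q. \<psi> i q')" for q'
  define AH where "AH = (\<Sum>i=k q..<v. \<psi> (Suc i) (h q i))"
  define CH where "CH = (\<Sum>i=k q..<v. \<psi> i (h q i))"
  have split: "sum g {u..<v} = sum g {u..<k q} + sum g {k q..<v}" for g :: "nat \<Rightarrow> 'b"
    by (rule sum.atLeastLessThan_concat[OF uk, symmetric])
  have S: "(\<Sum>i=u..<v. \<psi> (Suc i) (h q i)) = A q + AH" "(\<Sum>i=u..<v. \<psi> (Suc i) (h (Suc q) i)) = A (Suc q) + AH"
     "(\<Sum>i=u..<v. \<psi> i (h q i)) = C q + CH" "(\<Sum>i=u..<v. \<psi> i (h (Suc q) i)) = C (Suc q) + CH"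
    unfolding split A_def C_def AH_def CH_def by (intro arg_cong2[where f = "(+)"] sum.cong refl; simp add: lo hi)+
  have T: "A q' + \<psi> u q' = \<psi> (k q) q' + C q'" for q'
    unfolding A_def C_def by (rule sum_telescope_up[OF uk(1)])
  have IH: "A q + AH + (\<Sum>j=p..<q. \<psi> (k j) j) + \<psi> u q = \<psi> v p + (C q + CH) + (\<Sum>j=p..<q. \<psi> (k j) (Suc j))"
    unfolding S[symmetric] h_def using step.prems by (intro step.IH) auto
  let ?B = "\<Sum>j=p..<q. \<psi> (k j) j" and ?D = "\<Sum>j=p..<q. \<psi> (k j) (Suc j)"
  have "C q + (\<psi> (k q) q + AH + ?B) = C q + (\<psi> v p + CH + ?D)"
  proof -
    have "C q + (\<psi> (k q) q + AH + ?B) = (\<psi> (k q) q + C q) + (AH + ?B)"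
      by (simp only: ac_simps)
    also have "\<dots> = A q + AH + ?B + \<psi> u q"
      unfolding T[symmetric] by (simp only: ac_simps)
    also have "\<dots> = C q + (\<psi> v p + CH + ?D)"
      unfolding IH by (simp only: ac_simps)
    finally show ?thesis .
  qed
  then have "\<psi> (k q) q + AH + ?B = \<psi> v p + CH + ?D"
    by (rule add_left_imp_eq)
  then have "A (Suc q) + \<psi> u (Suc q) + (\<psi> (k q) q + AH + ?B) = \<psi> (k q) (Suc q) + C (Suc q) + (\<psi> v p + CH + ?D)"
    unfolding T by simp
  then show ?case
    unfolding h_def[symmetric] S using step.hyps by (simp add: ac_simps)
qed

lemma prod_mset_sum_singleton:
  "finite S \<Longrightarrow> prod_mset (image_mset f (\<Sum>i\<in>S. {#g i#})) = (\<Prod>i\<in>S. f (g i))"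
  by (induction S rule: finite_induct) auto

text \<open>\<open>path_sum\<close> is applied in the free commutative monoid on lattice points, and
  \<phi> is then multiplied over the two equal multisets. This avoids any cancellation before the
  nonvanishing conditions are available.\<close>

lemma path_ratio:
  fixes \<phi> :: "nat \<Rightarrow> nat \<Rightarrow> 'a::field"
  assumes "p \<le> q" "u \<le> v"
    and "\<And>j. p \<le> j \<Longrightarrow> j < q \<Longrightarrow> u \<le> k j \<and> k j \<le> v"
    and "\<And>i j. p \<le> i \<Longrightarrow> i \<le> j \<Longrightarrow> j < q \<Longrightarrow> k j \<le> k i"
    and h: "\<And>i. u \<le> i \<Longrightarrow> i < v \<Longrightarrow> h i = p + card {j \<in> {p..<q}. i < k j}"
    and nz: "\<phi> u q \<noteq> 0" "\<And>i. u \<le> i \<Longrightarrow> i < v \<Longrightarrow> \<phi> i (h i) \<noteq> 0" "\<And>j. p \<le> j \<Longrightarrow> j < q \<Longrightarrow> \<phi> (k j) j \<noteq> 0"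
  shows "(\<Prod>i=u..<v. \<phi> (Suc i) (h i) / \<phi> i (h i)) = \<phi> v p / \<phi> u q * (\<Prod>j=p..<q. \<phi> (k j) (Suc j) / \<phi> (k j) j)"
proof -
  let ?h = "\<lambda>i. p + card {j \<in> {p..<q}. i < k j}"
  let ?P = "\<lambda>M. prod_mset (image_mset (\<lambda>(i, j). \<phi> i j) M)"
  have "?P ((\<Sum>i=u..<v. {#(Suc i, ?h i)#}) + (\<Sum>j=p..<q. {#(k j, j)#}) + {#(u, q)#})
      = ?P ({#(v, p)#} + (\<Sum>i=u..<v. {#(i, ?h i)#}) + (\<Sum>j=p..<q. {#(k j, Suc j)#}))"
    using path_sum[of p q u v k "\<lambda>i j. {#(i, j)#}"] assms(1-4) by simp
  then have "(\<Prod>i=u..<v. \<phi> (Suc i) (?h i)) * (\<Prod>j=p..<q. \<phi> (k j) j) * \<phi> u q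
      = \<phi> v p * (\<Prod>i=u..<v. \<phi> i (?h i)) * (\<Prod>j=p..<q. \<phi> (k j) (Suc j))"
    by (simp add: prod_mset_sum_singleton ac_simps)
  moreover have "(\<Prod>i=u..<v. \<phi> (Suc i) (?h i)) = (\<Prod>i=u..<v. \<phi> (Suc i) (h i))"
     "(\<Prod>i=u..<v. \<phi> i (?h i)) = (\<Prod>i=u..<v. \<phi> i (h i))"
    using h by (auto intro!: prod.cong)
  moreover have "(\<Prod>i=u..<v. \<phi> i (h i)) \<noteq> 0" "(\<Prod>j=p..<q. \<phi> (k j) j) \<noteq> 0"
    using nz by auto
  ultimately show ?thesis
    using nz(1) by (simp add: prod_dividef frac_eq_eq divide_simps) (simp add: ac_simps)
qed

section \<open>Hooks, contents and the addition of a box\<close>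

definition col :: "(nat \<Rightarrow> nat) \<Rightarrow> nat \<Rightarrow> nat" where
  "col f i = card {j. i < f j}"

definition dg :: "(nat \<Rightarrow> nat) \<Rightarrow> (nat \<times> nat) set" where
  "dg f = {(i, j). i < f j}"

text \<open>Arm and leg are written as \<open>f j - i - 1\<close> and \<open>col f i - j - 1\<close>
  with subtraction in the field. The formulas thus make sense at all positions and agree with the
  hook values inside the diagram.\<close>

fun hU :: "(nat \<Rightarrow> nat) \<Rightarrow> nat \<times> nat \<Rightarrow> ratfun" where
  "hU f (i, j) = alpha * (of_nat (f j) - of_nat i) + (of_nat (col f i) - of_nat j - 1)"

fun hL :: "(nat \<Rightarrow> nat) \<Rightarrow> nat \<times> nat \<Rightarrow> ratfun" where
  "hL f (i, j) = alpha * (of_nat (f j) - of_nat i - 1) + (of_nat (col f i) - of_nat j)"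

lemma finite_col: "ptn f \<Longrightarrow> finite {j. i < f j}"
  by (rule finite_subset[OF _ ptn_fs]) auto

lemma less_col_iff:
  assumes f: "ptn f"
  shows "j < col f i \<longleftrightarrow> i < f j"
proof
  assume j: "i < f j"
  have "{..j} \<subseteq> {j. i < f j}"
  proof
    fix x assume "x \<in> {..j}"
    then show "x \<in> {j. i < f j}"
      using j ptn_le[OF f, of x j] by simp
  qed
  then have "card {..j} \<le> col f i"
    unfolding col_def by (rule card_mono[OF finite_col[OF f]])
  then show "j < col f i"
    by simp
next
  assume j: "j < col f i"
  show "i < f j"
  proof (rule ccontr)
    assume n: "\<not> i < f j"
    have "{j. i < f j} \<subseteq> {..<j}"
    proof
      fix x assume "x \<in> {j. i < f j}"
      then have "\<not> f x \<le> f j"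
        using n by simp
      then show "x \<in> {..<j}"
        using ptn_le[OF f, of j x] by (meson lessThan_iff not_le)
    qed
    then have "col f i \<le> card {..<j}"
      unfolding col_def by (intro card_mono) auto
    then show False
      using j by simp
  qed
qed

lemma finite_dg: "ptn f \<Longrightarrow> finite (dg f)"
proof (rule finite_subset)
  assume f: "ptn f"
  show "dg f \<subseteq> {..<f 0} \<times> supp f"
    using ptn_le[OF f, of 0] by (auto simp: dg_def intro: less_le_trans)
  show "finite ({..<f 0} \<times> supp f)"
    using ptn_fs[OF f] by simp
qed

lemma hook_pos:
  assumes f: "ptn f" and b: "b \<in> dg f"
  shows "hU f b > 0" "hL f b > 0"
proof -
  obtain i j where ij: "b = (i, j)" "i < f j"
    using b by (auto simp: dg_def)
  have j: "j < col f i"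
    using less_col_iff[OF f] ij by simp
  obtain a where a: "f j = Suc (i + a)"
    using ij(2) less_iff_Suc_add by auto
  obtain l where l: "col f i = Suc (j + l)"
    using j less_iff_Suc_add by auto
  have "hU f b = alpha * of_nat (Suc a) + of_nat l" "hL f b = alpha * of_nat a + of_nat (Suc l)"
    by (simp_all add: ij(1) a l algebra_simps)
  then show "hU f b > 0" "hL f b > 0"
    using alpha_pos by (simp_all add: add_pos_nonneg add_nonneg_pos del: of_nat_Suc)
qed

lemma col_add:
  assumes f: "ptn f" and y: "addable f y"
  shows "col (add_box f y) i = col f i + (if i = f y then 1 else 0)" and "col f (f y) = y"
proof -
  have eq: "{j. i < add_box f y j} = {j. i < f j} \<union> (if i = f y then {y} else {})"
    by (auto simp: add_box_def less_Suc_eq split: if_splits)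
  show "col (add_box f y) i = col f i + (if i = f y then 1 else 0)"
    unfolding col_def eq using finite_col[OF f] by (auto simp: card_insert_if)
  show "col f (f y) = y"
    unfolding col_def card_addable[OF f y] by simp
qed

lemma dg_add: "dg (add_box f y) = insert (f y, y) (dg f)" "(f y, y) \<notin> dg f"
  by (auto simp: dg_def add_box_def less_Suc_eq split: if_splits)

lemma hook_add_other:
  assumes f: "ptn f" "addable f y" and b: "fst b \<noteq> f y" "snd b \<noteq> y"
  shows "hU (add_box f y) b = hU f b" "hL (add_box f y) b = hL f b"
proof -
  obtain i j where b': "b = (i, j)"
    by force
  then show "hU (add_box f y) b = hU f b" "hL (add_box f y) b = hL f b"
    using b col_add(1)[OF f] by (simp_all add: add_box_def)
qed

text \<open>Only boxes in the row and in the column of the new box change their hooks. The functions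
  h and h' are arbitrary so that any choice of upper and lower hooks can be inserted.\<close>

lemma prod_dg_add:
  fixes h h' :: "nat \<times> nat \<Rightarrow> ratfun"
  assumes f: "ptn f" "addable f y" and nz: "\<And>b. b \<in> dg f \<Longrightarrow> h b \<noteq> 0"
    and eq: "\<And>b. b \<in> dg f \<Longrightarrow> fst b \<noteq> f y \<Longrightarrow> snd b \<noteq> y \<Longrightarrow> h' b = h b"
  shows "(\<Prod>b\<in>dg (add_box f y). h' b) = (\<Prod>b\<in>dg f. h b) * h' (f y, y) *
    (\<Prod>j<y. h' (f y, j) / h (f y, j)) * (\<Prod>i<f y. h' (i, y) / h (i, y))"
proof -
  let ?C = "(\<lambda>j. (f y, j)) ` {..<y}" and ?R = "(\<lambda>i. (i, y)) ` {..<f y}"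
  let ?q = "\<lambda>b. h' b / h b"
  have fin: "finite (dg f)"
    by (rule finite_dg[OF f(1)])
  have sub: "?C \<union> ?R \<subseteq> dg f"
    using f(2) by (auto simp: dg_def addable_def)
  have "(\<Prod>b\<in>dg f. h' b) = (\<Prod>b\<in>dg f. h b) * (\<Prod>b\<in>dg f. ?q b)"
    unfolding prod.distrib[symmetric] using nz by (intro prod.cong) auto
  also have "(\<Prod>b\<in>dg f. ?q b) = (\<Prod>b\<in>?C \<union> ?R. ?q b)"
  proof (rule prod.mono_neutral_right[OF fin sub], rule ballI)
    fix b assume b: "b \<in> dg f - (?C \<union> ?R)"
    obtain i j where ij: "b = (i, j)"
      by force
    have lt: "i < f j"
      using b by (simp add: dg_def ij)
    have "i \<noteq> f y"
    proof
      assume "i = f y"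
      then have "\<not> y \<le> j"
        using lt ptn_le[OF f(1), of y j] by auto
      then show False
        using b \<open>i = f y\<close> by (auto simp: ij)
    qed
    moreover have "j \<noteq> y"
      using b lt by (auto simp: ij)
    ultimately have "fst b \<noteq> f y" "snd b \<noteq> y"
      by (simp_all add: ij)
    then show "?q b = 1"
      using eq[of b] nz[of b] b by simp
  qed
  also have "\<dots> = (\<Prod>b\<in>?C. ?q b) * (\<Prod>b\<in>?R. ?q b)"
    by (rule prod.union_disjoint) auto
  also have "(\<Prod>b\<in>?C. ?q b) = (\<Prod>j<y. ?q (f y, j))"
    by (subst prod.reindex) (auto simp: inj_on_def)
  also have "(\<Prod>b\<in>?R. ?q b) = (\<Prod>i<f y. ?q (i, y))"
    by (subst prod.reindex) (auto simp: inj_on_def)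
  finally show ?thesis
    unfolding dg_add(1) using fin dg_add(2) by simp
qed

text \<open>Below the new box, hooks are differences of contents up to constants, the form in which
  they meet the interpolation formula.\<close>

lemma hooks_col:
  assumes f: "ptn f" "addable f y" and j: "j < y"
  shows "hL f (f y, j) = ct f j - ct f y - alpha" "hL (add_box f y) (f y, j) = ct f j - ct f y - alpha + 1"
    "hU f (f y, j) = ct f j - ct f y - 1" "hU (add_box f y) (f y, j) = ct f j - ct f y"
  using j col_add[OF f] by (simp_all add: ct_def add_box_def algebra_simps)

lemma hooks_row:
  assumes f: "ptn f" "addable f y" and i: "i < f y"
  shows "hL f (i, y) = alpha * (of_nat (f y) - of_nat (Suc i)) + (of_nat (col f i) - of_nat y)"
    "hL (add_box f y) (i, y) = alpha * (of_nat (f y) - of_nat i) + (of_nat (col f i) - of_nat y)"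
    "hU f (i, y) = alpha * (of_nat (f y) - of_nat (Suc i)) + (of_nat (col f i) - of_nat y) + (alpha - 1)"
    "hU (add_box f y) (i, y) = alpha * (of_nat (f y) - of_nat i) + (of_nat (col f i) - of_nat y) + (alpha - 1)"
  using i col_add[OF f] by (simp_all add: add_box_def algebra_simps)

lemma hooks_corner:
  assumes f: "ptn f" "addable f y"
  shows "hL (add_box f y) (f y, y) = 1" "hU (add_box f y) (f y, y) = alpha"
  using col_add[OF f] by (simp_all add: add_box_def algebra_simps)

declare hU.simps [simp del] hL.simps [simp del]

text \<open>The factors are ratios of one affine function at neighbouring boundary points, so
  \<open>path_ratio\<close> turns the product over the columns of row y into one over the rows above
  it. The value t = 0 gives lower hooks, t = \<alpha> - 1 upper hooks.\<close>

lemma row_ratio: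
  assumes f: "ptn f" and L: "f L = 0" "y < L" and t: "t \<ge> 0"
  shows "(\<Prod>i<f y. (alpha * (of_nat (f y) - of_nat (Suc i)) + (of_nat (col f i) - of_nat y) + t) /
      (alpha * (of_nat (f y) - of_nat i) + (of_nat (col f i) - of_nat y) + t))
    = (1 + t) / (ct f y - ct f L + t) * (\<Prod>j=Suc y..<L. (ct f y - ct f j + 1 + t) / (ct f y - ct f j + t))"
proof -
  define \<phi> where "\<phi> i h = alpha * (of_nat (f y) - of_nat i) + (of_nat h - of_nat y) + t" for i h
  have pos: "\<phi> i h > 0" if ih: "i \<le> f y" "y < h" for i h
  proof -
    obtain a where a: "f y = i + a"
      using le_Suc_ex[OF ih(1)] by blast
    obtain l where l: "h = Suc (y + l)"
      using ih(2) less_iff_Suc_add[of y h] by blast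
    have "\<phi> i h = alpha * of_nat a + of_nat (Suc l) + t"
      by (simp add: \<phi>_def a l algebra_simps)
    moreover have "0 < alpha * of_nat a + of_nat (Suc l)"
      using alpha_pos by (intro add_nonneg_pos) (simp_all del: of_nat_Suc)
    ultimately show ?thesis
      using t by simp
  qed
  have le: "f j \<le> f y" if "Suc y \<le> j" for j
    using ptn_le[OF f] that by simp
  have h: "col f i = Suc y + card {j \<in> {Suc y..<L}. i < f j}" if i: "i < f y" for i
  proof -
    have "{j. i < f j} = {..y} \<union> {j \<in> {Suc y..<L}. i < f j}"
    proof (intro set_eqI iffI)
      fix j assume "j \<in> {j. i < f j}"
      then have "i < f j" by simp
      moreover have "j < L"
        using ptn_le[OF f, of L j] L(1) \<open>i < f j\<close> by (metis le_zero_eq linorder_not_less not_less_zero)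
      ultimately show "j \<in> {..y} \<union> {j \<in> {Suc y..<L}. i < f j}"
        by auto
    next
      fix j assume "j \<in> {..y} \<union> {j \<in> {Suc y..<L}. i < f j}"
      then show "j \<in> {j. i < f j}"
        using i ptn_le[OF f, of j y] by auto
    qed
    moreover have "card ({..y} \<union> {j \<in> {Suc y..<L}. i < f j}) = card {..y} + card {j \<in> {Suc y..<L}. i < f j}"
      by (rule card_Un_disjoint) auto
    ultimately show ?thesis
      by (simp add: col_def)
  qed
  have "(\<Prod>i=0..<f y. \<phi> (Suc i) (col f i) / \<phi> i (col f i))
      = \<phi> (f y) (Suc y) / \<phi> 0 L * (\<Prod>j=Suc y..<L. \<phi> (f j) (Suc j) / \<phi> (f j) j)"
  proof (rule path_ratio)
    show "\<phi> 0 L \<noteq> 0"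
      using pos[of 0 L] L(2) by simp
    show "\<phi> i (col f i) \<noteq> 0" if "i < f y" for i
      using pos[of i "col f i"] that h[OF that] by simp
    show "\<phi> (f j) j \<noteq> 0" if "Suc y \<le> j" for j
      using pos[of "f j" j] that le[OF that] by simp
    show "f j \<le> f i" if "i \<le> j" for i j
      using ptn_le[OF f that] .
  qed (use L le h in auto)
  moreover have "\<phi> (f y) (Suc y) = 1 + t" "\<phi> 0 L = ct f y - ct f L + t"
    using L(1) by (simp_all add: \<phi>_def ct_def algebra_simps)
  moreover have "\<phi> (f j) (Suc j) = ct f y - ct f j + 1 + t" "\<phi> (f j) j = ct f y - ct f j + t" for j
    by (simp_all add: \<phi>_def ct_def algebra_simps)
  ultimately have "(\<Prod>i=0..<f y. \<phi> (Suc i) (col f i) / \<phi> i (col f i))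
      = (1 + t) / (ct f y - ct f L + t) * (\<Prod>j=Suc y..<L. (ct f y - ct f j + 1 + t) / (ct f y - ct f j + t))"
    by (simp only:)
  then show ?thesis
    unfolding \<phi>_def atLeast0LessThan .
qed

lemma prod_lessThan_remove:
  fixes g :: "nat \<Rightarrow> ratfun"
  assumes "y < L"
  shows "(\<Prod>j\<in>{..<L} - {y}. g j) = (\<Prod>j<y. g j) * (\<Prod>j=Suc y..<L. g j)"
proof -
  have "{..<L} - {y} = {..<y} \<union> {Suc y..<L}"
    using assms by auto
  moreover have "prod g ({..<y} \<union> {Suc y..<L}) = prod g {..<y} * prod g {Suc y..<L}"
    by (rule prod.union_disjoint) auto
  ultimately show ?thesis
    by simp
qed

section \<open>The norms of the Jack functions\<close>

lemma ex_zero_ptn: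
  assumes "ptn f"
  obtains L where "f L = 0" "y < L"
proof
  let ?L = "Suc (max y (card (supp f)))"
  have "?L \<notin> {..<card (supp f)}"
    by simp
  then have "?L \<notin> supp f"
    using supp_ptn[OF assms] by simp
  then show "f ?L = 0"
    by simp
qed simp

lemma ptn_deg_zero:
  assumes "ptn f" "deg f \<le> L"
  shows "f L = 0"
proof (rule ccontr)
  assume "f L \<noteq> 0"
  then have "L \<in> {..<card (supp f)}"
    using supp_ptn[OF assms(1)] by (metis in_supp)
  moreover have "card (supp f) \<le> deg f"
    unfolding deg_def using sum_mono[of "supp f" "\<lambda>_. 1" f] by (simp add: Suc_le_eq)
  ultimately show False
    using assms(2) by simp
qed

lemma sum_ct:
  assumes f: "ptn f" "f L = 0"
  shows "2 * (\<Sum>j<L. ct f j) = 2 * alpha * of_nat (deg f) - of_nat L * (of_nat L - 1)"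
proof -
  have "supp f \<subseteq> {..<L}"
  proof
    fix j assume "j \<in> supp f"
    then have "\<not> L \<le> j"
      using ptn_le[OF f(1), of L j] f(2) by auto
    then show "j \<in> {..<L}"
      by simp
  qed
  then have "deg f = (\<Sum>j<L. f j)"
    using f by (intro deg_superset) (simp_all add: ptn_fs)
  moreover have "2 * (\<Sum>j<L. of_nat j) = (of_nat L * (of_nat L - 1) :: ratfun)" for L
    by (induction L) (simp_all add: algebra_simps)
  ultimately show ?thesis
    by (simp add: ct_def sum_subtractf sum_distrib_left[symmetric] right_diff_distrib)
qed

lemma coeff_mult_linear: "coeff (p * [:- a, 1:]) (Suc k) = coeff p k - a * coeff p (Suc k)" for a :: "'a::field"
  by (simp add: mult.commute)

lemma root_poly_Suc: "root_poly c {..<Suc n} = root_poly c {..<n} * [:- c n, 1:]"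
  by (simp add: root_poly_def lessThan_Suc mult.commute)

lemma coeff_root_poly_lessThan:
  "coeff (root_poly c {..<n}) n = 1" "coeff (root_poly c {..<Suc n}) n = - (\<Sum>j<Suc n. c j)"
  "2 * coeff (root_poly c {..<Suc (Suc n)}) n = (\<Sum>j<Suc (Suc n). c j)\<^sup>2 - (\<Sum>j<Suc (Suc n). (c j)\<^sup>2)"
proof -
  show 0: "coeff (root_poly c {..<n}) n = 1" for n
    using coeff_root_poly_card[of c "{..<n}"] by simp
  show 1: "coeff (root_poly c {..<Suc n}) n = - (\<Sum>j<Suc n. c j)" for n
  proof (induction n)
    case (Suc n)
    then show ?case
      using 0[of "Suc n"] by (simp only: root_poly_Suc[of c "Suc n"] coeff_mult_linear) simp
  qed (simp add: root_poly_def)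
  show "2 * coeff (root_poly c {..<Suc (Suc n)}) n = (\<Sum>j<Suc (Suc n). c j)\<^sup>2 - (\<Sum>j<Suc (Suc n). (c j)\<^sup>2)"
  proof (induction n)
    case 0
    have "root_poly c {..<Suc (Suc 0)} = [:- c 0, 1:] * [:- c 1, 1:]"
      by (simp add: root_poly_def lessThan_Suc mult.commute)
    then show ?case
      by (simp add: power2_eq_square algebra_simps)
  next
    case (Suc n)
    have "2 * coeff (root_poly c {..<Suc (Suc (Suc n))}) (Suc n) =
        2 * coeff (root_poly c {..<Suc (Suc n)}) n - 2 * (c (Suc (Suc n)) * coeff (root_poly c {..<Suc (Suc n)}) (Suc n))"
      unfolding root_poly_Suc[of c "Suc (Suc n)"] coeff_mult_linear by (rule right_diff_distrib)
    also have "\<dots> = (\<Sum>j<Suc (Suc n). c j)\<^sup>2 - (\<Sum>j<Suc (Suc n). (c j)\<^sup>2) +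
        2 * (c (Suc (Suc n)) * (\<Sum>j<Suc (Suc n). c j))"
      unfolding Suc.IH 1 by (simp only: mult_minus_right diff_minus_eq_add)
    also have "\<dots> = (\<Sum>j<Suc (Suc (Suc n)). c j)\<^sup>2 - (\<Sum>j<Suc (Suc (Suc n)). (c j)\<^sup>2)"
      unfolding sum.lessThan_Suc[of _ "Suc (Suc n)"] by (simp add: power2_eq_square algebra_simps)
    finally show ?case .
  qed
qed

text \<open>The sum is a divided difference of \<open>\<Prod>j\<le>L. (z - ct f j - 1)\<close> at the contents
  \<open>ct f 0, \<dots>, ct f (L - 1)\<close>.\<close>

lemma content_sum_identity:
  assumes f: "ptn f" "f L = 0"
  defines "b \<equiv> \<lambda>y. (ct f y - 1 - ct f L) * (\<Prod>j\<in>{..<L} - {y}. (ct f y - 1 - ct f j) / (ct f y - ct f j))"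
  shows "(\<Sum>y<L. b y) = alpha * of_nat (deg f)"
proof (cases L)
  case 0
  have "deg f = sum f {}"
    using ptn_le[OF f(1), of 0] f(2) 0 by (intro deg_superset) (auto simp: ptn_fs f)
  then show ?thesis
    using 0 by simp
next
  case (Suc k)
  define c where "c = ct f"
  define a where "a j = c j + 1" for j
  define P where "P = root_poly a {..<Suc L}"
  define W where "W = root_poly c {..<L}"
  \<comment> \<open>\<open>W\<close> vanishes at all nodes, so subtracting a multiple of it does not
    change the values of \<open>P\<close> there. The factor z - 1 cancels the two top coefficients,
    because the roots of \<open>P\<close> have a sum larger by 1 than those of
    \<open>W\<close>.\<close>
  define R where "R = P - [:- 1, 1:] * W"
  have sa: "(\<Sum>j<Suc L. a j) = (\<Sum>j<L. c j) + 1"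
    using f(2) by (simp add: a_def c_def ct_def sum.distrib)
  have cW: "coeff ([:- 1, 1:] * W) (Suc i) = coeff W i - coeff W (Suc i)" for i
    using coeff_mult_linear[of W 1 i] by (simp add: mult.commute)
  have dP: "degree P = Suc (Suc k)" and dW: "degree W = Suc k"
    by (simp_all add: P_def W_def degree_root_poly Suc)
  have "degree R \<le> k"
  proof (rule degree_le, intro allI impI)
    fix i assume "k < i"
    then consider "i = Suc k" | "i = Suc (Suc k)" | i' where "i = Suc i'" "i' > Suc k"
      by (metis Suc_lessE less_antisym not_less_eq)
    then show "coeff R i = 0"
    proof cases
      case 1
      have "coeff P (Suc k) = - ((\<Sum>j<L. c j) + 1)"
        using coeff_root_poly_lessThan(2)[of a "Suc k"] sa by (simp only: P_def Suc)
      moreover have "coeff W k = - (\<Sum>j<L. c j)" "coeff W (Suc k) = 1"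
        using coeff_root_poly_lessThan(2)[of c k] coeff_root_poly_lessThan(1)[of c "Suc k"] by (simp_all only: W_def Suc)
      ultimately show ?thesis
        unfolding R_def 1 coeff_diff cW by simp
    next
      case 2
      have "coeff P (Suc (Suc k)) = 1" "coeff W (Suc k) = 1" "coeff W (Suc (Suc k)) = 0"
        using coeff_root_poly_lessThan(1)[of a "Suc (Suc k)"] coeff_root_poly_lessThan(1)[of c "Suc k"] dW
        unfolding P_def W_def Suc by (simp_all add: coeff_eq_0)
      then show ?thesis
        unfolding R_def 2 coeff_diff cW by simp
    next
      case 3
      then show ?thesis
        using dP dW unfolding R_def 3(1) coeff_diff cW by (simp add: coeff_eq_0)
    qed
  qed
  have "2 * coeff R k = - (2 * (alpha * of_nat (deg f)))"
  proof -
    have P: "2 * coeff P k = ((\<Sum>j<L. c j) + 1)\<^sup>2 - (\<Sum>j<Suc L. (a j)\<^sup>2)"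
      using coeff_root_poly_lessThan(3)[of a k] unfolding P_def sa[symmetric] unfolding Suc .
    have "2 * coeff ([:- 1, 1:] * W) k = 2 * (\<Sum>j<L. c j) + ((\<Sum>j<L. c j)\<^sup>2 - (\<Sum>j<L. (c j)\<^sup>2))"
    proof (cases k)
      case 0
      then show ?thesis
        using coeff_root_poly_lessThan(2)[of c 0] by (simp add: W_def Suc)
    next
      case k: (Suc l)
      have "coeff W (Suc l) = - (\<Sum>j<L. c j)" "2 * coeff W l = (\<Sum>j<L. c j)\<^sup>2 - (\<Sum>j<L. (c j)\<^sup>2)"
        using coeff_root_poly_lessThan(2)[of c "Suc l"] coeff_root_poly_lessThan(3)[of c l] by (simp_all only: W_def Suc k)
      then show ?thesis
        unfolding k cW right_diff_distrib by simp
    qed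
    then have "2 * coeff R k = ((\<Sum>j<L. c j) + 1)\<^sup>2 - (\<Sum>j<Suc L. (a j)\<^sup>2)
        - (2 * (\<Sum>j<L. c j) + ((\<Sum>j<L. c j)\<^sup>2 - (\<Sum>j<L. (c j)\<^sup>2)))"
      by (simp only: R_def coeff_diff right_diff_distrib P)
    moreover have "(\<Sum>j<Suc L. (a j)\<^sup>2) = (\<Sum>j<L. (c j)\<^sup>2) + 2 * (\<Sum>j<L. c j) + of_nat L + (1 - of_nat L)\<^sup>2"
    proof -
      have "(a j)\<^sup>2 = (c j)\<^sup>2 + 2 * c j + 1" for j
        by (simp add: a_def power2_eq_square algebra_simps)
      then have "(\<Sum>j<L. (a j)\<^sup>2) = (\<Sum>j<L. (c j)\<^sup>2) + 2 * (\<Sum>j<L. c j) + of_nat L"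
        by (simp add: sum.distrib sum_distrib_left)
      moreover have "a L = 1 - of_nat L"
        using f(2) by (simp add: a_def c_def ct_def)
      ultimately show ?thesis
        by simp
    qed
    ultimately have "2 * coeff R k = 1 - 2 * (\<Sum>j<L. c j) - of_nat L - (1 - of_nat L)\<^sup>2"
      by (simp add: power2_eq_square algebra_simps)
    moreover have "2 * (\<Sum>j<L. c j) = 2 * alpha * of_nat (deg f) - of_nat L * (of_nat L - 1)"
      unfolding c_def by (rule sum_ct[of f L, OF f])
    ultimately show ?thesis
      by (simp only:) (simp add: power2_eq_square algebra_simps)
  qed
  then have "coeff R k = - (alpha * of_nat (deg f))"
    by simp
  moreover have "(\<Sum>y<L. poly R (c y) / (\<Prod>i\<in>{..<L} - {y}. c y - c i)) = coeff R k"
    using \<open>degree R \<le> k\<close> ct_inj Suc unfolding c_def by (intro divided_difference) (auto simp: inj_on_def)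
  moreover have "poly R (c y) / (\<Prod>i\<in>{..<L} - {y}. c y - c i) = - b y" if y: "y < L" for y
  proof -
    have "poly W (c y) = 0"
      unfolding W_def poly_root_poly using y by (intro prod_zero) auto
    then have "poly R (c y) = (\<Prod>j<Suc L. c y - a j)"
      by (simp add: R_def P_def poly_root_poly)
    also have "\<dots> = (c y - 1 - c L) * (\<Prod>j<L. c y - 1 - c j)"
      by (simp add: a_def algebra_simps)
    also have "(\<Prod>j<L. c y - 1 - c j) = (c y - 1 - c y) * (\<Prod>j\<in>{..<L} - {y}. c y - 1 - c j)"
      using y by (intro prod.remove) auto
    finally show ?thesis
      by (simp add: b_def c_def prod_dividef)
  qed
  ultimately show ?thesis
    by (simp add: sum_negf)
qed

lemma fact_replicate_mset: "zfact (replicate_mset n 1) = fact n"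
  by (induction n) (simp_all add: zfact_add, simp add: zfact_def)

lemma pm_replicate: "pm (replicate_mset n 1) = power_sum 1 ^ n"
  by (induction n) (simp_all add: pm_add)

lemma coef_pm_ones: "0 \<notin># M \<Longrightarrow> coef (pm M) (ones n) = (if M = replicate_mset n 1 then of_nat (fact n) else 0)"
proof (induction M arbitrary: n)
  case empty
  have "ones n = (\<lambda>_. 0) \<longleftrightarrow> n = 0"
    by (auto simp: ones_def fun_eq_iff)
  then show ?case
    by (auto simp: coef_one)
next
  case (add k M)
  show ?case
  proof (cases "k = 1")
    case True
    show ?thesis
    proof (cases n)
      case 0
      then show ?thesis
        using True coef_power_sum_mult[of "ones 0" "{}" 1 "pm M"] by (simp add: pm_add supp_ones)
    next
      case (Suc n')
      have "coef (pm (add_mset k M)) (ones n) = of_nat (Suc n') * coef (pm M) (ones n')"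
        unfolding pm_add True Suc using add.prems by (intro ones_power_sum_1 sym_pm) simp
      also have "coef (pm M) (ones n') = (if M = replicate_mset n' 1 then of_nat (fact n') else 0)"
        using add.prems by (intro add.IH) simp
      finally show ?thesis
        by (simp add: True Suc algebra_simps)
    qed
  next
    case False
    then have "k \<ge> 2"
      using add.prems by (cases k) auto
    moreover have "add_mset k M \<noteq> replicate_mset n 1"
      using False by (metis in_replicate_mset union_single_eq_member)
    ultimately show ?thesis
      by (simp add: pm_add ones_power_sum_ge_2)
  qed
qed

lemma power_sum_1_Lam: "power_sum 1 ^ n \<in> Lam"
  using Lam_pm[of "replicate_mset n 1"] pm_replicate[of n] by simp

text \<open>Among products of power sums only p_1^n itself has a squarefree monomial of degree n,
  and only it pairs nontrivially with p_1^n. The normalisation of the Jack functions thereby fixes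
  their inner products with p_1^n.\<close>

lemma jack_inner_p1_power:
  assumes "F \<in> Lam"
  shows "jack_inner F (power_sum 1 ^ n) = alpha ^ n * coef F (ones n)"
  using assms
proof (induction rule: Lam_induct)
  case zero
  then show ?case
    by (simp add: jack_inner_zero_left)
next
  case (step c M g)
  have "jack_inner (pm M) (power_sum 1 ^ n) = alpha ^ n * coef (pm M) (ones n)"
    unfolding pm_replicate[symmetric] coef_pm_ones[OF step(1)]
    using step(1) fact_replicate_mset[of n] by (subst jack_inner_pm) auto
  then show ?case
    using step power_sum_1_Lam[of n]
    by (simp add: jack_inner_add_left jack_inner_mscale_left Lam_mscale Lam_pm distrib_left mult.left_commute)
qed

definition hom :: "nat \<Rightarrow> ratfun mseries \<Rightarrow> bool" where
  "hom n g \<longleftrightarrow> (\<forall>u. fs u \<longrightarrow> coef g u \<noteq> 0 \<longrightarrow> deg u = n)"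

lemma hom_power_sum_mult:
  assumes g: "hom n g" and k: "k \<ge> 1"
  shows "hom (n + k) (power_sum k * g)"
  unfolding hom_def
proof (intro allI impI)
  fix u assume u: "fs u" "coef (power_sum k * g) u \<noteq> 0"
  then obtain i where i: "i \<in> supp u" "(if k \<le> u i then coef g (u(i := u i - k)) else 0) \<noteq> 0"
    unfolding coef_power_sum_mult[OF u(1) u(1) order_refl k] by (elim sum.not_neutral_contains_not_neutral)
  then have ki: "k \<le> u i" "coef g (u(i := u i - k)) \<noteq> 0"
    by (auto split: if_splits)
  have "deg (u(i := u i - k)) = n"
    using g u(1) ki(2) by (simp add: hom_def)
  moreover have "deg (u(i := u i - k)) = sum (u(i := u i - k)) (supp u)"
    using u(1) by (intro deg_superset) (auto split: if_splits)
  moreover have "sum (u(i := u i - k)) (supp u) + k = deg u"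
    unfolding deg_def using u(1) i(1) ki(1) by (simp add: sum.remove[of "supp u" i] del: in_supp)
  ultimately show "deg u = n + k"
    by simp
qed

definition hook_prod :: "(nat \<Rightarrow> nat) \<Rightarrow> ratfun" where
  "hook_prod f = (\<Prod>b\<in>dg f. hU f b * hL f b)"

lemma hook_prod_pos: "ptn f \<Longrightarrow> hook_prod f > 0"
  unfolding hook_prod_def by (intro prod_pos mult_pos_pos hook_pos)

section \<open>Pieri coefficients as hook ratios, and the norm recursion\<close>

context jack
begin

text \<open>In \<open>pieri_eq\<close> the rows j < y give the upper hooks in the column of the new
  box, and the rows j > y give, through \<open>row_ratio\<close> with t = 0, the lower hooks in its
  row. The factor for j = y in the numerator equals 1.\<close>

lemma pieri_hooks:
  assumes f: "ptn f" "addable f y"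
  shows "pieri f y = (\<Prod>j<y. hU f (f y, j) / hU (add_box f y) (f y, j)) * (\<Prod>i<f y. hL f (i, y) / hL (add_box f y) (i, y))"
proof -
  obtain L where L: "f L = 0" "y < L"
    using ex_zero_ptn[OF f(1)] .
  have ne: "ct f y - ct f j \<noteq> 0" if "j \<noteq> y" for j
    using ct_inj[of f y f j] that by auto
  have row: "(\<Prod>i<f y. hL f (i, y) / hL (add_box f y) (i, y)) =
      1 / (ct f y - ct f L) * (\<Prod>j=Suc y..<L. (ct f y - ct f j + 1) / (ct f y - ct f j))"
    using row_ratio[OF f(1) L, of 0] by (simp add: hooks_row[OF f])
  have col: "hU f (f y, j) / hU (add_box f y) (f y, j) = (ct f y - ct f j + 1) / (ct f y - ct f j)" if "j < y" for j
    using ne[of j] that by (simp add: hooks_col[OF f] frac_eq_eq) (simp add: algebra_simps)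
  have "pieri f y * (\<Prod>i\<in>{..L} - {y}. ct f y - ct f i) = (\<Prod>j<L. ct f y - (ct f j - 1))"
    using f L by (intro pieri_eq) auto
  moreover have "(\<Prod>i\<in>{..L} - {y}. ct f y - ct f i) = (ct f y - ct f L) * (\<Prod>j\<in>{..<L} - {y}. ct f y - ct f j)"
  proof -
    have "{..L} - {y} = insert L ({..<L} - {y})"
      using L(2) by auto
    then show ?thesis
      by simp
  qed
  moreover have "(\<Prod>j<L. ct f y - (ct f j - 1)) = (\<Prod>j\<in>{..<L} - {y}. ct f y - ct f j + 1)"
    using L(2) by (subst prod.remove[of _ y]) (auto simp: algebra_simps)
  moreover have "(ct f y - ct f L) * (\<Prod>j\<in>{..<L} - {y}. ct f y - ct f j) \<noteq> 0"
    using ne L(2) by auto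
  ultimately have "pieri f y = (\<Prod>j\<in>{..<L} - {y}. ct f y - ct f j + 1) / ((ct f y - ct f L) * (\<Prod>j\<in>{..<L} - {y}. ct f y - ct f j))"
    by (metis nonzero_eq_divide_eq)
  also have "\<dots> = 1 / (ct f y - ct f L) * (\<Prod>j\<in>{..<L} - {y}. (ct f y - ct f j + 1) / (ct f y - ct f j))"
    by (simp add: prod_dividef)
  finally show ?thesis
    unfolding prod_lessThan_remove[OF L(2)] row by (simp add: col)
qed

text \<open>Multiplying by the ratio of hook products exchanges the roles: lower hooks remain in the
  column and upper hooks in the row. These are again differences of contents, now through
  \<open>row_ratio\<close> with t = \<alpha> - 1, whose numerator \<alpha> cancels against the hooks
  of the corner.\<close>

lemma pieri_HH:
  assumes f: "ptn f" "f L = 0" and y: "f (Suc y) < f y"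
  shows "pieri (rem_box f y) y * hook_prod f / hook_prod (rem_box f y) =
    (ct f y - 1 - ct f L) * (\<Prod>j\<in>{..<L} - {y}. (ct f y - 1 - ct f j) / (ct f y - ct f j))"
proof -
  define k where "k = rem_box f y"
  have k: "ptn k" "addable k y" "f = add_box k y"
    using rem_box[OF f(1) y] by (simp_all add: k_def)
  have yL: "y < L"
    using ptn_le[OF f(1), of L y] f(2) y by (metis le_zero_eq linorder_not_less not_less_zero)
  have kL: "k L = 0"
    using f(2) yL by (simp add: k_def rem_box_def)
  have cty: "ct f y = ct k y + alpha"
    by (simp add: k(3) ct_def add_box_def algebra_simps)
  have ctj: "ct f j = ct k j" if "j \<noteq> y" for j
    using that by (simp add: k(3) ct_def add_box_def)
  have nzk: "hU k b \<noteq> 0" "hL k b \<noteq> 0" if "b \<in> dg k" for b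
    using hook_pos[OF k(1) that] by auto
  have colb: "(k y, j) \<in> dg k" "(k y, j) \<in> dg f" if "j < y" for j
    using k(2) that dg_add(1)[of k y] by (auto simp: dg_def addable_def k(3))
  have rowb: "(i, y) \<in> dg k" "(i, y) \<in> dg f" if "i < k y" for i
    using that dg_add(1)[of k y] by (auto simp: dg_def k(3))
  have nzf: "hU f b \<noteq> 0" "hL f b \<noteq> 0" if "b \<in> dg f" for b
    using hook_pos[OF f(1) that] by auto
  have "hook_prod f = hook_prod k * alpha * (\<Prod>j<y. hU f (k y, j) * hL f (k y, j) / (hU k (k y, j) * hL k (k y, j))) *
     (\<Prod>i<k y. hU f (i, y) * hL f (i, y) / (hU k (i, y) * hL k (i, y)))"
    unfolding hook_prod_def k(3) using nzk hook_add_other[OF k(1,2)] hooks_corner[OF k(1,2)]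
    by (subst prod_dg_add[OF k(1,2)]) auto
  then have "pieri k y * hook_prod f / hook_prod k = alpha * (pieri k y *
     (\<Prod>j<y. hU f (k y, j) * hL f (k y, j) / (hU k (k y, j) * hL k (k y, j))) *
     (\<Prod>i<k y. hU f (i, y) * hL f (i, y) / (hU k (i, y) * hL k (i, y))))"
    using hook_prod_pos[OF k(1)] by simp
  also have "\<dots> = alpha * ((\<Prod>j<y. hL f (k y, j) / hL k (k y, j)) * (\<Prod>i<k y. hU f (i, y) / hU k (i, y)))"
  proof -
    have "(\<Prod>j<y. hL f (k y, j) / hL k (k y, j)) = (\<Prod>j<y. hU k (k y, j) / hU f (k y, j)) *
        (\<Prod>j<y. hU f (k y, j) * hL f (k y, j) / (hU k (k y, j) * hL k (k y, j)))"
      unfolding prod.distrib[symmetric] using nzk[OF colb(1)] nzf[OF colb(2)] by (intro prod.cong) auto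
    moreover have "(\<Prod>i<k y. hU f (i, y) / hU k (i, y)) = (\<Prod>i<k y. hL k (i, y) / hL f (i, y)) *
        (\<Prod>i<k y. hU f (i, y) * hL f (i, y) / (hU k (i, y) * hL k (i, y)))"
      unfolding prod.distrib[symmetric] using nzk[OF rowb(1)] nzf[OF rowb(2)] by (intro prod.cong) auto
    ultimately show ?thesis
      unfolding pieri_hooks[OF k(1,2)] k(3)[symmetric] by (simp only: ac_simps)
  qed
  also have "(\<Prod>j<y. hL f (k y, j) / hL k (k y, j)) = (\<Prod>j<y. (ct f y - 1 - ct f j) / (ct f y - ct f j))"
  proof (intro prod.cong refl)
    fix j assume j: "j \<in> {..<y}"
    have "hL f (k y, j) = - (ct f y - 1 - ct f j)" "hL k (k y, j) = - (ct f y - ct f j)"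
      using j hooks_col[OF k(1,2), of j] ctj[of j] cty by (simp_all add: k(3)[symmetric])
    then show "hL f (k y, j) / hL k (k y, j) = (ct f y - 1 - ct f j) / (ct f y - ct f j)"
      by (simp only: minus_divide_divide)
  qed
  also have "(\<Prod>i<k y. hU f (i, y) / hU k (i, y)) = inverse (\<Prod>i<k y. hU k (i, y) / hU f (i, y))"
    by (simp add: prod_inversef[symmetric] prod_dividef field_simps)
  also have "(\<Prod>i<k y. hU k (i, y) / hU f (i, y)) =
      alpha / (ct f y - 1 - ct f L) * (\<Prod>j=Suc y..<L. (ct f y - ct f j) / (ct f y - 1 - ct f j))"
  proof -
    have "alpha - 1 \<ge> 0"
      using alpha_gt_of_nat[of 1] by simp
    note r = row_ratio[OF k(1) kL yL this]
    have "(\<Prod>j=Suc y..<L. (ct k y - ct k j + 1 + (alpha - 1)) / (ct k y - ct k j + (alpha - 1))) =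
        (\<Prod>j=Suc y..<L. (ct f y - ct f j) / (ct f y - 1 - ct f j))"
      by (intro prod.cong refl arg_cong2[where f = "(/)"]) (simp_all add: cty ctj)
    moreover have "(1 + (alpha - 1)) / (ct k y - ct k L + (alpha - 1)) = alpha / (ct f y - 1 - ct f L)"
      using yL by (simp add: cty ctj)
    moreover have "(\<Prod>i<k y. hU k (i, y) / hU f (i, y)) =
      (\<Prod>i<k y. (alpha * (of_nat (k y) - of_nat (Suc i)) + (of_nat (col k i) - of_nat y) + (alpha - 1)) /
        (alpha * (of_nat (k y) - of_nat i) + (of_nat (col k i) - of_nat y) + (alpha - 1)))"
      by (intro prod.cong refl) (simp only: hooks_row[OF k(1,2)] k(3) lessThan_iff)
    ultimately show ?thesis
      by (simp only: r)
  qed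
  finally have "pieri k y * hook_prod f / hook_prod k = alpha * ((\<Prod>j<y. (ct f y - 1 - ct f j) / (ct f y - ct f j)) *
      inverse (alpha / (ct f y - 1 - ct f L) * (\<Prod>j=Suc y..<L. (ct f y - ct f j) / (ct f y - 1 - ct f j))))" .
  also have "\<dots> = alpha * inverse alpha * ((ct f y - 1 - ct f L) * ((\<Prod>j<y. (ct f y - 1 - ct f j) / (ct f y - ct f j)) *
      (\<Prod>j=Suc y..<L. (ct f y - 1 - ct f j) / (ct f y - ct f j))))"
    by (simp add: prod_dividef)
  finally show ?thesis
    unfolding prod_lessThan_remove[OF yL] k_def[symmetric] using alpha_pos by simp
qed

end

lemma deg_zero_ptn: "ptn f \<Longrightarrow> deg f = 0 \<Longrightarrow> f = (\<lambda>_. 0)"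
  using ptn_deg_zero[of f] by auto

lemma hom_one: "hom 0 1"
  by (auto simp: hom_def coef_one deg_def supp_def split: if_splits)

lemma hom_p1_power: "hom n (power_sum 1 ^ n)"
proof (induction n)
  case (Suc n)
  then show ?case
    using hom_power_sum_mult[of n "power_sum 1 ^ n" 1] by simp
qed (simp add: hom_one)

context jack
begin

lemma p1_power_expansion: "power_sum 1 ^ n = (\<Sum>g\<in>ptns n. mscale (alpha ^ n * of_nat (fact n) / jack_norm g) (JJ g))"
proof -
  have "power_sum 1 ^ n = (\<Sum>g\<in>ptns n. mscale (jack_inner (power_sum 1 ^ n) (JJ g) / jack_norm g) (JJ g))"
    using hom_p1_power[of n] by (intro JJ_expansion power_sum_1_Lam) (auto simp: hom_def)
  also have "\<dots> = (\<Sum>g\<in>ptns n. mscale (alpha ^ n * of_nat (fact n) / jack_norm g) (JJ g))"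
  proof (intro sum.cong refl)
    fix g assume "g \<in> ptns n"
    then have "jack_inner (power_sum 1 ^ n) (JJ g) = alpha ^ n * of_nat (fact n)"
      unfolding jack_inner_commute[OF power_sum_1_Lam JJ_Lam] jack_inner_p1_power[OF JJ_Lam]
      using JJ_ones[of g] by (simp add: ptns_def)
    then show "mscale (jack_inner (power_sum 1 ^ n) (JJ g) / jack_norm g) (JJ g)
        = mscale (alpha ^ n * of_nat (fact n) / jack_norm g) (JJ g)"
      by (simp only:)
  qed
  finally show ?thesis .
qed

lemma pieri_jack_inner:
  assumes g: "ptn g" and f: "ptn f"
  shows "pieri g y * jack_inner (JJ (add_box g y)) (JJ f) = (if f (Suc y) < f y \<and> g = rem_box f y then pieri g y * jack_norm f else 0)"
proof (cases "addable g y")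
  case False
  then have "pieri g y = 0"
    by (rule pieri_nonaddable[OF g])
  then show ?thesis
    by (simp only: mult_zero_left if_cancel)
next
  case True
  have iff: "f = add_box g y \<longleftrightarrow> f (Suc y) < f y \<and> g = rem_box f y"
  proof
    assume "f = add_box g y"
    then show "f (Suc y) < f y \<and> g = rem_box f y"
      using ptn_le[OF g, of y "Suc y"] by (auto simp: add_box_def rem_box_def)
  qed (use add_rem[OF f] in auto)
  show ?thesis
  proof (cases "f = add_box g y")
    case True
    have "jack_inner (JJ (add_box g y)) (JJ f) = jack_norm f"
      unfolding True jack_norm_def ..
    moreover have "f (Suc y) < f y \<and> g = rem_box f y"
      using iff True by (rule iffD1)
    ultimately show ?thesis
      by (simp only: simp_thms if_True)
  next
    case False
    then have "jack_inner (JJ (add_box g y)) (JJ f) = 0"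
      by (intro JJ_orth ptn_add g True f) auto
    then show ?thesis
      by (simp only: iff[symmetric] False if_False mult_zero_right)
  qed
qed

text \<open>The inner product of p_1^(n+1) with \<open>JJ f\<close> is evaluated twice: from the
  squarefree coefficient of \<open>JJ f\<close>, and by expanding p_1^n in Jack functions and
  multiplying by p_1.\<close>

lemma jack_norm_recursion:
  assumes f: "ptn f" "deg f = Suc n"
  shows "alpha * of_nat (Suc n) = (\<Sum>y\<le>Suc n. if f (Suc y) < f y then pieri (rem_box f y) y * jack_norm f / jack_norm (rem_box f y) else 0)"
proof -
  let ?w = "\<lambda>g. alpha ^ n * of_nat (fact n) / jack_norm g"
  have L: "g (Suc n) = 0" if "g \<in> ptns n" for g
    using ptn_deg_zero[of g "Suc n"] that by (simp add: ptns_def)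
  have "power_sum 1 ^ Suc n = (\<Sum>g\<in>ptns n. mscale (?w g) (power_sum 1 * JJ g))"
    using p1_power_expansion[of n] by (simp add: sum_distrib_left mscale_mult_right)
  then have "jack_inner (power_sum 1 ^ Suc n) (JJ f) = (\<Sum>g\<in>ptns n. ?w g * jack_inner (power_sum 1 * JJ g) (JJ f))"
    using JJ_Lam by (simp only: jack_inner_sum_left Lam_mscale Lam_power_sum_mult order_refl jack_inner_mscale_left)
  also have "\<dots> = (\<Sum>g\<in>ptns n. \<Sum>y\<le>Suc n. ?w g * (if f (Suc y) < f y \<and> g = rem_box f y then pieri g y * jack_norm f else 0))"
  proof (intro sum.cong refl)
    fix g assume g: "g \<in> ptns n"
    then have pg: "ptn g"
      by (simp add: ptns_def)
    have "jack_inner (power_sum 1 * JJ g) (JJ f) = (\<Sum>y\<le>Suc n. pieri g y * jack_inner (JJ (add_box g y)) (JJ f))"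
      unfolding p1_JJ[of g "Suc n", OF pg L[OF g]]
      using JJ_Lam by (simp only: jack_inner_sum_left Lam_mscale jack_inner_mscale_left)
    then show "?w g * jack_inner (power_sum 1 * JJ g) (JJ f) =
        (\<Sum>y\<le>Suc n. ?w g * (if f (Suc y) < f y \<and> g = rem_box f y then pieri g y * jack_norm f else 0))"
      by (simp only: pieri_jack_inner[OF pg f(1)] sum_distrib_left)
  qed
  also have "\<dots> = (\<Sum>y\<le>Suc n. \<Sum>g\<in>ptns n. ?w g * (if f (Suc y) < f y \<and> g = rem_box f y then pieri g y * jack_norm f else 0))"
    by (rule sum.swap)
  also have "\<dots> = (\<Sum>y\<le>Suc n. alpha ^ n * of_nat (fact n) * (if f (Suc y) < f y then pieri (rem_box f y) y * jack_norm f / jack_norm (rem_box f y) else 0))"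
  proof (intro sum.cong refl)
    fix y
    show "(\<Sum>g\<in>ptns n. ?w g * (if f (Suc y) < f y \<and> g = rem_box f y then pieri g y * jack_norm f else 0)) =
       alpha ^ n * of_nat (fact n) * (if f (Suc y) < f y then pieri (rem_box f y) y * jack_norm f / jack_norm (rem_box f y) else 0)"
    proof (cases "f (Suc y) < f y")
      case True
      have "rem_box f y \<in> ptns n"
        using rem_box[OF f(1) True] deg_add[of "rem_box f y" y] f(2) by (simp add: ptns_def)
      moreover have "(\<Sum>g\<in>ptns n. ?w g * (if f (Suc y) < f y \<and> g = rem_box f y then pieri g y * jack_norm f else 0)) =
          (\<Sum>g\<in>ptns n. if g = rem_box f y then ?w g * (pieri g y * jack_norm f) else 0)"
        using True by (intro sum.cong) auto
      ultimately show ?thesis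
        using True finite_ptns by (simp add: sum.delta)
    qed simp
  qed
  finally have "jack_inner (power_sum 1 ^ Suc n) (JJ f) = alpha ^ n * of_nat (fact n) *
      (\<Sum>y\<le>Suc n. if f (Suc y) < f y then pieri (rem_box f y) y * jack_norm f / jack_norm (rem_box f y) else 0)"
    by (simp only: sum_distrib_left)
  moreover have "jack_inner (power_sum 1 ^ Suc n) (JJ f) = alpha ^ n * of_nat (fact n) * (alpha * of_nat (Suc n))"
    unfolding jack_inner_commute[OF power_sum_1_Lam JJ_Lam] jack_inner_p1_power[OF JJ_Lam]
    using JJ_ones[of f] f(2) by (simp add: algebra_simps)
  moreover have "alpha ^ n * of_nat (fact n) \<noteq> 0"
    using alpha_pos by (simp add: fact_nonzero)
  ultimately have "alpha ^ n * of_nat (fact n) * (alpha * of_nat (Suc n)) = alpha ^ n * of_nat (fact n) *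
      (\<Sum>y\<le>Suc n. if f (Suc y) < f y then pieri (rem_box f y) y * jack_norm f / jack_norm (rem_box f y) else 0)"
    and nz: "alpha ^ n * of_nat (fact n) \<noteq> (0::ratfun)"
    by (simp_all only:) simp
  then show ?thesis
    by (simp only: mult_left_cancel[OF nz])
qed

lemma JJ_zero: "JJ (\<lambda>_. 0) = 1"
  and jack_norm_zero: "jack_norm (\<lambda>_. 0) = 1"
proof -
  let ?z = "\<lambda>_::nat. 0 :: nat"
  have z: "ptn ?z" "deg ?z = 0"
    by (simp_all add: ptn_def supp_def antimono_def deg_def)
  have "ptns 0 = {?z}"
  proof (intro set_eqI iffI)
    fix f assume "f \<in> ptns 0"
    then show "f \<in> {?z}"
      unfolding ptns_def using deg_zero_ptn[of f] by simp
  next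
    fix f assume "f \<in> {?z}"
    then show "f \<in> ptns 0"
      unfolding ptns_def using z by blast
  qed
  then have 1: "1 = mscale (1 / jack_norm ?z) (JJ ?z)"
    using p1_power_expansion[of 0] by simp
  have one: "coef 1 (ones 0) = 1" "ones 0 = ?z"
    using coef_one[OF fs_ones, of 0] by (simp_all add: ones_def)
  have "1 / jack_norm ?z * coef (JJ ?z) (ones 0) = 1"
    using one(1) by (metis 1 coef_mscale)
  then show jack_norm: "jack_norm ?z = 1"
    using JJ_ones[of ?z] z by (simp add: field_simps split: if_splits)
  show "JJ ?z = 1"
    using 1 by (simp add: jack_norm)
qed

text \<open>With the smaller norms known, each term of \<open>jack_norm_recursion\<close> is the
  ratio of norm to hook product of \<open>f\<close> times a term of
  \<open>content_sum_identity\<close>. Both sums have the same value, so the ratio is 1.\<close>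

theorem jack_norm_eq_hook_prod: "ptn f \<Longrightarrow> jack_norm f = hook_prod f"
proof (induction "deg f" arbitrary: f rule: less_induct)
  case less
  show ?case
  proof (cases "deg f")
    case 0
    then have "f = (\<lambda>_. 0)"
      using deg_zero_ptn less.prems by blast
    then show ?thesis
      by (simp add: jack_norm_zero hook_prod_def dg_def)
  next
    case (Suc n)
    define b where "b y = (ct f y - 1 - ct f (Suc n)) * (\<Prod>j\<in>{..<Suc n} - {y}. (ct f y - 1 - ct f j) / (ct f y - ct f j))" for y
    have L: "f (Suc n) = 0"
      using ptn_deg_zero[OF less.prems, of "Suc n"] Suc by simp
    have "(if f (Suc y) < f y then pieri (rem_box f y) y * jack_norm f / jack_norm (rem_box f y) else 0) = jack_norm f / hook_prod f * b y" if y: "y < Suc n" for y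
    proof (cases "f (Suc y) < f y")
      case True
      have "deg (rem_box f y) < deg f"
        using rem_box[OF less.prems True] deg_add[of "rem_box f y" y] by simp
      then have IH: "jack_norm (rem_box f y) = hook_prod (rem_box f y)"
        using ptn_rem[OF less.prems True] by (rule less.hyps)
      have "b y = pieri (rem_box f y) y * hook_prod f / hook_prod (rem_box f y)"
        unfolding b_def by (rule pieri_HH[OF less.prems L True, symmetric])
      then have "pieri (rem_box f y) y * jack_norm f / hook_prod (rem_box f y) = jack_norm f / hook_prod f * b y"
        using hook_prod_pos[OF less.prems] by simp
      then show ?thesis
        using True IH by simp
    next
      \<comment> \<open>A row without removable box is absent from the recursion, and its term in
        the content sum vanishes as well: the factor of row y + 1 is 0. For y = n that factor is the
        separate one in front of the product.\<close>
      case False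
      then have "f (Suc y) = f y"
        using ptn_le[OF less.prems, of y "Suc y"] by simp
      then have eq: "ct f y - 1 - ct f (Suc y) = 0"
        by (simp add: ct_def)
      have "b y = 0"
      proof (cases "y = n")
        case True
        then show ?thesis
          using eq by (simp add: b_def)
      next
        case False
        then have "(\<Prod>j\<in>{..<Suc n} - {y}. (ct f y - 1 - ct f j) / (ct f y - ct f j)) = 0"
          using y eq by (intro prod_zero bexI[of _ "Suc y"]) auto
        then show ?thesis
          by (simp add: b_def)
      qed
      then show ?thesis
        using False by simp
    qed
    then have "alpha * of_nat (Suc n) = (\<Sum>y<Suc n. jack_norm f / hook_prod f * b y)"
      unfolding jack_norm_recursion[OF less.prems Suc] using L by (simp add: lessThan_Suc_atMost[symmetric] sum.lessThan_Suc[of _ "Suc n"] del: sum.lessThan_Suc)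
    also have "\<dots> = jack_norm f / hook_prod f * (\<Sum>y<Suc n. b y)"
      by (rule sum_distrib_left[symmetric])
    also have "(\<Sum>y<Suc n. b y) = alpha * of_nat (Suc n)"
      unfolding b_def content_sum_identity[of f "Suc n", OF less.prems L] by (simp only: Suc)
    finally have "1 * (alpha * of_nat (Suc n)) = jack_norm f / hook_prod f * (alpha * of_nat (Suc n))"
      by simp
    moreover have "alpha * of_nat (Suc n) \<noteq> 0"
      using alpha_pos by (simp del: of_nat_Suc)
    ultimately have "jack_norm f / hook_prod f = 1"
      by (metis mult_right_cancel)
    then show ?thesis
      using hook_prod_pos[OF less.prems] by (simp add: field_simps)
  qed
qed

end

section \<open>Complementation in a rectangle\<close>

text \<open>
  Here \<open>l\<close> is the union of a partition with the rectangle \<open>m\<^sup>n\<close>; \<open>interval\<close> consists of the partitions that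
  differ from \<open>l\<close> only inside the box \<open>[a, m) \<times> [c, n)\<close>, and \<open>bar k\<close> is the complement of
  \<open>k \<inter> m\<^sup>n\<close> (truncated subtraction accounts for the rows that stick out).
\<close>

locale box =
  fixes l :: "nat \<Rightarrow> nat" and m n a c :: nat
  assumes l: "ptn l" and am: "a < m"
    and l_low: "\<And>j. j < c \<Longrightarrow> m \<le> l j" and l_mid: "\<And>j. c \<le> j \<Longrightarrow> j < n \<Longrightarrow> l j = m"
    and l_high: "\<And>j. n \<le> j \<Longrightarrow> l j \<le> a"
begin

definition interval :: "(nat \<Rightarrow> nat) set" where
  "interval = {k. ptn k \<and> (\<forall>j. c \<le> j \<and> j < n \<longrightarrow> a \<le> k j \<and> k j \<le> m) \<and> (\<forall>j. \<not> (c \<le> j \<and> j < n) \<longrightarrow> k j = l j)}"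

definition bar :: "(nat \<Rightarrow> nat) \<Rightarrow> nat \<Rightarrow> nat" where
  "bar k i = (if i < n then m - k (n - 1 - i) else 0)"

lemma interval_ptn: "k \<in> interval \<Longrightarrow> ptn k"
  by (simp add: interval_def)

lemma interval_mid: "k \<in> interval \<Longrightarrow> c \<le> j \<Longrightarrow> j < n \<Longrightarrow> a \<le> k j \<and> k j \<le> m"
  by (simp add: interval_def)

lemma interval_out: "k \<in> interval \<Longrightarrow> j < c \<or> n \<le> j \<Longrightarrow> k j = l j"
  by (auto simp: interval_def)

lemma interval_le: "k \<in> interval \<Longrightarrow> k j \<le> l j"
  using interval_mid[of k j] interval_out[of k j] l_mid[of j] by (cases "c \<le> j \<and> j < n") auto

lemma l_interval: "l \<in> interval"
  using l l_mid am by (simp add: interval_def)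

lemma bar_ptn: "ptn k \<Longrightarrow> ptn (bar k)"
  unfolding ptn_def
proof
  assume k: "antimono k \<and> fs k"
  show "antimono (bar k)"
  proof (rule antimonoI)
    fix i j :: nat assume ij: "i \<le> j"
    have "k (n - 1 - i) \<le> k (n - 1 - j)"
      using k ij by (intro antimonoD[of k]) auto
    then show "bar k j \<le> bar k i"
      using ij diff_le_mono2 by (simp add: bar_def)
  qed
  show "fs (bar k)"
    by (rule finite_subset[of _ "{..<n}"]) (auto simp: bar_def split: if_splits)
qed

lemma bar_inj: "inj_on bar interval"
proof (rule inj_onI, rule ext)
  fix k k' j assume k: "k \<in> interval" "k' \<in> interval" "bar k = bar k'"
  show "k j = k' j"
  proof (cases "c \<le> j \<and> j < n")
    case True
    then have "m - k j = m - k' j"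
      using fun_cong[OF k(3), of "n - 1 - j"] by (simp add: bar_def)
    then show ?thesis
      using interval_mid[OF k(1), of j] interval_mid[OF k(2), of j] True by linarith
  next
    case False
    then show ?thesis
      using interval_out[OF k(1), of j] interval_out[OF k(2), of j] by auto
  qed
qed

lemma bar_l: "bar l = (\<lambda>_. 0)"
proof
  fix i
  show "bar l i = 0"
    using l_low[of "n - 1 - i"] l_mid[of "n - 1 - i"] by (cases "n - 1 - i < c") (simp_all add: bar_def)
qed

text \<open>Confines sums over intermediate partitions to the interval.\<close>

lemma interval_convex:
  assumes k: "k \<in> interval" "k' \<in> interval" and t: "ptn t" "\<And>j. k j \<le> t j" "\<And>j. t j \<le> k' j"
  shows "t \<in> interval"
  unfolding interval_def mem_Collect_eq
proof (intro conjI allI impI t(1))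
  fix j
  show "a \<le> t j" "t j \<le> m" if "c \<le> j \<and> j < n"
    using interval_mid[OF k(1), of j] interval_mid[OF k(2), of j] t(2,3)[of j] that by linarith+
  show "t j = l j" if "\<not> (c \<le> j \<and> j < n)"
    using interval_out[OF k(1), of j] interval_out[OF k(2), of j] t(2,3)[of j] that by linarith
qed

text \<open>On the complementary side an upper bound alone suffices: the complements of members of
  the interval are exactly the partitions fitting into a box of m - a columns and n - c rows, and
  this set is closed under taking subdiagrams.\<close>

lemma bar_down:
  assumes k: "k \<in> interval" and t: "ptn t" "\<And>j. t j \<le> bar k j"
  shows "t \<in> bar ` interval"
proof (rule image_eqI)
  define k' where "k' j = (if c \<le> j \<and> j < n then m - t (n - 1 - j) else l j)" for j
  have k'_in: "k' j = m - t (n - 1 - j)" if "c \<le> j" "j < n" for j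
    using that by (simp add: k'_def)
  have k'_out: "k' j = l j" if "\<not> (c \<le> j \<and> j < n)" for j
    unfolding k'_def using that by (rule if_not_P)
  have tm: "t i \<le> m - a" if "i < n - c" for i
  proof -
    have "a \<le> k (n - 1 - i)"
      using interval_mid[OF k, of "n - 1 - i"] that by auto
    moreover have "t i \<le> m - k (n - 1 - i)"
      using t(2)[of i] that by (simp add: bar_def split: if_splits)
    ultimately show ?thesis
      by linarith
  qed
  have t0: "t i = 0" if "n - c \<le> i" for i
  proof (cases "i < n")
    case True
    then have "n - 1 - i < c"
      using that by linarith
    then have "m \<le> k (n - 1 - i)"
      using interval_out[OF k, of "n - 1 - i"] l_low[of "n - 1 - i"] by simp
    then show ?thesis
      using t(2)[of i] True by (simp add: bar_def)
  qed (use t(2)[of i] in \<open>simp add: bar_def\<close>)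
  have mid: "a \<le> k' j" "k' j \<le> m" if "c \<le> j" "j < n" for j
  proof -
    have "n - 1 - j < n - c"
      using that by linarith
    then show "a \<le> k' j" "k' j \<le> m"
      using tm[of "n - 1 - j"] am unfolding k'_in[OF that] by linarith+
  qed
  have "antimono k'"
  proof (rule antimonoI)
    fix i j :: nat assume ij: "i \<le> j"
    show "k' j \<le> k' i"
    proof (cases "c \<le> i \<and> i < n")
      case True
      show ?thesis
      proof (cases "j < n")
        case False
        then have "k' j \<le> a"
          using l_high[of j] k'_out[of j] by simp
        then show ?thesis
          using mid(1)[of i] True by simp
      next
        case jn: True
        have "t (n - 1 - i) \<le> t (n - 1 - j)"
          using ij by (intro ptn_le[OF t(1)]) simp
        then show ?thesis
          using True ij jn by (simp add: k'_in diff_le_mono2)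
      qed
    next
      case False
      then have ki: "k' i = l i"
        by (rule k'_out)
      show ?thesis
      proof (cases "c \<le> j \<and> j < n")
        case True
        then show ?thesis
          using mid(2)[of j] l_low[of i] ki False ij by simp
      next
        case False
        show ?thesis
          using ki ptn_le[OF l ij] k'_out[OF False] by simp
      qed
    qed
  qed
  moreover have "fs k'"
  proof (rule finite_subset)
    show "supp k' \<subseteq> supp l \<union> {..<n}"
    proof
      fix x assume "x \<in> supp k'"
      then show "x \<in> supp l \<union> {..<n}"
        using k'_out[of x] by (cases "x < n") auto
    qed
  qed (use ptn_fs[OF l] in simp)
  ultimately show "k' \<in> interval"
    unfolding interval_def ptn_def using mid k'_out by blast
  show "t = bar k'"
  proof
    fix i
    consider "i < n - c" | "n - c \<le> i" "i < n" | "n \<le> i"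
      by linarith
    then show "t i = bar k' i"
    proof cases
      case 1
      then have "c \<le> n - 1 - i" "n - 1 - i < n" "n - 1 - (n - 1 - i) = i" "i < n"
        by linarith+
      then show ?thesis
        using tm[OF 1] k'_in[of "n - 1 - i"] by (simp add: bar_def)
    next
      case 2
      then have "n - 1 - i < c"
        by linarith
      then show ?thesis
        using t0[of i] l_low[of "n - 1 - i"] 2 k'_out[of "n - 1 - i"] by (simp add: bar_def)
    next
      case 3
      then show ?thesis
        using t0[of i] by (simp add: bar_def)
    qed
  qed
qed

lemma finite_interval: "finite interval"
proof (rule finite_subset)
  show "interval \<subseteq> {k. \<forall>x. (x \<in> supp l \<longrightarrow> k x \<in> {..l 0}) \<and> (x \<notin> supp l \<longrightarrow> k x = 0)}"
  proof (intro subsetI CollectI allI conjI impI)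
    fix k x assume k: "k \<in> interval"
    show "k x \<in> {..l 0}"
      using interval_le[OF k, of x] ptn_le[OF l, of 0 x] by simp
    show "k x = 0" if "x \<notin> supp l"
      using interval_le[OF k, of x] that by simp
  qed
  show "finite {k. \<forall>x. (x \<in> supp l \<longrightarrow> k x \<in> {..l 0}) \<and> (x \<notin> supp l \<longrightarrow> k x = (0::nat))}"
    using ptn_fs[OF l] by (intro finite_set_of_finite_funs) auto
qed

text \<open>Adding a box to \<open>k\<close> removes the opposite box from its complement.\<close>

lemma add_in_interval:
  assumes k: "k \<in> interval" and y: "addable k y" and k': "add_box k y \<in> interval"
  shows "c \<le> y" "y < n" "k y < m"
    and "bar k = add_box (bar (add_box k y)) (n - 1 - y)" "addable (bar (add_box k y)) (n - 1 - y)"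
    and "bar (add_box k y) (n - 1 - y) = m - 1 - k y"
proof -
  show yn: "c \<le> y" "y < n"
    using interval_out[OF k, of y] interval_out[OF k', of y] by (auto simp: add_box_def not_le[symmetric])
  show km: "k y < m"
    using interval_mid[OF k', of y] yn by (simp add: add_box_def)
  show v: "bar (add_box k y) (n - 1 - y) = m - 1 - k y"
    using yn by (simp add: bar_def add_box_def)
  show "bar k = add_box (bar (add_box k y)) (n - 1 - y)"
  proof
    fix i
    show "bar k i = add_box (bar (add_box k y)) (n - 1 - y) i"
    proof (cases "i = n - 1 - y")
      case True
      then show ?thesis
        using yn km v by (simp add: add_box_def[of "bar _"] bar_def)
    next
      case False
      then have "n - 1 - i \<noteq> y \<or> n \<le> i"
        using yn by auto
      then show ?thesis
        using False by (auto simp: add_box_def bar_def)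
    qed
  qed
  show "addable (bar (add_box k y)) (n - 1 - y)"
    unfolding addable_def
  proof (intro allI impI)
    fix j assume j: "j < n - 1 - y"
    then have "k (n - 1 - j) \<le> k y"
      using yn by (intro ptn_le[OF interval_ptn[OF k]]) simp
    moreover have "n - 1 - j \<noteq> y" "j < n"
      using j by auto
    ultimately show "bar (add_box k y) (n - 1 - y) < bar (add_box k y) j"
      using km unfolding v by (simp add: bar_def add_box_def)
  qed
qed

lemma add_of_bar:
  assumes k: "k \<in> interval" "k' \<in> interval" and z: "bar k = add_box (bar k') z" "addable (bar k') z"
  shows "z < n" "addable k (n - 1 - z)" "k' = add_box k (n - 1 - z)"
proof -
  let ?y = "n - 1 - z"
  have bz: "bar k z = Suc (bar k' z)"
    by (simp add: z(1) add_box_def)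
  then show zn: "z < n"
    by (auto simp: bar_def split: if_splits)
  have eq: "bar k j = bar k' j" if "j \<noteq> z" for j
    using that by (simp add: z(1) add_box_def)
  have "c \<le> ?y"
  proof (rule ccontr)
    assume "\<not> c \<le> ?y"
    then show False
      using bz zn l_low[of ?y] interval_out[OF k(1), of ?y] by (simp add: bar_def)
  qed
  then have my: "m - k ?y = Suc (m - k' ?y)" "k' ?y \<le> m"
    using bz zn interval_mid[OF k(2), of ?y] by (simp_all add: bar_def)
  show k': "k' = add_box k ?y"
  proof
    fix j
    show "k' j = add_box k ?y j"
    proof (cases "c \<le> j \<and> j < n")
      case True
      then have "k j \<le> m" "k' j \<le> m"
        using interval_mid[OF k(1), of j] interval_mid[OF k(2), of j] by auto
      moreover have "m - k j = m - k' j" if "j \<noteq> ?y"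
        using eq[of "n - 1 - j"] True that zn by (auto simp: bar_def)
      ultimately show ?thesis
        using my by (auto simp: add_box_def)
    next
      case False
      then have "j \<noteq> ?y"
        using \<open>c \<le> ?y\<close> zn by auto
      then show ?thesis
        using False interval_out[OF k(1), of j] interval_out[OF k(2), of j] by (auto simp: add_box_def)
    qed
  qed
  show "addable k ?y"
    unfolding addable_def
  proof (intro allI impI)
    fix j assume "j < ?y"
    then have "k' ?y \<le> k' j" "k' j = k j"
      using ptn_le[OF interval_ptn[OF k(2)], of j ?y] by (auto simp: k' add_box_def)
    then show "k ?y < k j"
      by (simp add: k' add_box_def)
  qed
qed

text \<open>The two boxes are exchanged by the half-turn of the rectangle, so their contents add up
  to the content of the corner (m - 1, n - 1).\<close>

lemma eps_bar:
  assumes "k \<in> interval" "addable k y" "add_box k y \<in> interval"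
  shows "eps (add_box k y) - eps k = ct k y"
    and "eps (bar k) - eps (bar (add_box k y)) = (alpha * of_nat (m - 1) - of_nat (n - 1)) - ct k y"
proof -
  note A = add_in_interval[OF assms]
  show "eps (add_box k y) - eps k = ct k y"
    using eps_add[OF interval_ptn[OF assms(1)] assms(2)] by simp
  have "eps (bar k) = eps (bar (add_box k y)) + ct (bar (add_box k y)) (n - 1 - y)"
    unfolding A(4) using eps_add[OF bar_ptn[OF interval_ptn[OF assms(3)]] A(5)] A(4) by simp
  moreover have "ct (bar (add_box k y)) (n - 1 - y) = (alpha * of_nat (m - 1) - of_nat (n - 1)) - ct k y"
    unfolding ct_def A(6) using A(2,3) by (simp add: of_nat_diff algebra_simps)
  ultimately show "eps (bar k) - eps (bar (add_box k y)) = (alpha * of_nat (m - 1) - of_nat (n - 1)) - ct k y"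
    by simp
qed

text \<open>The three factors of the claimed value, with \<open>k\<close> for \<open>\<mu>\<close>. In \<open>RX\<close> the diagram is that of \<open>l\<close>
  throughout, and \<open>k\<close> only determines which hooks are upper.\<close>

definition PX :: "(nat \<Rightarrow> nat) \<Rightarrow> ratfun" where
  "PX k = (\<Prod>b\<in>dg k. if snd b < c then hU k b else hL k b)"

definition QX :: "(nat \<Rightarrow> nat) \<Rightarrow> ratfun" where
  "QX k = (\<Prod>b\<in>dg (bar k). hU (bar k) b)"

text \<open>Inside K the rows c, ..., n - 1 are reflected. Adding the box (x, y) to k therefore
  changes the choice in \<open>l\<close> at the single box (x, n - 1 + c - y), from lower to
  upper.\<close>

definition UX :: "(nat \<Rightarrow> nat) \<Rightarrow> nat \<times> nat \<Rightarrow> bool" where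
  "UX k b \<longleftrightarrow> c \<le> snd b \<and> (a \<le> fst b \<and> fst b < m \<and> snd b < n \<longrightarrow> (fst b, n - 1 + c - snd b) \<in> dg k)"

definition RX :: "(nat \<Rightarrow> nat) \<Rightarrow> ratfun" where
  "RX k = (\<Prod>b\<in>dg l. if UX k b then hU l b else hL l b)"

text \<open>Within the n rows, those of \<open>add_box k y\<close> longer than x and the others are
  counted separately; the others form a column of the complement. As x exceeds \<open>k y\<close>,
  the longer rows all lie below row y, and they include every row below c.\<close>

lemma col_bar:
  assumes k: "k \<in> interval" and k': "add_box k y \<in> interval" and y: "addable k y" and x: "k y < x" "x < m"
  shows "col (bar (add_box k y)) (m - 1 - x) + (c + card {j \<in> {c..<y}. x < k j}) = n"
proof -
  note A = add_in_interval[OF k y k']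
  let ?k' = "add_box k y"
  have ge: "m \<le> ?k' j" if "j < c" for j
    using l_low[OF that] interval_out[OF k', of j] that by simp
  have le: "?k' j \<le> x" if "y \<le> j" for j
    using ptn_le[OF interval_ptn[OF k'] that] x(1) by (simp add: add_box_def)
  have same: "?k' j = k j" if "j < y" for j
    using that by (simp add: add_box_def)
  have "{t. m - 1 - x < bar ?k' t} = (\<lambda>j. n - 1 - j) ` ({y..<n} \<union> {j \<in> {c..<y}. \<not> x < k j})"
  proof (intro set_eqI iffI)
    fix t assume t: "t \<in> {t. m - 1 - x < bar ?k' t}"
    let ?j = "n - 1 - t"
    have tn: "t < n" "?k' ?j \<le> x"
      using t x by (auto simp: bar_def split: if_splits)
    then have "c \<le> ?j"
      using ge[of ?j] x by (auto simp: not_less[symmetric])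
    then have "?j \<in> {y..<n} \<union> {j \<in> {c..<y}. \<not> x < k j}"
      using tn same[of ?j] by (auto simp: not_le)
    then show "t \<in> (\<lambda>j. n - 1 - j) ` ({y..<n} \<union> {j \<in> {c..<y}. \<not> x < k j})"
      using tn(1) by (intro image_eqI[of _ _ ?j]) auto
  next
    fix t assume "t \<in> (\<lambda>j. n - 1 - j) ` ({y..<n} \<union> {j \<in> {c..<y}. \<not> x < k j})"
    then obtain j where j: "t = n - 1 - j" "j \<in> {y..<n} \<union> {j \<in> {c..<y}. \<not> x < k j}"
      by blast
    have "?k' j \<le> x" "j < n"
      using j(2) le[of j] same[of j] A(2) by auto
    then show "t \<in> {t. m - 1 - x < bar ?k' t}"
      using x by (auto simp: bar_def j(1))
  qed
  moreover have "inj_on (\<lambda>j. n - 1 - j) ({y..<n} \<union> {j \<in> {c..<y}. \<not> x < k j})"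
    using A(2) by (auto simp: inj_on_def)
  ultimately have "col (bar ?k') (m - 1 - x) = card ({y..<n} \<union> {j \<in> {c..<y}. \<not> x < k j})"
    by (simp only: col_def card_image)
  also have "\<dots> = card {y..<n} + card {j \<in> {c..<y}. \<not> x < k j}"
    by (rule card_Un_disjoint) auto
  moreover have "card {j \<in> {c..<y}. x < k j} + card {j \<in> {c..<y}. \<not> x < k j} = card {c..<y}"
  proof (subst card_Un_disjoint[symmetric])
    show "card ({j \<in> {c..<y}. x < k j} \<union> {j \<in> {c..<y}. \<not> x < k j}) = card {c..<y}"
      by (rule arg_cong[where f = card]) auto
  qed auto
  ultimately show ?thesis
    using A(1,2) by simp
qed

text \<open>Both products follow the boundary of \<open>k\<close> between the points (x + 1, y) and
  (m, c): the left one along its rows, the right one along its columns, seen from the complement.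
  \<open>path_ratio\<close>, used for upper and for lower hook values, converts one into the other.
  The end values at (x + 1, y) are \<alpha> and 1, and those at (m, c) are the two hooks of
  \<open>l\<close> at the flipped box.\<close>

lemma core_identity:
  assumes k: "k \<in> interval" and k': "add_box k y \<in> interval" and y: "addable k y"
  defines "x \<equiv> k y" and "z \<equiv> n - 1 - y" and "g \<equiv> bar (add_box k y)"
  shows "(\<Prod>j=c..<y. hU k (x, j) * hL (add_box k y) (x, j) / (hU (add_box k y) (x, j) * hL k (x, j))) *
      (hU l (x, n - 1 + c - y) / hL l (x, n - 1 + c - y)) =
    alpha * (\<Prod>i<g z. hU (add_box g z) (i, z) * hL g (i, z) / (hU g (i, z) * hL (add_box g z) (i, z)))"
proof -
  note A = add_in_interval[OF k y k']
  have pk: "ptn k" and pg: "ptn g"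
    using interval_ptn[OF k] bar_ptn[OF interval_ptn[OF k']] by (simp_all add: g_def)
  have gz: "g z = m - 1 - x" and az: "addable g z"
    using A(5,6) by (simp_all add: g_def z_def x_def)
  define h where "h i = c + card {j \<in> {c..<y}. i < k j}" for i
  have hy: "h i \<le> y" for i
  proof -
    have "card {j \<in> {c..<y}. i < k j} \<le> card {c..<y}"
      by (rule card_mono) auto
    then show ?thesis
      using A(1) by (simp add: h_def)
  qed
  \<comment> \<open>Upper and lower hook values as affine functions of a boundary point. They
    describe the hooks in the column of the new box and, after the half-turn, those in the
    corresponding row of the complement.\<close>
  define A0 where "A0 i h = alpha * (of_nat i - of_nat x) + (of_nat y - of_nat h)" for i h
  define A1 where "A1 i h = alpha * (of_nat i - of_nat x - 1) + (of_nat y - of_nat h + 1)" for i h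
  have A0: "A0 i h > 0" and A1: "A1 i h > 0" if ih: "x < i" "h \<le> y" for i h
  proof -
    obtain p where p: "i = Suc (x + p)"
      using ih(1) less_iff_Suc_add[of x i] by blast
    obtain q where q: "y = h + q"
      using le_Suc_ex[OF ih(2)] by blast
    have "A0 i h = alpha * of_nat (Suc p) + of_nat q" "A1 i h = alpha * of_nat p + of_nat (Suc q)"
      by (simp_all add: A0_def A1_def p q algebra_simps)
    then show "A0 i h > 0" "A1 i h > 0"
      using alpha_pos by (simp_all add: add_pos_nonneg add_nonneg_pos del: of_nat_Suc)
  qed
  have kj: "x < k j" if "j < y" for j
    using y that by (simp add: addable_def x_def)
  have km: "k j \<le> m" if "c \<le> j" "j < y" for j
    using interval_mid[OF k, of j] that A(2) by simp
  have P0: "(\<Prod>i=Suc x..<m. A0 (Suc i) (h i) / A0 i (h i)) =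
      A0 m c / A0 (Suc x) y * (\<Prod>j=c..<y. A0 (k j) (Suc j) / A0 (k j) j)"
    using A(1,3) kj km hy A0 ptn_le[OF pk]
    by (intro path_ratio) (auto simp: h_def x_def Suc_le_eq less_imp_neq[OF A0, THEN not_sym])
  have P1: "(\<Prod>i=Suc x..<m. A1 (Suc i) (h i) / A1 i (h i)) =
      A1 m c / A1 (Suc x) y * (\<Prod>j=c..<y. A1 (k j) (Suc j) / A1 (k j) j)"
    using A(1,3) kj km hy A1 ptn_le[OF pk]
    by (intro path_ratio) (auto simp: h_def x_def Suc_le_eq less_imp_neq[OF A1, THEN not_sym])
  have e1: "A0 (Suc x) y = alpha" "A1 (Suc x) y = 1"
    by (simp_all add: A0_def A1_def)
  have R: "(\<Prod>i<g z. hU (add_box g z) (i, z) * hL g (i, z) / (hU g (i, z) * hL (add_box g z) (i, z))) =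
      (\<Prod>i=Suc x..<m. (A0 (Suc i) (h i) / A0 i (h i)) / (A1 (Suc i) (h i) / A1 i (h i)))"
  proof (rule prod.reindex_bij_witness[of _ "\<lambda>i. m - 1 - i" "\<lambda>i. m - 1 - i"])
    fix i assume i: "i \<in> {..<g z}"
    let ?x = "m - 1 - i"
    have x': "x < ?x" "?x < m" "m - 1 - ?x = i"
      using i A(3) by (auto simp: gz x_def)
    have "col g i + h ?x = n"
      using col_bar[OF k k' y x'(1)[unfolded x_def] x'(2)] x'(3) by (simp add: g_def h_def)
    then have "of_nat (col g i + h ?x) = (of_nat (Suc (z + y)) :: ratfun)"
      using A(2) by (simp only: z_def) simp
    then have c': "of_nat (col g i) - of_nat z = of_nat y + 1 - (of_nat (h ?x) :: ratfun)"
      by (simp add: algebra_simps)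
    have gzi: "of_nat (g z) - of_nat i = of_nat ?x - (of_nat x :: ratfun)"
      using A(3) i by (simp add: gz x_def of_nat_diff)
    have gzi': "of_nat (g z) - of_nat (Suc i) = of_nat ?x - (of_nat x :: ratfun) - 1"
      unfolding gzi[symmetric] by simp
    have ig: "i < g z"
      using i by simp
    have "hL g (i, z) = A1 ?x (h ?x)" "hL (add_box g z) (i, z) = A1 (Suc ?x) (h ?x)"
      "hU g (i, z) = A0 ?x (h ?x)" "hU (add_box g z) (i, z) = A0 (Suc ?x) (h ?x)"
      unfolding hooks_row[OF pg az ig] c' gzi gzi' A0_def A1_def by (simp_all add: algebra_simps)
    then show "(A0 (Suc ?x) (h ?x) / A0 ?x (h ?x)) / (A1 (Suc ?x) (h ?x) / A1 ?x (h ?x)) =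
        hU (add_box g z) (i, z) * hL g (i, z) / (hU g (i, z) * hL (add_box g z) (i, z))"
      by simp
  qed (use A(3) in \<open>auto simp: gz x_def\<close>)
  have L: "(\<Prod>j=c..<y. hU k (x, j) * hL (add_box k y) (x, j) / (hU (add_box k y) (x, j) * hL k (x, j))) =
      (\<Prod>j=c..<y. (A0 (k j) (Suc j) / A0 (k j) j) / (A1 (k j) (Suc j) / A1 (k j) j))"
  proof (intro prod.cong refl)
    fix j assume j: "j \<in> {c..<y}"
    have "A0 (k j) (Suc j) = hU k (x, j)" "A0 (k j) j = hU (add_box k y) (x, j)"
      "A1 (k j) (Suc j) = hL k (x, j)" "A1 (k j) j = hL (add_box k y) (x, j)"
      using j hooks_col[OF pk y, of j] by (simp_all add: x_def A0_def A1_def ct_def algebra_simps)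
    then show "hU k (x, j) * hL (add_box k y) (x, j) / (hU (add_box k y) (x, j) * hL k (x, j)) =
        (A0 (k j) (Suc j) / A0 (k j) j) / (A1 (k j) (Suc j) / A1 (k j) j)"
      by simp
  qed
  have "hU l (x, n - 1 + c - y) = A0 m c" "hL l (x, n - 1 + c - y) = A1 m c"
  proof -
    have "a \<le> x"
      using interval_mid[OF k, of y] A(1,2) by (simp add: x_def)
    have "x < l j \<longleftrightarrow> j < n" for j
    proof (cases "j < n")
      case True
      then have "m \<le> l j"
        using l_low[of j] l_mid[of j] by (cases "j < c") simp_all
      then show ?thesis
        using True A(3) by (simp add: x_def)
    next
      case False
      then show ?thesis
        using l_high[of j] \<open>a \<le> x\<close> by simp
    qed
    then have "{j. x < l j} = {..<n}"
      by (simp add: lessThan_def)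
    then have "col l x = n"
      by (simp add: col_def)
    moreover have "l (n - 1 + c - y) = m"
      using A(1,2) by (intro l_mid) auto
    moreover have "of_nat (n - 1 + c - y) = (of_nat n - 1 + of_nat c - of_nat y :: ratfun)"
      using A(2) by (simp add: of_nat_diff)
    ultimately show "hU l (x, n - 1 + c - y) = A0 m c" "hL l (x, n - 1 + c - y) = A1 m c"
      by (simp_all add: hU.simps hL.simps A0_def A1_def algebra_simps)
  qed
  then show ?thesis
    unfolding trans[OF R prod_dividef] trans[OF L prod_dividef] P0 P1 e1 using alpha_pos
    by (simp only: times_divide_eq_right times_divide_eq_left divide_divide_eq_left divide_divide_eq_right
      mult_1_left mult_1_right div_by_1) (simp add: ac_simps)
qed

end

section \<open>The weighted identity between Pieri coefficients\<close>

locale jack_box = jack J + box l m n a c for J l m n a c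
begin

definition weight :: "(nat \<Rightarrow> nat) \<Rightarrow> ratfun" where
  "weight k = PX k * QX k * RX k"

text \<open>The Pieri coefficient of \<open>k\<close> cancels the change of \<open>PX\<close> in the
  row of the new box and in its column below row c; that of the complement cancels the change of
  \<open>QX\<close> in the column of the opposite box. What is left, with the flipped hook in
  \<open>RX\<close>, is \<open>core_identity\<close>.\<close>

lemma gauge:
  assumes k: "k \<in> interval" and k': "add_box k y \<in> interval" and y: "addable k y"
  shows "pieri k y * weight (add_box k y) = weight k * pieri (bar (add_box k y)) (n - 1 - y)"
proof -
  note A = add_in_interval[OF k y k']
  let ?x = "k y" and ?k' = "add_box k y" and ?g = "bar (add_box k y)" and ?z = "n - 1 - y"
  have pk: "ptn k" and pk': "ptn ?k'" and pg: "ptn ?g"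
    using interval_ptn[OF k] interval_ptn[OF k'] bar_ptn[OF interval_ptn[OF k']] by simp_all
  have nzk: "hU k b \<noteq> 0" "hL k b \<noteq> 0" if "b \<in> dg k" for b
    using hook_pos[OF pk that] by auto
  have nzk': "hU ?k' b \<noteq> 0" "hL ?k' b \<noteq> 0" if "b \<in> dg ?k'" for b
    using hook_pos[OF pk' that] by auto
  have nzg: "hU ?g b \<noteq> 0" "hL ?g b \<noteq> 0" if "b \<in> dg ?g" for b
    using hook_pos[OF pg that] by auto
  have nzg': "hU (add_box ?g ?z) b \<noteq> 0" "hL (add_box ?g ?z) b \<noteq> 0" if "b \<in> dg (add_box ?g ?z)" for b
    using hook_pos[OF ptn_add[OF pg A(5)] that] by auto
  have colb: "(?x, j) \<in> dg k" "(?x, j) \<in> dg ?k'" if "j < y" for j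
    using y that dg_add(1)[of k y] by (auto simp: dg_def addable_def)
  have rowb: "(i, y) \<in> dg k" "(i, y) \<in> dg ?k'" if "i < ?x" for i
    using that dg_add(1)[of k y] by (auto simp: dg_def)
  have gcolb: "(?g ?z, j) \<in> dg ?g" "(?g ?z, j) \<in> dg (add_box ?g ?z)" if "j < ?z" for j
    using A(5) that dg_add(1)[of ?g ?z] by (auto simp: dg_def addable_def)
  let ?h = "\<lambda>k b. if snd b < c then hU k b else hL k b"
  have P: "PX ?k' = PX k * (\<Prod>j<y. ?h ?k' (?x, j) / ?h k (?x, j)) * (\<Prod>i<?x. hL ?k' (i, y) / hL k (i, y))"
    unfolding PX_def using nzk hook_add_other[OF pk y] hooks_corner[OF pk y] A(1)
    by (subst prod_dg_add[OF pk y, of "?h k"]) auto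
  have Q: "QX k = QX ?k' * alpha * (\<Prod>j<?z. hU (add_box ?g ?z) (?g ?z, j) / hU ?g (?g ?z, j)) *
      (\<Prod>i<?g ?z. hU (add_box ?g ?z) (i, ?z) / hU ?g (i, ?z))"
    unfolding QX_def A(4) using nzg hook_add_other[OF pg A(5)] hooks_corner[OF pg A(5)]
    by (subst prod_dg_add[OF pg A(5), of "hU ?g"]) auto
  let ?b = "(?x, n - 1 + c - y)"
  have R: "RX ?k' = RX k * (hU l ?b / hL l ?b)"
  proof -
    have bl: "?b \<in> dg l"
      using l_mid[of "n - 1 + c - y"] A(1-3) by (simp add: dg_def)
    have "a \<le> ?x"
      using interval_mid[OF k, of y] A(1,2) by simp
    then have Ub: "UX ?k' ?b" "\<not> UX k ?b"
      using A(1-3) by (auto simp: UX_def dg_def add_box_def)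
    have U: "UX ?k' b \<longleftrightarrow> UX k b" if "b \<noteq> ?b" for b
    proof -
      have "(fst b, n - 1 + c - snd b) \<noteq> (?x, y)" if "c \<le> snd b" "snd b < n"
        using that \<open>b \<noteq> ?b\<close> by (cases b) auto
      then show ?thesis
        unfolding UX_def dg_add(1) by auto
    qed
    have "RX ?k' = hU l ?b * (\<Prod>b\<in>dg l - {?b}. if UX k b then hU l b else hL l b)"
      unfolding RX_def using finite_dg[OF l] bl Ub U by (subst prod.remove[of _ ?b]) (auto intro!: prod.cong)
    moreover have "RX k = hL l ?b * (\<Prod>b\<in>dg l - {?b}. if UX k b then hU l b else hL l b)"
      unfolding RX_def using finite_dg[OF l] bl Ub by (subst prod.remove[of _ ?b]) auto
    ultimately show ?thesis
      using hook_pos[OF l bl] by simp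
  qed
  have dk: "pieri k y * (\<Prod>j<y. ?h ?k' (?x, j) / ?h k (?x, j)) * (\<Prod>i<?x. hL ?k' (i, y) / hL k (i, y)) =
      (\<Prod>j=c..<y. hU k (?x, j) * hL ?k' (?x, j) / (hU ?k' (?x, j) * hL k (?x, j)))"
  proof -
    have "(\<Prod>i<?x. hL k (i, y) / hL ?k' (i, y)) * (\<Prod>i<?x. hL ?k' (i, y) / hL k (i, y)) = 1"
      unfolding prod.distrib[symmetric] using nzk[OF rowb(1)] nzk'[OF rowb(2)] by (intro prod.neutral) auto
    moreover have "(\<Prod>j<y. hU k (?x, j) / hU ?k' (?x, j)) * (\<Prod>j<y. ?h ?k' (?x, j) / ?h k (?x, j)) =
        (\<Prod>j=c..<y. hU k (?x, j) * hL ?k' (?x, j) / (hU ?k' (?x, j) * hL k (?x, j)))"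
      unfolding prod.distrib[symmetric]
    proof (rule prod.mono_neutral_cong_right)
      show "\<forall>j\<in>{..<y} - {c..<y}. hU k (?x, j) / hU ?k' (?x, j) * (?h ?k' (?x, j) / ?h k (?x, j)) = 1"
        using nzk[OF colb(1)] nzk'[OF colb(2)] by auto
    qed auto
    ultimately have "((\<Prod>j<y. hU k (?x, j) / hU ?k' (?x, j)) * (\<Prod>j<y. ?h ?k' (?x, j) / ?h k (?x, j))) *
        ((\<Prod>i<?x. hL k (i, y) / hL ?k' (i, y)) * (\<Prod>i<?x. hL ?k' (i, y) / hL k (i, y))) =
        (\<Prod>j=c..<y. hU k (?x, j) * hL ?k' (?x, j) / (hU ?k' (?x, j) * hL k (?x, j)))"
      by (simp only: mult_1_right)
    then show ?thesis
      unfolding pieri_hooks[OF pk y] by (simp only: ac_simps)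
  qed
  have dg': "alpha * (\<Prod>j<?z. hU (add_box ?g ?z) (?g ?z, j) / hU ?g (?g ?z, j)) *
      (\<Prod>i<?g ?z. hU (add_box ?g ?z) (i, ?z) / hU ?g (i, ?z)) * pieri ?g ?z =
      alpha * (\<Prod>i<?g ?z. hU (add_box ?g ?z) (i, ?z) * hL ?g (i, ?z) / (hU ?g (i, ?z) * hL (add_box ?g ?z) (i, ?z)))"
  proof -
    have "(\<Prod>j<?z. hU (add_box ?g ?z) (?g ?z, j) / hU ?g (?g ?z, j)) * (\<Prod>j<?z. hU ?g (?g ?z, j) / hU (add_box ?g ?z) (?g ?z, j)) = 1"
      unfolding prod.distrib[symmetric] using nzg[OF gcolb(1)] nzg'[OF gcolb(2)] by (intro prod.neutral) auto
    moreover have "(\<Prod>i<?g ?z. hU (add_box ?g ?z) (i, ?z) / hU ?g (i, ?z)) * (\<Prod>i<?g ?z. hL ?g (i, ?z) / hL (add_box ?g ?z) (i, ?z)) =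
       (\<Prod>i<?g ?z. hU (add_box ?g ?z) (i, ?z) * hL ?g (i, ?z) / (hU ?g (i, ?z) * hL (add_box ?g ?z) (i, ?z)))"
      unfolding prod.distrib[symmetric] by simp
    ultimately have "alpha * (((\<Prod>j<?z. hU (add_box ?g ?z) (?g ?z, j) / hU ?g (?g ?z, j)) *
        (\<Prod>j<?z. hU ?g (?g ?z, j) / hU (add_box ?g ?z) (?g ?z, j))) *
        ((\<Prod>i<?g ?z. hU (add_box ?g ?z) (i, ?z) / hU ?g (i, ?z)) * (\<Prod>i<?g ?z. hL ?g (i, ?z) / hL (add_box ?g ?z) (i, ?z)))) =
      alpha * (\<Prod>i<?g ?z. hU (add_box ?g ?z) (i, ?z) * hL ?g (i, ?z) / (hU ?g (i, ?z) * hL (add_box ?g ?z) (i, ?z)))"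
      by (simp only: mult_1_left)
    then show ?thesis
      unfolding pieri_hooks[OF pg A(5)] by (simp only: ac_simps)
  qed
  have "pieri k y * weight ?k' = PX k * QX ?k' * RX k * ((\<Prod>j=c..<y. hU k (?x, j) * hL ?k' (?x, j) / (hU ?k' (?x, j) * hL k (?x, j))) *
      (hU l ?b / hL l ?b))"
    unfolding weight_def P R dk[symmetric] by (simp only: ac_simps)
  also have "\<dots> = PX k * QX ?k' * RX k * (alpha * (\<Prod>j<?z. hU (add_box ?g ?z) (?g ?z, j) / hU ?g (?g ?z, j)) *
      (\<Prod>i<?g ?z. hU (add_box ?g ?z) (i, ?z) / hU ?g (i, ?z)) * pieri ?g ?z)"
    unfolding core_identity[OF k k' y] dg' ..
  also have "\<dots> = weight k * pieri ?g ?z"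
    unfolding weight_def Q by (simp only: ac_simps)
  finally show ?thesis .
qed

end

section \<open>Matrix coefficients of multiplication operators\<close>

context jack
begin

definition mcoef :: "ratfun mseries \<Rightarrow> (nat \<Rightarrow> nat) \<Rightarrow> (nat \<Rightarrow> nat) \<Rightarrow> ratfun" where
  "mcoef F k k' = jack_inner (F * JJ k) (JJ k') / jack_norm k'"

text \<open>Homogeneity of degree d, phrased through the action on homogeneous series so that
  products are handled by composition.\<close>

definition mult_hom :: "nat \<Rightarrow> ratfun mseries \<Rightarrow> bool" where
  "mult_hom d F \<longleftrightarrow> F \<in> Lam \<and> (\<forall>e h. hom e h \<longrightarrow> hom (e + d) (F * h))"

definition mult_incr :: "ratfun mseries \<Rightarrow> bool" where
  "mult_incr F \<longleftrightarrow> (\<forall>k k'. ptn k \<longrightarrow> ptn k' \<longrightarrow> mcoef F k k' \<noteq> 0 \<longrightarrow> (\<forall>j. k j \<le> k' j))"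

lemma mult_incrD: "mult_incr F \<Longrightarrow> mcoef F k k' \<noteq> 0 \<Longrightarrow> ptn k \<Longrightarrow> ptn k' \<Longrightarrow> k j \<le> k' j"
  by (simp add: mult_incr_def)

lemma hom_JJ: "ptn k \<Longrightarrow> hom (deg k) (JJ k)"
  using belowD[OF JJ_below] by (simp add: hom_def dom_def)

lemma mult_hom_Lam: "mult_hom d F \<Longrightarrow> F \<in> Lam"
  by (simp add: mult_hom_def)

lemma mult_hom_expansion:
  assumes F: "mult_hom d F" and k: "ptn k"
  shows "F * JJ k = (\<Sum>t\<in>ptns (deg k + d). mscale (mcoef F k t) (JJ t))"
  unfolding mcoef_def
proof (rule JJ_expansion)
  show "F * JJ k \<in> Lam"
    using F by (intro Lam_mult JJ_Lam mult_hom_Lam)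
  fix u assume "fs u" "coef (F * JJ k) u \<noteq> 0"
  then show "deg u = deg k + d"
    using F hom_JJ[OF k] by (simp add: mult_hom_def hom_def)
qed

lemma jack_inner_mult_sum:
  assumes F: "F \<in> Lam"
  shows "jack_inner (F * (\<Sum>t\<in>T. mscale (w t) (JJ t))) (JJ k') / jack_norm k' = (\<Sum>t\<in>T. w t * mcoef F t k')"
proof -
  have "F * (\<Sum>t\<in>T. mscale (w t) (JJ t)) = (\<Sum>t\<in>T. mscale (w t) (F * JJ t))"
    by (simp add: sum_distrib_left mscale_mult_right)
  also have "jack_inner \<dots> (JJ k') = (\<Sum>t\<in>T. w t * jack_inner (F * JJ t) (JJ k'))"
    using F JJ_Lam by (subst jack_inner_sum_left) (auto intro!: sum.cong jack_inner_mscale_left Lam_mscale Lam_mult)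
  finally show ?thesis
    by (simp add: mcoef_def sum_divide_distrib)
qed

lemma mcoef_outside:
  assumes F: "mult_hom d F" and k: "ptn k" and t: "ptn t" "t \<notin> ptns (deg k + d)"
  shows "mcoef F k t = 0"
proof -
  have "jack_inner (F * JJ k) (JJ t) = (\<Sum>s\<in>ptns (deg k + d). mcoef F k s * jack_inner (JJ s) (JJ t))"
    unfolding mult_hom_expansion[OF F k] using JJ_Lam
    by (subst jack_inner_sum_left) (auto intro!: sum.cong jack_inner_mscale_left Lam_mscale)
  also have "\<dots> = 0"
  proof (rule sum.neutral, rule ballI)
    fix s assume s: "s \<in> ptns (deg k + d)"
    then have "s \<noteq> t"
      using t(2) by blast
    then have "jack_inner (JJ s) (JJ t) = 0"
      using s t(1) by (intro JJ_orth) (simp_all add: ptns_def)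
    then show "mcoef F k s * jack_inner (JJ s) (JJ t) = 0"
      by simp
  qed
  finally show ?thesis
    by (simp add: mcoef_def)
qed

text \<open>Any finite set of partitions that captures the nonzero terms may replace the set of all
  partitions of the right size; in the application it is the interval or its image under
  complementation.\<close>

lemma mcoef_sum_cong:
  assumes G: "mult_hom e G" and k: "ptn k" and A: "finite A" "A \<subseteq> Collect ptn"
    and sub: "\<And>t. ptn t \<Longrightarrow> mcoef G k t \<noteq> 0 \<Longrightarrow> mcoef F t k' \<noteq> 0 \<Longrightarrow> t \<in> A"
  shows "(\<Sum>t\<in>ptns (deg k + e). w t * mcoef G k t * mcoef F t k') = (\<Sum>t\<in>A. w t * (mcoef G k t * mcoef F t k'))"
proof -
  let ?h = "\<lambda>t. w t * (mcoef G k t * mcoef F t k')"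
  let ?T = "ptns (deg k + e)"
  have "sum ?h ?T = sum ?h (?T \<union> A)"
    using finite_ptns A mcoef_outside[OF G k] by (intro sum.mono_neutral_left) auto
  also have "\<dots> = sum ?h A"
  proof (rule sum.mono_neutral_right)
    show "\<forall>t\<in>?T \<union> A - A. ?h t = 0"
    proof
      fix t assume "t \<in> ?T \<union> A - A"
      then have "ptn t" "t \<notin> A"
        by (auto simp: ptns_def)
      then have "mcoef G k t = 0 \<or> mcoef F t k' = 0"
        using sub by blast
      then show "?h t = 0"
        by auto
    qed
  qed (use finite_ptns A in auto)
  finally show ?thesis
    by (simp add: mult.assoc)
qed

lemma mcoef_mult:
  assumes F: "F \<in> Lam" and G: "mult_hom e G" and k: "ptn k" and A: "finite A" "A \<subseteq> Collect ptn"
    and sub: "\<And>t. ptn t \<Longrightarrow> mcoef G k t \<noteq> 0 \<Longrightarrow> mcoef F t k' \<noteq> 0 \<Longrightarrow> t \<in> A"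
  shows "mcoef (F * G) k k' = (\<Sum>t\<in>A. mcoef G k t * mcoef F t k')"
proof -
  have "mcoef (F * G) k k' = jack_inner (F * (G * JJ k)) (JJ k') / jack_norm k'"
    by (simp add: mcoef_def mult.assoc)
  also have "\<dots> = (\<Sum>t\<in>ptns (deg k + e). 1 * mcoef G k t * mcoef F t k')"
    unfolding mult_hom_expansion[OF G k] jack_inner_mult_sum[OF F] by simp
  also have "\<dots> = (\<Sum>t\<in>A. 1 * (mcoef G k t * mcoef F t k'))"
    by (rule mcoef_sum_cong[OF G k A sub])
  finally show ?thesis
    by simp
qed

lemma mcoef_opD:
  assumes F: "F \<in> Lam" and G: "mult_hom e G" and k: "ptn k" and A: "finite A" "A \<subseteq> Collect ptn"
    and sub: "\<And>t. ptn t \<Longrightarrow> mcoef G k t \<noteq> 0 \<Longrightarrow> mcoef F t k' \<noteq> 0 \<Longrightarrow> t \<in> A"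
  shows "jack_inner (F * opD (G * JJ k)) (JJ k') / jack_norm k' = (\<Sum>t\<in>A. eps t * (mcoef G k t * mcoef F t k'))"
proof -
  have "opD (G * JJ k) = (\<Sum>t\<in>ptns (deg k + e). mscale (eps t * mcoef G k t) (JJ t))"
    unfolding mult_hom_expansion[OF G k] opD_sum
    by (intro sum.cong refl) (simp add: opD_mscale JJ_eigen ptns_def mult.commute)
  then have "jack_inner (F * opD (G * JJ k)) (JJ k') / jack_norm k' = (\<Sum>t\<in>ptns (deg k + e). eps t * mcoef G k t * mcoef F t k')"
    by (simp only: jack_inner_mult_sum[OF F])
  also have "\<dots> = (\<Sum>t\<in>A. eps t * (mcoef G k t * mcoef F t k'))"
    by (rule mcoef_sum_cong[OF G k A sub])
  finally show ?thesis .
qed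

lemma mult_hom_power_sum: "k \<ge> 1 \<Longrightarrow> mult_hom k (power_sum k)"
  using Lam_power_sum_mult[OF Lam_one, of k] hom_power_sum_mult by (simp add: mult_hom_def)

lemma mult_hom_mult: "mult_hom d F \<Longrightarrow> mult_hom e G \<Longrightarrow> mult_hom (e + d) (F * G)"
  by (simp add: mult_hom_def Lam_mult mult.assoc add.assoc[symmetric])

text \<open>The double commutator read in the basis of Jack functions, where \<open>opD\<close> is
  diagonal: each commutator becomes a difference of eigenvalues.\<close>

lemma mcoef_power_sum_Suc:
  assumes d: "d \<ge> 1" and k: "ptn k" "ptn k'" and A: "finite A" "A \<subseteq> Collect ptn"
    and sub: "\<And>t. ptn t \<Longrightarrow> mcoef (power_sum d) k t \<noteq> 0 \<Longrightarrow> mcoef (power_sum 1) t k' \<noteq> 0 \<Longrightarrow> t \<in> A"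
      "\<And>t. ptn t \<Longrightarrow> mcoef (power_sum 1) k t \<noteq> 0 \<Longrightarrow> mcoef (power_sum d) t k' \<noteq> 0 \<Longrightarrow> t \<in> A"
  shows "alpha * of_nat d * mcoef (power_sum (Suc d)) k k' =
    (\<Sum>t\<in>A. (eps k' - eps t) * (mcoef (power_sum d) k t * mcoef (power_sum 1) t k')) -
    (\<Sum>t\<in>A. (eps t - eps k) * (mcoef (power_sum 1) k t * mcoef (power_sum d) t k'))"
proof -
  let ?p = "power_sum 1" and ?q = "power_sum d"
  have H: "mult_hom 1 ?p" "mult_hom d ?q"
    using d by (simp_all add: mult_hom_power_sum)
  have L: "?p \<in> Lam" "?q \<in> Lam"
    using H by (auto intro: mult_hom_Lam)
  let ?f = "JJ k"
  let ?I = "\<lambda>g. jack_inner g (JJ k') / jack_norm k'"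
  have I_diff: "?I (g - h) = ?I g - ?I h" if "g \<in> Lam" "h \<in> Lam" for g h
  proof -
    have "jack_inner (g - h) (JJ k') = jack_inner g (JJ k') - jack_inner h (JJ k')"
      using jack_inner_add_left[of "g - h" h "JJ k'"] that by (simp add: Lam_diff JJ_Lam)
    then show ?thesis
      by (simp add: diff_divide_distrib)
  qed
  have "alpha * of_nat d * mcoef (power_sum (Suc d)) k k' = ?I (mscale (alpha * of_nat d) (power_sum (Suc d) * ?f))"
    by (subst jack_inner_mscale_left) (auto simp: mcoef_def intro!: Lam_power_sum_mult JJ_Lam)
  also have "mscale (alpha * of_nat d) (power_sum (Suc d) * ?f) =
      opD (?p * (?q * ?f)) - ?p * opD (?q * ?f) - ?q * (opD (?p * ?f) - ?p * opD ?f)"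
    by (rule power_sum_Suc_commutator[OF JJ_Lam d])
  also have "\<dots> = (opD (?p * (?q * ?f)) - ?p * opD (?q * ?f)) - (?q * opD (?p * ?f) - mscale (eps k) (?q * ?p * ?f))"
    by (simp add: JJ_eigen[OF k(1)] mscale_mult_right right_diff_distrib mult.assoc)
  also have "?I \<dots> = (?I (opD (?p * (?q * ?f))) - ?I (?p * opD (?q * ?f))) -
      (?I (?q * opD (?p * ?f)) - ?I (mscale (eps k) (?q * ?p * ?f)))"
    using L JJ_Lam by (simp only: I_diff Lam_diff Lam_mult opD_Lam Lam_mscale)
  also have "?I (opD (?p * (?q * ?f))) = eps k' * mcoef (?p * ?q) k k'"
    using L JJ_Lam jack_inner_opD[of "?p * (?q * ?f)" "JJ k'"]
    by (simp add: Lam_mult JJ_eigen[OF k(2)] jack_inner_mscale_right mcoef_def mult.assoc)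
  also have "?I (mscale (eps k) (?q * ?p * ?f)) = eps k * mcoef (?q * ?p) k k'"
    using L JJ_Lam by (simp add: Lam_mult jack_inner_mscale_left mcoef_def)
  also have "?I (?p * opD (?q * ?f)) = (\<Sum>t\<in>A. eps t * (mcoef ?q k t * mcoef ?p t k'))"
    by (rule mcoef_opD[OF L(1) H(2) k(1) A sub(1)])
  also have "?I (?q * opD (?p * ?f)) = (\<Sum>t\<in>A. eps t * (mcoef ?p k t * mcoef ?q t k'))"
    by (rule mcoef_opD[OF L(2) H(1) k(1) A sub(2)])
  also have "mcoef (?p * ?q) k k' = (\<Sum>t\<in>A. mcoef ?q k t * mcoef ?p t k')"
    by (rule mcoef_mult[OF L(1) H(2) k(1) A sub(1)])
  also have "mcoef (?q * ?p) k k' = (\<Sum>t\<in>A. mcoef ?p k t * mcoef ?q t k')"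
    by (rule mcoef_mult[OF L(2) H(1) k(1) A sub(2)])
  finally show ?thesis
    by (simp only: left_diff_distrib sum_subtractf sum_distrib_left)
qed

lemma mcoef_p1:
  assumes k: "ptn k" "k L = 0"
  shows "mcoef (power_sum 1) k k' = (\<Sum>y\<le>L. pieri k y * jack_inner (JJ (add_box k y)) (JJ k')) / jack_norm k'"
proof -
  have "jack_inner (power_sum 1 * JJ k) (JJ k') = (\<Sum>y\<le>L. pieri k y * jack_inner (JJ (add_box k y)) (JJ k'))"
    unfolding p1_JJ[of k L, OF k]
    using JJ_Lam by (simp only: jack_inner_sum_left Lam_mscale jack_inner_mscale_left)
  then show ?thesis
    by (simp add: mcoef_def)
qed

lemma mcoef_p1_nonzero:
  assumes k: "ptn k" "ptn k'" and nz: "mcoef (power_sum 1) k k' \<noteq> 0"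
  obtains y where "addable k y" "k' = add_box k y"
proof -
  obtain L where L: "k L = 0"
    using ex_zero_ptn[OF k(1)] .
  have "(\<Sum>y\<le>L. pieri k y * jack_inner (JJ (add_box k y)) (JJ k')) \<noteq> 0"
    using nz unfolding mcoef_p1[of k L, OF k(1) L] by simp
  then obtain y where y: "pieri k y * jack_inner (JJ (add_box k y)) (JJ k') \<noteq> 0"
    by (elim sum.not_neutral_contains_not_neutral)
  then have a: "addable k y"
    using pieri_nonaddable[OF k(1), of y] by auto
  moreover have "add_box k y = k'"
    using JJ_orth[OF ptn_add[OF k(1) a] k(2)] y by auto
  ultimately show thesis
    using that by blast
qed

lemma mcoef_p1_add:
  assumes k: "ptn k" and y: "addable k y"
  shows "mcoef (power_sum 1) k (add_box k y) = pieri k y"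
proof -
  obtain L where L: "k L = 0" "y < L"
    using ex_zero_ptn[OF k] .
  have "(\<Sum>x\<le>L. pieri k x * jack_inner (JJ (add_box k x)) (JJ (add_box k y))) =
      (\<Sum>x\<le>L. if x = y then pieri k y * jack_norm (add_box k y) else 0)"
  proof (intro sum.cong refl)
    fix x
    show "pieri k x * jack_inner (JJ (add_box k x)) (JJ (add_box k y)) = (if x = y then pieri k y * jack_norm (add_box k y) else 0)"
    proof (cases "x = y \<or> \<not> addable k x")
      case True
      then show ?thesis
        using y pieri_nonaddable[OF k, of x] by (auto simp: jack_norm_def)
    next
      case False
      then have "add_box k x y \<noteq> add_box k y y"
        by (simp add: add_box_def)
      then have "add_box k x \<noteq> add_box k y"
        by metis
      then have "jack_inner (JJ (add_box k x)) (JJ (add_box k y)) = 0"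
        using False y k by (intro JJ_orth ptn_add) auto
      then show ?thesis
        using False by simp
    qed
  qed
  then show ?thesis
    unfolding mcoef_p1[of k L, OF k L(1)] using L(2) jack_norm_pos[of "add_box k y"] by simp
qed

lemma mult_incr_p1: "mult_incr (power_sum 1)"
  unfolding mult_incr_def
proof (intro allI impI)
  fix k k' j assume k: "ptn k" "ptn k'" "mcoef (power_sum 1) k k' \<noteq> 0"
  obtain y where "k' = add_box k y"
    using mcoef_p1_nonzero[OF k] .
  then show "k j \<le> k' j"
    by (simp add: add_box_def)
qed

lemma mult_incr_mult:
  assumes F: "F \<in> Lam" "mult_incr F" and G: "mult_hom e G" "mult_incr G"
  shows "mult_incr (F * G)"
  unfolding mult_incr_def
proof (intro allI impI)
  fix k k' j assume k: "ptn k" "ptn k'" "mcoef (F * G) k k' \<noteq> 0"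
  have "mcoef (F * G) k k' = (\<Sum>t\<in>ptns (deg k + e). mcoef G k t * mcoef F t k')"
    using mcoef_outside[OF G(1) k(1)] by (intro mcoef_mult[OF F(1) G(1) k(1)] finite_ptns) (auto simp: ptns_def)
  then have "(\<Sum>t\<in>ptns (deg k + e). mcoef G k t * mcoef F t k') \<noteq> 0"
    using k(3) by simp
  then obtain t where "t \<in> ptns (deg k + e)" "mcoef G k t * mcoef F t k' \<noteq> 0"
    by (elim sum.not_neutral_contains_not_neutral)
  then have "k j \<le> t j" "t j \<le> k' j"
    using F(2) G(2) k(1,2) by (auto simp: mult_incr_def ptns_def)
  then show "k j \<le> k' j"
    by simp
qed

text \<open>p_1 adds a single box, and every entry of p_(d+1) is a combination of products of
  entries of p_1 and p_d.\<close>

lemma mult_incr_power_sum: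
  assumes "d \<ge> 1"
  shows "mult_incr (power_sum d)"
  using assms
proof (induction d rule: dec_induct)
  case base
  show ?case
    using mult_incr_p1 by simp
next
  case (step d)
  let ?A = "\<lambda>k. ptns (deg k + d) \<union> ptns (deg k + 1)"
  show ?case
    unfolding mult_incr_def
  proof (intro allI impI)
    fix k k' j assume k: "ptn k" "ptn k'" "mcoef (power_sum (Suc d)) k k' \<noteq> 0"
    have "alpha * of_nat d * mcoef (power_sum (Suc d)) k k' =
      (\<Sum>t\<in>?A k. (eps k' - eps t) * (mcoef (power_sum d) k t * mcoef (power_sum 1) t k')) -
      (\<Sum>t\<in>?A k. (eps t - eps k) * (mcoef (power_sum 1) k t * mcoef (power_sum d) t k'))"
    proof (rule mcoef_power_sum_Suc)
      fix t assume t: "ptn t"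
      show "t \<in> ?A k" if "mcoef (power_sum d) k t \<noteq> 0"
        using mcoef_outside[OF mult_hom_power_sum[OF step.hyps(1)] k(1) t] that by blast
      show "t \<in> ?A k" if "mcoef (power_sum 1) k t \<noteq> 0"
        using mcoef_outside[OF mult_hom_power_sum[OF order_refl] k(1) t] that by blast
    qed (use step.hyps k finite_ptns in \<open>auto simp: ptns_def\<close>)
    moreover have "alpha * of_nat d * mcoef (power_sum (Suc d)) k k' \<noteq> 0"
      using k(3) step.hyps alpha_pos by simp
    ultimately have "(\<Sum>t\<in>?A k. (eps k' - eps t) * (mcoef (power_sum d) k t * mcoef (power_sum 1) t k')) \<noteq> 0 \<or>
      (\<Sum>t\<in>?A k. (eps t - eps k) * (mcoef (power_sum 1) k t * mcoef (power_sum d) t k')) \<noteq> 0"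
      by auto
    then obtain t where t: "t \<in> ?A k"
      "mcoef (power_sum d) k t * mcoef (power_sum 1) t k' \<noteq> 0 \<or> mcoef (power_sum 1) k t * mcoef (power_sum d) t k' \<noteq> 0"
      by (elim disjE sum.not_neutral_contains_not_neutral) auto
    then have "k j \<le> t j" "t j \<le> k' j"
      using step.IH mult_incr_p1 k(1,2) by (auto simp: mult_incr_def ptns_def)
    then show "k j \<le> k' j"
      by simp
  qed
qed

end

section \<open>Duality under complementation\<close>

context jack_box
begin

text \<open>Up to the weight, complementation transposes multiplication by \<open>F\<close> on the interval.\<close>

definition dual :: "ratfun mseries \<Rightarrow> bool" where
  "dual F \<longleftrightarrow> (\<forall>k\<in>interval. \<forall>k'\<in>interval. mcoef F k k' * weight k' = weight k * mcoef F (bar k') (bar k))"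

lemma dualD: "dual F \<Longrightarrow> k \<in> interval \<Longrightarrow> k' \<in> interval \<Longrightarrow> mcoef F k k' * weight k' = weight k * mcoef F (bar k') (bar k)"
  by (simp add: dual_def)

text \<open>A nonzero entry on either side forces \<open>k'\<close> to be \<open>k\<close> with one
  more box; for the complements this is \<open>add_of_bar\<close>.\<close>

lemma mcoef_p1_gauge:
  assumes k: "k \<in> interval" "k' \<in> interval"
  shows "(\<exists>y. addable k y \<and> k' = add_box k y) \<or> mcoef (power_sum 1) k k' = 0 \<and> mcoef (power_sum 1) (bar k') (bar k) = 0"
proof (rule disjCI)
  assume *: "\<not> (mcoef (power_sum 1) k k' = 0 \<and> mcoef (power_sum 1) (bar k') (bar k) = 0)"
  show "\<exists>y. addable k y \<and> k' = add_box k y"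
  proof (cases "mcoef (power_sum 1) k k' = 0")
    case False
    then show ?thesis
      using mcoef_p1_nonzero[OF interval_ptn[OF k(1)] interval_ptn[OF k(2)]] by blast
  next
    case True
    then have "mcoef (power_sum 1) (bar k') (bar k) \<noteq> 0"
      using * by simp
    then obtain z where "addable (bar k') z" "bar k = add_box (bar k') z"
      using mcoef_p1_nonzero[OF bar_ptn[OF interval_ptn[OF k(2)]] bar_ptn[OF interval_ptn[OF k(1)]]] by blast
    then show ?thesis
      using add_of_bar[OF k] by blast
  qed
qed

lemma dual_p1: "dual (power_sum 1)"
  unfolding dual_def
proof (intro ballI)
  fix k k' assume k: "k \<in> interval" "k' \<in> interval"
  show "mcoef (power_sum 1) k k' * weight k' = weight k * mcoef (power_sum 1) (bar k') (bar k)"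
    using mcoef_p1_gauge[OF k]
  proof
    assume "\<exists>y. addable k y \<and> k' = add_box k y"
    then obtain y where y: "addable k y" "k' = add_box k y"
      by blast
    have k': "add_box k y \<in> interval"
      using k(2) y(2) by simp
    have "mcoef (power_sum 1) (bar k') (bar k) = pieri (bar k') (n - 1 - y)"
      using mcoef_p1_add[OF bar_ptn[OF interval_ptn[OF k(2)]], of "n - 1 - y"] add_in_interval(4,5)[OF k(1) y(1) k']
      unfolding y(2) by simp
    moreover have "mcoef (power_sum 1) k k' = pieri k y"
      using mcoef_p1_add[OF interval_ptn[OF k(1)] y(1)] y(2) by simp
    ultimately show ?thesis
      using gauge[OF k(1) k' y(1)] y(2) by simp
  qed simp
qed

lemma bar_interval: "finite (bar ` interval)" "bar ` interval \<subseteq> Collect ptn"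
  using finite_interval interval_ptn bar_ptn by blast+

text \<open>Intermediate partitions are squeezed between \<open>k\<close> and \<open>k''\<close>,
  and on the complementary side they lie inside \<open>bar k\<close>. Convexity of the interval and
  \<open>bar_down\<close> confine them accordingly.\<close>

lemma mcoef_interval_mult:
  assumes k: "k \<in> interval" "k'' \<in> interval" and F: "F \<in> Lam" "mult_incr F" and G: "mult_hom e G" "mult_incr G"
  shows "mcoef (F * G) k k'' = (\<Sum>t\<in>interval. mcoef G k t * mcoef F t k'')"
    and "mcoef (F * G) (bar k'') (bar k) = (\<Sum>t\<in>interval. mcoef G (bar k'') (bar t) * mcoef F (bar t) (bar k))"
proof -
  note pk = interval_ptn[OF k(1)] interval_ptn[OF k(2)]
  show "mcoef (F * G) k k'' = (\<Sum>t\<in>interval. mcoef G k t * mcoef F t k'')"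
  proof (rule mcoef_mult[OF F(1) G(1) pk(1) finite_interval])
    fix t assume "ptn t" "mcoef G k t \<noteq> 0" "mcoef F t k'' \<noteq> 0"
    then show "t \<in> interval"
      using pk by (intro interval_convex[OF k] mult_incrD[OF F(2)] mult_incrD[OF G(2)])
  qed (use interval_ptn in blast)
  have "mcoef (F * G) (bar k'') (bar k) = (\<Sum>t\<in>bar ` interval. mcoef G (bar k'') t * mcoef F t (bar k))"
  proof (rule mcoef_mult[OF F(1) G(1) bar_ptn[OF pk(2)] bar_interval])
    fix t assume "ptn t" "mcoef G (bar k'') t \<noteq> 0" "mcoef F t (bar k) \<noteq> 0"
    then show "t \<in> bar ` interval"
      by (intro bar_down[OF k(1)] mult_incrD[OF F(2)] bar_ptn[OF pk(1)])
  qed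
  then show "mcoef (F * G) (bar k'') (bar k) = (\<Sum>t\<in>interval. mcoef G (bar k'') (bar t) * mcoef F (bar t) (bar k))"
    by (simp add: sum.reindex[OF bar_inj])
qed

text \<open>Complementation reverses arrows, so the factors appear in the opposite order on the
  complementary side; commutativity of the ring restores it.\<close>

lemma dual_mult:
  assumes F: "mult_hom d F" "mult_incr F" "dual F" and G: "mult_hom e G" "mult_incr G" "dual G"
  shows "dual (F * G)"
  unfolding dual_def
proof (intro ballI)
  fix k k'' assume k: "k \<in> interval" "k'' \<in> interval"
  have "mcoef (F * G) k k'' * weight k'' = (\<Sum>t\<in>interval. mcoef G k t * (mcoef F t k'' * weight k''))"
    unfolding mcoef_interval_mult(1)[OF k mult_hom_Lam[OF F(1)] F(2) G(1,2)] by (simp add: sum_distrib_right mult.assoc)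
  also have "\<dots> = (\<Sum>t\<in>interval. weight k * (mcoef F (bar k'') (bar t) * mcoef G (bar t) (bar k)))"
  proof (intro sum.cong refl)
    fix t assume t: "t \<in> interval"
    have "mcoef G k t * (mcoef F t k'' * weight k'') = (mcoef G k t * weight t) * mcoef F (bar k'') (bar t)"
      unfolding dualD[OF F(3) t k(2)] by (simp only: ac_simps)
    also have "\<dots> = weight k * (mcoef F (bar k'') (bar t) * mcoef G (bar t) (bar k))"
      unfolding dualD[OF G(3) k(1) t] by (simp only: ac_simps)
    finally show "mcoef G k t * (mcoef F t k'' * weight k'') = weight k * (mcoef F (bar k'') (bar t) * mcoef G (bar t) (bar k))" .
  qed
  also have "\<dots> = weight k * mcoef (G * F) (bar k'') (bar k)"
    unfolding mcoef_interval_mult(2)[OF k mult_hom_Lam[OF G(1)] G(2) F(1,2)] by (rule sum_distrib_left[symmetric])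
  finally show "mcoef (F * G) k k'' * weight k'' = weight k * mcoef (F * G) (bar k'') (bar k)"
    by (simp only: mult.commute[of G F])
qed

text \<open>The step rests on the contents of a box and of its opposite having a constant sum: the contribution
  of that constant to the double commutator cancels, because \<open>p\<^sub>1\<close> and \<open>p\<^sub>d\<close> commute.\<close>

lemma dual_power_sum_Suc:
  assumes d: "d \<ge> 1" and S: "dual (power_sum d)"
  shows "dual (power_sum (Suc d))"
  unfolding dual_def
proof (intro ballI)
  fix k k'' assume k: "k \<in> interval" "k'' \<in> interval"
  note pk = interval_ptn[OF k(1)] interval_ptn[OF k(2)]
  let ?p = "power_sum 1" and ?q = "power_sum d"
  let ?C = "alpha * of_nat (m - 1) - of_nat (n - 1) :: ratfun"
  note Hp = mult_hom_power_sum[OF order_refl] and Hq = mult_hom_power_sum[OF d]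
  note Cq = mult_incr_power_sum[OF d]
  have b: "interval \<subseteq> Collect ptn"
    using interval_ptn by blast
  have Iq: "alpha * of_nat d * mcoef (power_sum (Suc d)) k k'' =
    (\<Sum>t\<in>interval. (eps k'' - eps t) * (mcoef ?q k t * mcoef ?p t k'')) -
    (\<Sum>t\<in>interval. (eps t - eps k) * (mcoef ?p k t * mcoef ?q t k''))"
  proof (rule mcoef_power_sum_Suc[OF d pk finite_interval b])
    fix t assume t: "ptn t"
    show "t \<in> interval" if "mcoef ?q k t \<noteq> 0" "mcoef ?p t k'' \<noteq> 0"
      using mult_incrD[OF Cq that(1) pk(1) t] mult_incrD[OF mult_incr_p1 that(2) t pk(2)] by (rule interval_convex[OF k t])
    show "t \<in> interval" if "mcoef ?p k t \<noteq> 0" "mcoef ?q t k'' \<noteq> 0"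
      using mult_incrD[OF mult_incr_p1 that(1) pk(1) t] mult_incrD[OF Cq that(2) t pk(2)] by (rule interval_convex[OF k t])
  qed
  have "alpha * of_nat d * mcoef (power_sum (Suc d)) (bar k'') (bar k) =
    (\<Sum>t\<in>bar ` interval. (eps (bar k) - eps t) * (mcoef ?q (bar k'') t * mcoef ?p t (bar k))) -
    (\<Sum>t\<in>bar ` interval. (eps t - eps (bar k'')) * (mcoef ?p (bar k'') t * mcoef ?q t (bar k)))"
  proof (rule mcoef_power_sum_Suc[OF d bar_ptn[OF pk(2)] bar_ptn[OF pk(1)] bar_interval])
    fix t assume t: "ptn t"
    show "t \<in> bar ` interval" if "mcoef ?p t (bar k) \<noteq> 0"
      by (rule bar_down[OF k(1) t mult_incrD[OF mult_incr_p1 that t bar_ptn[OF pk(1)]]])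
    show "t \<in> bar ` interval" if "mcoef ?q t (bar k) \<noteq> 0"
      by (rule bar_down[OF k(1) t mult_incrD[OF Cq that t bar_ptn[OF pk(1)]]])
  qed
  then have Bq: "alpha * of_nat d * mcoef (power_sum (Suc d)) (bar k'') (bar k) =
    (\<Sum>t\<in>interval. (eps (bar k) - eps (bar t)) * (mcoef ?q (bar k'') (bar t) * mcoef ?p (bar t) (bar k))) -
    (\<Sum>t\<in>interval. (eps (bar t) - eps (bar k'')) * (mcoef ?p (bar k'') (bar t) * mcoef ?q (bar t) (bar k)))"
    by (simp only: sum.reindex[OF bar_inj] o_def)
  have dual: "mcoef F s t * weight t = weight s * mcoef F (bar t) (bar s)" if "F = ?p \<or> F = ?q" "s \<in> interval" "t \<in> interval" for F s t
    using that(1) dualD[OF S that(2,3)] dualD[OF dual_p1 that(2,3)] by blast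
  \<comment> \<open>The eigenvalue differences are related only if t is s with one box added.
    Multiplied by an entry of p_1 the relation holds for all pairs, both sides being 0
    otherwise.\<close>
  have cont: "(eps t - eps s) * mcoef ?p (bar t) (bar s) = (?C - (eps (bar s) - eps (bar t))) * mcoef ?p (bar t) (bar s)"
    if st: "s \<in> interval" "t \<in> interval" for s t
    using mcoef_p1_gauge[OF st]
  proof
    assume "\<exists>y. addable s y \<and> t = add_box s y"
    then obtain y where y: "addable s y" "t = add_box s y"
      by blast
    then have "eps t - eps s = ?C - (eps (bar s) - eps (bar t))"
      using eps_bar[OF st(1) y(1)] st(2) by simp
    then show ?thesis
      by (simp only:)
  qed simp
  \<comment> \<open>The weight is carried from \<open>k''\<close> over t to \<open>k\<close> by one
    use of duality for each factor, and \<open>cont\<close> converts the eigenvalue difference on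
    the way.\<close>
  have 1: "(eps k'' - eps t) * (mcoef ?q k t * mcoef ?p t k'') * weight k'' =
      weight k * (?C * (mcoef ?p (bar k'') (bar t) * mcoef ?q (bar t) (bar k)) -
        (eps (bar t) - eps (bar k'')) * (mcoef ?p (bar k'') (bar t) * mcoef ?q (bar t) (bar k)))" if t: "t \<in> interval" for t
  proof -
    have "(eps k'' - eps t) * (mcoef ?q k t * mcoef ?p t k'') * weight k'' = (eps k'' - eps t) * mcoef ?q k t * (mcoef ?p t k'' * weight k'')"
      by (simp only: ac_simps)
    also have "\<dots> = (eps k'' - eps t) * mcoef ?p (bar k'') (bar t) * (mcoef ?q k t * weight t)"
      unfolding dual[of ?p t k'', OF disjI1[OF refl] t k(2)] by (simp only: ac_simps)
    also have "\<dots> = (?C - (eps (bar t) - eps (bar k''))) * mcoef ?p (bar k'') (bar t) * (weight k * mcoef ?q (bar t) (bar k))"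
      unfolding dual[of ?q k t, OF disjI2[OF refl] k(1) t] cont[OF t k(2)] ..
    finally show ?thesis
      by (simp only: left_diff_distrib right_diff_distrib ac_simps)
  qed
  have 2: "(eps t - eps k) * (mcoef ?p k t * mcoef ?q t k'') * weight k'' =
      weight k * (?C * (mcoef ?q (bar k'') (bar t) * mcoef ?p (bar t) (bar k)) -
        (eps (bar k) - eps (bar t)) * (mcoef ?q (bar k'') (bar t) * mcoef ?p (bar t) (bar k)))" if t: "t \<in> interval" for t
  proof -
    have "(eps t - eps k) * (mcoef ?p k t * mcoef ?q t k'') * weight k'' = (eps t - eps k) * mcoef ?p k t * (mcoef ?q t k'' * weight k'')"
      by (simp only: ac_simps)
    also have "\<dots> = (eps t - eps k) * (mcoef ?p k t * weight t) * mcoef ?q (bar k'') (bar t)"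
      unfolding dual[of ?q t k'', OF disjI2[OF refl] t k(2)] by (simp only: ac_simps)
    also have "\<dots> = (eps t - eps k) * mcoef ?p (bar t) (bar k) * (weight k * mcoef ?q (bar k'') (bar t))"
      unfolding dual[of ?p k t, OF disjI1[OF refl] k(1) t] by (simp only: ac_simps)
    also have "\<dots> = (?C - (eps (bar k) - eps (bar t))) * mcoef ?p (bar t) (bar k) * (weight k * mcoef ?q (bar k'') (bar t))"
      unfolding cont[OF k(1) t] ..
    finally show ?thesis
      by (simp only: left_diff_distrib right_diff_distrib ac_simps)
  qed
  have comm: "(\<Sum>t\<in>interval. mcoef ?p (bar k'') (bar t) * mcoef ?q (bar t) (bar k)) =
      (\<Sum>t\<in>interval. mcoef ?q (bar k'') (bar t) * mcoef ?p (bar t) (bar k))"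
    using mcoef_interval_mult(2)[OF k mult_hom_Lam[OF Hq] Cq Hp mult_incr_p1] mcoef_interval_mult(2)[OF k mult_hom_Lam[OF Hp] mult_incr_p1 Hq Cq]
    by (simp only: mult.commute[of ?q ?p])
  have "alpha * of_nat d * (mcoef (power_sum (Suc d)) k k'' * weight k'') =
     (\<Sum>t\<in>interval. (eps k'' - eps t) * (mcoef ?q k t * mcoef ?p t k'') * weight k'') -
     (\<Sum>t\<in>interval. (eps t - eps k) * (mcoef ?p k t * mcoef ?q t k'') * weight k'')"
    unfolding mult.assoc[symmetric, of "alpha * of_nat d"] Iq left_diff_distrib[of _ _ "weight k''"] sum_distrib_right ..
  also have "\<dots> = weight k * (alpha * of_nat d * mcoef (power_sum (Suc d)) (bar k'') (bar k))"
  proof -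
    have S1: "(\<Sum>t\<in>interval. (eps k'' - eps t) * (mcoef ?q k t * mcoef ?p t k'') * weight k'') =
      weight k * (?C * (\<Sum>t\<in>interval. mcoef ?q (bar k'') (bar t) * mcoef ?p (bar t) (bar k)) -
        (\<Sum>t\<in>interval. (eps (bar t) - eps (bar k'')) * (mcoef ?p (bar k'') (bar t) * mcoef ?q (bar t) (bar k))))"
      unfolding comm[symmetric] sum_distrib_left sum_subtractf[symmetric] by (rule sum.cong[OF refl 1])
    have S2: "(\<Sum>t\<in>interval. (eps t - eps k) * (mcoef ?p k t * mcoef ?q t k'') * weight k'') =
      weight k * (?C * (\<Sum>t\<in>interval. mcoef ?q (bar k'') (bar t) * mcoef ?p (bar t) (bar k)) -
        (\<Sum>t\<in>interval. (eps (bar k) - eps (bar t)) * (mcoef ?q (bar k'') (bar t) * mcoef ?p (bar t) (bar k))))"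
      unfolding sum_distrib_left sum_subtractf[symmetric] by (rule sum.cong[OF refl 2])
    show ?thesis
      unfolding S1 S2 Bq by (simp only: right_diff_distrib)
  qed
  finally have "alpha * of_nat d * (mcoef (power_sum (Suc d)) k k'' * weight k'') =
      alpha * of_nat d * (weight k * mcoef (power_sum (Suc d)) (bar k'') (bar k))"
    by (simp only: ac_simps)
  moreover have "alpha * of_nat d \<noteq> 0"
    using d alpha_pos by simp
  ultimately show "mcoef (power_sum (Suc d)) k k'' * weight k'' = weight k * mcoef (power_sum (Suc d)) (bar k'') (bar k)"
    by simp
qed

lemma dual_power_sum: "d \<ge> 1 \<Longrightarrow> dual (power_sum d)"
proof (induction d rule: dec_induct)
  case base
  show ?case
    using dual_p1 by simp
qed (rule dual_power_sum_Suc)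

lemma mcoef_one: "ptn k \<Longrightarrow> ptn k' \<Longrightarrow> mcoef 1 k k' = (if k = k' then 1 else 0)"
  using JJ_orth[of k k'] jack_norm_pos[of k] by (auto simp: mcoef_def jack_norm_def)

lemma mult_hom_one: "mult_hom 0 1"
  by (simp add: mult_hom_def Lam_one)

lemma mult_hom_mult_incr_dual_pm: "0 \<notin># M \<Longrightarrow> mult_hom (sum_mset M) (pm M) \<and> mult_incr (pm M) \<and> dual (pm M)"
proof (induction M)
  case empty
  have "mult_incr 1"
    by (auto simp: mult_incr_def mcoef_one split: if_splits)
  moreover have "dual 1"
    using bar_inj by (auto simp: dual_def mcoef_one interval_ptn bar_ptn dest: inj_onD)
  ultimately show ?case
    using mult_hom_one by simp
next
  case (add k M)
  then have k: "k \<ge> 1" and M: "mult_hom (sum_mset M) (pm M)" "mult_incr (pm M)" "dual (pm M)"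
    by auto
  then show ?case
    unfolding pm_add using mult_hom_mult[OF mult_hom_power_sum[OF k] M(1)] mult_incr_mult[OF mult_hom_Lam[OF mult_hom_power_sum[OF k]] mult_incr_power_sum[OF k] M(1,2)]
      dual_mult[OF mult_hom_power_sum[OF k] mult_incr_power_sum[OF k] dual_power_sum[OF k] M]
    by (simp add: add.commute)
qed

lemma dual_Lam: "F \<in> Lam \<Longrightarrow> dual F"
proof (induction rule: Lam_induct)
  case zero
  then show ?case
    by (simp add: dual_def mcoef_def jack_inner_zero_left)
next
  case (step e M g)
  have "mcoef (mscale e (pm M) + g) s t = e * mcoef (pm M) s t + mcoef g s t" for s t
    using step(1,2) JJ_Lam
    by (simp add: mcoef_def distrib_right mscale_mult_left jack_inner_add_left jack_inner_mscale_left Lam_mscale Lam_mult Lam_pm add_divide_distrib)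
  moreover have "dual (pm M)"
    using mult_hom_mult_incr_dual_pm[OF step(1)] by blast
  ultimately show ?case
    using step(3) by (simp add: dual_def algebra_simps)
qed

text \<open>For \<open>k = l\<close> the reflection of a box of K is again in \<open>l\<close>, so
  \<open>PX\<close> and \<open>RX\<close> choose opposite hooks in every box and together give the
  hook product.\<close>

lemma weight_l: "weight l = jack_norm l"
proof -
  have U: "UX l b \<longleftrightarrow> c \<le> snd b" if "b \<in> dg l" for b
    using l_mid by (auto simp: UX_def dg_def)
  have "PX l * RX l = hook_prod l"
    unfolding PX_def RX_def hook_prod_def prod.distrib[symmetric] by (intro prod.cong refl) (auto simp: U)
  moreover have "QX l = 1"
    by (simp add: QX_def bar_l dg_def)
  ultimately show ?thesis
    by (simp add: weight_def jack_norm_eq_hook_prod[OF l] mult.commute)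
qed

theorem jack_inner_complement:
  assumes k: "k \<in> interval"
  shows "jack_inner (JJ k * JJ (bar k)) (JJ l) = weight k"
proof -
  let ?F = "JJ (bar k)"
  have "mcoef ?F k l * weight l = weight k * mcoef ?F (bar l) (bar k)"
    using dual_Lam[OF JJ_Lam] k l_interval unfolding dual_def by blast
  moreover have "mcoef ?F (bar l) (bar k) = 1"
    using jack_norm_pos[of "bar k"] by (simp add: mcoef_def bar_l JJ_zero jack_norm_def)
  moreover have "mcoef ?F k l * weight l = jack_inner (JJ k * JJ (bar k)) (JJ l)"
    using jack_norm_pos[of l] by (simp add: mcoef_def weight_l mult.commute)
  ultimately show ?thesis
    by simp
qed

end

section \<open>Young diagrams of lists\<close>

lemma diagram_dg: "diagram l = dg (part l)"
  by (simp add: diagram_def dg_def)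

lemma card_dg:
  assumes f: "ptn f"
  shows "card (dg f) = deg f"
proof -
  have "dg f = prod.swap ` (SIGMA j:supp f. {..<f j})"
    by (auto simp: dg_def image_iff)
  then have "card (dg f) = card (SIGMA j:supp f. {..<f j})"
    by (simp add: card_image)
  also have "\<dots> = (\<Sum>j\<in>supp f. f j)"
    using ptn_fs[OF f] by (subst card_SigmaI) auto
  finally show ?thesis
    by (simp add: deg_def)
qed

text \<open>Stated additively, so that the hook values can be moved into the field without truncated
  subtraction.\<close>

lemma arm_leg:
  assumes l: "int_partition l" and b: "(i, j) \<in> diagram l"
  shows "part l j = Suc (i + arm l (i, j))" "col (part l) i = Suc (j + leg l (i, j))"
proof -
  have ij: "i < part l j" and ji: "j < col (part l) i"
    using b less_col_iff[OF ptn_part[OF l]] by (simp_all add: diagram_def)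
  have "{k. k > i \<and> (k, j) \<in> diagram l} = {Suc i..<part l j}"
    by (auto simp: diagram_def)
  then show "part l j = Suc (i + arm l (i, j))"
    using ij by simp
  have "{k. k > j \<and> (i, k) \<in> diagram l} = {Suc j..<col (part l) i}"
    using less_col_iff[OF ptn_part[OF l]] by (auto simp: diagram_def)
  then show "col (part l) i = Suc (j + leg l (i, j))"
    using ji by simp
qed

lemma chosen_hook_eq:
  assumes l: "int_partition l" and b: "b \<in> diagram l"
  shows "chosen_hook U l b = (if b \<in> U then hU (part l) b else hL (part l) b)"
proof -
  obtain i j where ij: "b = (i, j)"
    by force
  note al = arm_leg[OF l b[unfolded ij]]
  show ?thesis
    unfolding chosen_hook_def upper_hook_def lower_hook_def ij hU.simps hL.simps al
    by (simp add: algebra_simps)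
qed

lemma part_conj_part:
  assumes l: "int_partition l"
  shows "part (conj_part l) i = col (part l) i"
proof (cases "i < part l 0")
  case True
  then show ?thesis
    unfolding part_def[of "conj_part l"] by (simp add: conj_part_def col_def diagram_def)
next
  case False
  then have "{j. i < part l j} = {}"
    using ptn_le[OF ptn_part[OF l], of 0] by (auto intro: less_le_trans)
  then show ?thesis
    using False unfolding part_def[of "conj_part l"] by (simp add: conj_part_def col_def)
qed

lemma part_Cons: "part (x # xs) j = (case j of 0 \<Rightarrow> x | Suc k \<Rightarrow> part xs k)"
  by (simp add: part_def split: nat.split)

text \<open>In a decreasing list the zeros form a tail, which \<open>part\<close> does not
  distinguish from the end of the list.\<close>

lemma part_filter_pos:
  "sorted_wrt (\<ge>) xs \<Longrightarrow> part (filter (\<lambda>x. x > 0) xs) j = part xs j"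
proof (induction xs arbitrary: j)
  case (Cons x xs)
  show ?case
  proof (cases "x = 0")
    case True
    then have "\<forall>y\<in>set xs. y = 0"
      using Cons.prems by simp
    then have "filter (\<lambda>x. x > 0) (x # xs) = []" "part (x # xs) j = 0"
      using True by (auto simp: part_def nth_Cons split: nat.split)
    then show ?thesis
      by (simp add: part_def)
  next
    case False
    then show ?thesis
      using Cons.IH[of "j - 1"] Cons.prems by (cases j) (simp_all add: part_Cons)
  qed
qed (simp add: part_def)

lemma complement:
  assumes s: "int_partition s"
  shows int_partition_complement: "int_partition (complement m n s)"
    and part_complement: "part (complement m n s) i = (if i < n then m - part s (n - 1 - i) else 0)"
proof -
  define xs where "xs = map (\<lambda>j. m - part s j) (rev [0..<n])"
  have xs: "length xs = n" "\<And>i. i < n \<Longrightarrow> xs ! i = m - part s (n - 1 - i)"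
    by (simp_all add: xs_def rev_nth)
  have sorted: "sorted_wrt (\<ge>) xs"
    unfolding sorted_wrt_iff_nth_less
  proof (intro allI impI)
    fix i j assume ij: "i < j" "j < length xs"
    have "part s (n - 1 - i) \<le> part s (n - 1 - j)"
      using ij by (intro ptn_le[OF ptn_part[OF s]]) simp
    then show "xs ! j \<le> xs ! i"
      using xs ij by (simp add: diff_le_mono2)
  qed
  have c: "complement m n s = filter (\<lambda>x. x > 0) xs"
    by (simp add: complement_def xs_def)
  show "int_partition (complement m n s)"
    unfolding c int_partition_def using sorted by (auto intro: sorted_wrt_filter)
  show "part (complement m n s) i = (if i < n then m - part s (n - 1 - i) else 0)"
    unfolding c part_filter_pos[OF sorted] using xs by (simp add: part_def)
qed

lemma eq_of_less_iff: "(\<And>i::nat. i < p \<longleftrightarrow> i < q) \<Longrightarrow> p = q"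
  by (metis linorder_neqE_nat less_irrefl)

text \<open>The boxes of \<open>l\<close> outside \<open>f\<close> lie in K and correspond to those
  of \<open>s\<close> by the half-turn of the rectangle. Reflecting the rows of K carries them to
  the boxes in rows from c on that \<open>V\<close> omits, so \<open>V\<close> falls short of these
  rows by the size of \<open>s\<close>; below row c the diagrams of \<open>f\<close> and
  \<open>l\<close> agree.\<close>

lemma card_choices:
  fixes f l s :: "nat \<Rightarrow> nat"
  assumes f: "ptn f" and l: "ptn l" "\<And>j. l j = max (f j) (if j < n then m else 0)"
    and s: "ptn s" "\<And>i. s i = (if i < n then m - f (n - 1 - i) else 0)"
    and a: "a = min (f n) m" and c: "c = min (col f m) n"
  defines "V \<equiv> {(x, y) \<in> dg l. y \<ge> c \<and> (a \<le> x \<and> x < m \<and> y < n \<longrightarrow> (x, n - 1 + c - y) \<in> dg f)}"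
  shows "card {(x, y) \<in> dg f. y < c} + card (dg s) + card V = card (dg l)"
    and "card (dg f) + card (dg s) = card (dg l)"
proof -
  have low: "m < f j" if "j < c" for j
    using that less_col_iff[OF f, of j m] by (simp add: c)
  have fl: "dg f \<subseteq> dg l"
    by (auto simp: dg_def l(2))
  note fin = finite_dg[OF l(1)] finite_dg[OF f] finite_dg[OF s(1)]
  define K where "K = {(x, y). a \<le> x \<and> x < m \<and> c \<le> y \<and> y < n}"
  have KD: "dg l - dg f = K - dg f"
  proof (intro set_eqI iffI)
    fix b assume b: "b \<in> dg l - dg f"
    obtain x y where xy: "b = (x, y)"
      by force
    have *: "x < m" "y < n" "f y \<le> x"
      using b by (auto simp: xy dg_def l(2) split: if_splits)
    moreover have "c \<le> y"
      using low[of y] * by (auto simp: not_less[symmetric])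
    moreover have "a \<le> x"
      using * ptn_le[OF f, of y n] by (simp add: a)
    ultimately show "b \<in> K - dg f"
      using b by (simp add: K_def xy)
  qed (auto simp: K_def dg_def l(2))
  have "bij_betw (\<lambda>(i, j). (m - 1 - i, n - 1 - j)) (dg s) (dg l - dg f)"
  proof (rule bij_betw_byWitness[where f' = "\<lambda>(i, j). (m - 1 - i, n - 1 - j)"])
    show "(\<lambda>(i, j). (m - 1 - i, n - 1 - j)) ` dg s \<subseteq> dg l - dg f"
      by (auto simp: dg_def l(2) s(2) split: if_splits)
    show "(\<lambda>(i, j). (m - 1 - i, n - 1 - j)) ` (dg l - dg f) \<subseteq> dg s"
      by (auto simp: dg_def l(2) s(2) split: if_splits)
  qed (auto simp: dg_def l(2) s(2) split: if_splits)
  then have s': "card (dg s) = card (dg l - dg f)"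
    by (rule bij_betw_same_card)
  then show "card (dg f) + card (dg s) = card (dg l)"
    using fl fin by (simp add: card_Diff_subset card_mono)
  let ?r = "\<lambda>(x, y). (x, n - 1 + c - y)"
  let ?H = "{(x, y) \<in> dg l. c \<le> y}"
  have V: "V = ?H - ?r ` (K - dg f)"
  proof (intro set_eqI iffI)
    fix b assume b: "b \<in> V"
    then have "b \<notin> ?r ` (K - dg f)"
      by (auto simp: V_def K_def)
    then show "b \<in> ?H - ?r ` (K - dg f)"
      using b by (auto simp: V_def)
  next
    fix b assume b: "b \<in> ?H - ?r ` (K - dg f)"
    obtain x y where xy: "b = (x, y)"
      by force
    have "(x, n - 1 + c - y) \<in> dg f" if "a \<le> x" "x < m" "y < n"
    proof (rule ccontr)
      assume "(x, n - 1 + c - y) \<notin> dg f"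
      then have "(x, n - 1 + c - y) \<in> K - dg f"
        using that b by (auto simp: K_def xy)
      moreover have "b = ?r (x, n - 1 + c - y)"
        using that b by (auto simp: xy)
      ultimately show False
        using b by blast
    qed
    then show "b \<in> V"
      using b by (auto simp: V_def xy)
  qed
  have inj: "inj_on ?r (K - dg f)"
    by (auto simp: inj_on_def K_def)
  have sub: "?r ` (K - dg f) \<subseteq> ?H"
    by (auto simp: K_def dg_def l(2))
  have finH: "finite ?H"
    by (rule finite_subset[OF _ fin(1)]) auto
  have "card V = card ?H - card (K - dg f)"
    unfolding V card_Diff_subset[OF finite_subset[OF sub finH] sub] card_image[OF inj] ..
  moreover have "card (K - dg f) \<le> card ?H"
    unfolding card_image[OF inj, symmetric] by (rule card_mono[OF finH sub])
  moreover have "card (dg l) = card {(x, y) \<in> dg f. y < c} + card ?H"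
  proof -
    have "dg l = {(x, y) \<in> dg f. y < c} \<union> ?H"
      using low fl by (fastforce simp: dg_def l(2) split: if_splits)
    then have "card (dg l) = card ({(x, y) \<in> dg f. y < c} \<union> ?H)"
      by simp
    also have "\<dots> = card {(x, y) \<in> dg f. y < c} + card ?H"
      using fin by (intro card_Un_disjoint) (auto intro: finite_subset[of _ "dg f"] finite_subset[of _ "dg l"])
    finally show ?thesis .
  qed
  ultimately show "card {(x, y) \<in> dg f. y < c} + card (dg s) + card V = card (dg l)"
    using s' KD by simp
qed

context jack
begin

lemma J_part: "int_partition l \<Longrightarrow> J l = JJ (part l)"
  by (simp add: JJ_def lst_part)

lemma jack_inner_hooks:
  assumes f: "ptn f" and l: "ptn l" "\<And>j. l j = max (f j) (if j < n then m else 0)"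
    and s: "\<And>i. s i = (if i < n then m - f (n - 1 - i) else 0)"
    and a: "a = min (f n) m" and c: "c = min (col f m) n"
  shows "jack_inner (JJ f * JJ s) (JJ l) =
    (\<Prod>b\<in>dg f. if snd b < c then hU f b else hL f b) * (\<Prod>b\<in>dg s. hU s b) *
    (\<Prod>b\<in>dg l. if c \<le> snd b \<and> (a \<le> fst b \<and> fst b < m \<and> snd b < n \<longrightarrow> (fst b, n - 1 + c - snd b) \<in> dg f)
       then hU l b else hL l b)"
proof (cases "a < m \<and> c < n")
  case True
  have low: "m < f j" if "j < c" for j
    using that less_col_iff[OF f, of j m] by (simp add: c)
  have mid: "f j \<le> m" if "c \<le> j" "j < n" for j
    using that less_col_iff[OF f, of j m] True by (simp add: c)
  \<comment> \<open>As a < m, the minimum defining a is attained at row n, so rows from n on have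
    length at most a, as the locale demands.\<close>
  have fa: "f n = a"
    using True unfolding a by linarith
  note lj = l(2)
  interpret jack_box J l m n a c
  proof
    show "l j \<le> a" if "n \<le> j" for j
      using that ptn_le[OF f that] by (simp add: l(2) fa)
    show "m \<le> l j" if "j < c" for j
      using low[OF that] by (simp add: l(2))
    show "l j = m" if "c \<le> j" "j < n" for j
      using mid[OF that] that by (simp add: l(2))
  qed (use l True in auto)
  have "f \<in> interval"
    unfolding interval_def mem_Collect_eq
  proof (intro conjI allI impI f)
    fix j
    show "a \<le> f j" "f j \<le> m" if "c \<le> j \<and> j < n"
      using mid[of j] that ptn_le[OF f, of j n] by (simp_all add: fa)
    show "f j = l j" if "\<not> (c \<le> j \<and> j < n)"
      using low[of j] that by (cases "j < c") (auto simp: lj)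
  qed
  moreover have "s = bar f"
    by (rule ext) (simp add: s bar_def)
  ultimately show ?thesis
    using jack_inner_complement[of f] by (simp add: weight_def PX_def QX_def RX_def UX_def)
next
  case False
  \<comment> \<open>In this case K is empty: the rectangle lies inside \<open>f\<close>, the
    complement is empty, and the claim reduces to the norm formula.\<close>
  have ge: "m \<le> f j" if "j < n" for j
  proof (cases "a < m")
    case True
    then have "j < col f m"
      using False that by (simp add: c)
    then show ?thesis
      using less_col_iff[OF f, of j m] by simp
  next
    case False
    then show ?thesis
      using ptn_le[OF f, of j n] that by (simp add: a)
  qed
  have lf: "l = f"
    using ge by (auto simp: l(2))
  have s0: "s = (\<lambda>_. 0)"
    using ge by (auto simp: s)
  have K: "\<not> (a \<le> fst b \<and> fst b < m \<and> snd b < n \<and> c \<le> snd b)" for b :: "nat \<times> nat"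
    using False by auto
  have "(\<Prod>b\<in>dg f. if snd b < c then hU f b else hL f b) *
      (\<Prod>b\<in>dg f. if c \<le> snd b \<and> (a \<le> fst b \<and> fst b < m \<and> snd b < n \<longrightarrow> (fst b, n - 1 + c - snd b) \<in> dg f)
       then hU f b else hL f b) = hook_prod f"
    unfolding hook_prod_def prod.distrib[symmetric]
  proof (intro prod.cong refl)
    fix b
    show "(if snd b < c then hU f b else hL f b) *
       (if c \<le> snd b \<and> (a \<le> fst b \<and> fst b < m \<and> snd b < n \<longrightarrow> (fst b, n - 1 + c - snd b) \<in> dg f)
        then hU f b else hL f b) = hU f b * hL f b"
      using K[of b] by (cases "snd b < c") auto
  qed
  moreover have "jack_inner (JJ f * JJ s) (JJ l) = hook_prod f"
    by (simp add: lf s0 JJ_zero jack_norm_eq_hook_prod[OF f, symmetric] jack_norm_def)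
  moreover have "(\<Prod>b\<in>dg s. hU s b) = 1"
    by (simp add: s0 dg_def)
  ultimately show ?thesis
    unfolding lf by simp
qed

end

theorem theorem1p7:
  fixes J :: "nat list \<Rightarrow> ratfun mseries"
    and mu sigma sigma_bar lam :: "nat list"
    and m n a c :: nat
    and K U_mu U_sigma_bar U_lam :: "(nat \<times> nat) set"
  assumes "jack_family J"
    and "int_partition mu" and "m \<ge> 1" and "n \<ge> 1"
    and "int_partition sigma" and "diagram sigma = diagram mu \<inter> diagram (rect m n)"
    and "sigma_bar = complement m n sigma"
    and "int_partition lam" and "diagram lam = diagram mu \<union> diagram (rect m n)"
    and "a = min (part mu n) m"
    and "c = min (part (conj_part mu) m) n"
    and "K = {(x, y). a \<le> x \<and> x \<le> m - 1 \<and> c \<le> y \<and> y \<le> n - 1}"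
    and "U_mu = {(x, y) \<in> diagram mu. y < c}"
    and "U_sigma_bar = diagram sigma_bar"
    and "U_lam = {(x, y) \<in> diagram lam.
           y \<ge> c \<and> ((x, y) \<in> K \<longrightarrow> (x, n - 1 + c - y) \<in> diagram mu)}"
  shows "jack_inner (J mu * J sigma_bar) (J lam) =
           (\<Prod>b \<in> diagram mu. chosen_hook U_mu mu b) *
           (\<Prod>b \<in> diagram sigma_bar. chosen_hook U_sigma_bar sigma_bar b) *
           (\<Prod>b \<in> diagram lam. chosen_hook U_lam lam b)
         \<and> card U_mu + card U_sigma_bar + card U_lam = sum_list lam
         \<and> card (diagram mu - U_mu) + card (diagram sigma_bar - U_sigma_bar) +
           card (diagram lam - U_lam) = sum_list lam"
proof -
  interpret jack J
    by unfold_locales (rule assms(1))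
  define f l s where "f = part mu" and "l = part lam" and "s = part sigma_bar"
  have f: "ptn f" and l: "ptn l"
    using assms(2,8) by (simp_all add: f_def l_def ptn_part)
  have rect: "part (rect m n) j = (if j < n then m else 0)" for j
    by (simp add: part_def rect_def)
  \<comment> \<open>Equations between diagrams become equations between row lengths by comparing the
    occupied columns of each row.\<close>
  have lj: "l j = max (f j) (if j < n then m else 0)" for j
  proof (rule eq_of_less_iff)
    fix i
    have "(i, j) \<in> diagram lam \<longleftrightarrow> (i, j) \<in> diagram mu \<union> diagram (rect m n)"
      by (simp only: assms(9))
    then show "i < l j \<longleftrightarrow> i < max (f j) (if j < n then m else 0)"
      by (simp add: diagram_def rect l_def f_def less_max_iff_disj)
  qed
  have sj: "part sigma j = min (f j) (if j < n then m else 0)" for j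
  proof (rule eq_of_less_iff)
    fix i
    have "(i, j) \<in> diagram sigma \<longleftrightarrow> (i, j) \<in> diagram mu \<inter> diagram (rect m n)"
      by (simp only: assms(6))
    then show "i < part sigma j \<longleftrightarrow> i < min (f j) (if j < n then m else 0)"
      by (simp add: diagram_def rect f_def)
  qed
  have sb: "int_partition sigma_bar"
    unfolding assms(7) by (rule int_partition_complement[OF assms(5)])
  have s: "ptn s"
    unfolding s_def by (rule ptn_part[OF sb])
  have si: "s i = (if i < n then m - f (n - 1 - i) else 0)" for i
    unfolding s_def assms(7) part_complement[OF assms(5)] sj by (auto simp: min_def)
  have a: "a = min (f n) m"
    by (simp add: assms(10) f_def)
  have c: "c = min (col f m) n"
    by (simp add: assms(11) f_def part_conj_part[OF assms(2)])
  have K: "(x, y) \<in> K \<longleftrightarrow> a \<le> x \<and> x < m \<and> c \<le> y \<and> y < n" for x y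
    using assms(3,4) unfolding assms(12) by auto
  have Dm: "diagram mu = dg f" and Dl: "diagram lam = dg l" and Ds: "diagram sigma_bar = dg s"
    by (simp_all add: diagram_dg f_def l_def s_def)
  have U: "b \<in> U_lam \<longleftrightarrow> c \<le> snd b \<and> (a \<le> fst b \<and> fst b < m \<and> snd b < n \<longrightarrow> (fst b, n - 1 + c - snd b) \<in> dg f)"
    if "b \<in> dg l" for b
    using that unfolding assms(15) Dl Dm by (cases b) (auto simp: K)
  have "jack_inner (J mu * J sigma_bar) (J lam) = jack_inner (JJ f * JJ s) (JJ l)"
    using assms(2,8) sb by (simp add: J_part f_def s_def l_def)
  also have "\<dots> = (\<Prod>b \<in> diagram mu. chosen_hook U_mu mu b) *
           (\<Prod>b \<in> diagram sigma_bar. chosen_hook U_sigma_bar sigma_bar b) *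
           (\<Prod>b \<in> diagram lam. chosen_hook U_lam lam b)"
  proof -
    have "(\<Prod>b \<in> diagram mu. chosen_hook U_mu mu b) = (\<Prod>b\<in>dg f. if snd b < c then hU f b else hL f b)"
      unfolding Dm
    proof (intro prod.cong refl)
      fix b assume b: "b \<in> dg f"
      then have "b \<in> U_mu \<longleftrightarrow> snd b < c"
        unfolding assms(13) Dm by (cases b) auto
      then show "chosen_hook U_mu mu b = (if snd b < c then hU f b else hL f b)"
        using chosen_hook_eq[OF assms(2), of b U_mu] b by (simp add: Dm f_def)
    qed
    moreover have "(\<Prod>b \<in> diagram sigma_bar. chosen_hook U_sigma_bar sigma_bar b) = (\<Prod>b\<in>dg s. hU s b)"
      using chosen_hook_eq[OF sb] by (intro prod.cong) (simp_all add: assms(14) Ds s_def)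
    moreover have "(\<Prod>b \<in> diagram lam. chosen_hook U_lam lam b) =
        (\<Prod>b\<in>dg l. if c \<le> snd b \<and> (a \<le> fst b \<and> fst b < m \<and> snd b < n \<longrightarrow> (fst b, n - 1 + c - snd b) \<in> dg f)
         then hU l b else hL l b)"
      unfolding Dl
    proof (intro prod.cong refl)
      fix b assume b: "b \<in> dg l"
      show "chosen_hook U_lam lam b = (if c \<le> snd b \<and> (a \<le> fst b \<and> fst b < m \<and> snd b < n \<longrightarrow> (fst b, n - 1 + c - snd b) \<in> dg f)
         then hU l b else hL l b)"
        using chosen_hook_eq[OF assms(8), of b U_lam] b unfolding U[OF b, symmetric] by (simp add: Dl l_def)
    qed
    ultimately show ?thesis
      using jack_inner_hooks[of f l n m s a c, OF f l lj si a c] by simp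
  qed
  finally have 1: "jack_inner (J mu * J sigma_bar) (J lam) =
           (\<Prod>b \<in> diagram mu. chosen_hook U_mu mu b) *
           (\<Prod>b \<in> diagram sigma_bar. chosen_hook U_sigma_bar sigma_bar b) *
           (\<Prod>b \<in> diagram lam. chosen_hook U_lam lam b)" .
  note C = card_choices[of f l n m s a c, OF f l lj s si a c]
  have U_lam: "U_lam = {(x, y) \<in> dg l. y \<ge> c \<and> (a \<le> x \<and> x < m \<and> y < n \<longrightarrow> (x, n - 1 + c - y) \<in> dg f)}"
    unfolding assms(15) Dl Dm by (auto simp: K)
  have size: "card (dg l) = sum_list lam"
    using card_dg[OF l] deg_part[OF assms(8)] by (simp add: l_def)
  have 2: "card U_mu + card U_sigma_bar + card U_lam = card (dg l)"
    unfolding assms(13,14) U_lam Dm Ds by (rule C(1))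
  have sub: "U_mu \<subseteq> dg f" "U_lam \<subseteq> dg l"
    unfolding assms(13) U_lam Dm by auto
  have "card U_mu \<le> card (dg f)" "card U_lam \<le> card (dg l)"
    using sub finite_dg f l by (auto intro: card_mono)
  moreover have "card (dg f - U_mu) = card (dg f) - card U_mu" "card (dg l - U_lam) = card (dg l) - card U_lam"
    using sub finite_dg f l by (auto intro!: card_Diff_subset intro: finite_subset)
  moreover have "card U_sigma_bar = card (dg s)"
    by (simp add: assms(14) Ds)
  ultimately have "card (diagram mu - U_mu) + card (diagram sigma_bar - U_sigma_bar) +
           card (diagram lam - U_lam) = card (dg l)"
    using 2 C(2) unfolding assms(14) Dm Dl by simp
  then show ?thesis
    using 1 2 unfolding size by simp
qed

end
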